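(* Let $N\ge1$, $2\le p<\infty$, $0<s<1$ and $0\le A\le 1$. Let $\Omega\subset\mathbb{R}^N$ be an open and bounded set and let $u\in W^{1,p}_{\rm loc}(\Omega)\cap L^{p-1}_{sp}(\mathbb{R}^N)$ be a weak solution of $$-\Delta_p u+A(-\Delta_p)^s u=f\quad\text{in }\Omega,$$ where $f\in L^q_{\rm loc}(\Omega)$ with $q>N/p$ if $p\le N$, and $q\ge 1$ if $p>N$. Then $u^+=\max\{u,0\}$ satisfies $u^+\in L^\infty_{\rm loc}(\Omega)$, and for every $0<R<1$ such that $B_R(x_0)\Subset\Omega$ and every $0<\sigma<1$ there holds $$\|u^+\|_{L^\infty(B_{\sigma R}(x_0))}\le C\left[\left(\frac{1}{|B_R(x_0)|}\int_{B_R(x_0)}(u^+)^p\,dx\right)^{\frac1p}+\mathrm{Tail}_{p-1,sp,sp}(u^+;x_0,R)+\left(R^{p-\frac Nq}\|f\|_{L^q(B_R(x_0))}\right)^{\frac1{p-1}}\right],$$ where $C=C(N,s,p,q,\sigma)>0$ depends only on $N,s,p,q,\sigma$.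
   Context: $B_r(x_0)$ is the ball of radius $r$ centered at $x_0$; $E\Subset\Omega$ means $\overline E$ is a compact subset of $\Omega$. Operators: $\Delta_p u=\mathrm{div}(|\nabla u|^{p-2}\nabla u)$ and $(-\Delta_p)^s u(x)=\mathrm{P.V.}\int_{\mathbb{R}^N}\frac{|u(x)-u(y)|^{p-2}(u(x)-u(y))}{|x-y|^{N+ps}}\,dy$, understood weakly as below. Write $J_p(a)=|a|^{p-2}a$ for $a\in\mathbb{R}$ and $d\mu=|x-y|^{-N-sp}\,dx\,dy$. Tail space: $L^m_\alpha(\mathbb{R}^N)=\{u\in L^m_{\rm loc}(\mathbb{R}^N):\int_{\mathbb{R}^N}\frac{|u|^m}{1+|x|^{N+\alpha}}\,dx<\infty\}$ for $m,\alpha>0$; here $m=p-1$, $\alpha=sp$. Tail: $\mathrm{Tail}_{m,\alpha,\beta}(u;x_0,R)=\left[R^\beta\int_{\mathbb{R}^N\setminus B_R(x_0)}\frac{|u|^m}{|x-x_0|^{N+\alpha}}\,dx\right]^{1/m}$. Weak solution: $u\in W^{1,p}_{\rm loc}(\Omega)\cap L^{p-1}_{sp}(\mathbb{R}^N)$ is a weak solution of $-\Delta_p u+A(-\Delta_p)^s u=f$ in $\Omega$ if for every (open) $K\Subset\Omega$ and every $\phi\in W^{1,p}_0(K)$ (extended by zero), $$\int_K|\nabla u|^{p-2}\nabla u\cdot\nabla\phi\,dx+A\int_{\mathbb{R}^N}\int_{\mathbb{R}^N}J_p(u(x)-u(y))(\phi(x)-\phi(y))\,d\mu=\int_K f\phi\,dx.$$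 *)

theory Defs
  imports "HOL-Probability.Essential_Supremum"
begin

text \<open>
  The space of dimension \<open>N\<close> is an arbitrary Euclidean space \<open>'a\<close> with \<open>N = DIM('a)\<close>.
  Elements of the Lebesgue and Sobolev spaces are given by representatives that are Borel
  measurable on the set in question; every Lebesgue measurable function has one.
\<close>

definition compactly_contained :: "'a::topological_space set \<Rightarrow> 'a set \<Rightarrow> bool"
  (infix "\<Subset>" 50)
  where "E \<Subset> \<Omega> \<longleftrightarrow> compact (closure E) \<and> closure E \<subseteq> \<Omega>"

definition pos_part :: "('a \<Rightarrow> real) \<Rightarrow> 'a \<Rightarrow> real"
  where "pos_part u x = max (u x) 0"

definition zero_extension :: "'a set \<Rightarrow> ('a \<Rightarrow> real) \<Rightarrow> 'a \<Rightarrow> real"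
  where "zero_extension K \<phi> x = (if x \<in> K then \<phi> x else 0)"


subsection \<open>Lebesgue spaces\<close>

definition Linf_norm :: "'a::euclidean_space set \<Rightarrow> ('a \<Rightarrow> 'b::euclidean_space) \<Rightarrow> ereal"
  where "Linf_norm S g = esssup (restrict_space lborel S) (\<lambda>x. ereal (norm (g x)))"

text \<open>The exponent \<open>q\<close> ranges over \<open>0 < q \<le> \<infinity>\<close>.\<close>

definition in_Lp :: "ereal \<Rightarrow> 'a::euclidean_space set \<Rightarrow> ('a \<Rightarrow> 'b::euclidean_space) \<Rightarrow> bool"
  where "in_Lp q S g \<longleftrightarrow>
    set_borel_measurable lborel S g \<and>
    (if q = \<infinity> then Linf_norm S g < \<infinity>
     else set_integrable lborel S (\<lambda>x. norm (g x) powr real_of_ereal q))"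

text \<open>This is the norm only for members of the space; it is a junk value for other functions.\<close>

definition Lp_norm :: "ereal \<Rightarrow> 'a::euclidean_space set \<Rightarrow> ('a \<Rightarrow> 'b::euclidean_space) \<Rightarrow> real"
  where "Lp_norm q S g =
    (if q = \<infinity> then real_of_ereal (Linf_norm S g)
     else (LINT x:S|lborel. norm (g x) powr real_of_ereal q) powr (1 / real_of_ereal q))"

definition in_Lp_loc :: "ereal \<Rightarrow> 'a::euclidean_space set \<Rightarrow> ('a \<Rightarrow> 'b::euclidean_space) \<Rightarrow> bool"
  where "in_Lp_loc q \<Omega> g \<longleftrightarrow> (\<forall>K. compact K \<and> K \<subseteq> \<Omega> \<longrightarrow> in_Lp q K g)"


subsection \<open>Sobolev spaces\<close>

text \<open>\<open>C\<^sup>k\<close> on the whole space: all partial derivatives up to order \<open>k\<close> are continuous.\<close>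

primrec Ck :: "nat \<Rightarrow> ('a::euclidean_space \<Rightarrow> real) \<Rightarrow> bool" where
  "Ck 0 f \<longleftrightarrow> continuous_on UNIV f"
| "Ck (Suc k) f \<longleftrightarrow> (\<forall>x. f differentiable (at x)) \<and>
     (\<forall>i\<in>Basis. Ck k (\<lambda>x. frechet_derivative f (at x) i))"

definition test_function :: "'a::euclidean_space set \<Rightarrow> ('a \<Rightarrow> real) \<Rightarrow> bool"
  where "test_function \<Omega> \<phi> \<longleftrightarrow> (\<forall>k. Ck k \<phi>) \<and> {x. \<phi> x \<noteq> 0} \<Subset> \<Omega>"

definition has_weak_gradient ::
  "'a::euclidean_space set \<Rightarrow> ('a \<Rightarrow> real) \<Rightarrow> ('a \<Rightarrow> 'a) \<Rightarrow> bool"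
  where "has_weak_gradient \<Omega> u G \<longleftrightarrow>
    in_Lp_loc 1 \<Omega> u \<and> in_Lp_loc 1 \<Omega> G \<and>
    (\<forall>\<phi>. test_function \<Omega> \<phi> \<longrightarrow>
      (\<forall>i\<in>Basis. (LINT x:\<Omega>|lborel. u x * frechet_derivative \<phi> (at x) i) =
                  - (LINT x:\<Omega>|lborel. (G x \<bullet> i) * \<phi> x)))"

text \<open>On an open set the weak gradient is unique up to a null set, so the choice is immaterial.\<close>

definition weak_gradient :: "'a::euclidean_space set \<Rightarrow> ('a \<Rightarrow> real) \<Rightarrow> 'a \<Rightarrow> 'a"
  where "weak_gradient \<Omega> u = (SOME G. has_weak_gradient \<Omega> u G)"

definition in_W1p :: "real \<Rightarrow> 'a::euclidean_space set \<Rightarrow> ('a \<Rightarrow> real) \<Rightarrow> bool"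
  where "in_W1p p \<Omega> u \<longleftrightarrow>
    in_Lp (ereal p) \<Omega> u \<and> (\<exists>G. has_weak_gradient \<Omega> u G \<and> in_Lp (ereal p) \<Omega> G)"

definition W1p_norm :: "real \<Rightarrow> 'a::euclidean_space set \<Rightarrow> ('a \<Rightarrow> real) \<Rightarrow> real"
  where "W1p_norm p \<Omega> u = Lp_norm (ereal p) \<Omega> u + Lp_norm (ereal p) \<Omega> (weak_gradient \<Omega> u)"

definition in_W1p_loc :: "real \<Rightarrow> 'a::euclidean_space set \<Rightarrow> ('a \<Rightarrow> real) \<Rightarrow> bool"
  where "in_W1p_loc p \<Omega> u \<longleftrightarrow> (\<forall>K. open K \<and> K \<Subset> \<Omega> \<longrightarrow> in_W1p p K u)"

text \<open>The closure of the test functions in \<open>W\<^sup>1\<^sup>,\<^sup>p\<close>.\<close>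

definition in_W1p_0 :: "real \<Rightarrow> 'a::euclidean_space set \<Rightarrow> ('a \<Rightarrow> real) \<Rightarrow> bool"
  where "in_W1p_0 p \<Omega> u \<longleftrightarrow> in_W1p p \<Omega> u \<and>
    (\<exists>\<psi>. (\<forall>n. test_function \<Omega> (\<psi> n)) \<and>
         (\<lambda>n. W1p_norm p \<Omega> (\<lambda>x. \<psi> n x - u x)) \<longlonglongrightarrow> 0)"


subsection \<open>Tails\<close>

definition in_tail_space :: "real \<Rightarrow> real \<Rightarrow> ('a::euclidean_space \<Rightarrow> real) \<Rightarrow> bool"
  where "in_tail_space m \<alpha> u \<longleftrightarrow> in_Lp_loc (ereal m) UNIV u \<and>
    integrable lborel (\<lambda>x. \<bar>u x\<bar> powr m / (1 + norm x powr (real DIM('a) + \<alpha>)))"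

definition Tail ::
  "real \<Rightarrow> real \<Rightarrow> real \<Rightarrow> ('a::euclidean_space \<Rightarrow> real) \<Rightarrow> 'a \<Rightarrow> real \<Rightarrow> real"
  where "Tail m \<alpha> \<beta> u x0 R =
    (R powr \<beta> * (LINT x:- ball x0 R|lborel.
        \<bar>u x\<bar> powr m / norm (x - x0) powr (real DIM('a) + \<alpha>))) powr (1 / m)"


subsection \<open>Weak solutions\<close>

text \<open>
  Since \<open>0 powr 0 = 0\<close>, the factors \<open>\<bar>a\<bar> powr (p - 2)\<close> with \<open>p = 2\<close> vanish at \<open>a = 0\<close> instead of
  being \<open>1\<close>; this is harmless, as they are always multiplied by \<open>a\<close>. Likewise the kernel is \<open>0\<close>
  on the diagonal, where the other factors of the nonlocal integrand vanish anyway.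
\<close>

definition J :: "real \<Rightarrow> real \<Rightarrow> real"
  where "J p a = \<bar>a\<bar> powr (p - 2) * a"

definition nonlocal_form ::
  "real \<Rightarrow> real \<Rightarrow> ('a::euclidean_space \<Rightarrow> real) \<Rightarrow> ('a \<Rightarrow> real) \<Rightarrow> real"
  where "nonlocal_form p s u \<phi> =
    (LINT (x, y)|(lborel \<Otimes>\<^sub>M lborel).
       J p (u x - u y) * (\<phi> x - \<phi> y) / norm (x - y) powr (real DIM('a) + s * p))"

definition weak_solution ::
  "real \<Rightarrow> real \<Rightarrow> real \<Rightarrow> 'a::euclidean_space set \<Rightarrow> ('a \<Rightarrow> real) \<Rightarrow> ('a \<Rightarrow> real) \<Rightarrow> bool"
  where "weak_solution p s A \<Omega> f u \<longleftrightarrow>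
    in_W1p_loc p \<Omega> u \<and> in_tail_space (p - 1) (s * p) u \<and>
    (\<forall>K \<phi>. open K \<and> K \<Subset> \<Omega> \<and> in_W1p_0 p K \<phi> \<longrightarrow>
      (LINT x:K|lborel. norm (weak_gradient K u x) powr (p - 2) *
                        (weak_gradient K u x \<bullet> weak_gradient K \<phi> x))
      + A * nonlocal_form p s u (zero_extension K \<phi>)
      = (LINT x:K|lborel. f x * \<phi> x))"

end

theory Submission
  imports Defs
begin

text \<open>
  The proof tests the equation with \<open>\<phi> = (u - k)\<^sub>+ \<zeta>\<close>, a truncation of the solution times a
  cutoff function of a ball. The local part of the equation controls \<open>\<integral> |\<nabla>\<phi>|\<^sup>p\<close>. The nonlocal part
  has the good sign up to two errors. For two points of the ball the error comes from the
  oscillation of \<open>\<zeta>\<close>; its \<open>p\<close>-th power makes the kernel integrable because \<open>s < 1\<close>. For a point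
  outside the ball only values of \<open>u\<close> above those inside do harm, and these are collected in the
  tail. With \<open>M\<close> the inverse width of the cutoff region and \<open>\<Theta>\<close> the tail this gives the energy
  estimate (lemma \<open>Caccioppoli\<close>)
  \<open>\<integral> |\<nabla>\<phi>|\<^sup>p \<le> C (M\<^sup>p \<integral> (u - k)\<^sub>+\<^sup>p + \<Theta> \<integral> \<phi> + \<integral> |f| \<phi>)\<close>.
  The nonlocal operator thus enters as a perturbation only, and as \<open>A \<le> 1\<close> and \<open>R < 1\<close> the
  constants depend neither on \<open>A\<close> nor on the radius.

  It remains to combine the estimate with an embedding for functions vanishing outside a ball; it
  is derived from the bound of a function by the Riesz potential of its gradient. The term with
  \<open>f\<close> is absorbed, since it grows only like the first power of \<open>\<phi>\<close>, whereas the energy is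
  homogeneous of degree \<open>p\<close> (lemma \<open>absorbed_energy\<close>).
  For \<open>p > N\<close> the energy bounds \<open>\<phi>\<close> pointwise, and \<open>k = 0\<close> already yields the claim (lemma
  \<open>bounded_above_dimension\<close>). For \<open>p \<le> N\<close> the energy bounds \<open>\<phi>\<close> in \<open>L\<^sup>p\<^sup>\<kappa>\<close> for some
  \<open>\<kappa> > 1\<close>. Together with Chebyshev's inequality for the set where \<open>u > k\<close> this improves
  \<open>\<integral> (u - k)\<^sub>+\<^sup>p\<close> by a power larger than one when the level is raised and the ball is shrunk (lemma
  \<open>level_step\<close>); iterating along levels that increase to a multiple of the right-hand side makes
  the integral vanish in the limit (lemma \<open>bounded_below_dimension\<close>). The condition \<open>q > N / p\<close>
  says exactly that an exponent \<open>\<kappa>\<close> below the critical one can be matched with \<open>f\<close>.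

  All estimates are run with a single number \<open>L\<close> that bounds the mean, the tail and the norm of
  \<open>f\<close> in the scaling of the ball (\<open>local_data\<close>), and their conclusion is \<open>u \<le> C L\<close>.

  A good part of the text serves to show that \<open>\<phi>\<close> is admissible. Elements of \<open>W\<^sub>0\<^sup>1\<^sup>,\<^sup>p\<close> are
  handled as limits of pairs of a test function and its gradient (\<open>W0_limit\<close>); mollification
  produces such pairs, and the chain rule and the embeddings are proved for smooth functions
  first.
\<close>

section \<open>Smooth functions\<close>

lemma CkI:
  assumes "\<And>x. (f has_derivative D x) (at x)" and "\<And>i. i \<in> Basis \<Longrightarrow> Ck k (\<lambda>x. D x i)"
  shows "Ck (Suc k) f"
proof -
  have "frechet_derivative f (at x) = D x" for x
    using frechet_derivative_at[OF assms(1)] by simp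
  then show ?thesis
    using assms by (auto simp: differentiable_def)
qed

lemma Ck_has_derivative:
  assumes "Ck (Suc k) f"
  shows "(f has_derivative frechet_derivative f (at x)) (at x)"
  using assms by (simp add: frechet_derivative_works)

lemma Ck_continuous: "Ck k f \<Longrightarrow> continuous_on UNIV f"
  by (cases k) (auto simp: continuous_on_eq_continuous_at differentiable_imp_continuous_within)

lemma Ck_SucD: "Ck (Suc k) f \<Longrightarrow> Ck k f"
proof (induction k arbitrary: f)
  case 0
  then show ?case using Ck_continuous by fastforce
next
  case (Suc k)
  then show ?case by (metis Ck.simps(2))
qed

lemma Ck_const: "Ck k (\<lambda>_. c)"
proof (induction k arbitrary: c)
  case (Suc k)
  show ?case by (rule CkI[where D="\<lambda>x h. 0"]) (auto simp: Suc)
qed simp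

lemma Ck_inner: "Ck k (\<lambda>x. x \<bullet> a)"
proof (cases k)
  case (Suc m)
  show ?thesis unfolding Suc
    by (rule CkI[where D="\<lambda>x h. h \<bullet> a"]) (auto intro!: derivative_eq_intros Ck_const)
qed (auto intro!: continuous_intros)

lemma Ck_add: "Ck k f \<Longrightarrow> Ck k g \<Longrightarrow> Ck k (\<lambda>x. f x + g x)"
proof (induction k arbitrary: f g)
  case (Suc k)
  show ?case
    by (rule CkI[where D="\<lambda>x h. frechet_derivative f (at x) h + frechet_derivative g (at x) h"])
      (use Suc in \<open>auto intro!: has_derivative_add simp flip: frechet_derivative_works\<close>)
qed (auto intro!: continuous_intros)

lemma Ck_mult: "Ck k f \<Longrightarrow> Ck k g \<Longrightarrow> Ck k (\<lambda>x. f x * g x)"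
proof (induction k arbitrary: f g)
  case (Suc k)
  have "Ck k f" "Ck k g" using Suc.prems Ck_SucD by blast+
  then show ?case
    by (intro CkI[where D="\<lambda>x h. f x * frechet_derivative g (at x) h
          + frechet_derivative f (at x) h * g x"])
      (use Suc in \<open>auto intro!: has_derivative_mult Ck_add simp flip: frechet_derivative_works\<close>)
qed (auto intro!: continuous_intros)

lemma Ck_cmult: "Ck k f \<Longrightarrow> Ck k (\<lambda>x. c * f x)"
  by (rule Ck_mult[OF Ck_const])

lemma Ck_reflect: "Ck k f \<Longrightarrow> Ck k (\<lambda>y. f (x - y))"
proof (induction k arbitrary: f)
  case 0
  then show ?case
    by simp (intro continuous_on_compose2[of UNIV f UNIV "\<lambda>y. x - y"] continuous_intros; simp)
next
  case (Suc k)
  have "((\<lambda>y. f (x - y)) has_derivative (\<lambda>h. frechet_derivative f (at (x - y)) (- h))) (at y)" for y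
    by (rule has_derivative_compose[where g=f and f="\<lambda>y. x - y"])
      (auto intro!: derivative_eq_intros Ck_has_derivative[OF Suc.prems])
  moreover have "frechet_derivative f (at z) (- h) = - 1 * frechet_derivative f (at z) h" for z h
    using Ck_has_derivative[OF Suc.prems] has_derivative_linear linear_neg by fastforce
  moreover have "Ck k (\<lambda>y. - 1 * frechet_derivative f (at (x - y)) i)" if "i \<in> Basis" for i
    by (rule Ck_cmult, rule Suc.IH) (use Suc.prems that in simp)
  ultimately show ?case
    by (intro CkI[where D="\<lambda>y h. - 1 * frechet_derivative f (at (x - y)) h"]) auto
qed

subsection \<open>Bump functions\<close>

text \<open>The functions \<open>exp (- 1 / t) / t ^ m\<close> for \<open>t > 0\<close>; with all powers \<open>m\<close> the family is closed
  under differentiation up to linear combinations.\<close>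

definition flat_fun :: "nat \<Rightarrow> real \<Rightarrow> real"
  where "flat_fun m t = (if t \<le> 0 then 0 else exp (- (1 / t)) / t ^ m)"

lemma power_over_fact_le_exp:
  assumes "0 \<le> (x::real)" shows "x ^ n / fact n \<le> exp x"
proof -
  have "(\<Sum>k\<in>{n}. x ^ k /\<^sub>R fact k) \<le> (\<Sum>k. x ^ k /\<^sub>R fact k)"
    using exp_converges[of x] assms by (intro sum_le_suminf) (auto simp: sums_iff)
  then show ?thesis
    using exp_converges[of x] by (simp add: sums_iff divide_inverse mult.commute)
qed

text \<open>The exponential beats every power, so that all these functions vanish to second order
  at \<open>0\<close>.\<close>

lemma flat_fun_le: "\<bar>flat_fun m t\<bar> \<le> fact (m + 2) * t\<^sup>2"
proof (cases "t \<le> 0")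
  case False
  then have "(1 / t) ^ (m + 2) / fact (m + 2) \<le> exp (1 / t)"
    by (intro power_over_fact_le_exp) auto
  moreover have "(1 / t) ^ (m + 2) = 1 / (t ^ m * t\<^sup>2)"
    by (simp add: power_add power_divide power2_eq_square)
  ultimately have "1 / (t ^ m * t\<^sup>2) / fact (m + 2) \<le> exp (1 / t)" by metis
  then have "1 / (t ^ m * t\<^sup>2) \<le> exp (1 / t) * fact (m + 2)"
    by (subst (asm) pos_divide_le_eq) auto
  then have "exp (- (1 / t)) * (1 / (t ^ m * t\<^sup>2)) \<le> exp (- (1 / t)) * (exp (1 / t) * fact (m + 2))"
    by (intro mult_left_mono) auto
  also have "\<dots> = fact (m + 2)"
    by (simp add: mult.assoc[symmetric] exp_minus)
  finally show ?thesis
    using False by (simp add: flat_fun_def field_simps del: fact_Suc)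
qed (simp add: flat_fun_def)

lemma has_derivative_zero_if_quadratic:
  assumes "\<And>t. \<bar>f t\<bar> \<le> c * (t::real)\<^sup>2"
  shows "(f has_real_derivative 0) (at 0)"
proof -
  have "f 0 = 0" using assms[of 0] by simp
  moreover have "(\<lambda>h. f h / h) \<midarrow>0\<rightarrow> 0"
  proof (rule Lim_null_comparison[where g="\<lambda>h. c * \<bar>h\<bar>"])
    have "norm (f h / h) \<le> c * \<bar>h\<bar>" if "h \<noteq> 0" for h
    proof -
      have "\<bar>f h\<bar> / \<bar>h\<bar> \<le> (c * h\<^sup>2) / \<bar>h\<bar>"
        using assms[of h] by (intro divide_right_mono) auto
      also have "\<dots> = c * \<bar>h\<bar>"
        using that by (simp add: power2_eq_square abs_if)
      finally show ?thesis by simp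
    qed
    then show "\<forall>\<^sub>F h in at 0. norm (f h / h) \<le> c * \<bar>h\<bar>"
      by (auto simp: eventually_at intro: exI[of _ 1])
    show "(\<lambda>h. c * \<bar>h\<bar>) \<midarrow>0\<rightarrow> 0"
      by (auto intro!: tendsto_eq_intros)
  qed
  ultimately show ?thesis by (simp add: DERIV_def)
qed

lemma flat_fun_deriv:
  "(flat_fun m has_real_derivative flat_fun (m + 2) t - real m * flat_fun (m + 1) t) (at t)"
proof -
  consider "t < 0" | "t = 0" | "t > 0" by linarith
  then show ?thesis
  proof cases
    case 1
    have "(flat_fun m has_real_derivative 0) (at t)"
      by (rule has_field_derivative_transform_within_open[where f="\<lambda>_. 0" and S="{..<0}"])
        (use 1 in \<open>auto simp: flat_fun_def\<close>)
    then show ?thesis using 1 by (simp add: flat_fun_def)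
  next
    case 2
    then show ?thesis
      using has_derivative_zero_if_quadratic[of "flat_fun m", OF flat_fun_le]
      by (simp add: flat_fun_def)
  next
    case 3
    have "((\<lambda>t. exp (- (1 / t)) / t ^ m) has_real_derivative
        flat_fun (m + 2) t - real m * flat_fun (m + 1) t) (at t)"
    proof (rule DERIV_cong[OF DERIV_divide[OF _ DERIV_pow]])
      show "((\<lambda>t. exp (- (1 / t))) has_real_derivative exp (- (1 / t)) / t\<^sup>2) (at t)"
        using 3 by (auto intro!: derivative_eq_intros simp: power2_eq_square)
      show "t ^ m \<noteq> 0" using 3 by auto
      show "(exp (- (1 / t)) / t\<^sup>2 * t ^ m - exp (- (1 / t)) * (real m * t ^ (m - Suc 0)))
          / (t ^ m * t ^ m) = flat_fun (m + 2) t - real m * flat_fun (m + 1) t"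
      proof (cases m)
        case (Suc k)
        have alg: "(e / t\<^sup>2 * (t * a) - e * (r * a)) / ((t * a) * (t * a))
            = e / (t * (t * (t * a))) - r * (e / (t * (t * a)))" if "a \<noteq> 0" for a e r :: real
        proof -
          have "e / t\<^sup>2 * (t * a) / ((t * a) * (t * a)) = e / (t * (t * (t * a)))"
            using 3 that by (simp add: power2_eq_square)
          moreover have "e * (r * a) / ((t * a) * (t * a)) = r * (e / (t * (t * a)))"
            using 3 that by simp
          ultimately show ?thesis by (simp add: diff_divide_distrib)
        qed
        show ?thesis
          using 3 alg[of "t ^ k" "exp (- (1 / t))" "real m"] by (simp add: flat_fun_def Suc)
      qed (use 3 in \<open>simp add: flat_fun_def field_simps power2_eq_square\<close>)
    qed
    then show ?thesis
      by (rule has_field_derivative_transform_within_open[where S="{0<..}"])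
        (use 3 in \<open>auto simp: flat_fun_def\<close>)
  qed
qed

text \<open>Every partial derivative combines functions of the same family with larger exponents, so the
  induction over the order has to run for all exponents at once.\<close>

lemma Ck_bump: "Ck k (\<lambda>x. flat_fun m (c - x \<bullet> x))"
proof (induction k arbitrary: m)
  case 0
  have "continuous_on UNIV (flat_fun m)"
    using flat_fun_deriv DERIV_isCont continuous_at_imp_continuous_on by blast
  then show ?case
    by (simp, intro continuous_on_compose2[of UNIV "flat_fun m" UNIV "\<lambda>x. c - x \<bullet> x"]
        continuous_intros) auto
next
  case (Suc k)
  let ?d = "\<lambda>t. flat_fun (m + 2) t - real m * flat_fun (m + 1) t"
  have "((\<lambda>x. flat_fun m (c - x \<bullet> x)) has_derivative
      (\<lambda>h. (flat_fun (m + 2) (c - x \<bullet> x) + - real m * flat_fun (m + 1) (c - x \<bullet> x))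
          * (- 2 * (x \<bullet> h)))) (at x)" for x :: 'a
  proof -
    have "((\<lambda>x. flat_fun m (c - x \<bullet> x)) has_derivative
        (\<lambda>h. ?d (c - x \<bullet> x) * (- (x \<bullet> h + h \<bullet> x)))) (at x)"
      by (rule has_derivative_compose[OF _ flat_fun_deriv[unfolded has_field_derivative_def]])
        (auto intro!: derivative_eq_intros)
    then show ?thesis by (simp add: inner_commute algebra_simps)
  qed
  moreover have "Ck k (\<lambda>x. (flat_fun (m + 2) (c - x \<bullet> x) + - real m * flat_fun (m + 1) (c - x \<bullet> x))
          * (- 2 * (x \<bullet> i)))" for i :: 'a
    by (intro Ck_mult Ck_add Ck_cmult Suc Ck_const Ck_inner)
  ultimately show ?case by (rule CkI)
qed

subsection \<open>Functions with a continuous gradient\<close>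

definition C1_gradient :: "('a::euclidean_space \<Rightarrow> real) \<Rightarrow> ('a \<Rightarrow> 'a) \<Rightarrow> bool"
  where "C1_gradient f g \<longleftrightarrow>
    (\<forall>x. (f has_derivative (\<lambda>h. g x \<bullet> h)) (at x)) \<and> continuous_on UNIV g"

definition grad :: "('a::euclidean_space \<Rightarrow> real) \<Rightarrow> 'a \<Rightarrow> 'a"
  where "grad f x = (\<Sum>i\<in>Basis. frechet_derivative f (at x) i *\<^sub>R i)"

lemma C1_gradientI:
  assumes "\<And>x. (f has_derivative D x) (at x)" "\<And>x h. D x h = g x \<bullet> h" "continuous_on UNIV g"
  shows "C1_gradient f g"
proof -
  have "D x = (\<lambda>h. g x \<bullet> h)" for x using assms(2) by blast
  then show ?thesis using assms(1,3) unfolding C1_gradient_def by metis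
qed

lemma C1_gradient_deriv: "C1_gradient f g \<Longrightarrow> (f has_derivative (\<lambda>h. g x \<bullet> h)) (at x)"
  by (simp add: C1_gradient_def)

lemma C1_gradient_cont: "C1_gradient f g \<Longrightarrow> continuous_on UNIV g"
  by (simp add: C1_gradient_def)

lemma C1_gradient_cont_fun: "C1_gradient f g \<Longrightarrow> continuous_on UNIV f"
  by (meson C1_gradient_def continuous_at_imp_continuous_on has_derivative_continuous)

lemma C1_gradient_measurable:
  assumes "C1_gradient f g"
  shows "f \<in> borel_measurable borel" "g \<in> borel_measurable borel"
  using C1_gradient_cont_fun[OF assms] C1_gradient_cont[OF assms]
  by (simp_all add: borel_measurable_continuous_onI)

lemma frechet_derivative_C1:
  "C1_gradient f g \<Longrightarrow> frechet_derivative f (at x) h = g x \<bullet> h"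
  using frechet_derivative_at[OF C1_gradient_deriv] by metis

lemma C1_gradient_grad:
  assumes "Ck 1 f" shows "C1_gradient f (grad f)"
proof -
  have d: "(f has_derivative frechet_derivative f (at x)) (at x)" for x
    using assms Ck_has_derivative[of 0] by simp
  have "frechet_derivative f (at x) h = grad f x \<bullet> h" for x h
  proof -
    have "linear (frechet_derivative f (at x))"
      using d has_derivative_linear by blast
    then have "frechet_derivative f (at x) (\<Sum>i\<in>Basis. (h \<bullet> i) *\<^sub>R i)
        = (\<Sum>i\<in>Basis. (h \<bullet> i) * frechet_derivative f (at x) i)"
      by (simp add: linear_sum linear_cmul)
    then show ?thesis
      by (simp add: euclidean_representation grad_def inner_sum_left)
        (simp add: inner_commute mult.commute)
  qed
  moreover have "continuous_on UNIV (grad f)"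
    unfolding grad_def using assms by (auto intro!: continuous_intros)
  ultimately show ?thesis
    using d unfolding C1_gradient_def by (metis (no_types, lifting) ext)
qed

lemma C1_gradient_mult:
  assumes "C1_gradient f F" "C1_gradient g G"
  shows "C1_gradient (\<lambda>x. f x * g x) (\<lambda>x. f x *\<^sub>R G x + g x *\<^sub>R F x)"
proof (rule C1_gradientI)
  show "((\<lambda>x. f x * g x) has_derivative (\<lambda>h. f x * (G x \<bullet> h) + (F x \<bullet> h) * g x)) (at x)" for x
    using assms by (intro has_derivative_mult C1_gradient_deriv)
qed (auto simp: inner_add_left intro!: continuous_intros C1_gradient_cont[OF assms(1)]
    C1_gradient_cont[OF assms(2)] C1_gradient_cont_fun[OF assms(1)] C1_gradient_cont_fun[OF assms(2)])

lemma C1_gradient_compose: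
  assumes "C1_gradient f F"
    and "\<And>t. (\<Psi> has_real_derivative \<Psi>' t) (at t)" and "continuous_on UNIV \<Psi>'"
  shows "C1_gradient (\<lambda>x. \<Psi> (f x)) (\<lambda>x. \<Psi>' (f x) *\<^sub>R F x)"
proof (rule C1_gradientI)
  show "((\<lambda>x. \<Psi> (f x)) has_derivative (\<lambda>h. \<Psi>' (f x) * (F x \<bullet> h))) (at x)" for x
    using assms(2)[of "f x"] C1_gradient_deriv[OF assms(1)]
    by (intro has_derivative_compose[where g=\<Psi> and f=f]) (auto simp: has_field_derivative_def)
  show "continuous_on UNIV (\<lambda>x. \<Psi>' (f x) *\<^sub>R F x)"
    by (intro continuous_on_scaleR C1_gradient_cont[OF assms(1)]
        continuous_on_compose2[OF assms(3) C1_gradient_cont_fun[OF assms(1)]]) auto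
qed simp

lemma C1_gradient_reflect:
  assumes "C1_gradient f F"
  shows "C1_gradient (\<lambda>y. f (x - y)) (\<lambda>y. - F (x - y))"
proof (rule C1_gradientI)
  show "((\<lambda>y. f (x - y)) has_derivative (\<lambda>h. F (x - y) \<bullet> (- h))) (at y)" for y
    by (rule has_derivative_compose[where g=f and f="\<lambda>y. x - y"])
      (auto intro!: derivative_eq_intros C1_gradient_deriv[OF assms])
  show "continuous_on UNIV (\<lambda>y. - F (x - y))"
    by (intro continuous_on_minus continuous_on_compose2[OF C1_gradient_cont[OF assms]]
        continuous_on_diff continuous_on_const continuous_on_id) auto
qed simp

lemma gradient_zero_outside_support:
  assumes "C1_gradient f g" and "\<And>x. x \<notin> S \<Longrightarrow> f x = 0" and "closed S" and "x \<notin> S"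
  shows "g x = 0"
proof -
  have "(f has_derivative (\<lambda>h. 0)) (at x)"
    by (rule has_derivative_transform_within_open[where f="\<lambda>_. 0" and s="- S"])
      (use assms in auto)
  then have "(\<lambda>h. g x \<bullet> h) = (\<lambda>h. 0)"
    using C1_gradient_deriv[OF assms(1)] has_derivative_unique by blast
  then have "g x \<bullet> g x = 0" by metis
  then show ?thesis by simp
qed

lemma continuous_compact_support_bounded:
  fixes g :: "'a::euclidean_space \<Rightarrow> 'b::real_normed_vector"
  assumes "continuous_on UNIV g" and "\<And>x. x \<notin> S \<Longrightarrow> g x = 0" and "compact S"
  obtains M where "0 \<le> M" "\<And>x. norm (g x) \<le> M"
proof -
  have "bounded (g ` S)"
    using compact_continuous_image[OF continuous_on_subset[OF assms(1)] assms(3)]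
    by (simp add: compact_imp_bounded)
  then obtain M where "\<forall>x\<in>S. norm (g x) \<le> M" by (auto simp: bounded_iff)
  then have "norm (g x) \<le> max M 0" for x
    using assms(2)[of x] by (cases "x \<in> S") auto
  then show ?thesis using that[of "max M 0"] by auto
qed

lemma C1_lipschitz:
  assumes "C1_gradient f g" and "\<And>x. norm (g x) \<le> M"
  shows "\<bar>f x - f y\<bar> \<le> M * norm (x - y)"
proof -
  have "onorm (\<lambda>h. g x \<bullet> h) \<le> M" for x
  proof (rule onorm_le)
    fix h show "norm (g x \<bullet> h) \<le> M * norm h"
      using Cauchy_Schwarz_ineq2[of "g x" h] mult_right_mono[OF assms(2)[of x], of "norm h"] by simp
  qed
  then show ?thesis
    using differentiable_bound[of UNIV f "\<lambda>x h. g x \<bullet> h" M x y] C1_gradient_deriv[OF assms(1)]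
    by auto
qed

lemma integrable_continuous_compact_support:
  fixes g :: "'a::euclidean_space \<Rightarrow> 'b::euclidean_space"
  assumes "continuous_on UNIV g" and "\<And>x. x \<notin> S \<Longrightarrow> g x = 0" and "compact S"
  shows "integrable lborel g"
proof -
  obtain M where M: "0 \<le> M" "\<And>x. norm (g x) \<le> M"
    using continuous_compact_support_bounded[OF assms] by blast
  show ?thesis
  proof (rule Bochner_Integration.integrable_bound)
    show "integrable lborel (\<lambda>x. indicator S x * M)"
      using assms(3) emeasure_lborel_cbox_finite
      by (auto intro!: integrable_real_indicator borel_compact emeasure_compact_finite)
    show "AE x in lborel. norm (g x) \<le> norm (indicator S x * M)"
      using M assms(2) by (auto simp: indicator_def)
  qed (use assms in \<open>simp add: borel_measurable_continuous_onI\<close>)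
qed

lemma integral_lborel_translate:
  fixes f :: "'a::euclidean_space \<Rightarrow> 'b::euclidean_space"
  assumes "f \<in> borel_measurable borel"
  shows "(\<integral>x. f (x + a) \<partial>lborel) = (\<integral>x. f x \<partial>lborel)"
proof -
  have "(\<integral>x. f x \<partial>lborel) = (\<integral>x. f x \<partial>distr lborel borel ((+) a))"
    by (simp add: lborel_distr_plus)
  also have "\<dots> = (\<integral>x. f (a + x) \<partial>lborel)"
    by (rule integral_distr) (use assms in auto)
  finally show ?thesis by (simp add: add.commute)
qed

text \<open>By translation invariance every difference quotient has integral zero, and so has its limit;
  this replaces Fubini and the fundamental theorem of calculus.\<close>

lemma integral_gradient_zero:
  assumes fg: "C1_gradient f g" and supp: "\<And>x. x \<notin> S \<Longrightarrow> f x = 0" "compact S"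
  shows "(\<integral>x. g x \<bullet> i \<partial>lborel) = 0"
proof -
  have g0: "g x = 0" if "x \<notin> S" for x
    using gradient_zero_outside_support[OF fg supp(1) compact_imp_closed[OF supp(2)] that] .
  obtain M where M: "0 \<le> M" "\<And>x. norm (g x) \<le> M"
    using continuous_compact_support_bounded[OF C1_gradient_cont[OF fg] g0 supp(2)] by blast
  have [measurable]: "f \<in> borel_measurable borel" "g \<in> borel_measurable borel"
    using C1_gradient_measurable[OF fg] .
  obtain r where r: "S \<subseteq> ball 0 r"
    using bounded_subset_ballD[OF compact_imp_bounded[OF supp(2)]] by blast
  let ?e = "\<lambda>n::nat. 1 / real (Suc n)"
  define D where "D n x = (f (x + ?e n *\<^sub>R i) - f x) / ?e n" for n x
  have "(\<lambda>n. \<integral>x. D n x \<partial>lborel) \<longlonglongrightarrow> (\<integral>x. g x \<bullet> i \<partial>lborel)"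
  proof (rule integral_dominated_convergence
      [where w="\<lambda>x. indicator (ball 0 (r + norm i)) x * (M * norm i)"])
    show "integrable lborel (\<lambda>x::'a. indicator (ball 0 (r + norm i)) x * (M * norm i))"
      using emeasure_lborel_ball_finite[of "0::'a" "r + norm i"]
      by (intro integrable_mult_left integrable_real_indicator) auto
    show "AE x in lborel. norm (D n x) \<le> indicator (ball 0 (r + norm i)) x * (M * norm i)" for n
    proof (rule AE_I2)
      fix x
      have "norm (?e n *\<^sub>R i) \<le> norm i" by (simp add: field_simps)
      moreover have "norm x \<le> norm (x + ?e n *\<^sub>R i) + norm (?e n *\<^sub>R i)"
        using norm_triangle_ineq4[of "x + ?e n *\<^sub>R i" "?e n *\<^sub>R i"] by simp
      moreover have "z \<in> S \<Longrightarrow> norm z < r" for z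
        using r by auto
      moreover have "0 \<le> norm i" by simp
      ultimately have "x \<notin> ball 0 (r + norm i) \<Longrightarrow> x \<notin> S \<and> x + ?e n *\<^sub>R i \<notin> S"
        by (smt (verit) mem_ball_0)
      then have "x \<notin> ball 0 (r + norm i) \<Longrightarrow> D n x = 0"
        using supp(1) by (simp add: D_def)
      moreover have "norm (D n x) \<le> M * norm i"
      proof -
        have "\<bar>f (x + ?e n *\<^sub>R i) - f x\<bar> \<le> M * norm (?e n *\<^sub>R i)"
          using C1_lipschitz[OF fg M(2), of "x + ?e n *\<^sub>R i" x] by simp
        then have "\<bar>f (x + ?e n *\<^sub>R i) - f x\<bar> * real (Suc n) \<le> (M * (norm i / real (Suc n))) * real (Suc n)"
          by (intro mult_right_mono) auto
        then show ?thesis by (simp add: D_def abs_mult del: of_nat_Suc)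
      qed
      ultimately show "norm (D n x) \<le> indicator (ball 0 (r + norm i)) x * (M * norm i)"
        by (cases "x \<in> ball 0 (r + norm i)") auto
    qed
    show "AE x in lborel. (\<lambda>n. D n x) \<longlonglongrightarrow> g x \<bullet> i"
    proof (rule AE_I2)
      fix x
      have "((\<lambda>t. f (x + t *\<^sub>R i)) has_derivative (\<lambda>t. g x \<bullet> (t *\<^sub>R i))) (at 0)"
        by (rule has_derivative_compose[where g=f and f="\<lambda>t. x + t *\<^sub>R i"])
          (auto intro!: derivative_eq_intros C1_gradient_deriv[OF fg])
      then have "((\<lambda>t. f (x + t *\<^sub>R i)) has_real_derivative (g x \<bullet> i)) (at 0)"
        by (simp add: has_field_derivative_def mult_commute_abs)
      then have "(\<lambda>h. (f (x + h *\<^sub>R i) - f x) / h) \<midarrow>0\<rightarrow> g x \<bullet> i"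
        by (simp add: DERIV_def)
      then show "(\<lambda>n. D n x) \<longlonglongrightarrow> g x \<bullet> i"
        unfolding D_def
        by (rule LIMSEQ_SEQ_conv[THEN iffD2, rule_format]) (auto intro: LIMSEQ_Suc[OF lim_1_over_n] simp del: of_nat_Suc)
    qed
  qed (auto simp: D_def)
  moreover have "(\<integral>x. D n x \<partial>lborel) = 0" for n
  proof -
    have int: "integrable lborel f"
      using integrable_continuous_compact_support[OF C1_gradient_cont_fun[OF fg] supp] .
    have "integrable lborel (\<lambda>x. f (x + ?e n *\<^sub>R i))"
    proof (rule integrable_continuous_compact_support[where S="(\<lambda>y. y + - (?e n *\<^sub>R i)) ` S"])
      show "continuous_on UNIV (\<lambda>x. f (x + ?e n *\<^sub>R i))"
        by (intro continuous_on_compose2[OF C1_gradient_cont_fun[OF fg]]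
            continuous_on_add continuous_on_const continuous_on_id) auto
      show "f (x + ?e n *\<^sub>R i) = 0" if "x \<notin> (\<lambda>y. y + - (?e n *\<^sub>R i)) ` S" for x
      proof (rule supp(1))
        show "x + ?e n *\<^sub>R i \<notin> S"
          using that by (auto simp: image_iff)
      qed
      show "compact ((\<lambda>y. y + - (?e n *\<^sub>R i)) ` S)"
        by (intro compact_continuous_image supp(2) continuous_intros)
    qed
    then show ?thesis
      unfolding D_def using int integral_lborel_translate[of f "?e n *\<^sub>R i"]
      by (simp del: of_nat_Suc)
  qed
  ultimately show ?thesis
    by (simp add: LIMSEQ_const_iff)
qed

subsection \<open>Convolutions\<close>

definition mollify :: "('a::euclidean_space \<Rightarrow> real) \<Rightarrow> ('a \<Rightarrow> 'b::euclidean_space) \<Rightarrow> 'a \<Rightarrow> 'b"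
  where "mollify \<rho> f x = (\<integral>y. \<rho> (x - y) *\<^sub>R f y \<partial>lborel)"

lemma integrable_mollify:
  fixes f :: "'a::euclidean_space \<Rightarrow> 'b::euclidean_space"
  assumes "integrable lborel f" and "\<rho> \<in> borel_measurable borel" and "\<And>x. \<bar>\<rho> x\<bar> \<le> M"
  shows "integrable lborel (\<lambda>y. \<rho> (x - y) *\<^sub>R f y)"
proof (rule Bochner_Integration.integrable_bound)
  show "integrable lborel (\<lambda>y. M *\<^sub>R f y)" using assms by simp
  show "AE y in lborel. norm (\<rho> (x - y) *\<^sub>R f y) \<le> norm (M *\<^sub>R f y)"
    using assms(3) by (auto intro!: mult_right_mono order_trans[OF assms(3) abs_ge_self])
qed (use assms in measurable)

text \<open>The derivative falls on the smooth factor, so that the other one need only be integrable.\<close>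

lemma mollify_has_derivative:
  fixes f :: "'a::euclidean_space \<Rightarrow> real"
  assumes f: "integrable lborel f" and \<rho>: "C1_gradient \<rho> Z"
    and supp: "\<And>x. x \<notin> S \<Longrightarrow> \<rho> x = 0" "compact S"
  shows "(mollify \<rho> f has_derivative (\<lambda>h. \<integral>y. (Z (x - y) \<bullet> h) * f y \<partial>lborel)) (at x)"
proof -
  have Z0: "Z x = 0" if "x \<notin> S" for x
    using gradient_zero_outside_support[OF \<rho> supp(1) compact_imp_closed[OF supp(2)] that] .
  obtain M where M: "0 \<le> M" "\<And>x. norm (Z x) \<le> M"
    using continuous_compact_support_bounded[OF C1_gradient_cont[OF \<rho>] Z0 supp(2)] by blast
  obtain M' where M': "0 \<le> M'" "\<And>x. norm (\<rho> x) \<le> M'"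
    using continuous_compact_support_bounded[OF C1_gradient_cont_fun[OF \<rho>] supp] by blast
  have [measurable]: "\<rho> \<in> borel_measurable borel" "Z \<in> borel_measurable borel"
    "f \<in> borel_measurable borel"
    using C1_gradient_measurable[OF \<rho>] f by auto
  have intZ: "integrable lborel (\<lambda>y. f y *\<^sub>R Z (x - y))" for x
  proof (rule Bochner_Integration.integrable_bound)
    show "integrable lborel (\<lambda>y. M * f y)" using f by simp
    show "AE y in lborel. norm (f y *\<^sub>R Z (x - y)) \<le> norm (M * f y)"
      using M by (auto simp: abs_mult mult.commute[of _ "\<bar>f _\<bar>"] intro!: mult_left_mono)
  qed measurable
  have Deq: "(\<integral>y. (Z (x - y) \<bullet> h) * f y \<partial>lborel) = (\<integral>y. f y *\<^sub>R Z (x - y) \<partial>lborel) \<bullet> h" for h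
  proof -
    have "(\<integral>y. f y *\<^sub>R Z (x - y) \<partial>lborel) \<bullet> h = (\<integral>y. (f y *\<^sub>R Z (x - y)) \<bullet> h \<partial>lborel)"
      by (rule integral_inner_left[symmetric]) (rule intZ)
    then show ?thesis by (simp add: mult.commute)
  qed
  let ?D = "\<lambda>h. \<integral>y. (Z (x - y) \<bullet> h) * f y \<partial>lborel"
  have intZh: "integrable lborel (\<lambda>y. (Z (x - y) \<bullet> h) * f y)" for h
    using integrable_inner_left[OF intZ, of x h] by (simp add: mult.commute)
  have int\<rho>: "integrable lborel (\<lambda>y. \<rho> (x - y) * f y)" for x
    using integrable_mollify[OF f, of \<rho> M' x] M' by simp
  show ?thesis
    unfolding has_derivative_at
  proof
    show "bounded_linear ?D" unfolding Deq by (rule bounded_linear_inner_right)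
    show "(\<lambda>h. norm (mollify \<rho> f (x + h) - mollify \<rho> f x - ?D h) / norm h) \<midarrow>0\<rightarrow> 0"
      unfolding tendsto_at_iff_sequentially comp_def
    proof (intro allI impI)
      fix X :: "nat \<Rightarrow> 'a" assume X: "\<forall>i. X i \<in> UNIV - {0}" "X \<longlonglongrightarrow> 0"
      define e where "e n y = (\<rho> (x + X n - y) - \<rho> (x - y) - Z (x - y) \<bullet> X n) / norm (X n)" for n y
      have "(\<lambda>n. \<integral>y. e n y * f y \<partial>lborel) \<longlonglongrightarrow> (\<integral>y. 0 \<partial>(lborel :: 'a measure))"
      proof (rule integral_dominated_convergence[where w="\<lambda>y. (2 * M) * \<bar>f y\<bar>"])
        show "AE y in lborel. norm (e n y * f y) \<le> (2 * M) * \<bar>f y\<bar>" for n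
        proof (rule AE_I2)
          fix y
          have n0: "norm (X n) > 0" using X(1) by auto
          have "\<bar>\<rho> (x + X n - y) - \<rho> (x - y)\<bar> \<le> M * norm (X n)"
            using C1_lipschitz[OF \<rho> M(2), of "x + X n - y" "x - y"] by simp
          moreover have "\<bar>Z (x - y) \<bullet> X n\<bar> \<le> M * norm (X n)"
            using Cauchy_Schwarz_ineq2[of "Z (x - y)" "X n"]
              mult_right_mono[OF M(2)[of "x - y"], of "norm (X n)"] by simp
          ultimately have "\<bar>e n y\<bar> \<le> 2 * M"
            using n0 by (simp add: e_def field_simps)
          then show "norm (e n y * f y) \<le> (2 * M) * \<bar>f y\<bar>"
            by (simp add: abs_mult mult_right_mono)
        qed
        show "AE y in lborel. (\<lambda>n. e n y * f y) \<longlonglongrightarrow> 0"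
        proof (rule AE_I2)
          fix y
          have "(\<lambda>h. norm (\<rho> (x - y + h) - \<rho> (x - y) - Z (x - y) \<bullet> h) / norm h) \<midarrow>0\<rightarrow> 0"
            using C1_gradient_deriv[OF \<rho>, of "x - y"] by (simp add: has_derivative_at)
          then have "(\<lambda>n. norm (\<rho> (x - y + X n) - \<rho> (x - y) - Z (x - y) \<bullet> X n) / norm (X n))
              \<longlonglongrightarrow> 0"
            using X unfolding tendsto_at_iff_sequentially comp_def by blast
          then have "(\<lambda>n. \<bar>e n y\<bar>) \<longlonglongrightarrow> 0"
            by (simp add: e_def algebra_simps)
          then show "(\<lambda>n. e n y * f y) \<longlonglongrightarrow> 0"
            by (metis tendsto_mult_left_zero tendsto_rabs_zero_iff)
        qed
      qed (use f in \<open>auto simp: e_def\<close>)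
      moreover have "(\<integral>y. e n y * f y \<partial>lborel)
          = (mollify \<rho> f (x + X n) - mollify \<rho> f x - ?D (X n)) / norm (X n)" for n
      proof -
        have "e n y * f y = (\<rho> (x + X n - y) * f y - \<rho> (x - y) * f y - (Z (x - y) \<bullet> X n) * f y)
            / norm (X n)" for y
          by (simp add: e_def field_simps)
        then show ?thesis
          using int\<rho>[of "x + X n"] int\<rho>[of x] intZh[of "X n"]
          by (simp add: mollify_def)
      qed
      ultimately have "(\<lambda>n. (mollify \<rho> f (x + X n) - mollify \<rho> f x - ?D (X n)) / norm (X n)) \<longlonglongrightarrow> 0"
        by simp
      then show "(\<lambda>n. norm (mollify \<rho> f (x + X n) - mollify \<rho> f x - ?D (X n)) / norm (X n)) \<longlonglongrightarrow> 0"
        using tendsto_norm_zero by fastforce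
    qed
  qed
qed

lemma Ck_mollify:
  fixes f :: "'a::euclidean_space \<Rightarrow> real"
  assumes f: "integrable lborel f" and \<rho>: "\<And>j. Ck j \<rho>"
    and supp: "\<And>x. x \<notin> S \<Longrightarrow> \<rho> x = 0" "compact S"
  shows "Ck k (mollify \<rho> f)"
  using \<rho> supp(1)
proof (induction k arbitrary: \<rho>)
  case 0
  have "C1_gradient \<rho> (grad \<rho>)" using C1_gradient_grad 0 by blast
  from has_derivative_continuous[OF mollify_has_derivative[OF f this 0(2) supp(2)]]
  show ?case by (simp add: continuous_at_imp_continuous_on)
next
  case (Suc k)
  have g: "C1_gradient \<rho> (grad \<rho>)" using C1_gradient_grad Suc by blast
  show ?case
  proof (rule CkI[OF mollify_has_derivative[OF f g Suc(3) supp(2)]])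
    fix i :: 'a assume i: "i \<in> Basis"
    have "Ck k (mollify (\<lambda>z. grad \<rho> z \<bullet> i) f)"
    proof (rule Suc.IH)
      show "Ck j (\<lambda>z. grad \<rho> z \<bullet> i)" for j
        using Suc.prems(1)[of "Suc j"] i frechet_derivative_C1[OF g] by simp
      show "grad \<rho> x \<bullet> i = 0" if "x \<notin> S" for x
        using gradient_zero_outside_support[OF g Suc(3) compact_imp_closed[OF supp(2)] that] by simp
    qed
    then show "Ck k (\<lambda>x. \<integral>y. (grad \<rho> (x - y) \<bullet> i) * f y \<partial>lborel)"
      by (simp add: mollify_def[abs_def])
  qed
qed

section \<open>Integrals of powers\<close>

text \<open>The \<open>p\<close>-th power of the norm of \<open>L\<^sup>p\<close>, which may be infinite; the power is kept since all
  energy estimates are additive in it.\<close>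

definition pint :: "real \<Rightarrow> ('a::euclidean_space \<Rightarrow> 'b::euclidean_space) \<Rightarrow> ennreal"
  where "pint p g = (\<integral>\<^sup>+x. ennreal (norm (g x) powr p) \<partial>lborel)"

lemma powr_add_le:
  fixes a b p :: real
  assumes "0 \<le> a" "0 \<le> b" "0 \<le> p"
  shows "(a + b) powr p \<le> 2 powr p * (a powr p + b powr p)"
proof -
  have "(a + b) powr p \<le> (2 * max a b) powr p"
    using assms by (intro powr_mono2) auto
  also have "\<dots> = 2 powr p * max a b powr p"
    by (simp add: powr_mult)
  also have "max a b powr p \<le> a powr p + b powr p"
    by (simp add: max_def)
  finally show ?thesis by simp
qed

lemma pint_mono:
  assumes "\<And>x. norm (f x) \<le> norm (g x)" "0 \<le> p"
  shows "pint p f \<le> pint p g"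
  unfolding pint_def using assms by (intro nn_integral_mono ennreal_leI powr_mono2) auto

lemma pint_cong_AE:
  assumes "AE x in lborel. f x = g x" shows "pint p f = pint p g"
  unfolding pint_def by (rule nn_integral_cong_AE) (use assms in auto)

lemma pint_add:
  assumes [measurable]: "f \<in> borel_measurable borel" "g \<in> borel_measurable borel" and "0 \<le> p"
  shows "pint p (\<lambda>x. f x + g x) \<le> ennreal (2 powr p) * (pint p f + pint p g)"
proof -
  have "pint p (\<lambda>x. f x + g x)
      \<le> (\<integral>\<^sup>+x. ennreal (2 powr p) * (ennreal (norm (f x) powr p) + ennreal (norm (g x) powr p)) \<partial>lborel)"
    unfolding pint_def
  proof (rule nn_integral_mono)
    fix x
    have "norm (f x + g x) powr p \<le> (norm (f x) + norm (g x)) powr p"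
      using assms(3) norm_triangle_ineq by (intro powr_mono2) auto
    also have "\<dots> \<le> 2 powr p * (norm (f x) powr p + norm (g x) powr p)"
      using assms(3) by (intro powr_add_le) auto
    finally show "ennreal (norm (f x + g x) powr p)
        \<le> ennreal (2 powr p) * (ennreal (norm (f x) powr p) + ennreal (norm (g x) powr p))"
      by (simp add: ennreal_leI flip: ennreal_plus ennreal_mult)
  qed
  also have "\<dots> = ennreal (2 powr p) * (pint p f + pint p g)"
    unfolding pint_def by (simp add: nn_integral_cmult nn_integral_add)
  finally show ?thesis .
qed

lemma pint_minus: "pint p (\<lambda>x. - f x) = pint p f"
  by (simp add: pint_def)

lemma pint_diff_commute: "pint p (\<lambda>x. f x - g x) = pint p (\<lambda>x. g x - f x)"
  by (simp add: pint_def norm_minus_commute)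

lemma pint_triangle:
  assumes "f \<in> borel_measurable borel" "g \<in> borel_measurable borel" "h \<in> borel_measurable borel"
    and "0 \<le> p"
  shows "pint p (\<lambda>x. f x - h x)
    \<le> ennreal (2 powr p) * (pint p (\<lambda>x. f x - g x) + pint p (\<lambda>x. g x - h x))"
  using pint_add[of "\<lambda>x. f x - g x" "\<lambda>x. g x - h x" p] assms by simp

lemma pint_triangle_le:
  assumes "f \<in> borel_measurable borel" "g \<in> borel_measurable borel" "h \<in> borel_measurable borel"
    and "0 \<le> p" and "pint p (\<lambda>x. f x - g x) \<le> ennreal a" "pint p (\<lambda>x. g x - h x) \<le> ennreal b"
    and "0 \<le> a" "0 \<le> b"
  shows "pint p (\<lambda>x. f x - h x) \<le> ennreal (2 powr p * (a + b))"
proof -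
  have "pint p (\<lambda>x. f x - h x) \<le> ennreal (2 powr p) * (ennreal a + ennreal b)"
    using assms by (intro order_trans[OF pint_triangle[of f g h p]] mult_left_mono add_mono) auto
  then show ?thesis using assms by (simp add: ennreal_mult' flip: ennreal_plus)
qed

lemma pint_cmult:
  assumes "g \<in> borel_measurable borel"
  shows "pint p (\<lambda>x. c *\<^sub>R g x) = ennreal (\<bar>c\<bar> powr p) * pint p g"
  unfolding pint_def using assms
  by (simp add: powr_mult ennreal_mult nn_integral_cmult)

lemma pint_tendsto_0_dominated:
  fixes f :: "nat \<Rightarrow> 'a::euclidean_space \<Rightarrow> 'b::euclidean_space"
  assumes [measurable]: "\<And>n. f n \<in> borel_measurable borel" "w \<in> borel_measurable borel"
    and "\<And>n x. norm (f n x) \<le> norm (w x)" and "pint p w < \<infinity>"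
    and "AE x in lborel. (\<lambda>n. f n x) \<longlonglongrightarrow> 0" and "0 < p"
  shows "(\<lambda>n. pint p (f n)) \<longlonglongrightarrow> 0"
proof -
  have "(\<lambda>n. pint p (f n)) \<longlonglongrightarrow> (\<integral>\<^sup>+x. 0 \<partial>(lborel :: 'a measure))"
    unfolding pint_def
  proof (rule nn_integral_dominated_convergence[where w="\<lambda>x. ennreal (norm (w x) powr p)"])
    show "(\<integral>\<^sup>+x. ennreal (norm (w x) powr p) \<partial>lborel) < \<infinity>"
      using assms(4) by (simp add: pint_def)
    show "AE x in lborel. (\<lambda>n. ennreal (norm (f n x) powr p)) \<longlonglongrightarrow> 0"
      using assms(5)
    proof eventually_elim
      case (elim x)
      have "(\<lambda>n. norm (f n x) powr p) \<longlonglongrightarrow> 0"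
        using elim assms(6) by (intro tendsto_zero_powrI[where b=p] tendsto_norm_zero) auto
      then show ?case using ennreal_0 by (metis tendsto_ennrealI)
    qed
    show "AE x in lborel. ennreal (norm (f n x) powr p) \<le> ennreal (norm (w x) powr p)" for n
      using assms(3,6) by (intro AE_I2 ennreal_leI powr_mono2) auto
  qed simp_all
  then show ?thesis by simp
qed

lemma nn_integral_lborel_affine:
  fixes t :: "'a::euclidean_space"
  assumes [measurable]: "f \<in> borel_measurable borel" and "c \<noteq> 0"
  shows "(\<integral>\<^sup>+x. f x \<partial>lborel) = ennreal (\<bar>c\<bar> ^ DIM('a)) * (\<integral>\<^sup>+x. f (t + c *\<^sub>R x) \<partial>lborel)"
  by (subst lborel_affine[OF assms(2), of t])
    (simp add: nn_integral_density nn_integral_distr nn_integral_cmult)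

lemma nn_integral_lborel_translate:
  fixes t :: "'a::euclidean_space"
  assumes "f \<in> borel_measurable borel"
  shows "(\<integral>\<^sup>+x. f (x + t) \<partial>lborel) = (\<integral>\<^sup>+x. f x \<partial>lborel)"
  using nn_integral_lborel_affine[OF assms, of 1 t] by (simp add: add.commute)

lemma nn_integral_lborel_reflect:
  fixes t :: "'a::euclidean_space"
  assumes "f \<in> borel_measurable borel"
  shows "(\<integral>\<^sup>+x. f (t - x) \<partial>lborel) = (\<integral>\<^sup>+x. f x \<partial>lborel)"
  using nn_integral_lborel_affine[OF assms, of "-1" t] by simp

subsection \<open>Hoelder's inequality\<close>

text \<open>Real upper bounds stand for the two integrals, so that estimates can be chained without
  arithmetic in the extended reals.\<close>

lemma nn_integral_Hoelder:
  fixes f g :: "'a \<Rightarrow> real"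
  assumes [measurable]: "f \<in> borel_measurable M" "g \<in> borel_measurable M"
    and nn: "\<And>x. 0 \<le> f x" "\<And>x. 0 \<le> g x"
    and pq: "1 < p" "1 < q" "1 / p + 1 / q = 1"
    and A: "(\<integral>\<^sup>+x. ennreal (f x powr p) \<partial>M) \<le> ennreal A" "0 \<le> A"
    and B: "(\<integral>\<^sup>+x. ennreal (g x powr q) \<partial>M) \<le> ennreal B" "0 \<le> B"
  shows "(\<integral>\<^sup>+x. ennreal (f x * g x) \<partial>M) \<le> ennreal (A powr (1 / p) * B powr (1 / q))"
proof (cases "A = 0 \<or> B = 0")
  case True
  have "AE x in M. f x * g x = 0"
  proof (cases "A = 0")
    case True
    then have "(\<integral>\<^sup>+x. ennreal (f x powr p) \<partial>M) = 0" using A by simp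
    then have "AE x in M. ennreal (f x powr p) = 0"
      by (subst (asm) nn_integral_0_iff_AE) auto
    then show ?thesis by eventually_elim (use nn in auto)
  next
    case False
    then have "(\<integral>\<^sup>+x. ennreal (g x powr q) \<partial>M) = 0" using B \<open>A = 0 \<or> B = 0\<close> by simp
    then have "AE x in M. ennreal (g x powr q) = 0"
      by (subst (asm) nn_integral_0_iff_AE) auto
    then show ?thesis by eventually_elim (use nn in auto)
  qed
  then have "(\<integral>\<^sup>+x. ennreal (f x * g x) \<partial>M) = (\<integral>\<^sup>+x. 0 \<partial>M)"
    by (intro nn_integral_cong_AE) auto
  then show ?thesis by simp
next
  case False
  then have pos: "A > 0" "B > 0" using A B by auto
  let ?c = "A powr (1 / p) * B powr (1 / q)"
  have c: "?c > 0" using pos by simp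
  have "f x * g x \<le> ?c * (f x powr p / (p * A) + g x powr q / (q * B))" for x
  proof -
    have "(f x / A powr (1 / p)) * (g x / B powr (1 / q))
        \<le> (f x / A powr (1 / p)) powr p / p + (g x / B powr (1 / q)) powr q / q"
      using pq nn by (intro Youngs_inequality) auto
    also have "\<dots> = f x powr p / (p * A) + g x powr q / (q * B)"
      using pos pq nn by (simp add: powr_divide powr_powr mult.commute)
    finally show ?thesis using c by (simp add: field_simps)
  qed
  then have "(\<integral>\<^sup>+x. ennreal (f x * g x) \<partial>M)
      \<le> (\<integral>\<^sup>+x. ennreal ?c * (ennreal (1 / (p * A)) * ennreal (f x powr p)
          + ennreal (1 / (q * B)) * ennreal (g x powr q)) \<partial>M)"
    using pq pos nn
    by (intro nn_integral_mono) (simp flip: ennreal_mult ennreal_plus add: ennreal_leI)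
  also have "\<dots> = ennreal ?c * (ennreal (1 / (p * A)) * (\<integral>\<^sup>+x. ennreal (f x powr p) \<partial>M)
      + ennreal (1 / (q * B)) * (\<integral>\<^sup>+x. ennreal (g x powr q) \<partial>M))"
    by (simp add: nn_integral_cmult nn_integral_add)
  also have "\<dots> \<le> ennreal ?c * (ennreal (1 / (p * A)) * ennreal A + ennreal (1 / (q * B)) * ennreal B)"
    using A B by (intro mult_left_mono add_mono) auto
  also have "\<dots> = ennreal (?c * (1 / (p * A) * A + 1 / (q * B) * B))"
    using pq pos by (simp flip: ennreal_mult ennreal_plus)
  also have "1 / (p * A) * A + 1 / (q * B) * B = 1"
    using pq pos by simp
  finally show ?thesis by simp
qed

text \<open>Hoelder's inequality for the factors \<open>\<rho> powr (1 / p) * h\<close> and \<open>\<rho> powr (1 - 1 / p)\<close>.\<close>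

lemma nn_integral_power_mean:
  fixes \<rho> h :: "'a \<Rightarrow> real"
  assumes [measurable]: "\<rho> \<in> borel_measurable M" "h \<in> borel_measurable M"
    and nn: "\<And>x. 0 \<le> \<rho> x" "\<And>x. 0 \<le> h x" and p: "1 \<le> p"
    and W: "(\<integral>\<^sup>+x. ennreal (\<rho> x) \<partial>M) \<le> ennreal W" "0 \<le> W"
    and A: "(\<integral>\<^sup>+x. ennreal (\<rho> x * h x powr p) \<partial>M) \<le> ennreal A" "0 \<le> A"
  shows "(\<integral>\<^sup>+x. ennreal (\<rho> x * h x) \<partial>M) \<le> ennreal (W powr (1 - 1 / p) * A powr (1 / p))"
proof (cases "p = 1")
  case True
  then have "(\<integral>\<^sup>+x. ennreal (\<rho> x * h x) \<partial>M) \<le> ennreal A" using A nn by simp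
  moreover have "W powr 0 * A = A \<or> W = 0" by simp
  moreover have "(\<integral>\<^sup>+x. ennreal (\<rho> x * h x) \<partial>M) = 0" if "W = 0"
  proof -
    have "AE x in M. ennreal (\<rho> x) = 0"
    proof -
      have "(\<integral>\<^sup>+x. ennreal (\<rho> x) \<partial>M) = 0" using W that by simp
      then show ?thesis by (subst (asm) nn_integral_0_iff_AE) auto
    qed
    then have "AE x in M. ennreal (\<rho> x * h x) = 0"
      by eventually_elim (use nn in \<open>simp add: ennreal_eq_0_iff mult_nonpos_nonneg\<close>)
    then show ?thesis by (subst nn_integral_0_iff_AE) auto
  qed
  ultimately show ?thesis using True A by auto
next
  case False
  then have p1: "1 < p" using p by simp
  define q where "q = p / (p - 1)"
  have q: "1 < q" "1 / p + 1 / q = 1" "1 / q = 1 - 1 / p"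
    using p1 by (auto simp: q_def field_simps)
  have split: "\<rho> x powr (1 / p) * \<rho> x powr (1 / q) = \<rho> x" for x
    using nn(1)[of x] q(2) by (cases "\<rho> x = 0") (auto simp flip: powr_add)
  have "(\<integral>\<^sup>+x. ennreal (\<rho> x * h x) \<partial>M)
      = (\<integral>\<^sup>+x. ennreal ((\<rho> x powr (1 / p) * h x) * \<rho> x powr (1 / q)) \<partial>M)"
    using split by (intro nn_integral_cong) (metis mult.assoc mult.commute)
  also have "\<dots> \<le> ennreal (A powr (1 / p) * W powr (1 / q))"
  proof (rule nn_integral_Hoelder)
    have "(\<rho> x powr (1 / p) * h x) powr p = \<rho> x * h x powr p" for x
      using nn p1 by (simp add: powr_mult powr_powr)
    then show "(\<integral>\<^sup>+x. ennreal ((\<rho> x powr (1 / p) * h x) powr p) \<partial>M) \<le> ennreal A"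
      using A by simp
    have "(\<rho> x powr (1 / q)) powr q = \<rho> x" for x
      using nn q(1) by (simp add: powr_powr)
    then show "(\<integral>\<^sup>+x. ennreal ((\<rho> x powr (1 / q)) powr q) \<partial>M) \<le> ennreal W"
      using W by simp
  qed (use nn p1 q A W in auto)
  finally show ?thesis using q(3) by (simp add: mult.commute)
qed

section \<open>Mollification\<close>

definition mollifier :: "real \<Rightarrow> ('a::euclidean_space \<Rightarrow> real) \<Rightarrow> bool"
  where "mollifier \<epsilon> \<rho> \<longleftrightarrow> (\<forall>k. Ck k \<rho>) \<and> (\<forall>x. 0 \<le> \<rho> x) \<and> (\<forall>x. \<epsilon> \<le> norm x \<longrightarrow> \<rho> x = 0) \<and>
    (\<integral>x. \<rho> x \<partial>lborel) = 1"

lemma ex_mollifier: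
  assumes "0 < \<epsilon>" shows "\<exists>\<rho>. mollifier \<epsilon> (\<rho> :: 'a::euclidean_space \<Rightarrow> real)"
proof -
  define b :: "'a \<Rightarrow> real" where "b x = flat_fun 0 (\<epsilon>\<^sup>2 - x \<bullet> x)" for x
  have Ckb: "Ck k b" for k
    using Ck_bump[of k 0 "\<epsilon>\<^sup>2"] by (simp add: b_def[abs_def])
  have b0: "b x = 0" if "\<epsilon> \<le> norm x" for x
  proof -
    have "\<epsilon>\<^sup>2 \<le> (norm x)\<^sup>2" using assms that by (intro power_mono) auto
    then show ?thesis by (simp add: b_def flat_fun_def dot_square_norm)
  qed
  have bpos: "b x > 0" if "norm x < \<epsilon>" for x
  proof -
    have "(norm x)\<^sup>2 < \<epsilon>\<^sup>2" using assms that by (intro power_strict_mono) auto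
    then show ?thesis by (simp add: b_def flat_fun_def dot_square_norm)
  qed
  have bnn: "0 \<le> b x" for x by (simp add: b_def flat_fun_def)
  have int: "integrable lborel b"
    by (rule integrable_continuous_compact_support[where S="cball 0 \<epsilon>"])
      (use Ck_continuous[OF Ckb[of 0]] b0 in auto)
  have "(\<integral>x. b x \<partial>lborel) \<noteq> 0"
  proof
    assume "(\<integral>x. b x \<partial>lborel) = 0"
    then have "AE x in lborel. b x = 0"
      using integral_nonneg_eq_0_iff_AE[OF int] bnn by auto
    then have "AE x in lborel. x \<notin> ball (0::'a) \<epsilon>"
      by eventually_elim (use bpos in force)
    then have "emeasure lborel (ball (0::'a) \<epsilon>) = 0"
      by (subst (asm) AE_iff_measurable[of "ball 0 \<epsilon>"]) auto
    then show False
      using content_ball_pos[OF assms, of "0::'a"] by (simp add: measure_def)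
  qed
  moreover have "(\<integral>x. b x \<partial>lborel) \<ge> 0" using bnn by simp
  ultimately have pos: "(\<integral>x. b x \<partial>lborel) > 0" by simp
  have "mollifier \<epsilon> (\<lambda>x. inverse (\<integral>x. b x \<partial>lborel) * b x)"
    unfolding mollifier_def using Ckb b0 bnn pos by (auto intro: Ck_cmult)
  then show ?thesis by blast
qed

lemma mollifier_Ck: "mollifier \<epsilon> \<rho> \<Longrightarrow> Ck k \<rho>"
  and mollifier_nonneg: "mollifier \<epsilon> \<rho> \<Longrightarrow> 0 \<le> \<rho> x"
  and mollifier_zero: "mollifier \<epsilon> \<rho> \<Longrightarrow> \<epsilon> \<le> norm x \<Longrightarrow> \<rho> x = 0"
  and mollifier_integral: "mollifier \<epsilon> \<rho> \<Longrightarrow> (\<integral>x. \<rho> x \<partial>lborel) = 1"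
  by (auto simp: mollifier_def)

lemma mollifier_support: "mollifier \<epsilon> \<rho> \<Longrightarrow> x \<notin> cball 0 \<epsilon> \<Longrightarrow> \<rho> x = 0"
  by (rule mollifier_zero) auto

lemma mollifier_measurable: "mollifier \<epsilon> \<rho> \<Longrightarrow> \<rho> \<in> borel_measurable borel"
  by (intro borel_measurable_continuous_onI Ck_continuous[of 0] mollifier_Ck)

lemma mollifier_integrable: "mollifier \<epsilon> \<rho> \<Longrightarrow> integrable lborel \<rho>"
  by (rule integrable_continuous_compact_support[where S="cball 0 \<epsilon>"])
    (simp_all add: Ck_continuous[OF mollifier_Ck[where k=0]] mollifier_zero)

lemma mollifier_bounded:
  assumes "mollifier \<epsilon> \<rho>" obtains M where "\<And>x. \<bar>\<rho> x\<bar> \<le> M"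
  using continuous_compact_support_bounded[OF Ck_continuous[OF mollifier_Ck[OF assms, of 0]]
      mollifier_support[OF assms] compact_cball]
  by (metis real_norm_def)

lemma mollifier_nn_integral:
  assumes "mollifier \<epsilon> \<rho>"
  shows "(\<integral>\<^sup>+x. ennreal (\<rho> x) \<partial>lborel) = 1" "(\<integral>\<^sup>+y. ennreal (\<rho> (x - y)) \<partial>lborel) = 1"
    "(\<integral>\<^sup>+x. ennreal (\<rho> (x - y)) \<partial>lborel) = 1"
proof -
  have [measurable]: "\<rho> \<in> borel_measurable borel" using mollifier_measurable[OF assms] .
  show 1: "(\<integral>\<^sup>+x. ennreal (\<rho> x) \<partial>lborel) = 1"
    using nn_integral_eq_integral[OF mollifier_integrable[OF assms]] mollifier_nonneg[OF assms]
      mollifier_integral[OF assms] by simp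
  show "(\<integral>\<^sup>+y. ennreal (\<rho> (x - y)) \<partial>lborel) = 1"
    using nn_integral_lborel_reflect[of "\<lambda>x. ennreal (\<rho> x)" x] 1 by simp
  show "(\<integral>\<^sup>+x. ennreal (\<rho> (x - y)) \<partial>lborel) = 1"
    using nn_integral_lborel_translate[of "\<lambda>x. ennreal (\<rho> x)" "- y"] 1 by simp
qed

lemma mollify_measurable:
  fixes g :: "'a::euclidean_space \<Rightarrow> 'b::euclidean_space"
  assumes [measurable]: "\<rho> \<in> borel_measurable borel" "g \<in> borel_measurable borel"
  shows "mollify \<rho> g \<in> borel_measurable borel"
proof -
  have "(\<lambda>x. \<integral>y. \<rho> (x - y) *\<^sub>R g y \<partial>lborel) \<in> borel_measurable (borel :: 'a measure)"
    by (rule lborel.borel_measurable_lebesgue_integral) measurable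
  then show ?thesis by (simp add: mollify_def[abs_def])
qed

lemma pint_mollify_le:
  fixes g :: "'a::euclidean_space \<Rightarrow> 'b::euclidean_space"
  assumes \<rho>: "mollifier \<epsilon> \<rho>" and [measurable]: "g \<in> borel_measurable borel"
    and p: "1 \<le> p"
  shows "pint p (mollify \<rho> g) \<le> pint p g"
proof -
  have [measurable]: "\<rho> \<in> borel_measurable borel" using mollifier_measurable[OF \<rho>] .
  have pt: "ennreal (norm (mollify \<rho> g x) powr p)
      \<le> (\<integral>\<^sup>+y. ennreal (\<rho> (x - y) * norm (g y) powr p) \<partial>lborel)" (is "_ \<le> ?I") for x
  proof (cases "?I = \<infinity>")
    case False
    then obtain A where A: "?I = ennreal A" "0 \<le> A" by (cases ?I) auto
    have "(\<integral>\<^sup>+y. ennreal (\<rho> (x - y) * norm (g y)) \<partial>lborel) \<le> ennreal (1 powr (1 - 1/p) * A powr (1/p))"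
      by (rule nn_integral_power_mean)
        (use p A mollifier_nonneg[OF \<rho>] mollifier_nn_integral[OF \<rho>] in auto)
    moreover have "ennreal (norm (mollify \<rho> g x)) \<le> (\<integral>\<^sup>+y. ennreal (\<rho> (x - y) * norm (g y)) \<partial>lborel)"
    proof (cases "integrable lborel (\<lambda>y. \<rho> (x - y) *\<^sub>R g y)")
      case True
      then show ?thesis
        unfolding mollify_def using integral_norm_bound_ennreal[OF True] mollifier_nonneg[OF \<rho>] by simp
    next
      case False
      then show ?thesis by (simp add: mollify_def not_integrable_integral_eq)
    qed
    ultimately have "norm (mollify \<rho> g x) \<le> A powr (1 / p)"
      by (metis (no_types, lifting) dual_order.trans ennreal_le_iff mult_1 powr_ge_zero powr_one_eq_one)
    then have "norm (mollify \<rho> g x) powr p \<le> (A powr (1 / p)) powr p"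
      using p by (intro powr_mono2) auto
    also have "\<dots> = A" using p A by (simp add: powr_powr)
    finally show ?thesis using A by (simp add: ennreal_leI)
  qed simp
  have "pint p (mollify \<rho> g)
      \<le> (\<integral>\<^sup>+x. \<integral>\<^sup>+y. ennreal (\<rho> (x - y) * norm (g y) powr p) \<partial>lborel \<partial>lborel)"
    unfolding pint_def by (intro nn_integral_mono pt)
  also have "\<dots> = (\<integral>\<^sup>+y. \<integral>\<^sup>+x. ennreal (\<rho> (x - y) * norm (g y) powr p) \<partial>lborel \<partial>lborel)"
    by (rule lborel_pair.Fubini') measurable
  also have "\<dots> = (\<integral>\<^sup>+y. (\<integral>\<^sup>+x. ennreal (\<rho> (x - y)) \<partial>lborel) * ennreal (norm (g y) powr p) \<partial>lborel)"
    by (intro nn_integral_cong) (simp add: ennreal_mult' mollifier_nonneg[OF \<rho>] nn_integral_multc ennreal_mult)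
  also have "\<dots> = pint p g"
    by (simp add: mollifier_nn_integral[OF \<rho>] pint_def)
  finally show ?thesis .
qed

definition truncate :: "real \<Rightarrow> 'b::euclidean_space \<Rightarrow> 'b"
  where "truncate m v = (m / max m (norm v)) *\<^sub>R v"

lemma truncate_continuous: "0 < m \<Longrightarrow> continuous_on UNIV (truncate m)"
  unfolding truncate_def[abs_def] by (intro continuous_intros) (auto simp: max_def)

lemma norm_truncate_le: "0 < m \<Longrightarrow> norm (truncate m v) \<le> m"
  by (auto simp: truncate_def max_def)

lemma truncate_eq: "norm v \<le> m \<Longrightarrow> 0 < m \<Longrightarrow> truncate m v = v"
  by (auto simp: truncate_def max_def)

lemma norm_truncate_diff: "0 < m \<Longrightarrow> norm (truncate m v - v) \<le> norm v"
proof (cases "norm v \<le> m")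
  case False
  assume "0 < m"
  have "truncate m v - v = (m / norm v - 1) *\<^sub>R v"
    using False by (simp add: truncate_def algebra_simps max_def)
  moreover have "\<bar>m / norm v - 1\<bar> \<le> 1"
  proof -
    have "m / norm v \<le> 1" "0 \<le> m / norm v"
      using False \<open>0 < m\<close> by (auto simp: divide_le_eq)
    then show ?thesis by linarith
  qed
  ultimately show ?thesis by (simp add: mult_left_le_one_le)
qed (simp add: truncate_eq)

text \<open>Continuous functions are dense in \<open>L\<^sup>p\<close>: after truncation a function is bounded, and it is
  an almost everywhere limit of continuous functions, which may be truncated likewise.\<close>

lemma pint_approx_continuous:
  fixes g :: "'a::euclidean_space \<Rightarrow> 'b::euclidean_space"
  assumes g[measurable]: "g \<in> borel_measurable borel" and p: "0 < p" and fin: "pint p g < \<infinity>"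
    and supp: "\<And>x. r \<le> norm x \<Longrightarrow> g x = 0" and e: "0 < e"
  shows "\<exists>c. continuous_on UNIV c \<and> (\<forall>x. r + 1 \<le> norm x \<longrightarrow> c x = 0) \<and>
    pint p (\<lambda>x. g x - c x) \<le> ennreal e"
proof -
  define d where "d = e / (2 * 2 powr p)"
  have d: "0 < ennreal d" "0 \<le> d" "2 powr p * (d + d) = e"
    using e by (auto simp: d_def)
  have "g measurable_on UNIV"
    by (rule lebesgue_measurable_imp_measurable_on) (auto intro: measurable_completion)
  then obtain N G where N: "negligible N" and G: "\<And>n. continuous_on UNIV (G n)"
    and lim: "\<And>x. x \<notin> N \<Longrightarrow> (\<lambda>n. G n x) \<longlonglongrightarrow> g x"
    unfolding measurable_on_def by auto
  have AE_lim: "AE x in lborel. (\<lambda>n. G n x) \<longlonglongrightarrow> g x"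
  proof -
    have "N \<in> null_sets lebesgue" using N negligible_iff_null_sets by blast
    then have "AE x in lebesgue. x \<notin> N" by (rule AE_not_in)
    then have "AE x in lborel. x \<notin> N" by (simp add: AE_completion_iff)
    then show ?thesis by eventually_elim (use lim in auto)
  qed
  have "(\<lambda>m. pint p (\<lambda>x. truncate (real (Suc m)) (g x) - g x)) \<longlonglongrightarrow> 0"
  proof (rule pint_tendsto_0_dominated[where w=g])
    show "(\<lambda>x. truncate (real (Suc n)) (g x) - g x) \<in> borel_measurable borel" for n
      using borel_measurable_continuous_onI[OF truncate_continuous[of "real (Suc n)"]] by measurable
    show "AE x in lborel. (\<lambda>n. truncate (real (Suc n)) (g x) - g x) \<longlonglongrightarrow> 0"
    proof (rule AE_I2)
      fix x
      obtain k where k: "norm (g x) \<le> real k" using real_arch_simple by blast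
      have "\<forall>\<^sub>F n in sequentially. truncate (real (Suc n)) (g x) - g x = 0"
        using eventually_ge_at_top[of k] by eventually_elim (use k in \<open>simp add: truncate_eq\<close>)
      then show "(\<lambda>n. truncate (real (Suc n)) (g x) - g x) \<longlonglongrightarrow> 0"
        by (rule tendsto_eventually)
    qed
  qed (use p fin in \<open>auto intro!: norm_truncate_diff simp del: of_nat_Suc\<close>)
  then have "\<forall>\<^sub>F m in sequentially. pint p (\<lambda>x. truncate (real (Suc m)) (g x) - g x) < ennreal d"
    using d(1) by (rule order_tendstoD)
  then obtain k where k: "pint p (\<lambda>x. truncate (real (Suc k)) (g x) - g x) < ennreal d"
    using eventually_happens'[OF sequentially_bot] by blast
  define m where "m = real (Suc k)"
  have m: "0 < m" by (simp add: m_def)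
  have [measurable]: "truncate m \<in> borel_measurable (borel :: 'b measure)"
    by (rule borel_measurable_continuous_onI[OF truncate_continuous[OF m]])
  have [measurable]: "G n \<in> borel_measurable borel" for n
    by (rule borel_measurable_continuous_onI[OF G])
  define cut :: "'a \<Rightarrow> real" where "cut x = max 0 (min 1 (r + 1 - norm x))" for x
  have cut: "0 \<le> cut x" "cut x \<le> 1" "norm x \<le> r \<Longrightarrow> cut x = 1" "r + 1 \<le> norm x \<Longrightarrow> cut x = 0" for x
    by (auto simp: cut_def)
  have cutc: "continuous_on UNIV cut"
    unfolding cut_def[abs_def] by (intro continuous_intros)
  then have [measurable]: "cut \<in> borel_measurable borel" by (rule borel_measurable_continuous_onI)
  let ?c = "\<lambda>n x. cut x *\<^sub>R truncate m (G n x)"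
  have "(\<lambda>n. pint p (\<lambda>x. truncate m (g x) - ?c n x)) \<longlonglongrightarrow> 0"
  proof (rule pint_tendsto_0_dominated[where w="\<lambda>x. indicator (ball 0 (r + 1)) x * (2 * m)"])
    show "norm (truncate m (g x) - ?c n x) \<le> norm (indicator (ball 0 (r + 1)) x * (2 * m))" for n x
    proof (cases "x \<in> ball 0 (r + 1)")
      case True
      have "norm (truncate m (g x) - ?c n x) \<le> norm (truncate m (g x)) + norm (?c n x)"
        by (rule norm_triangle_ineq4)
      also have "\<dots> \<le> m + 1 * m"
      proof (rule add_mono[OF norm_truncate_le[OF m]])
        have "cut x * norm (truncate m (G n x)) \<le> 1 * m"
          using cut(1,2)[of x] m by (intro mult_mono norm_truncate_le) auto
        then show "norm (?c n x) \<le> 1 * m" using cut(1)[of x] by simp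
      qed
      finally show ?thesis using True m by simp
    next
      case False
      then show ?thesis using cut(4)[of x] supp[of x] m by (simp add: truncate_def)
    qed
    have "(\<integral>\<^sup>+x. ennreal (norm (indicator (ball (0::'a) (r + 1)) x * (2 * m)) powr p) \<partial>lborel)
        = (\<integral>\<^sup>+x. ennreal ((2 * m) powr p) * indicator (ball (0::'a) (r + 1)) x \<partial>lborel)"
      using m by (intro nn_integral_cong) (auto simp: indicator_def)
    then show "pint p (\<lambda>x::'a. indicator (ball 0 (r + 1)) x * (2 * m)) < \<infinity>"
      using emeasure_lborel_ball_finite[of "0::'a" "r + 1"]
      by (simp add: pint_def nn_integral_cmult_indicator ennreal_mult_less_top)
    show "AE x in lborel. (\<lambda>n. truncate m (g x) - ?c n x) \<longlonglongrightarrow> 0"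
      using AE_lim
    proof eventually_elim
      case (elim x)
      have "(\<lambda>n. truncate m (G n x)) \<longlonglongrightarrow> truncate m (g x)"
        using continuous_on_tendsto_compose[OF truncate_continuous[OF m] elim] by simp
      then have "(\<lambda>n. truncate m (g x) - ?c n x) \<longlonglongrightarrow> truncate m (g x) - cut x *\<^sub>R truncate m (g x)"
        by (intro tendsto_intros)
      moreover have "truncate m (g x) - cut x *\<^sub>R truncate m (g x) = 0"
        using cut(3)[of x] supp[of x] by (cases "norm x \<le> r") (auto simp: truncate_def)
      ultimately show ?case by simp
    qed
    show "(\<lambda>x::'a. indicator (ball 0 (r + 1)) x * (2 * m)) \<in> borel_measurable borel"
      by (intro borel_measurable_times borel_measurable_indicator borel_measurable_const) simp
  qed (use p in simp_all)
  then have "\<forall>\<^sub>F n in sequentially. pint p (\<lambda>x. truncate m (g x) - ?c n x) < ennreal d"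
    using d(1) by (rule order_tendstoD)
  then obtain n where n: "pint p (\<lambda>x. truncate m (g x) - ?c n x) < ennreal d"
    using eventually_happens'[OF sequentially_bot] by blast
  have k': "pint p (\<lambda>x. g x - truncate m (g x)) \<le> ennreal d"
    using k by (simp add: m_def pint_diff_commute[of p g] del: of_nat_Suc)
  have "pint p (\<lambda>x. g x - ?c n x) \<le> ennreal (2 powr p * (d + d))"
    by (rule pint_triangle_le[where g="\<lambda>x. truncate m (g x)"])
      (use p k' n d in \<open>auto simp: less_imp_le\<close>)
  then have "pint p (\<lambda>x. g x - ?c n x) \<le> ennreal e" using d by simp
  moreover have "continuous_on UNIV (?c n)"
    by (intro continuous_on_scaleR cutc continuous_on_compose2[OF truncate_continuous[OF m] G]) auto
  ultimately show ?thesis using cut(4) by (intro exI[of _ "?c n"]) auto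
qed

lemma mollify_const_diff:
  fixes g :: "'a::euclidean_space \<Rightarrow> 'b::euclidean_space"
  assumes \<rho>: "mollifier \<epsilon> \<rho>" and g: "integrable lborel g"
    and near: "\<And>y. norm (x - y) < \<epsilon> \<Longrightarrow> norm (g y - v) \<le> d"
  shows "norm (mollify \<rho> g x - v) \<le> d"
proof -
  obtain M where M: "\<And>x. \<bar>\<rho> x\<bar> \<le> M" using mollifier_bounded[OF \<rho>] by blast
  have [measurable]: "\<rho> \<in> borel_measurable borel" using mollifier_measurable[OF \<rho>] .
  have i1: "integrable lborel (\<lambda>y. \<rho> (x - y) *\<^sub>R g y)"
    by (rule integrable_mollify[OF g _ M]) measurable
  have i0: "has_bochner_integral lborel (\<lambda>y. \<rho> (x - y)) 1"
    using mollifier_nn_integral(2)[OF \<rho>, of x] mollifier_nonneg[OF \<rho>]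
    by (intro has_bochner_integral_nn_integral) auto
  have i2: "integrable lborel (\<lambda>y. \<rho> (x - y))" "(\<integral>y. \<rho> (x - y) \<partial>lborel) = 1"
    using i0 by (auto simp: has_bochner_integral_iff)
  have "mollify \<rho> g x - v = (\<integral>y. \<rho> (x - y) *\<^sub>R g y \<partial>lborel) - (\<integral>y. \<rho> (x - y) *\<^sub>R v \<partial>lborel)"
    using i2 by (simp add: mollify_def)
  also have "\<dots> = (\<integral>y. \<rho> (x - y) *\<^sub>R (g y - v) \<partial>lborel)"
    using i1 i2(1) by (simp add: algebra_simps)
  also have "norm \<dots> \<le> (\<integral>y. norm (\<rho> (x - y) *\<^sub>R (g y - v)) \<partial>lborel)"
    by (rule integral_norm_bound)
  also have "\<dots> \<le> (\<integral>y. \<rho> (x - y) * d \<partial>lborel)"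
  proof (rule integral_mono)
    show "integrable lborel (\<lambda>y. norm (\<rho> (x - y) *\<^sub>R (g y - v)))"
      using i1 i2(1) by (intro integrable_norm) (simp add: algebra_simps)
    show "norm (\<rho> (x - y) *\<^sub>R (g y - v)) \<le> \<rho> (x - y) * d" for y
      using near[of y] mollifier_nonneg[OF \<rho>, of "x - y"] mollifier_zero[OF \<rho>, of "x - y"]
      by (cases "norm (x - y) < \<epsilon>") (auto intro: mult_left_mono)
  qed (use i2 in simp)
  also have "\<dots> = d" using i2 by simp
  finally show ?thesis .
qed

lemma pint_bounded_support:
  fixes f :: "'a::euclidean_space \<Rightarrow> 'b::euclidean_space"
  assumes "\<And>x. norm (f x) \<le> \<eta>" and "\<And>x. r \<le> norm x \<Longrightarrow> f x = 0" and "0 < p" "0 \<le> \<eta>"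
  shows "pint p f \<le> ennreal (\<eta> powr p) * emeasure lborel (ball (0::'a) r)"
proof -
  have "pint p f \<le> (\<integral>\<^sup>+x. ennreal (\<eta> powr p) * indicator (ball (0::'a) r) x \<partial>lborel)"
    unfolding pint_def
  proof (rule nn_integral_mono)
    fix x show "ennreal (norm (f x) powr p) \<le> ennreal (\<eta> powr p) * indicator (ball 0 r) x"
      using assms powr_mono2[of p "norm (f x)" \<eta>]
      by (cases "norm x < r") (auto simp: indicator_def intro: ennreal_leI)
  qed
  then show ?thesis by (simp add: nn_integral_cmult_indicator)
qed

lemma integrable_of_pint:
  fixes g :: "'a::euclidean_space \<Rightarrow> 'b::euclidean_space"
  assumes [measurable]: "g \<in> borel_measurable borel" and "1 \<le> p" and "pint p g < \<infinity>"
    and "\<And>x. r \<le> norm x \<Longrightarrow> g x = 0"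
  shows "integrable lborel g"
proof (rule integrableI_bounded)
  have "(\<integral>\<^sup>+x. ennreal (norm (g x)) \<partial>lborel)
      \<le> (\<integral>\<^sup>+x. indicator (ball 0 r) x + ennreal (norm (g x) powr p) \<partial>lborel)"
  proof (rule nn_integral_mono)
    fix x
    consider "r \<le> norm x" | "norm x < r" "norm (g x) \<le> 1" | "1 \<le> norm (g x)" by linarith
    then show "ennreal (norm (g x)) \<le> indicator (ball 0 r) x + ennreal (norm (g x) powr p)"
    proof cases
      case 2
      then have "ennreal (norm (g x)) \<le> 1 + 0" by (simp add: ennreal_le_1)
      also have "\<dots> \<le> 1 + ennreal (norm (g x) powr p)" by (rule add_left_mono) simp
      finally show ?thesis using 2 by simp
    next
      case 3
      then have "norm (g x) powr 1 \<le> norm (g x) powr p" using assms by (intro powr_mono) auto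
      then have "0 + ennreal (norm (g x)) \<le> indicator (ball 0 r) x + ennreal (norm (g x) powr p)"
        using 3 by (intro add_mono ennreal_leI) auto
      then show ?thesis by simp
    qed (use assms in simp)
  qed
  also have "\<dots> = emeasure lborel (ball (0::'a) r) + pint p g"
    by (subst nn_integral_add) (auto simp: pint_def intro!: borel_measurable_indicator)
  also have "\<dots> < \<infinity>"
    using assms(3) emeasure_lborel_ball_finite[of "0::'a" r] by simp
  finally show "(\<integral>\<^sup>+x. ennreal (norm (g x)) \<partial>lborel) < \<infinity>" .
qed measurable

lemma mollify_diff:
  fixes f g :: "'a::euclidean_space \<Rightarrow> 'b::euclidean_space"
  assumes \<rho>: "mollifier \<epsilon> \<rho>" and "integrable lborel f" "integrable lborel g"
  shows "mollify \<rho> (\<lambda>x. f x - g x) x = mollify \<rho> f x - mollify \<rho> g x"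
proof -
  obtain M where M: "\<And>x. \<bar>\<rho> x\<bar> \<le> M" using mollifier_bounded[OF \<rho>] by blast
  show ?thesis
    unfolding mollify_def
    using integrable_mollify[OF assms(2) mollifier_measurable[OF \<rho>] M]
      integrable_mollify[OF assms(3) mollifier_measurable[OF \<rho>] M]
    by (simp add: scaleR_diff_right)
qed

text \<open>Mollification is a contraction of \<open>L\<^sup>p\<close> that converges uniformly on continuous functions
  with compact support, and these are dense.\<close>

lemma pint_mollify_converges:
  fixes g :: "'a::euclidean_space \<Rightarrow> 'b::euclidean_space"
  assumes g[measurable]: "g \<in> borel_measurable borel" and p: "1 \<le> p" and fin: "pint p g < \<infinity>"
    and supp: "\<And>x. r \<le> norm x \<Longrightarrow> g x = 0" and e: "0 < e"
  shows "\<exists>\<epsilon>0>0. \<forall>\<epsilon> \<rho>. \<epsilon> \<le> \<epsilon>0 \<and> mollifier \<epsilon> \<rho> \<longrightarrow> pint p (\<lambda>x. mollify \<rho> g x - g x) \<le> ennreal e"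
proof -
  define a where "a = 2 powr p"
  have a: "a > 0" by (simp add: a_def)
  define d where "d = e / (a * (a * 2 + 1))"
  have d: "0 < d" "a * (a * (d + d) + d) = e"
  proof -
    have c: "0 < a * (a * 2 + 1)" using a by (simp add: add_pos_pos)
    then show "0 < d" using e by (simp add: d_def)
    have "a * (a * (d + d) + d) = (a * (a * 2 + 1)) * d" by (simp add: algebra_simps)
    also have "\<dots> = e"
      unfolding d_def using c by (metis less_irrefl nonzero_mult_div_cancel_left times_divide_eq_right)
    finally show "a * (a * (d + d) + d) = e" .
  qed
  obtain c where c: "continuous_on UNIV c" "\<And>x. r + 1 \<le> norm x \<Longrightarrow> c x = 0"
    "pint p (\<lambda>x. g x - c x) \<le> ennreal d"
    using pint_approx_continuous[OF g _ fin supp d(1)] p by auto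
  have [measurable]: "c \<in> borel_measurable borel" using borel_measurable_continuous_onI[OF c(1)] .
  have intg: "integrable lborel g" by (rule integrable_of_pint[OF g p fin supp])
  have c0: "c x = 0" if "x \<notin> cball 0 (r + 1)" for x
    using c(2) that by auto
  have intc: "integrable lborel c"
    by (rule integrable_continuous_compact_support[OF c(1) c0 compact_cball])
  define V where "V = measure lborel (ball (0::'a) (r + 2))"
  have V: "emeasure lborel (ball (0::'a) (r + 2)) = ennreal V" "0 \<le> V"
    using emeasure_lborel_ball_finite[of "0::'a" "r + 2"]
    by (auto simp: V_def emeasure_eq_ennreal_measure)
  define \<eta> where "\<eta> = (d / (V + 1)) powr (1 / p)"
  have \<eta>: "0 < \<eta>" "\<eta> powr p * V \<le> d"
  proof -
    show "0 < \<eta>" using d V by (simp add: \<eta>_def)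
    have "\<eta> powr p = d / (V + 1)" using p d V by (simp add: \<eta>_def powr_powr)
    then have "\<eta> powr p * V = d * (V / (V + 1))" by simp
    also have "\<dots> \<le> d * 1" using d V by (intro mult_left_mono) auto
    finally show "\<eta> powr p * V \<le> d" by simp
  qed
  have "uniformly_continuous_on (cball 0 (r + 3)) c"
    using c(1) by (intro compact_uniformly_continuous) (auto intro: continuous_on_subset)
  then obtain \<delta> where \<delta>: "0 < \<delta>"
    "\<And>x y. x \<in> cball 0 (r + 3) \<Longrightarrow> y \<in> cball 0 (r + 3) \<Longrightarrow> dist y x < \<delta> \<Longrightarrow> dist (c y) (c x) < \<eta>"
    using \<eta>(1) unfolding uniformly_continuous_on_def by metis
  have "pint p (\<lambda>x. mollify \<rho> g x - g x) \<le> ennreal e"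
    if \<epsilon>: "\<epsilon> \<le> min 1 \<delta>" and \<rho>: "mollifier \<epsilon> \<rho>" for \<epsilon> \<rho>
  proof -
    have [measurable]: "mollify \<rho> g \<in> borel_measurable borel" "mollify \<rho> c \<in> borel_measurable borel"
      by (auto intro!: mollify_measurable mollifier_measurable[OF \<rho>])
    have "pint p (\<lambda>x. mollify \<rho> g x - mollify \<rho> c x) = pint p (mollify \<rho> (\<lambda>x. g x - c x))"
      by (simp add: mollify_diff[OF \<rho> intg intc, abs_def])
    also have "\<dots> \<le> pint p (\<lambda>x. g x - c x)"
      by (rule pint_mollify_le[OF \<rho> _ p]) measurable
    finally have 1: "pint p (\<lambda>x. mollify \<rho> g x - mollify \<rho> c x) \<le> ennreal d"
      using c(3) by simp
    have unif: "norm (mollify \<rho> c x - c x) \<le> \<eta>" for x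
    proof (rule mollify_const_diff[OF \<rho> intc])
      fix y assume y: "norm (x - y) < \<epsilon>"
      show "norm (c y - c x) \<le> \<eta>"
      proof (cases "norm x \<le> r + 2")
        case True
        have "norm y \<le> norm x + norm (x - y)" using norm_triangle_sub by (metis norm_minus_commute)
        then have "dist (c y) (c x) < \<eta>"
          using True y \<epsilon> by (intro \<delta>(2)) (auto simp: dist_norm norm_minus_commute)
        then show ?thesis by (simp add: dist_norm)
      next
        case False
        have "norm x \<le> norm y + norm (x - y)" using norm_triangle_sub by blast
        then have "r + 1 \<le> norm y" using False y \<epsilon> by simp
        then show ?thesis using c(2)[of x] c(2)[of y] False \<eta> by simp
      qed
    qed
    have zero: "mollify \<rho> c x - c x = 0" if "r + 2 \<le> norm x" for x
    proof -
      have "norm (mollify \<rho> c x - 0) \<le> 0"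
      proof (rule mollify_const_diff[OF \<rho> intc])
        fix y assume y: "norm (x - y) < \<epsilon>"
        have "norm x \<le> norm y + norm (x - y)" using norm_triangle_sub by blast
        then show "norm (c y - 0) \<le> 0" using c(2)[of y] that y \<epsilon> by simp
      qed
      then show ?thesis using c(2)[of x] that by simp
    qed
    have "pint p (\<lambda>x. mollify \<rho> c x - c x) \<le> ennreal (\<eta> powr p) * emeasure lborel (ball (0::'a) (r + 2))"
      by (rule pint_bounded_support[OF unif zero]) (use p \<eta> in auto)
    also have "\<dots> \<le> ennreal d"
      using V \<eta> by (simp add: ennreal_leI flip: ennreal_mult)
    finally have 2: "pint p (\<lambda>x. mollify \<rho> c x - c x) \<le> ennreal d" .
    have "pint p (\<lambda>x. c x - g x) \<le> ennreal d"
      using c(3) by (simp add: pint_diff_commute[of p c])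
    moreover have "pint p (\<lambda>x. mollify \<rho> g x - c x) \<le> ennreal (a * (d + d))"
      unfolding a_def by (rule pint_triangle_le[where g="mollify \<rho> c"]) (use p d 1 2 in auto)
    ultimately have "pint p (\<lambda>x. mollify \<rho> g x - g x) \<le> ennreal (a * (a * (d + d) + d))"
      using pint_triangle_le[of "mollify \<rho> g" c g p "a * (d + d)" d] p d a
      by (simp add: a_def)
    then show ?thesis using d by simp
  qed
  then show ?thesis using \<delta>(1) by (intro exI[of _ "min 1 \<delta>"]) auto
qed

section \<open>Weak gradients\<close>

definition restr :: "'a set \<Rightarrow> ('a \<Rightarrow> 'b::real_vector) \<Rightarrow> 'a \<Rightarrow> 'b"
  where "restr S g x = indicator S x *\<^sub>R g x"

lemma restr_in [simp]: "x \<in> S \<Longrightarrow> restr S g x = g x"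
  and restr_out [simp]: "x \<notin> S \<Longrightarrow> restr S g x = 0"
  by (auto simp: restr_def)

lemma restr_measurable:
  fixes g :: "'a::euclidean_space \<Rightarrow> 'b::euclidean_space"
  assumes [measurable]: "g \<in> borel_measurable borel" "S \<in> sets borel"
  shows "restr S g \<in> borel_measurable borel"
  unfolding restr_def[abs_def] by measurable

lemma in_Lp_iff:
  fixes g :: "'a::euclidean_space \<Rightarrow> 'b::euclidean_space"
  shows "in_Lp (ereal p) S g \<longleftrightarrow> restr S g \<in> borel_measurable borel \<and> pint p (restr S g) < \<infinity>"
proof -
  have eq: "indicator S x *\<^sub>R (norm (g x) powr p) = norm (restr S g x) powr p" for x
    by (cases "x \<in> S") auto
  have "integrable lborel (\<lambda>x. norm (restr S g x) powr p) \<longleftrightarrow> pint p (restr S g) < \<infinity>"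
    if "restr S g \<in> borel_measurable borel"
    using that by (simp add: integrable_iff_bounded pint_def)
  moreover have "(\<lambda>x. indicator S x *\<^sub>R g x) = restr S g"
    by (simp add: restr_def fun_eq_iff)
  ultimately show ?thesis
    unfolding in_Lp_def set_integrable_def set_borel_measurable_def real_of_ereal.simps eq
    by auto
qed

lemma Lp_norm_eq:
  assumes "restr S g \<in> borel_measurable borel"
  shows "Lp_norm (ereal p) S g = enn2real (pint p (restr S g)) powr (1 / p)"
proof -
  have eq: "indicator S x *\<^sub>R (norm (g x) powr p) = norm (restr S g x) powr p" for x
    by (cases "x \<in> S") auto
  show ?thesis
    unfolding Lp_norm_def set_lebesgue_integral_def real_of_ereal.simps eq pint_def using assms
    by (simp add: integral_eq_nn_integral)
qed

lemma test_function_compact: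
  assumes "test_function K \<phi>"
  obtains S where "compact S" "S \<subseteq> K" "\<And>x. x \<notin> S \<Longrightarrow> \<phi> x = 0"
proof
  show "compact (closure {x. \<phi> x \<noteq> 0})" "closure {x. \<phi> x \<noteq> 0} \<subseteq> K"
    using assms by (auto simp: test_function_def compactly_contained_def)
  show "\<phi> x = 0" if "x \<notin> closure {x. \<phi> x \<noteq> 0}" for x
    using that closure_subset[of "{x. \<phi> x \<noteq> 0}"] by auto
qed

lemma test_functionI:
  assumes "\<And>k. Ck k \<phi>" and "compact S" "S \<subseteq> K" and "\<And>x. x \<notin> S \<Longrightarrow> \<phi> x = 0"
  shows "test_function K \<phi>"
proof -
  have "closure {x. \<phi> x \<noteq> 0} \<subseteq> S"
    using assms by (intro closure_minimal compact_imp_closed) auto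
  moreover from this have "compact (closure {x. \<phi> x \<noteq> 0})"
    using compact_Int_closed[OF assms(2) closed_closure[of "{x. \<phi> x \<noteq> 0}"]]
    by (simp add: Int_absorb1)
  ultimately show ?thesis
    using assms(1,3) unfolding test_function_def compactly_contained_def by blast
qed

lemma test_function_C1: "test_function K \<phi> \<Longrightarrow> C1_gradient \<phi> (grad \<phi>)"
  unfolding test_function_def by (blast intro: C1_gradient_grad)

lemma test_function_reflect:
  assumes "mollifier \<epsilon> \<rho>" and "cball x \<epsilon> \<subseteq> K"
  shows "test_function K (\<lambda>y. \<rho> (x - y))"
proof (rule test_functionI)
  show "Ck k (\<lambda>y. \<rho> (x - y))" for k
    by (intro Ck_reflect mollifier_Ck[OF assms(1)])
  show "\<rho> (x - y) = 0" if "y \<notin> cball x \<epsilon>" for y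
    using that by (intro mollifier_zero[OF assms(1)]) (auto simp: dist_norm)
qed (use assms in auto)

lemma mollifier_C1: "mollifier \<epsilon> \<rho> \<Longrightarrow> C1_gradient \<rho> (grad \<rho>)"
  by (rule C1_gradient_grad[OF mollifier_Ck])

lemma mollify_Ck:
  fixes f :: "'a::euclidean_space \<Rightarrow> real"
  assumes "mollifier \<epsilon> \<rho>" and "integrable lborel f"
  shows "Ck k (mollify \<rho> f)"
  by (rule Ck_mollify[OF assms(2) mollifier_Ck[OF assms(1)] mollifier_support[OF assms(1)] compact_cball])

lemma C1_eq_grad:
  fixes f :: "'a::euclidean_space \<Rightarrow> real"
  assumes "(f has_derivative D) (at x)" and "\<And>i. i \<in> Basis \<Longrightarrow> D i = v \<bullet> i"
  shows "grad f x = v"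
proof -
  have "frechet_derivative f (at x) = D" using frechet_derivative_at[OF assms(1)] by simp
  then show ?thesis
    using assms(2) by (simp add: grad_def euclidean_representation)
qed

text \<open>Where the mollifier stays inside the domain, mollification commutes with the weak gradient:
  the translates of the mollifier are the test functions.\<close>

lemma grad_mollify:
  fixes u :: "'a::euclidean_space \<Rightarrow> real"
  assumes wg: "has_weak_gradient K u G" and u: "integrable lborel (restr K u)"
    and G: "integrable lborel (restr K G)"
    and \<rho>: "mollifier \<epsilon> \<rho>" and x: "cball x \<epsilon> \<subseteq> K"
  shows "grad (mollify \<rho> (restr K u)) x = mollify \<rho> (restr K G) x"
proof (rule C1_eq_grad)
  show "(mollify \<rho> (restr K u) has_derivative
      (\<lambda>h. \<integral>y. (grad \<rho> (x - y) \<bullet> h) * restr K u y \<partial>lborel)) (at x)"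
    by (rule mollify_has_derivative[OF u mollifier_C1[OF \<rho>] mollifier_support[OF \<rho>] compact_cball])
  fix i :: 'a assume i: "i \<in> Basis"
  have fd: "frechet_derivative (\<lambda>y. \<rho> (x - y)) (at y) i = - (grad \<rho> (x - y) \<bullet> i)" for y
    using frechet_derivative_C1[OF C1_gradient_reflect[OF mollifier_C1[OF \<rho>]]] by simp
  have "(LINT y:K|lborel. u y * frechet_derivative (\<lambda>y. \<rho> (x - y)) (at y) i)
      = - (LINT y:K|lborel. (G y \<bullet> i) * \<rho> (x - y))"
    using wg test_function_reflect[OF \<rho> x] i unfolding has_weak_gradient_def by blast
  then have "(LINT y:K|lborel. u y * (grad \<rho> (x - y) \<bullet> i)) = (LINT y:K|lborel. (G y \<bullet> i) * \<rho> (x - y))"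
    unfolding fd set_lebesgue_integral_def by simp
  then have "(\<integral>y. (grad \<rho> (x - y) \<bullet> i) * restr K u y \<partial>lborel)
      = (\<integral>y. (\<rho> (x - y) *\<^sub>R restr K G y) \<bullet> i \<partial>lborel)"
    unfolding set_lebesgue_integral_def restr_def by (simp add: mult_ac)
  also have "\<dots> = mollify \<rho> (restr K G) x \<bullet> i"
  proof -
    obtain M where M: "\<And>x. \<bar>\<rho> x\<bar> \<le> M" using mollifier_bounded[OF \<rho>] by blast
    show ?thesis
      unfolding mollify_def
      by (rule integral_inner_left) (rule integrable_mollify[OF G mollifier_measurable[OF \<rho>] M])
  qed
  finally show "(\<integral>y. (grad \<rho> (x - y) \<bullet> i) * restr K u y \<partial>lborel)
      = mollify \<rho> (restr K G) x \<bullet> i" .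
qed

text \<open>Mollifications of the difference of two weak gradients vanish in the smaller ball and converge to
  the difference.\<close>

lemma weak_gradient_unique_ball:
  fixes u :: "'a::euclidean_space \<Rightarrow> real"
  assumes G: "has_weak_gradient K u G" "has_weak_gradient K u H"
    and r: "r < r1" "cball z r1 \<subseteq> K"
  shows "AE x in lborel. x \<in> ball z r \<longrightarrow> G x = H x"
proof -
  let ?B = "cball z r1"
  have LG: "in_Lp (ereal 1) ?B G" "in_Lp (ereal 1) ?B H"
    using G r unfolding has_weak_gradient_def in_Lp_loc_def by (auto simp: one_ereal_def)
  have LG': "restr ?B G \<in> borel_measurable borel" "restr ?B H \<in> borel_measurable borel"
    "pint 1 (restr ?B G) < \<infinity>" "pint 1 (restr ?B H) < \<infinity>"
    using LG by (auto simp: in_Lp_iff)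
  then have int: "integrable lborel (restr ?B G)" "integrable lborel (restr ?B H)"
    by (auto simp: pint_def integrable_iff_bounded)
  define g where "g x = restr ?B G x - restr ?B H x" for x
  have intg: "integrable lborel g" unfolding g_def[abs_def] using int by simp
  then have gm[measurable]: "g \<in> borel_measurable borel" by simp
  have gfin: "pint 1 g < \<infinity>" using intg by (auto simp: pint_def integrable_iff_bounded)
  have gsupp: "g x = 0" if "norm z + r1 + 1 \<le> norm x" for x
  proof -
    have "norm x \<le> norm z + norm (z - x)" using norm_triangle_sub[of x z] by (simp add: norm_minus_commute)
    then have "x \<notin> ?B" using that by (auto simp: dist_norm)
    then show ?thesis by (simp add: g_def)
  qed
  have zero: "mollify \<rho> g x = 0"
    if \<rho>: "mollifier \<epsilon> \<rho>" and \<epsilon>: "\<epsilon> \<le> r1 - r" and x: "x \<in> ball z r" for \<epsilon> \<rho> x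
  proof (rule euclidean_eqI)
    fix i :: 'a assume i: "i \<in> Basis"
    have sub: "cball x \<epsilon> \<subseteq> ?B"
    proof
      fix y assume "y \<in> cball x \<epsilon>"
      then show "y \<in> ?B" using dist_triangle[of z y x] x \<epsilon> by auto
    qed
    have tf: "test_function K (\<lambda>y. \<rho> (x - y))"
      using test_function_reflect[OF \<rho>] sub r(2) by blast
    obtain M where M: "\<And>x. \<bar>\<rho> x\<bar> \<le> M" using mollifier_bounded[OF \<rho>] by blast
    have red: "(LINT y:K|lborel. (F y \<bullet> i) * \<rho> (x - y)) = mollify \<rho> (restr ?B F) x \<bullet> i"
      if F: "integrable lborel (restr ?B F)" for F :: "'a \<Rightarrow> 'a"
    proof -
      have "indicator K y *\<^sub>R ((F y \<bullet> i) * \<rho> (x - y)) = (\<rho> (x - y) *\<^sub>R restr ?B F y) \<bullet> i" for y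
      proof (cases "y \<in> cball x \<epsilon>")
        case True
        then have "y \<in> ?B" "y \<in> K" using sub r(2) by auto
        then show ?thesis by simp
      next
        case False
        then have "\<rho> (x - y) = 0" by (intro mollifier_zero[OF \<rho>]) (auto simp: dist_norm)
        then show ?thesis by simp
      qed
      then show ?thesis
        unfolding set_lebesgue_integral_def mollify_def
        by (simp only:) (rule integral_inner_left[OF integrable_mollify[OF F mollifier_measurable[OF \<rho>] M]])
    qed
    have ibp: "(LINT y:K|lborel. u y * frechet_derivative (\<lambda>y. \<rho> (x - y)) (at y) i)
        = - (LINT y:K|lborel. (F y \<bullet> i) * \<rho> (x - y))" if "has_weak_gradient K u F" for F
      using that tf i unfolding has_weak_gradient_def by blast
    have "(LINT y:K|lborel. (G y \<bullet> i) * \<rho> (x - y)) = (LINT y:K|lborel. (H y \<bullet> i) * \<rho> (x - y))"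
      using ibp[OF G(1)] ibp[OF G(2)] by simp
    then have "mollify \<rho> (restr ?B G) x \<bullet> i = mollify \<rho> (restr ?B H) x \<bullet> i"
      using red int by simp
    moreover have "mollify \<rho> g x = mollify \<rho> (restr ?B G) x - mollify \<rho> (restr ?B H) x"
      unfolding g_def[abs_def] by (rule mollify_diff[OF \<rho> int])
    ultimately show "mollify \<rho> g x \<bullet> i = 0 \<bullet> i"
      by (simp add: inner_diff_left)
  qed
  have small: "(\<integral>\<^sup>+x. ennreal (norm (restr (ball z r) g x)) \<partial>lborel) \<le> ennreal e" if e: "0 < e" for e
  proof -
    obtain \<epsilon>0 where \<epsilon>0: "\<epsilon>0 > 0"
      "\<And>\<epsilon> \<rho>. \<epsilon> \<le> \<epsilon>0 \<and> mollifier \<epsilon> \<rho> \<Longrightarrow> pint 1 (\<lambda>x. mollify \<rho> g x - g x) \<le> ennreal e"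
      using pint_mollify_converges[of g 1 "norm z + r1 + 1" e, OF gm _ gfin gsupp e] by auto
    obtain \<rho> :: "'a \<Rightarrow> real" where \<rho>: "mollifier (min \<epsilon>0 (r1 - r)) \<rho>"
      using ex_mollifier[of "min \<epsilon>0 (r1 - r)"] \<epsilon>0(1) r(1) by auto
    have "(\<integral>\<^sup>+x. ennreal (norm (restr (ball z r) g x)) \<partial>lborel) \<le> pint 1 (\<lambda>x. mollify \<rho> g x - g x)"
      unfolding pint_def
    proof (rule nn_integral_mono)
      fix x show "ennreal (norm (restr (ball z r) g x)) \<le> ennreal (norm (mollify \<rho> g x - g x) powr 1)"
        using zero[OF \<rho>, of x] by (cases "x \<in> ball z r") auto
    qed
    also have "\<dots> \<le> ennreal e" using \<epsilon>0(2) \<rho> by (meson min.cobounded1)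
    finally show ?thesis .
  qed
  have "(\<integral>\<^sup>+x. ennreal (norm (restr (ball z r) g x)) \<partial>lborel) = 0"
  proof -
    have "(\<integral>\<^sup>+x. ennreal (norm (restr (ball z r) g x)) \<partial>lborel) \<le> 0"
      by (rule ennreal_le_epsilon) (use small in simp)
    then show ?thesis by simp
  qed
  then have "AE x in lborel. restr (ball z r) g x = 0"
    using restr_measurable[OF gm, of "ball z r"] by (subst (asm) nn_integral_0_iff_AE) auto
  then show ?thesis
  proof eventually_elim
    case (elim x)
    then show ?case using r by (auto simp: g_def dist_norm)
  qed
qed

lemma weak_gradient_unique:
  fixes u :: "'a::euclidean_space \<Rightarrow> real"
  assumes "has_weak_gradient (ball x0 R) u G" "has_weak_gradient (ball x0 R) u H"
  shows "AE x in lborel. x \<in> ball x0 R \<longrightarrow> G x = H x"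
proof -
  have "AE x in lborel. \<forall>n::nat. x \<in> ball x0 (R - 1 / real (Suc n)) \<longrightarrow> G x = H x"
    unfolding AE_all_countable
  proof
    fix n :: nat
    define e where "e = 1 / real (Suc n)"
    have e: "0 < e" by (simp add: e_def)
    then have "cball x0 (R - e / 2) \<subseteq> ball x0 R"
      unfolding cball_subset_ball_iff by simp
    then show "AE x in lborel. x \<in> ball x0 (R - 1 / real (Suc n)) \<longrightarrow> G x = H x"
      using e unfolding e_def[symmetric]
      by (intro weak_gradient_unique_ball[OF assms, of _ "R - e / 2"]) auto
  qed
  then show ?thesis
  proof eventually_elim
    case (elim x)
    show ?case
    proof
      assume "x \<in> ball x0 R"
      then have "0 < R - dist x0 x" by simp
      then obtain n where "inverse (real (Suc n)) < R - dist x0 x" using reals_Archimedean by blast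
      then have "x \<in> ball x0 (R - 1 / real (Suc n))" by (simp add: inverse_eq_divide)
      then show "G x = H x" using elim by blast
    qed
  qed
qed

lemma weak_gradient_AE:
  assumes "has_weak_gradient (ball x0 R) u G"
  shows "AE x in lborel. x \<in> ball x0 R \<longrightarrow> weak_gradient (ball x0 R) u x = G x"
proof -
  have "has_weak_gradient (ball x0 R) u (weak_gradient (ball x0 R) u)"
    unfolding weak_gradient_def
    by (rule someI[of "has_weak_gradient (ball x0 R) u", OF assms])
  then show ?thesis using weak_gradient_unique assms by blast
qed

lemma in_Lp_loc_continuous:
  fixes g :: "'a::euclidean_space \<Rightarrow> 'b::euclidean_space"
  assumes "continuous_on UNIV g"
  shows "in_Lp_loc (ereal 1) K g"
  unfolding in_Lp_loc_def in_Lp_iff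
proof (intro allI impI conjI)
  fix S assume S: "compact S \<and> S \<subseteq> K"
  show m: "restr S g \<in> borel_measurable borel"
    using S borel_measurable_continuous_onI[OF assms] by (intro restr_measurable) (auto intro: borel_compact)
  have "bounded (g ` S)"
    using S compact_continuous_image[OF continuous_on_subset[OF assms]] compact_imp_bounded by blast
  then obtain M where M: "\<And>x. x \<in> S \<Longrightarrow> norm (g x) \<le> M" by (auto simp: bounded_iff)
  obtain r where r: "S \<subseteq> ball 0 r" using bounded_subset_ballD[OF compact_imp_bounded] S by blast
  have "pint 1 (restr S g) \<le> ennreal (max M 0 powr 1) * emeasure lborel (ball (0::'a) r)"
  proof (rule pint_bounded_support)
    show "norm (restr S g x) \<le> max M 0" for x using M[of x] by (cases "x \<in> S") auto
    show "restr S g x = 0" if "r \<le> norm x" for x using r that by (cases "x \<in> S") auto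
  qed auto
  also have "\<dots> < \<infinity>"
    using emeasure_lborel_ball_finite[of "0::'a" r] by (simp add: ennreal_mult_less_top)
  finally show "pint 1 (restr S g) < \<infinity>" .
qed

text \<open>Integration by parts: the gradient of the product with a test function has integral zero.\<close>

lemma C1_has_weak_gradient:
  assumes v: "C1_gradient v V"
  shows "has_weak_gradient K v V"
  unfolding has_weak_gradient_def
proof (intro conjI allI impI ballI)
  show "in_Lp_loc 1 K v" "in_Lp_loc 1 K V"
    using in_Lp_loc_continuous[OF C1_gradient_cont_fun[OF v]] in_Lp_loc_continuous[OF C1_gradient_cont[OF v]]
    by (auto simp: one_ereal_def)
  fix \<phi> and i :: 'a assume \<phi>: "test_function K \<phi>" and i: "i \<in> Basis"
  obtain S where S: "compact S" "S \<subseteq> K" "\<And>x. x \<notin> S \<Longrightarrow> \<phi> x = 0"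
    using test_function_compact[OF \<phi>] by blast
  have d\<phi>: "C1_gradient \<phi> (grad \<phi>)" using test_function_C1[OF \<phi>] .
  have g0: "grad \<phi> x = 0" if "x \<notin> S" for x
    using gradient_zero_outside_support[OF d\<phi> S(3) compact_imp_closed[OF S(1)] that] .
  have "(\<integral>x. (v x *\<^sub>R grad \<phi> x + \<phi> x *\<^sub>R V x) \<bullet> i \<partial>lborel) = 0"
    by (rule integral_gradient_zero[OF C1_gradient_mult[OF v d\<phi>] _ S(1)]) (use S in auto)
  moreover have "integrable lborel (\<lambda>x. v x * (grad \<phi> x \<bullet> i))"
    by (rule integrable_continuous_compact_support[OF _ _ S(1)])
      (use g0 in \<open>auto intro!: continuous_intros C1_gradient_cont[OF d\<phi>] C1_gradient_cont_fun[OF v]\<close>)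
  moreover have "integrable lborel (\<lambda>x. (V x \<bullet> i) * \<phi> x)"
    by (rule integrable_continuous_compact_support[OF _ _ S(1)])
      (use S in \<open>auto intro!: continuous_intros C1_gradient_cont[OF v] C1_gradient_cont_fun[OF d\<phi>]\<close>)
  ultimately have "(\<integral>x. v x * (grad \<phi> x \<bullet> i) \<partial>lborel) = - (\<integral>x. (V x \<bullet> i) * \<phi> x \<partial>lborel)"
    by (simp add: inner_add_left mult.commute)
  moreover have "indicator K x *\<^sub>R (v x * frechet_derivative \<phi> (at x) i) = v x * (grad \<phi> x \<bullet> i)" for x
    using frechet_derivative_C1[OF d\<phi>] g0[of x] S(2) by (cases "x \<in> S") auto
  moreover have "indicator K x *\<^sub>R ((V x \<bullet> i) * \<phi> x) = (V x \<bullet> i) * \<phi> x" for x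
    using S(2,3) by (cases "x \<in> S") auto
  ultimately show "(LINT x:K|lborel. v x * frechet_derivative \<phi> (at x) i)
      = - (LINT x:K|lborel. (V x \<bullet> i) * \<phi> x)"
    unfolding set_lebesgue_integral_def by presburger
qed

section \<open>Sobolev functions as limits of test functions\<close>

lemma pint_tendsto_add:
  fixes f g :: "nat \<Rightarrow> 'a::euclidean_space \<Rightarrow> 'b::euclidean_space"
  assumes "\<And>n. f n \<in> borel_measurable borel" "\<And>n. g n \<in> borel_measurable borel" "0 \<le> p"
    and "(\<lambda>n. pint p (f n)) \<longlonglongrightarrow> 0" "(\<lambda>n. pint p (g n)) \<longlonglongrightarrow> 0"
  shows "(\<lambda>n. pint p (\<lambda>x. f n x + g n x)) \<longlonglongrightarrow> 0"
proof (rule tendsto_sandwich[OF _ _ tendsto_const])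
  have "(\<lambda>n. ennreal (2 powr p) * (pint p (f n) + pint p (g n))) \<longlonglongrightarrow> ennreal (2 powr p) * (0 + 0)"
    using assms(4,5) by (intro ennreal_tendsto_cmult tendsto_add) auto
  then show "(\<lambda>n. ennreal (2 powr p) * (pint p (f n) + pint p (g n))) \<longlonglongrightarrow> 0" by simp
  show "\<forall>\<^sub>F n in sequentially. pint p (\<lambda>x. f n x + g n x) \<le> ennreal (2 powr p) * (pint p (f n) + pint p (g n))"
    using assms(1-3) by (auto intro!: always_eventually pint_add)
qed simp

lemma pint_tendsto_mono:
  fixes f :: "nat \<Rightarrow> 'a::euclidean_space \<Rightarrow> 'b::euclidean_space"
    and g :: "nat \<Rightarrow> 'a \<Rightarrow> 'c::euclidean_space"
  assumes "(\<lambda>n. pint p (g n)) \<longlonglongrightarrow> 0" "\<And>n x. norm (f n x) \<le> norm (g n x)" "0 \<le> p"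
  shows "(\<lambda>n. pint p (f n)) \<longlonglongrightarrow> 0"
  by (rule tendsto_sandwich[OF _ _ tendsto_const assms(1)])
    (use assms in \<open>auto intro!: always_eventually pint_mono\<close>)

lemma pint_tendsto_cmult:
  fixes f :: "nat \<Rightarrow> 'a::euclidean_space \<Rightarrow> 'b::euclidean_space"
  assumes "(\<lambda>n. pint p (f n)) \<longlonglongrightarrow> 0" "\<And>n. f n \<in> borel_measurable borel"
  shows "(\<lambda>n. pint p (\<lambda>x. c *\<^sub>R f n x)) \<longlonglongrightarrow> 0"
proof -
  have "(\<lambda>n. ennreal (\<bar>c\<bar> powr p) * pint p (f n)) \<longlonglongrightarrow> ennreal (\<bar>c\<bar> powr p) * 0"
    using assms(1) by (intro ennreal_tendsto_cmult) auto
  then show ?thesis using assms(2) by (simp add: pint_cmult)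
qed

lemma pint_AE_subseq:
  fixes f :: "nat \<Rightarrow> 'a::euclidean_space \<Rightarrow> 'b::euclidean_space"
  assumes [measurable]: "\<And>n. f n \<in> borel_measurable borel" and "0 < p"
    and lim: "(\<lambda>n. pint p (f n)) \<longlonglongrightarrow> 0" and fin: "\<And>n. pint p (f n) < \<infinity>"
  shows "\<exists>r::nat\<Rightarrow>nat. strict_mono r \<and> (AE x in lborel. (\<lambda>n. f (r n) x) \<longlonglongrightarrow> 0)"
proof -
  have int: "integrable lborel (\<lambda>x. norm (f n x) powr p)" for n
    using fin[of n] by (simp add: integrable_iff_bounded pint_def)
  have "ennreal (\<integral>x. norm (norm (f n x) powr p) \<partial>lborel) = pint p (f n)" for n
    using int by (simp add: pint_def nn_integral_eq_integral)
  then have "(\<lambda>n. ennreal (\<integral>x. norm (norm (f n x) powr p) \<partial>lborel)) \<longlonglongrightarrow> ennreal 0"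
    using lim by simp
  then have "(\<lambda>n. \<integral>x. norm (norm (f n x) powr p) \<partial>lborel) \<longlonglongrightarrow> 0"
    by (subst (asm) tendsto_ennreal_iff) auto
  from tendsto_L1_AE_subseq[OF int this] obtain r :: "nat \<Rightarrow> nat" where r: "strict_mono r"
    "AE x in lborel. (\<lambda>n. norm (f (r n) x) powr p) \<longlonglongrightarrow> 0" by blast
  from r(2) have "AE x in lborel. (\<lambda>n. f (r n) x) \<longlonglongrightarrow> 0"
  proof eventually_elim
    case (elim x)
    have "(\<lambda>n. (norm (f (r n) x) powr p) powr (1 / p)) \<longlonglongrightarrow> 0"
      by (rule tendsto_zero_powrI[where b="1 / p"]) (use elim assms(2) in auto)
    moreover have "(norm (f (r n) x) powr p) powr (1 / p) = norm (f (r n) x)" for n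
      using assms(2) by (simp add: powr_powr)
    ultimately show ?case by (simp add: tendsto_norm_zero_iff)
  qed
  with r(1) show ?thesis by blast
qed

text \<open>A pair \<open>(v, V)\<close> in the closure of the graph of the gradient on test functions:
  \<open>v\<close> belongs to \<open>W\<^sub>0\<^sup>1\<^sup>,\<^sup>p\<close> and \<open>V\<close> is its weak gradient. In this form chain and product rules
  reduce to those for smooth functions.\<close>

definition W0_limit :: "'a::euclidean_space set \<Rightarrow> real \<Rightarrow> ('a \<Rightarrow> real) \<Rightarrow> ('a \<Rightarrow> 'a) \<Rightarrow> bool"
  where "W0_limit K p v V \<longleftrightarrow> v \<in> borel_measurable borel \<and> V \<in> borel_measurable borel \<and>
    (\<exists>\<psi>. (\<forall>n. test_function K (\<psi> n)) \<and> (\<lambda>n. pint p (\<lambda>x. \<psi> n x - v x)) \<longlonglongrightarrow> 0 \<and>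
       (\<lambda>n. pint p (\<lambda>x. grad (\<psi> n) x - V x)) \<longlonglongrightarrow> 0)"

lemma tendsto_pint_inverse_Suc:
  assumes "\<And>n. a n \<le> ennreal (1 / real (Suc n))" shows "a \<longlonglongrightarrow> (0::ennreal)"
proof (rule tendsto_sandwich[OF _ _ tendsto_const])
  have "(\<lambda>n. ennreal (1 / real (Suc n))) \<longlonglongrightarrow> ennreal 0"
    by (intro tendsto_ennrealI LIMSEQ_Suc[OF lim_1_over_n])
  then show "(\<lambda>n. ennreal (1 / real (Suc n))) \<longlonglongrightarrow> 0" by simp
qed (use assms in auto)

lemma tendsto_0_ex_le:
  assumes "a \<longlonglongrightarrow> (0::ennreal)" "b \<longlonglongrightarrow> 0" "0 < e"
  shows "\<exists>n. a n \<le> ennreal e \<and> b n \<le> ennreal e"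
proof -
  have "\<forall>\<^sub>F n in sequentially. a n < ennreal e" "\<forall>\<^sub>F n in sequentially. b n < ennreal e"
    using assms by (auto intro: order_tendstoD)
  then have "\<forall>\<^sub>F n in sequentially. a n \<le> ennreal e \<and> b n \<le> ennreal e"
    by eventually_elim auto
  then show ?thesis using eventually_happens'[OF sequentially_bot] by blast
qed

lemma W0_limit_closed:
  assumes p: "0 \<le> p" and v: "\<And>n. W0_limit K p (v n) (V n)"
    and w: "w \<in> borel_measurable borel" "W \<in> borel_measurable borel"
    and lim: "(\<lambda>n. pint p (\<lambda>x. v n x - w x)) \<longlonglongrightarrow> 0" "(\<lambda>n. pint p (\<lambda>x. V n x - W x)) \<longlonglongrightarrow> 0"
  shows "W0_limit K p w W"
proof -
  have "\<exists>\<psi>. test_function K \<psi> \<and> pint p (\<lambda>x. \<psi> x - v n x) \<le> ennreal (1 / real (Suc n)) \<and>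
      pint p (\<lambda>x. grad \<psi> x - V n x) \<le> ennreal (1 / real (Suc n))" for n
  proof -
    obtain \<psi> where \<psi>: "\<And>m. test_function K (\<psi> m)" "(\<lambda>m. pint p (\<lambda>x. \<psi> m x - v n x)) \<longlonglongrightarrow> 0"
      "(\<lambda>m. pint p (\<lambda>x. grad (\<psi> m) x - V n x)) \<longlonglongrightarrow> 0"
      using v[of n] unfolding W0_limit_def by blast
    obtain m where "pint p (\<lambda>x. \<psi> m x - v n x) \<le> ennreal (1 / real (Suc n))"
      "pint p (\<lambda>x. grad (\<psi> m) x - V n x) \<le> ennreal (1 / real (Suc n))"
      using tendsto_0_ex_le[OF \<psi>(2,3), of "1 / real (Suc n)"] by auto
    then show ?thesis using \<psi>(1) by blast
  qed
  then obtain \<psi> where \<psi>: "\<And>n. test_function K (\<psi> n)"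
    "\<And>n. pint p (\<lambda>x. \<psi> n x - v n x) \<le> ennreal (1 / real (Suc n))"
    "\<And>n. pint p (\<lambda>x. grad (\<psi> n) x - V n x) \<le> ennreal (1 / real (Suc n))"
    by metis
  note m = C1_gradient_measurable[OF test_function_C1[OF \<psi>(1)]]
  have vm: "v n \<in> borel_measurable borel" "V n \<in> borel_measurable borel" for n
    using v[of n] by (auto simp: W0_limit_def)
  have "(\<lambda>n. pint p (\<lambda>x. (\<psi> n x - v n x) + (v n x - w x))) \<longlonglongrightarrow> 0"
    by (rule pint_tendsto_add[OF _ _ p tendsto_pint_inverse_Suc[OF \<psi>(2)] lim(1)])
      (use m vm w in measurable)
  moreover have "(\<lambda>n. pint p (\<lambda>x. (grad (\<psi> n) x - V n x) + (V n x - W x))) \<longlonglongrightarrow> 0"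
    by (rule pint_tendsto_add[OF _ _ p tendsto_pint_inverse_Suc[OF \<psi>(3)] lim(2)])
      (use m vm w in measurable)
  ultimately show ?thesis
    unfolding W0_limit_def using w \<psi>(1) by auto
qed

lemma norm_dist_bound:
  fixes x0 :: "'a::real_normed_vector"
  assumes "norm x0 + r \<le> norm x" shows "r \<le> dist x0 x"
  using assms norm_triangle_sub[of x x0] by (simp add: dist_norm norm_minus_commute)

lemma C1_compact_support_pint:
  fixes g :: "'a::euclidean_space \<Rightarrow> 'b::euclidean_space"
  assumes "continuous_on UNIV g" and "\<And>x. x \<notin> S \<Longrightarrow> g x = 0" and "compact S" and "0 < p"
  shows "pint p g < \<infinity>"
proof -
  obtain M where M: "0 \<le> M" "\<And>x. norm (g x) \<le> M"
    using continuous_compact_support_bounded[OF assms(1-3)] by blast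
  obtain r where r: "S \<subseteq> ball 0 r" using bounded_subset_ballD[OF compact_imp_bounded[OF assms(3)]] by blast
  have "pint p g \<le> ennreal (M powr p) * emeasure lborel (ball (0::'a) r)"
  proof (rule pint_bounded_support[OF M(2)])
    show "g x = 0" if "r \<le> norm x" for x
      using r that by (intro assms(2)) auto
  qed (use assms M in auto)
  also have "\<dots> < \<infinity>"
    using emeasure_lborel_ball_finite[of "0::'a" r] by (simp add: ennreal_mult_less_top)
  finally show ?thesis .
qed

text \<open>Mollification turns the function into test functions, and it commutes with the gradient.\<close>

lemma W0_limit_C1:
  fixes v :: "'a::euclidean_space \<Rightarrow> real"
  assumes v: "C1_gradient v V" and supp: "\<And>x. x \<notin> cball x0 r \<Longrightarrow> v x = 0" and r: "r < R" and p: "1 \<le> p"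
  shows "W0_limit (ball x0 R) p v V"
proof -
  have V0: "V x = 0" if "x \<notin> cball x0 r" for x
    by (rule gradient_zero_outside_support[OF v supp _ that]) auto
  note vc = C1_gradient_cont_fun[OF v] and Vc = C1_gradient_cont[OF v]
  note vm = C1_gradient_measurable[OF v]
  have iv: "integrable lborel v" "integrable lborel V"
    using integrable_continuous_compact_support[OF vc supp compact_cball]
      integrable_continuous_compact_support[OF Vc V0 compact_cball] by auto
  have fin: "pint p v < \<infinity>" "pint p V < \<infinity>"
    using C1_compact_support_pint[OF vc supp compact_cball] C1_compact_support_pint[OF Vc V0 compact_cball] p
    by auto
  have far: "x \<notin> cball x0 r" if "norm x0 + (r + 1) \<le> norm x" for x
    using norm_dist_bound[OF that] by auto
  have "\<exists>\<psi>. test_function (ball x0 R) \<psi> \<and> pint p (\<lambda>x. \<psi> x - v x) \<le> ennreal e \<and>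
      pint p (\<lambda>x. grad \<psi> x - V x) \<le> ennreal e" if e: "0 < e" for e
  proof -
    obtain \<epsilon>1 where \<epsilon>1: "\<epsilon>1 > 0"
      "\<And>\<epsilon> \<rho>. \<epsilon> \<le> \<epsilon>1 \<and> mollifier \<epsilon> \<rho> \<Longrightarrow> pint p (\<lambda>x. mollify \<rho> v x - v x) \<le> ennreal e"
      using pint_mollify_converges[of v p "norm x0 + (r + 1)" e, OF vm(1) p fin(1) supp[OF far] e] by blast
    obtain \<epsilon>2 where \<epsilon>2: "\<epsilon>2 > 0"
      "\<And>\<epsilon> \<rho>. \<epsilon> \<le> \<epsilon>2 \<and> mollifier \<epsilon> \<rho> \<Longrightarrow> pint p (\<lambda>x. mollify \<rho> V x - V x) \<le> ennreal e"
      using pint_mollify_converges[of V p "norm x0 + (r + 1)" e, OF vm(2) p fin(2) V0[OF far] e] by blast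
    define \<epsilon> where "\<epsilon> = min (min \<epsilon>1 \<epsilon>2) ((R - r) / 2)"
    have \<epsilon>: "0 < \<epsilon>" "\<epsilon> \<le> \<epsilon>1" "\<epsilon> \<le> \<epsilon>2" "r + \<epsilon> < R"
      using \<epsilon>1(1) \<epsilon>2(1) r by (auto simp: \<epsilon>_def min_def field_simps)
    obtain \<rho> :: "'a \<Rightarrow> real" where \<rho>: "mollifier \<epsilon> \<rho>" using ex_mollifier[OF \<epsilon>(1)] by blast
    have tf: "test_function (ball x0 R) (mollify \<rho> v)"
    proof (rule test_functionI)
      show "Ck k (mollify \<rho> v)" for k by (rule mollify_Ck[OF \<rho> iv(1)])
      show "mollify \<rho> v x = 0" if "x \<notin> cball x0 (r + \<epsilon>)" for x
      proof -
        have "norm (mollify \<rho> v x - 0) \<le> 0"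
        proof (rule mollify_const_diff[OF \<rho> iv(1)])
          fix y assume "norm (x - y) < \<epsilon>"
          then have "y \<notin> cball x0 r" using that dist_triangle[of x0 x y] by (auto simp: dist_norm norm_minus_commute)
          then show "norm (v y - 0) \<le> 0" using supp by simp
        qed
        then show ?thesis by simp
      qed
      show "compact (cball x0 (r + \<epsilon>))" "cball x0 (r + \<epsilon>) \<subseteq> ball x0 R" using \<epsilon> by auto
    qed
    have "grad (mollify \<rho> v) x = mollify \<rho> V x" for x
      using grad_mollify[OF C1_has_weak_gradient[OF v, of UNIV], of \<epsilon> \<rho> x] iv \<rho>
      by (simp add: restr_def[abs_def])
    then show ?thesis
      using tf \<epsilon>1(2)[of \<epsilon> \<rho>] \<epsilon>2(2)[of \<epsilon> \<rho>] \<epsilon> \<rho> by (intro exI[of _ "mollify \<rho> v"]) simp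
  qed
  then have "\<forall>n. \<exists>\<psi>. test_function (ball x0 R) \<psi> \<and> pint p (\<lambda>x. \<psi> x - v x) \<le> ennreal (1 / real (Suc n)) \<and>
      pint p (\<lambda>x. grad \<psi> x - V x) \<le> ennreal (1 / real (Suc n))"
    by (simp del: of_nat_Suc)
  then obtain \<psi> where \<psi>: "\<And>n. test_function (ball x0 R) (\<psi> n)"
    "\<And>n. pint p (\<lambda>x. \<psi> n x - v x) \<le> ennreal (1 / real (Suc n))"
    "\<And>n. pint p (\<lambda>x. grad (\<psi> n) x - V x) \<le> ennreal (1 / real (Suc n))"
    by metis
  then show ?thesis
    unfolding W0_limit_def using vm tendsto_pint_inverse_Suc[OF \<psi>(2)] tendsto_pint_inverse_Suc[OF \<psi>(3)]
    by blast
qed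

subsection \<open>The chain rule for positive parts\<close>

text \<open>The \<open>C\<^sup>1\<close> approximations \<open>sqrt (t\<^sub>+\<^sup>2 + \<delta>\<^sup>2) - \<delta>\<close> of the positive part, whose derivatives
  converge to the indicator function of \<open>t > 0\<close> everywhere, also at \<open>0\<close>.\<close>

definition smooth_pos :: "real \<Rightarrow> real \<Rightarrow> real"
  where "smooth_pos \<delta> t = sqrt ((max t 0)\<^sup>2 + \<delta>\<^sup>2) - \<delta>"

definition smooth_pos' :: "real \<Rightarrow> real \<Rightarrow> real"
  where "smooth_pos' \<delta> t = max t 0 / sqrt ((max t 0)\<^sup>2 + \<delta>\<^sup>2)"

lemma max_0_squared_deriv: "((\<lambda>t. (max t 0)\<^sup>2) has_real_derivative 2 * max t 0) (at (t::real))"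
proof -
  consider "t < 0" | "t = 0" | "t > 0" by linarith
  then show ?thesis
  proof cases
    case 1
    have "((\<lambda>t. (max t 0)\<^sup>2) has_real_derivative 0) (at t)"
      by (rule has_field_derivative_transform_within_open[where f="\<lambda>_. 0" and S="{..<0}"])
        (use 1 in \<open>auto simp: max_def\<close>)
    then show ?thesis using 1 by simp
  next
    case 2
    have "((\<lambda>t. (max t 0)\<^sup>2) has_real_derivative 0) (at (0::real))"
      by (rule has_derivative_zero_if_quadratic[where c=1]) (auto simp: max_def)
    then show ?thesis using 2 by simp
  next
    case 3
    have "((\<lambda>t. t\<^sup>2) has_real_derivative 2 * max t 0) (at t)"
      using 3 by (auto intro!: derivative_eq_intros)
    then show ?thesis
      by (rule has_field_derivative_transform_within_open[where S="{0<..}"]) (use 3 in auto)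
  qed
qed

lemma smooth_pos_deriv:
  assumes "0 < \<delta>" shows "(smooth_pos \<delta> has_real_derivative smooth_pos' \<delta> t) (at t)"
proof -
  have "(max t 0)\<^sup>2 + \<delta>\<^sup>2 > 0" using assms by (simp add: add_nonneg_pos)
  then have "((\<lambda>t. sqrt ((max t 0)\<^sup>2 + \<delta>\<^sup>2) - \<delta>) has_real_derivative smooth_pos' \<delta> t) (at t)"
    by (intro DERIV_cong[OF DERIV_diff[OF DERIV_chain2[OF DERIV_real_sqrt
            DERIV_add[OF max_0_squared_deriv DERIV_const]] DERIV_const]])
      (auto simp: smooth_pos'_def field_simps)
  then show ?thesis by (simp add: smooth_pos_def[abs_def])
qed

lemma smooth_pos'_continuous: "0 < \<delta> \<Longrightarrow> continuous_on UNIV (smooth_pos' \<delta>)"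
  unfolding smooth_pos'_def[abs_def]
  by (intro continuous_intros) (auto simp: add_nonneg_eq_0_iff)

lemma smooth_pos'_bounds:
  assumes "0 < \<delta>" shows "0 \<le> smooth_pos' \<delta> t" "smooth_pos' \<delta> t \<le> 1"
proof -
  show "0 \<le> smooth_pos' \<delta> t" by (simp add: smooth_pos'_def)
  have "max t 0 \<le> sqrt ((max t 0)\<^sup>2 + \<delta>\<^sup>2)" by (rule real_le_rsqrt) simp
  moreover have "sqrt ((max t 0)\<^sup>2 + \<delta>\<^sup>2) > 0" using assms by (simp add: add_nonneg_pos)
  ultimately show "smooth_pos' \<delta> t \<le> 1" by (simp add: smooth_pos'_def)
qed

lemma smooth_pos_lipschitz:
  assumes "0 < \<delta>" shows "\<bar>smooth_pos \<delta> a - smooth_pos \<delta> b\<bar> \<le> \<bar>a - b\<bar>"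
proof -
  have "norm (smooth_pos \<delta> a - smooth_pos \<delta> b) \<le> 1 * norm (a - b)"
    by (rule field_differentiable_bound[where S=UNIV and f'="smooth_pos' \<delta>"])
      (use smooth_pos_deriv[OF assms] smooth_pos'_bounds[OF assms] in auto)
  then show ?thesis by simp
qed

lemma smooth_pos_bounds:
  assumes "0 < \<delta>"
  shows "\<bar>smooth_pos \<delta> t - max t 0\<bar> \<le> \<delta>"
proof -
  have "max t 0 \<le> sqrt ((max t 0)\<^sup>2 + \<delta>\<^sup>2)" by (rule real_le_rsqrt) simp
  moreover have "sqrt ((max t 0)\<^sup>2 + \<delta>\<^sup>2) \<le> max t 0 + \<delta>"
    using assms by (intro real_le_lsqrt) (auto simp: power2_sum)
  ultimately show ?thesis by (simp add: smooth_pos_def)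
qed

lemma smooth_pos'_tendsto:
  assumes "\<delta> \<longlonglongrightarrow> 0"
  shows "(\<lambda>n. smooth_pos' (\<delta> n) t) \<longlonglongrightarrow> (if t > 0 then 1 else 0)"
proof (cases "t > 0")
  case True
  have "(\<lambda>n. max t 0 / sqrt ((max t 0)\<^sup>2 + (\<delta> n)\<^sup>2)) \<longlonglongrightarrow> max t 0 / sqrt ((max t 0)\<^sup>2 + 0\<^sup>2)"
    using True by (intro tendsto_intros assms) auto
  then show ?thesis using True by (simp add: smooth_pos'_def)
qed (simp add: smooth_pos'_def)

text \<open>The rule holds for the mollified function. In the limit the factor \<open>F' (u)\<close> is handled by
  dominated convergence along a subsequence that converges almost everywhere.\<close>

lemma W0_limit_chain:
  fixes u :: "'a::euclidean_space \<Rightarrow> real" and x0 :: 'a and R :: real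
  defines "K \<equiv> ball x0 R"
  assumes um[measurable]: "u \<in> borel_measurable borel" and Gm[measurable]: "G \<in> borel_measurable borel"
    and wg: "has_weak_gradient K u G" and fin: "pint p (restr K u) < \<infinity>" "pint p (restr K G) < \<infinity>"
    and \<zeta>: "C1_gradient \<zeta> Z" "\<And>x. x \<notin> cball x0 r \<Longrightarrow> \<zeta> x = 0" "\<And>x. 0 \<le> \<zeta> x" "\<And>x. \<zeta> x \<le> 1"
    and r: "r < R" and p: "1 \<le> p"
    and F: "\<And>t. (F has_real_derivative F' t) (at t)" "continuous_on UNIV F'"
      "\<And>t. \<bar>F' t\<bar> \<le> 1" "\<And>a b. \<bar>F a - F b\<bar> \<le> \<bar>a - b\<bar>"
  shows "W0_limit K p (\<lambda>x. F (u x) * \<zeta> x) (\<lambda>x. F (u x) *\<^sub>R Z x + \<zeta> x *\<^sub>R F' (u x) *\<^sub>R G x)"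
proof -
  have [measurable]: "K \<in> sets borel" by (simp add: K_def)
  have rm[measurable]: "restr K u \<in> borel_measurable borel" "restr K G \<in> borel_measurable borel"
    by (auto intro!: restr_measurable)
  have Fm[measurable]: "F \<in> borel_measurable borel"
    using F(1) by (intro borel_measurable_continuous_onI continuous_at_imp_continuous_on) (auto intro: DERIV_isCont)
  have F'm[measurable]: "F' \<in> borel_measurable borel"
    by (rule borel_measurable_continuous_onI[OF F(2)])
  have [measurable]: "\<zeta> \<in> borel_measurable borel" "Z \<in> borel_measurable borel"
    using C1_gradient_measurable[OF \<zeta>(1)] .
  have Z0: "Z x = 0" if "x \<notin> cball x0 r" for x
    by (rule gradient_zero_outside_support[OF \<zeta>(1,2) _ that]) auto
  obtain M where M: "0 \<le> M" "\<And>x. norm (Z x) \<le> M"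
    using continuous_compact_support_bounded[OF C1_gradient_cont[OF \<zeta>(1)] Z0 compact_cball] by blast
  have sub: "cball x0 r \<subseteq> K" using r by (auto simp: K_def)
  have far: "x \<notin> K" if "norm x0 + R \<le> norm x" for x
    using norm_dist_bound[OF that] by (auto simp: K_def)
  have iu: "integrable lborel (restr K u)" "integrable lborel (restr K G)"
    by (rule integrable_of_pint[OF _ p _ restr_out[OF far]]; use fin in simp)+
  define good where "good n \<rho> \<longleftrightarrow> (\<exists>\<epsilon>. mollifier \<epsilon> \<rho> \<and> r + \<epsilon> < R) \<and>
      pint p (\<lambda>x. mollify \<rho> (restr K u) x - restr K u x) \<le> ennreal (1 / real (Suc n)) \<and>
      pint p (\<lambda>x. mollify \<rho> (restr K G) x - restr K G x) \<le> ennreal (1 / real (Suc n))" for n \<rho>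
  have "\<exists>\<rho>. good n \<rho>" for n
  proof -
    have e: "0 < 1 / real (Suc n)" by simp
    obtain \<epsilon>1 where \<epsilon>1: "\<epsilon>1 > 0" "\<And>\<epsilon> \<rho>. \<epsilon> \<le> \<epsilon>1 \<and> mollifier \<epsilon> \<rho> \<Longrightarrow>
        pint p (\<lambda>x. mollify \<rho> (restr K u) x - restr K u x) \<le> ennreal (1 / real (Suc n))"
      using pint_mollify_converges[OF rm(1) p fin(1) restr_out[OF far] e] by blast
    obtain \<epsilon>2 where \<epsilon>2: "\<epsilon>2 > 0" "\<And>\<epsilon> \<rho>. \<epsilon> \<le> \<epsilon>2 \<and> mollifier \<epsilon> \<rho> \<Longrightarrow>
        pint p (\<lambda>x. mollify \<rho> (restr K G) x - restr K G x) \<le> ennreal (1 / real (Suc n))"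
      using pint_mollify_converges[OF rm(2) p fin(2) restr_out[OF far] e] by blast
    define \<epsilon> where "\<epsilon> = min (min \<epsilon>1 \<epsilon>2) ((R - r) / 2)"
    have \<epsilon>: "0 < \<epsilon>" "\<epsilon> \<le> \<epsilon>1" "\<epsilon> \<le> \<epsilon>2" "r + \<epsilon> < R"
      using \<epsilon>1(1) \<epsilon>2(1) r by (auto simp: \<epsilon>_def min_def field_simps)
    obtain \<rho> :: "'a \<Rightarrow> real" where \<rho>: "mollifier \<epsilon> \<rho>" using ex_mollifier[OF \<epsilon>(1)] by blast
    show ?thesis unfolding good_def using \<epsilon>1(2)[of \<epsilon> \<rho>] \<epsilon>2(2)[of \<epsilon> \<rho>] \<epsilon> \<rho> by blast
  qed
  then obtain \<rho> where "\<And>n. good n (\<rho> n)" by metis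
  then have \<rho>: "\<And>n. \<exists>\<epsilon>. mollifier \<epsilon> (\<rho> n) \<and> r + \<epsilon> < R"
    "\<And>n. pint p (\<lambda>x. mollify (\<rho> n) (restr K u) x - restr K u x) \<le> ennreal (1 / real (Suc n))"
    "\<And>n. pint p (\<lambda>x. mollify (\<rho> n) (restr K G) x - restr K G x) \<le> ennreal (1 / real (Suc n))"
    unfolding good_def by blast+
  define un where "un n = mollify (\<rho> n) (restr K u)" for n
  define gn where "gn n = mollify (\<rho> n) (restr K G)" for n
  have unC1: "C1_gradient (un n) (grad (un n))" for n
    using \<rho>(1)[of n] mollify_Ck[OF _ iu(1)] unfolding un_def by (blast intro: C1_gradient_grad)
  have un_m[measurable]: "un n \<in> borel_measurable borel" "grad (un n) \<in> borel_measurable borel" for n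
    using C1_gradient_measurable[OF unC1] .
  have gn_m[measurable]: "gn n \<in> borel_measurable borel" for n
    unfolding gn_def using \<rho>(1)[of n] by (auto intro!: mollify_measurable mollifier_measurable)
  have grad_un: "grad (un n) x = gn n x" if x: "x \<in> cball x0 r" for n x
  proof -
    obtain \<epsilon> where \<epsilon>: "mollifier \<epsilon> (\<rho> n)" "r + \<epsilon> < R" using \<rho>(1) by blast
    have "cball x \<epsilon> \<subseteq> K"
    proof
      fix y assume "y \<in> cball x \<epsilon>"
      then show "y \<in> K" using dist_triangle[of x0 y x] x \<epsilon> by (auto simp: K_def)
    qed
    then show ?thesis unfolding un_def gn_def by (rule grad_mollify[OF wg iu \<epsilon>(1)])
  qed
  have lim0: "(\<lambda>n. pint p (\<lambda>x. un n x - restr K u x)) \<longlonglongrightarrow> 0"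
    "(\<lambda>n. pint p (\<lambda>x. gn n x - restr K G x)) \<longlonglongrightarrow> 0"
    unfolding un_def gn_def by (rule tendsto_pint_inverse_Suc[OF \<rho>(2)] tendsto_pint_inverse_Suc[OF \<rho>(3)])+
  have finn: "pint p (\<lambda>x. un n x - restr K u x) < \<infinity>" for n
    unfolding un_def using le_less_trans[OF \<rho>(2)] by simp
  obtain s :: "nat \<Rightarrow> nat" where s: "strict_mono s"
    "AE x in lborel. (\<lambda>n. un (s n) x - restr K u x) \<longlonglongrightarrow> 0"
    using pint_AE_subseq[OF _ _ lim0(1) finn] p by auto
  note lim = lim0(1)[THEN LIMSEQ_subseq_LIMSEQ[OF _ s(1)], unfolded comp_def]
    lim0(2)[THEN LIMSEQ_subseq_LIMSEQ[OF _ s(1)], unfolded comp_def]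
  define v where "v n x = F (un (s n) x) * \<zeta> x" for n x
  define V where "V n x = F (un (s n) x) *\<^sub>R Z x + \<zeta> x *\<^sub>R (F' (un (s n) x) *\<^sub>R grad (un (s n)) x)" for n x
  show ?thesis
  proof (rule W0_limit_closed[where v=v and V=V])
    show "W0_limit K p (v n) (V n)" for n
      unfolding K_def
    proof (rule W0_limit_C1[OF _ _ r p])
      show "C1_gradient (v n) (V n)"
        unfolding v_def[abs_def] V_def[abs_def]
        by (rule C1_gradient_mult[OF C1_gradient_compose[OF unC1 F(1,2)] \<zeta>(1)])
      show "v n x = 0" if "x \<notin> cball x0 r" for x using \<zeta>(2)[OF that] by (simp add: v_def)
    qed
    show "(\<lambda>n. pint p (\<lambda>x. v n x - F (u x) * \<zeta> x)) \<longlonglongrightarrow> 0"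
    proof (rule pint_tendsto_mono[OF lim(1)])
      show "norm (v n x - F (u x) * \<zeta> x) \<le> norm (un (s n) x - restr K u x)" for n x
      proof (cases "x \<in> cball x0 r")
        case True
        have "norm (v n x - F (u x) * \<zeta> x) = \<bar>F (un (s n) x) - F (u x)\<bar> * \<bar>\<zeta> x\<bar>"
          by (simp add: v_def abs_mult[symmetric] left_diff_distrib)
        also have "\<dots> \<le> \<bar>un (s n) x - u x\<bar> * 1"
          using \<zeta>(3,4) by (intro mult_mono F(4)) auto
        finally show ?thesis using True sub by auto
      qed (simp add: v_def \<zeta>(2))
    qed (use p in simp)
    have 1: "(\<lambda>n. pint p (\<lambda>x. (F (un (s n) x) - F (u x)) *\<^sub>R Z x)) \<longlonglongrightarrow> 0"
    proof (rule pint_tendsto_mono)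
      show "(\<lambda>n. pint p (\<lambda>x. M *\<^sub>R (un (s n) x - restr K u x))) \<longlonglongrightarrow> 0"
        by (rule pint_tendsto_cmult[OF lim(1)]) measurable
      show "norm ((F (un (s n) x) - F (u x)) *\<^sub>R Z x) \<le> norm (M *\<^sub>R (un (s n) x - restr K u x))" for n x
      proof (cases "x \<in> cball x0 r")
        case True
        have "norm ((F (un (s n) x) - F (u x)) *\<^sub>R Z x) \<le> \<bar>un (s n) x - u x\<bar> * M"
          using M by (auto intro!: mult_mono F(4))
        then show ?thesis using True sub M by (auto simp: abs_mult mult.commute)
      qed (simp add: Z0)
    qed (use p in simp)
    have 2: "(\<lambda>n. pint p (\<lambda>x. (\<zeta> x * F' (un (s n) x)) *\<^sub>R (gn (s n) x - restr K G x))) \<longlonglongrightarrow> 0"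
    proof (rule pint_tendsto_mono[OF lim(2)])
      show "norm ((\<zeta> x * F' (un (s n) x)) *\<^sub>R (gn (s n) x - restr K G x)) \<le> norm (gn (s n) x - restr K G x)" for n x
      proof -
        have "\<bar>\<zeta> x\<bar> * \<bar>F' (un (s n) x)\<bar> \<le> 1 * 1"
          using \<zeta>(3,4) by (intro mult_mono F(3)) auto
        then have "\<bar>\<zeta> x * F' (un (s n) x)\<bar> * norm (gn (s n) x - restr K G x) \<le> 1 * norm (gn (s n) x - restr K G x)"
          by (intro mult_right_mono) (auto simp: abs_mult)
        then show ?thesis by simp
      qed
    qed (use p in simp)
    have 3: "(\<lambda>n. pint p (\<lambda>x. (\<zeta> x * (F' (un (s n) x) - F' (u x))) *\<^sub>R restr K G x)) \<longlonglongrightarrow> 0"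
    proof (rule pint_tendsto_0_dominated[where w="\<lambda>x. 2 *\<^sub>R restr K G x"])
      show "norm ((\<zeta> x * (F' (un (s n) x) - F' (u x))) *\<^sub>R restr K G x) \<le> norm (2 *\<^sub>R restr K G x)" for n x
      proof -
        have "\<bar>F' (un (s n) x) - F' (u x)\<bar> \<le> 2" using F(3)[of "un (s n) x"] F(3)[of "u x"] by linarith
        then have "\<bar>\<zeta> x\<bar> * \<bar>F' (un (s n) x) - F' (u x)\<bar> \<le> 1 * 2"
          using \<zeta>(3,4) by (intro mult_mono) auto
        then have "\<bar>\<zeta> x * (F' (un (s n) x) - F' (u x))\<bar> * norm (restr K G x) \<le> 2 * norm (restr K G x)"
          by (intro mult_right_mono) (auto simp: abs_mult)
        then show ?thesis by simp
      qed
      show "pint p (\<lambda>x. 2 *\<^sub>R restr K G x) < \<infinity>"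
        using fin(2) by (simp add: pint_cmult ennreal_mult_less_top)
      show "AE x in lborel. (\<lambda>n. (\<zeta> x * (F' (un (s n) x) - F' (u x))) *\<^sub>R restr K G x) \<longlonglongrightarrow> 0"
        using s(2)
      proof eventually_elim
        case (elim x)
        show ?case
        proof (cases "x \<in> cball x0 r")
          case True
          have "(\<lambda>n. un (s n) x) \<longlonglongrightarrow> u x"
            using tendsto_add[OF elim tendsto_const[of "u x"]] True sub by auto
          then have "(\<lambda>n. F' (un (s n) x)) \<longlonglongrightarrow> F' (u x)"
            using continuous_on_tendsto_compose[OF F(2)] by auto
          then have "(\<lambda>n. (\<zeta> x * (F' (un (s n) x) - F' (u x))) *\<^sub>R restr K G x)
              \<longlonglongrightarrow> (\<zeta> x * (F' (u x) - F' (u x))) *\<^sub>R restr K G x"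
            by (intro tendsto_intros)
          then show ?thesis by simp
        qed (simp add: \<zeta>(2))
      qed
    qed (use p in \<open>simp_all\<close>)
    have "(\<lambda>n. pint p (\<lambda>x. (F (un (s n) x) - F (u x)) *\<^sub>R Z x
        + ((\<zeta> x * F' (un (s n) x)) *\<^sub>R (gn (s n) x - restr K G x)
        + (\<zeta> x * (F' (un (s n) x) - F' (u x))) *\<^sub>R restr K G x))) \<longlonglongrightarrow> 0"
    proof (rule pint_tendsto_add[OF _ _ _ 1 pint_tendsto_add[OF _ _ _ 2 3]])
    qed (use p in \<open>simp_all\<close>)
    moreover have "(F (un (s n) x) - F (u x)) *\<^sub>R Z x
        + ((\<zeta> x * F' (un (s n) x)) *\<^sub>R (gn (s n) x - restr K G x)
        + (\<zeta> x * (F' (un (s n) x) - F' (u x))) *\<^sub>R restr K G x)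
        = V n x - (F (u x) *\<^sub>R Z x + \<zeta> x *\<^sub>R F' (u x) *\<^sub>R G x)" for n x
    proof (cases "x \<in> cball x0 r")
      case True
      then show ?thesis using grad_un[OF True] sub by (auto simp: V_def algebra_simps)
    qed (simp add: V_def \<zeta>(2) algebra_simps)
    ultimately show "(\<lambda>n. pint p (\<lambda>x. V n x - (F (u x) *\<^sub>R Z x + \<zeta> x *\<^sub>R F' (u x) *\<^sub>R G x))) \<longlonglongrightarrow> 0"
      by simp
  qed (use p in \<open>simp_all\<close>)
qed

text \<open>The source of the test functions for the equation. The smooth approximations of the positive
  part satisfy the chain rule, and their derivatives converge boundedly and everywhere.\<close>

lemma W0_limit_pos_part:
  fixes u :: "'a::euclidean_space \<Rightarrow> real" and x0 :: 'a and R :: real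
  defines "K \<equiv> ball x0 R"
  assumes um[measurable]: "u \<in> borel_measurable borel" and Gm[measurable]: "G \<in> borel_measurable borel"
    and wg: "has_weak_gradient K u G" and fin: "pint p (restr K u) < \<infinity>" "pint p (restr K G) < \<infinity>"
    and \<zeta>: "C1_gradient \<zeta> Z" "\<And>x. x \<notin> cball x0 r \<Longrightarrow> \<zeta> x = 0" "\<And>x. 0 \<le> \<zeta> x" "\<And>x. \<zeta> x \<le> 1"
    and r: "r < R" and p: "1 \<le> p"
  shows "W0_limit K p (\<lambda>x. max (u x - k) 0 * \<zeta> x)
    (\<lambda>x. max (u x - k) 0 *\<^sub>R Z x + \<zeta> x *\<^sub>R (if k < u x then 1 else 0) *\<^sub>R G x)"
proof -
  have [measurable]: "\<zeta> \<in> borel_measurable borel" "Z \<in> borel_measurable borel"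
    using C1_gradient_measurable[OF \<zeta>(1)] .
  have [measurable]: "K \<in> sets borel" by (simp add: K_def)
  have rm[measurable]: "restr K G \<in> borel_measurable borel"
    by (auto intro!: restr_measurable)
  have Z0: "Z x = 0" if "x \<notin> cball x0 r" for x
    by (rule gradient_zero_outside_support[OF \<zeta>(1,2) _ that]) auto
  have sub: "cball x0 r \<subseteq> K" using r by (auto simp: K_def)
  define d where "d n = 1 / real (Suc n)" for n
  have d: "0 < d n" "d n \<le> 1" "d \<longlonglongrightarrow> 0" for n
    unfolding d_def using LIMSEQ_Suc[OF lim_1_over_n] by (auto simp: d_def[abs_def])
  have [measurable]: "smooth_pos (d n) \<in> borel_measurable borel" "smooth_pos' (d n) \<in> borel_measurable borel" for n
    unfolding smooth_pos_def[abs_def] smooth_pos'_def[abs_def] by measurable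
  let ?F = "\<lambda>n x. smooth_pos (d n) (u x - k)" and ?F' = "\<lambda>n x. smooth_pos' (d n) (u x - k)"
  let ?i = "\<lambda>x. if k < u x then 1 else (0::real)"
  show ?thesis
  proof (rule W0_limit_closed[where v="\<lambda>n x. ?F n x * \<zeta> x"
        and V="\<lambda>n x. ?F n x *\<^sub>R Z x + \<zeta> x *\<^sub>R ?F' n x *\<^sub>R G x"])
    show "W0_limit K p (\<lambda>x. ?F n x * \<zeta> x) (\<lambda>x. ?F n x *\<^sub>R Z x + \<zeta> x *\<^sub>R ?F' n x *\<^sub>R G x)" for n
      unfolding K_def
    proof (rule W0_limit_chain[OF um Gm wg[unfolded K_def] fin[unfolded K_def] \<zeta> r p,
          where F="\<lambda>t. smooth_pos (d n) (t - k)" and F'="\<lambda>t. smooth_pos' (d n) (t - k)"])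
      show "((\<lambda>t. smooth_pos (d n) (t - k)) has_real_derivative smooth_pos' (d n) (t - k)) (at t)" for t
        by (rule DERIV_cong[OF DERIV_chain2[OF smooth_pos_deriv[OF d(1)]
              DERIV_diff[OF DERIV_ident DERIV_const]]]) simp
      show "continuous_on UNIV (\<lambda>t. smooth_pos' (d n) (t - k))"
        by (rule continuous_on_compose2[OF smooth_pos'_continuous[OF d(1)]]) (auto intro!: continuous_intros)
      show "\<bar>smooth_pos' (d n) (t - k)\<bar> \<le> 1" for t
        using smooth_pos'_bounds[OF d(1)] by (simp add: abs_le_iff)
      show "\<bar>smooth_pos (d n) (a - k) - smooth_pos (d n) (b - k)\<bar> \<le> \<bar>a - b\<bar>" for a b
        using smooth_pos_lipschitz[OF d(1), of n "a - k" "b - k"] by simp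
    qed
    have F_lim: "(\<lambda>n. ?F n x - max (u x - k) 0) \<longlonglongrightarrow> 0" for x
      by (rule Lim_null_comparison[OF _ d(3)]) (use smooth_pos_bounds[OF d(1)] in auto)
    have F'_lim: "(\<lambda>n. ?F' n x - ?i x) \<longlonglongrightarrow> 0" for x
      using smooth_pos'_tendsto[OF d(3), of "u x - k"] by (simp add: LIM_zero_iff)
    have Fb: "\<bar>?F n x - max (u x - k) 0\<bar> \<le> 1" for n x
      using smooth_pos_bounds[OF d(1)] d(2) order_trans by blast
    have fin\<zeta>: "pint p \<zeta> < \<infinity>" "pint p Z < \<infinity>"
      using C1_compact_support_pint[OF C1_gradient_cont_fun[OF \<zeta>(1)] \<zeta>(2) compact_cball]
        C1_compact_support_pint[OF C1_gradient_cont[OF \<zeta>(1)] Z0 compact_cball] p by auto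
    have "(\<lambda>n. pint p (\<lambda>x. (?F n x - max (u x - k) 0) * \<zeta> x)) \<longlonglongrightarrow> 0"
      by (rule pint_tendsto_0_dominated[where w=\<zeta>])
        (use Fb p fin\<zeta> F_lim in \<open>auto simp: abs_mult intro!: mult_left_le_one_le tendsto_mult_left_zero\<close>)
    then show "(\<lambda>n. pint p (\<lambda>x. ?F n x * \<zeta> x - max (u x - k) 0 * \<zeta> x)) \<longlonglongrightarrow> 0"
      by (simp add: left_diff_distrib)
    have 1: "(\<lambda>n. pint p (\<lambda>x. (?F n x - max (u x - k) 0) *\<^sub>R Z x)) \<longlonglongrightarrow> 0"
    proof (rule pint_tendsto_0_dominated[where w=Z])
      show "AE x in lborel. (\<lambda>n. (?F n x - max (u x - k) 0) *\<^sub>R Z x) \<longlonglongrightarrow> 0"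
      proof (rule AE_I2)
        fix x
        show "(\<lambda>n. (?F n x - max (u x - k) 0) *\<^sub>R Z x) \<longlonglongrightarrow> 0"
          using tendsto_scaleR[OF F_lim[of x] tendsto_const[of "Z x"]] by simp
      qed
    qed (use Fb p fin\<zeta> in \<open>auto intro!: mult_left_le_one_le\<close>)
    have 2: "(\<lambda>n. pint p (\<lambda>x. (\<zeta> x * (?F' n x - ?i x)) *\<^sub>R restr K G x)) \<longlonglongrightarrow> 0"
    proof (rule pint_tendsto_0_dominated[where w="restr K G"])
      show "norm ((\<zeta> x * (?F' n x - ?i x)) *\<^sub>R restr K G x) \<le> norm (restr K G x)" for n x
      proof -
        have "\<bar>?F' n x - ?i x\<bar> \<le> 1"
          using smooth_pos'_bounds[OF d(1), of n "u x - k"] by (auto simp: abs_le_iff)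
        then have "\<bar>\<zeta> x\<bar> * \<bar>?F' n x - ?i x\<bar> \<le> 1 * 1"
          using \<zeta>(3,4) by (intro mult_mono) auto
        then have "\<bar>\<zeta> x * (?F' n x - ?i x)\<bar> * norm (restr K G x) \<le> 1 * norm (restr K G x)"
          by (intro mult_right_mono) (auto simp: abs_mult)
        then show ?thesis by simp
      qed
      show "AE x in lborel. (\<lambda>n. (\<zeta> x * (?F' n x - ?i x)) *\<^sub>R restr K G x) \<longlonglongrightarrow> 0"
      proof (rule AE_I2)
        fix x
        have "(\<lambda>n. (\<zeta> x * (?F' n x - ?i x)) *\<^sub>R restr K G x) \<longlonglongrightarrow> (\<zeta> x * 0) *\<^sub>R restr K G x"
          by (intro tendsto_intros F'_lim)
        then show "(\<lambda>n. (\<zeta> x * (?F' n x - ?i x)) *\<^sub>R restr K G x) \<longlonglongrightarrow> 0" by simp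
      qed
    qed (use p fin in \<open>simp_all\<close>)
    have "(\<lambda>n. pint p (\<lambda>x. (?F n x - max (u x - k) 0) *\<^sub>R Z x + (\<zeta> x * (?F' n x - ?i x)) *\<^sub>R restr K G x)) \<longlonglongrightarrow> 0"
    proof (rule pint_tendsto_add[OF _ _ _ 1 2])
    qed (use p in \<open>simp_all\<close>)
    moreover have "(?F n x - max (u x - k) 0) *\<^sub>R Z x + (\<zeta> x * (?F' n x - ?i x)) *\<^sub>R restr K G x
        = ?F n x *\<^sub>R Z x + \<zeta> x *\<^sub>R ?F' n x *\<^sub>R G x
          - (max (u x - k) 0 *\<^sub>R Z x + \<zeta> x *\<^sub>R ?i x *\<^sub>R G x)" for n x
    proof (cases "x \<in> cball x0 r")
      case True
      then have "x \<in> K" using sub by auto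
      then show ?thesis by (simp add: algebra_simps)
    qed (simp add: \<zeta>(2) Z0)
    ultimately show "(\<lambda>n. pint p (\<lambda>x. ?F n x *\<^sub>R Z x + \<zeta> x *\<^sub>R ?F' n x *\<^sub>R G x
        - (max (u x - k) 0 *\<^sub>R Z x + \<zeta> x *\<^sub>R ?i x *\<^sub>R G x))) \<longlonglongrightarrow> 0"
      by simp
  qed (use p in \<open>simp_all\<close>)
qed

subsection \<open>Limits of test functions have weak gradients\<close>

lemma pint_1_le:
  fixes g :: "'a::euclidean_space \<Rightarrow> 'b::euclidean_space"
  assumes [measurable]: "g \<in> borel_measurable borel" and p: "1 \<le> p"
    and supp: "\<And>x. x \<notin> K \<Longrightarrow> g x = 0" and K: "K \<in> sets borel" "emeasure lborel K \<le> ennreal W" "0 \<le> W"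
    and A: "pint p g \<le> ennreal A" "0 \<le> A"
  shows "pint 1 g \<le> ennreal (W powr (1 - 1 / p) * A powr (1 / p))"
proof -
  have eq: "indicator K x * norm (g x) powr q = norm (g x) powr q" for x q
    using supp[of x] by (cases "x \<in> K") auto
  have "(\<integral>\<^sup>+x. ennreal (indicator K x * norm (g x)) \<partial>lborel) \<le> ennreal (W powr (1 - 1 / p) * A powr (1 / p))"
  proof (rule nn_integral_power_mean)
    have "(\<integral>\<^sup>+x. ennreal (indicator K x) \<partial>lborel) = emeasure lborel K"
      using K by (simp add: ennreal_indicator)
    then show "(\<integral>\<^sup>+x. ennreal (indicator K x) \<partial>lborel) \<le> ennreal W" using K by simp
    show "(\<integral>\<^sup>+x. ennreal (indicator K x * norm (g x) powr p) \<partial>lborel) \<le> ennreal A"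
      using A unfolding eq by (simp add: pint_def)
  qed (use K p A in auto)
  moreover have "indicator K x * norm (g x) = norm (g x)" for x
    using supp[of x] by (cases "x \<in> K") auto
  ultimately show ?thesis by (simp add: pint_def)
qed

lemma integral_mult_bounded_tendsto:
  fixes f :: "nat \<Rightarrow> 'a::euclidean_space \<Rightarrow> real"
  assumes int: "\<And>n. integrable lborel (f n)" "integrable lborel g" and p: "1 \<le> p"
    and supp: "\<And>n x. x \<notin> K \<Longrightarrow> f n x = 0" "\<And>x. x \<notin> K \<Longrightarrow> g x = 0"
    and K: "K \<in> sets borel" "emeasure lborel K < \<infinity>"
    and b[measurable]: "b \<in> borel_measurable borel" and M: "\<And>x. \<bar>b x\<bar> \<le> M"
    and lim: "(\<lambda>n. pint p (\<lambda>x. f n x - g x)) \<longlonglongrightarrow> 0" and fin: "\<And>n. pint p (\<lambda>x. f n x - g x) < \<infinity>"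
  shows "(\<lambda>n. \<integral>x. f n x * b x \<partial>lborel) \<longlonglongrightarrow> (\<integral>x. g x * b x \<partial>lborel)"
proof -
  have M0: "0 \<le> M" using M abs_ge_zero order_trans by blast
  have intb: "integrable lborel (\<lambda>x. h x * b x)" if "integrable lborel h" for h
  proof (rule Bochner_Integration.integrable_bound)
    show "integrable lborel (\<lambda>x. M * h x)" using that by simp
    show "AE x in lborel. norm (h x * b x) \<le> norm (M * h x)"
      using M M0 by (auto simp: abs_mult mult.commute[of _ "\<bar>b _\<bar>"] intro!: mult_right_mono)
  qed (use that in measurable)
  obtain W where W: "emeasure lborel K = ennreal W" "0 \<le> W" using K by (cases "emeasure lborel K") auto
  define a where "a n = enn2real (pint p (\<lambda>x. f n x - g x))" for n
  have a: "pint p (\<lambda>x. f n x - g x) = ennreal (a n)" "0 \<le> a n" for n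
    using fin[of n] by (auto simp: a_def)
  have "(\<lambda>n. ennreal (a n)) \<longlonglongrightarrow> ennreal 0" using lim a by simp
  then have a0: "a \<longlonglongrightarrow> 0" by (subst (asm) tendsto_ennreal_iff) (use a in auto)
  have "\<bar>(\<integral>x. f n x * b x \<partial>lborel) - (\<integral>x. g x * b x \<partial>lborel)\<bar> \<le> W powr (1 - 1 / p) * a n powr (1 / p) * M" for n
  proof -
    have id: "integrable lborel (\<lambda>x. f n x - g x)" using int by simp
    have "(\<integral>x. f n x * b x \<partial>lborel) - (\<integral>x. g x * b x \<partial>lborel) = (\<integral>x. (f n x - g x) * b x \<partial>lborel)"
      using int by (simp add: left_diff_distrib intb)
    also have "\<bar>\<dots>\<bar> \<le> (\<integral>x. \<bar>(f n x - g x) * b x\<bar> \<partial>lborel)"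
      by (rule integral_abs_bound)
    also have "\<dots> \<le> (\<integral>x. \<bar>f n x - g x\<bar> * M \<partial>lborel)"
    proof (rule integral_mono)
      show "integrable lborel (\<lambda>x. \<bar>(f n x - g x) * b x\<bar>)" by (rule integrable_abs[OF intb[OF id]])
    qed (use M id in \<open>auto simp: abs_mult intro!: mult_left_mono\<close>)
    also have "\<dots> = (\<integral>x. \<bar>f n x - g x\<bar> \<partial>lborel) * M" by simp
    also have "(\<integral>x. \<bar>f n x - g x\<bar> \<partial>lborel) \<le> W powr (1 - 1 / p) * a n powr (1 / p)"
    proof -
      have "pint 1 (\<lambda>x. f n x - g x) \<le> ennreal (W powr (1 - 1 / p) * a n powr (1 / p))"
        by (rule pint_1_le[where K=K]) (use p supp K W a id in auto)
      moreover have "pint 1 (\<lambda>x. f n x - g x) = ennreal (\<integral>x. \<bar>f n x - g x\<bar> \<partial>lborel)"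
        using id by (simp add: pint_def nn_integral_eq_integral)
      ultimately show ?thesis by simp
    qed
    finally show ?thesis using M0 by (simp add: mult_right_mono)
  qed
  moreover have "(\<lambda>n. W powr (1 - 1 / p) * a n powr (1 / p) * M) \<longlonglongrightarrow> W powr (1 - 1 / p) * 0 * M"
    using p a0 a by (intro tendsto_intros tendsto_zero_powrI[where b="1 / p"]) auto
  ultimately have "(\<lambda>n. (\<integral>x. f n x * b x \<partial>lborel) - (\<integral>x. g x * b x \<partial>lborel)) \<longlonglongrightarrow> 0"
    by (intro Lim_null_comparison[where f="\<lambda>n. (\<integral>x. f n x * b x \<partial>lborel) - (\<integral>x. g x * b x \<partial>lborel)"
          and g="\<lambda>n. W powr (1 - 1 / p) * a n powr (1 / p) * M"]) auto
  then show ?thesis by (simp add: LIM_zero_iff)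
qed

lemma restr_id: "(\<And>x. x \<notin> K \<Longrightarrow> g x = 0) \<Longrightarrow> restr K g = g"
  by (rule ext) (metis restr_in restr_out)

lemma in_Lp_loc_integrable:
  fixes v :: "'a::euclidean_space \<Rightarrow> 'b::euclidean_space"
  assumes "integrable lborel v" shows "in_Lp_loc 1 K v"
  unfolding in_Lp_loc_def
proof (intro allI impI)
  fix S assume S: "compact S \<and> S \<subseteq> K"
  have [measurable]: "v \<in> borel_measurable borel" "S \<in> sets borel" using assms S by (auto intro: borel_compact)
  have "pint 1 (restr S v) \<le> pint 1 v"
  proof (rule pint_mono)
    show "norm (restr S v x) \<le> norm (v x)" for x by (cases "x \<in> S") auto
  qed simp
  also have "\<dots> < \<infinity>" using assms by (simp add: pint_def integrable_iff_bounded)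
  finally have "in_Lp (ereal 1) S v" by (simp add: in_Lp_iff restr_measurable)
  then show "in_Lp 1 S v" by (simp add: one_ereal_def)
qed

lemma weak_gradient_measurable:
  assumes "has_weak_gradient (ball x0 R) u G"
  shows "restr (ball x0 R) G \<in> borel_measurable borel"
proof (rule borel_measurable_LIMSEQ_metric)
  fix n :: nat
  have "in_Lp (ereal 1) (cball x0 (R - 1 / real (Suc n))) G"
  proof -
    have "0 < 1 / real (Suc n)" by simp
    then have "cball x0 (R - 1 / real (Suc n)) \<subseteq> ball x0 R"
      unfolding cball_subset_ball_iff by auto
    then show ?thesis
      using assms unfolding has_weak_gradient_def in_Lp_loc_def by (auto simp: one_ereal_def)
  qed
  then show "restr (cball x0 (R - 1 / real (Suc n))) G \<in> borel_measurable borel"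
    by (simp add: in_Lp_iff)
next
  fix x
  show "(\<lambda>n. restr (cball x0 (R - 1 / real (Suc n))) G x) \<longlonglongrightarrow> restr (ball x0 R) G x"
  proof (rule tendsto_eventually)
    show "\<forall>\<^sub>F n in sequentially. restr (cball x0 (R - 1 / real (Suc n))) G x = restr (ball x0 R) G x"
    proof (cases "x \<in> ball x0 R")
      case True
      then have "0 < R - dist x0 x" by simp
      then obtain m where m: "inverse (real (Suc m)) < R - dist x0 x" using reals_Archimedean by blast
      show ?thesis
        using eventually_ge_at_top[of m]
      proof eventually_elim
        case (elim n)
        then have "inverse (real (Suc n)) \<le> inverse (real (Suc m))" by (intro le_imp_inverse_le) auto
        then have "x \<in> cball x0 (R - 1 / real (Suc n))" using m by (simp add: inverse_eq_divide)
        then show ?case using True by simp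
      qed
    next
      case False
      have "x \<notin> cball x0 (R - 1 / real (Suc n))" for n
      proof -
        have "0 < 1 / real (Suc n)" by simp
        then show ?thesis using False unfolding mem_cball mem_ball by linarith
      qed
      then show ?thesis using False by simp
    qed
  qed
qed

text \<open>Integration by parts passes to the limit. The \<open>W\<^sup>1\<^sup>,\<^sup>p\<close> norm refers to a chosen weak gradient of
  the difference; by uniqueness it can be computed with \<open>V\<close>.\<close>

lemma W0_limit_has_weak_gradient:
  fixes v :: "'a::euclidean_space \<Rightarrow> real"
  assumes lim: "W0_limit (ball x0 R) p v V" and p: "1 \<le> p"
    and fin: "pint p v < \<infinity>" "pint p V < \<infinity>"
    and supp: "\<And>x. x \<notin> ball x0 R \<Longrightarrow> v x = 0" "\<And>x. x \<notin> ball x0 R \<Longrightarrow> V x = 0"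
  shows "has_weak_gradient (ball x0 R) v V" "in_W1p_0 p (ball x0 R) v"
proof -
  let ?K = "ball x0 R"
  have vm[measurable]: "v \<in> borel_measurable borel" "V \<in> borel_measurable borel"
    using lim by (auto simp: W0_limit_def)
  obtain \<psi> where \<psi>: "\<And>n. test_function ?K (\<psi> n)" "(\<lambda>n. pint p (\<lambda>x. \<psi> n x - v x)) \<longlonglongrightarrow> 0"
    "(\<lambda>n. pint p (\<lambda>x. grad (\<psi> n) x - V x)) \<longlonglongrightarrow> 0"
    using lim unfolding W0_limit_def by blast
  have far: "x \<notin> ?K" if "norm x0 + R \<le> norm x" for x
    using norm_dist_bound[OF that] by auto
  have iv: "integrable lborel v" "integrable lborel V"
    using integrable_of_pint[OF vm(1) p fin(1) supp(1)[OF far]]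
      integrable_of_pint[OF vm(2) p fin(2) supp(2)[OF far]] by auto
  note C1 = test_function_C1[OF \<psi>(1)]
  note \<psi>m[measurable] = C1_gradient_measurable[OF C1]
  have \<psi>0: "\<psi> n x = 0" "grad (\<psi> n) x = 0" if "x \<notin> ?K" for n x
  proof -
    obtain S where S: "compact S" "S \<subseteq> ?K" "\<And>x. x \<notin> S \<Longrightarrow> \<psi> n x = 0"
      using test_function_compact[OF \<psi>(1)] by blast
    show "\<psi> n x = 0" using S that by blast
    show "grad (\<psi> n) x = 0"
      by (rule gradient_zero_outside_support[OF C1 S(3) compact_imp_closed[OF S(1)]]) (use S that in auto)
  qed
  have \<psi>i: "integrable lborel (\<psi> n)" "integrable lborel (grad (\<psi> n))" and
    \<psi>f: "pint p (\<psi> n) < \<infinity>" "pint p (grad (\<psi> n)) < \<infinity>" for n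
  proof -
    have s: "x \<notin> cball x0 R \<Longrightarrow> \<psi> n x = 0" "x \<notin> cball x0 R \<Longrightarrow> grad (\<psi> n) x = 0" for x
      using \<psi>0[of x n] by auto
    show "integrable lborel (\<psi> n)" "integrable lborel (grad (\<psi> n))"
      using integrable_continuous_compact_support[OF C1_gradient_cont_fun[OF C1] s(1) compact_cball]
        integrable_continuous_compact_support[OF C1_gradient_cont[OF C1] s(2) compact_cball] by auto
    show "pint p (\<psi> n) < \<infinity>" "pint p (grad (\<psi> n)) < \<infinity>"
      using C1_compact_support_pint[OF C1_gradient_cont_fun[OF C1] s(1) compact_cball, where p=p]
        C1_compact_support_pint[OF C1_gradient_cont[OF C1] s(2) compact_cball, where p=p] p by auto
  qed
  have dfin: "pint p (\<lambda>x. \<psi> n x - v x) < \<infinity>" "pint p (\<lambda>x. grad (\<psi> n) x - V x) < \<infinity>" for n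
  proof -
    have "pint p (\<lambda>x. \<psi> n x + - v x) \<le> ennreal (2 powr p) * (pint p (\<psi> n) + pint p (\<lambda>x. - v x))"
      by (rule pint_add) (use p in auto)
    then show "pint p (\<lambda>x. \<psi> n x - v x) < \<infinity>"
      using \<psi>f(1)[of n] fin(1) by (simp add: pint_minus ennreal_mult_less_top le_less_trans)
    have "pint p (\<lambda>x. grad (\<psi> n) x + - V x) \<le> ennreal (2 powr p) * (pint p (grad (\<psi> n)) + pint p (\<lambda>x. - V x))"
      by (rule pint_add) (use p in auto)
    then show "pint p (\<lambda>x. grad (\<psi> n) x - V x) < \<infinity>"
      using \<psi>f(2)[of n] fin(2) by (simp add: pint_minus ennreal_mult_less_top le_less_trans)
  qed
  have Kfin: "emeasure lborel ?K < \<infinity>" by (rule emeasure_lborel_ball_finite)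
  have indv: "indicator ?K x *\<^sub>R (v x * c) = v x * c" "indicator ?K x *\<^sub>R ((V x \<bullet> i) * c) = (V x \<bullet> i) * c"
    "indicator ?K x *\<^sub>R (\<psi> n x * c) = \<psi> n x * c" "indicator ?K x *\<^sub>R ((grad (\<psi> n) x \<bullet> i) * c) = (grad (\<psi> n) x \<bullet> i) * c"
    for x c i n using supp[of x] \<psi>0[of x n] by (cases "x \<in> ?K"; simp)+
  have bounds: "\<exists>M. (\<forall>x. \<bar>\<phi> x\<bar> \<le> M) \<and> (\<forall>x. \<bar>grad \<phi> x \<bullet> i\<bar> \<le> M)" if \<phi>: "test_function ?K \<phi>" and i: "i \<in> Basis" for \<phi> i
  proof -
    obtain S where S: "compact S" "S \<subseteq> ?K" "\<And>x. x \<notin> S \<Longrightarrow> \<phi> x = 0"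
      using test_function_compact[OF \<phi>] by blast
    note d = test_function_C1[OF \<phi>]
    obtain M1 where M1: "\<And>x. norm (\<phi> x) \<le> M1"
      using continuous_compact_support_bounded[OF C1_gradient_cont_fun[OF d] S(3,1)] by blast
    obtain M2 where M2: "\<And>x. norm (grad \<phi> x) \<le> M2"
      using continuous_compact_support_bounded[OF C1_gradient_cont[OF d]
          gradient_zero_outside_support[OF d S(3) compact_imp_closed[OF S(1)]] S(1)] by blast
    have "\<bar>grad \<phi> x \<bullet> i\<bar> \<le> M2" for x
      using Basis_le_norm[OF i, of "grad \<phi> x"] M2[of x] by linarith
    then show ?thesis using M1 by (intro exI[of _ "max M1 M2"]) (auto simp: le_max_iff_disj)
  qed
  have \<psi>ibp: "(\<integral>x. \<psi> n x * (grad \<phi> x \<bullet> i) \<partial>lborel) = - (\<integral>x. (grad (\<psi> n) x \<bullet> i) * \<phi> x \<partial>lborel)"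
    if \<phi>: "test_function ?K \<phi>" and i: "i \<in> Basis" for \<phi> i n
  proof -
    have "(LINT x:?K|lborel. \<psi> n x * frechet_derivative \<phi> (at x) i)
        = - (LINT x:?K|lborel. (grad (\<psi> n) x \<bullet> i) * \<phi> x)"
      using C1_has_weak_gradient[OF C1, of ?K n] \<phi> i unfolding has_weak_gradient_def by blast
    then show ?thesis
      unfolding set_lebesgue_integral_def frechet_derivative_C1[OF test_function_C1[OF \<phi>]] indv .
  qed
  have ibp: "(\<integral>x. v x * (grad \<phi> x \<bullet> i) \<partial>lborel) = - (\<integral>x. (V x \<bullet> i) * \<phi> x \<partial>lborel)"
    if \<phi>: "test_function ?K \<phi>" and i: "i \<in> Basis" for \<phi> i
  proof -
    obtain M where M: "\<And>x. \<bar>\<phi> x\<bar> \<le> M" "\<And>x. \<bar>grad \<phi> x \<bullet> i\<bar> \<le> M" using bounds[OF \<phi> i] by blast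
    note d = test_function_C1[OF \<phi>]
    have dm[measurable]: "\<phi> \<in> borel_measurable borel" "grad \<phi> \<in> borel_measurable borel"
      using C1_gradient_measurable[OF d] .
    have "(\<lambda>n. \<integral>x. \<psi> n x * (grad \<phi> x \<bullet> i) \<partial>lborel) \<longlonglongrightarrow> (\<integral>x. v x * (grad \<phi> x \<bullet> i) \<partial>lborel)"
      by (rule integral_mult_bounded_tendsto[where K="?K" and M=M])
        (use \<psi>i iv p \<psi>0 supp Kfin M \<psi>(2) dfin in auto)
    moreover have "(\<lambda>n. \<integral>x. (grad (\<psi> n) x \<bullet> i) * \<phi> x \<partial>lborel) \<longlonglongrightarrow> (\<integral>x. (V x \<bullet> i) * \<phi> x \<partial>lborel)"
    proof (rule integral_mult_bounded_tendsto[where K="?K" and M=M])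
      have c: "norm ((grad (\<psi> n) x \<bullet> i) - (V x \<bullet> i)) \<le> norm (grad (\<psi> n) x - V x)" for n x
        using Basis_le_norm[OF i, of "grad (\<psi> n) x - V x"] by (simp add: inner_diff_left)
      show "(\<lambda>n. pint p (\<lambda>x. (grad (\<psi> n) x \<bullet> i) - (V x \<bullet> i))) \<longlonglongrightarrow> 0"
        by (rule pint_tendsto_mono[OF \<psi>(3) c]) (use p in simp)
      show "pint p (\<lambda>x. (grad (\<psi> n) x \<bullet> i) - (V x \<bullet> i)) < \<infinity>" for n
        using pint_mono[of "\<lambda>x. (grad (\<psi> n) x \<bullet> i) - (V x \<bullet> i)" "\<lambda>x. grad (\<psi> n) x - V x" p, OF c] dfin(2)[of n] p
        by (simp add: le_less_trans)
    qed (use \<psi>i iv p \<psi>0 supp Kfin M in auto)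
    moreover note \<psi>ibp[OF \<phi> i]
    ultimately have "(\<lambda>n. - (\<integral>x. (grad (\<psi> n) x \<bullet> i) * \<phi> x \<partial>lborel)) \<longlonglongrightarrow> (\<integral>x. v x * (grad \<phi> x \<bullet> i) \<partial>lborel)"
      and "(\<lambda>n. - (\<integral>x. (grad (\<psi> n) x \<bullet> i) * \<phi> x \<partial>lborel)) \<longlonglongrightarrow> - (\<integral>x. (V x \<bullet> i) * \<phi> x \<partial>lborel)"
      by (simp_all add: tendsto_minus)
    then show ?thesis by (rule LIMSEQ_unique)
  qed
  show wg: "has_weak_gradient ?K v V"
    unfolding has_weak_gradient_def
  proof (intro conjI allI impI ballI in_Lp_loc_integrable iv)
    fix \<phi> and i :: 'a assume \<phi>: "test_function ?K \<phi>" and i: "i \<in> Basis"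
    show "(LINT x:?K|lborel. v x * frechet_derivative \<phi> (at x) i) = - (LINT x:?K|lborel. (V x \<bullet> i) * \<phi> x)"
      unfolding set_lebesgue_integral_def frechet_derivative_C1[OF test_function_C1[OF \<phi>]] indv
      by (rule ibp[OF \<phi> i])
  qed
  have wgd: "has_weak_gradient ?K (\<lambda>x. \<psi> n x - v x) (\<lambda>x. grad (\<psi> n) x - V x)" for n
    unfolding has_weak_gradient_def
  proof (intro conjI allI impI ballI in_Lp_loc_integrable)
    show "integrable lborel (\<lambda>x. \<psi> n x - v x)" "integrable lborel (\<lambda>x. grad (\<psi> n) x - V x)"
      using \<psi>i iv by auto
    fix \<phi> and i :: 'a assume \<phi>: "test_function ?K \<phi>" and i: "i \<in> Basis"
    obtain M where M: "\<And>x. \<bar>\<phi> x\<bar> \<le> M" "\<And>x. \<bar>grad \<phi> x \<bullet> i\<bar> \<le> M" using bounds[OF \<phi> i] by blast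
    note d = test_function_C1[OF \<phi>]
    have dm[measurable]: "\<phi> \<in> borel_measurable borel" "grad \<phi> \<in> borel_measurable borel"
      using C1_gradient_measurable[OF d] .
    have intb: "integrable lborel (\<lambda>x. h x * b x)"
      if "integrable lborel h" "b \<in> borel_measurable borel" "\<And>x. \<bar>b x\<bar> \<le> M" for h b :: "'a \<Rightarrow> real"
    proof (rule Bochner_Integration.integrable_bound)
      show "integrable lborel (\<lambda>x. M * h x)" using that by simp
      show "AE x in lborel. norm (h x * b x) \<le> norm (M * h x)"
        using that(3) order_trans[OF abs_ge_zero that(3)]
        by (auto simp: abs_mult mult.commute[of _ "\<bar>b _\<bar>"] intro!: mult_right_mono)
    qed (use that in measurable)
    have ii: "integrable lborel (\<lambda>x. \<psi> n x * (grad \<phi> x \<bullet> i))" "integrable lborel (\<lambda>x. v x * (grad \<phi> x \<bullet> i))"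
      "integrable lborel (\<lambda>x. (grad (\<psi> n) x \<bullet> i) * \<phi> x)" "integrable lborel (\<lambda>x. (V x \<bullet> i) * \<phi> x)"
      using \<psi>i[of n] iv M by (auto intro!: intb)
    have "indicator ?K x *\<^sub>R ((\<psi> n x - v x) * c) = \<psi> n x * c - v x * c"
      "indicator ?K x *\<^sub>R ((grad (\<psi> n) x - V x) \<bullet> i * c) = (grad (\<psi> n) x \<bullet> i) * c - (V x \<bullet> i) * c" for x c
      using supp[of x] \<psi>0[of x n] by (cases "x \<in> ?K"; simp add: algebra_simps inner_diff_left)+
    then show "(LINT x:?K|lborel. (\<psi> n x - v x) * frechet_derivative \<phi> (at x) i)
        = - (LINT x:?K|lborel. ((grad (\<psi> n) x - V x) \<bullet> i) * \<phi> x)"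
      unfolding set_lebesgue_integral_def frechet_derivative_C1[OF d]
      using \<psi>ibp[OF \<phi> i] ibp[OF \<phi> i] ii by simp
  qed
  have norm_eq: "W1p_norm p ?K (\<lambda>x. \<psi> n x - v x)
      = enn2real (pint p (\<lambda>x. \<psi> n x - v x)) powr (1 / p) + enn2real (pint p (\<lambda>x. grad (\<psi> n) x - V x)) powr (1 / p)" for n
  proof -
    let ?w = "\<lambda>x. \<psi> n x - v x" and ?W = "\<lambda>x. grad (\<psi> n) x - V x"
    have r: "restr ?K ?w = ?w" by (rule restr_id) (use \<psi>0 supp in auto)
    have hw: "has_weak_gradient ?K ?w (weak_gradient ?K ?w)"
      unfolding weak_gradient_def by (rule someI[of "has_weak_gradient ?K ?w", OF wgd])
    have "pint p (restr ?K (weak_gradient ?K ?w)) = pint p ?W"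
    proof (rule pint_cong_AE)
      show "AE x in lborel. restr ?K (weak_gradient ?K ?w) x = ?W x"
        using weak_gradient_AE[OF wgd[of n]]
      proof eventually_elim
        case (elim x)
        then show ?case using \<psi>0(2)[of x n] supp(2)[of x] by (cases "x \<in> ?K") auto
      qed
    qed
    then show ?thesis
      unfolding W1p_norm_def
      by (subst (1 2) Lp_norm_eq) (auto simp: r weak_gradient_measurable[OF hw])
  qed
  have "(\<lambda>n. W1p_norm p ?K (\<lambda>x. \<psi> n x - v x)) \<longlonglongrightarrow> 0"
  proof -
    have "(\<lambda>n. enn2real (a n) powr (1 / p)) \<longlonglongrightarrow> 0" if "a \<longlonglongrightarrow> 0" for a :: "nat \<Rightarrow> ennreal"
    proof -
      have "(\<lambda>n. enn2real (a n)) \<longlonglongrightarrow> 0" by (rule tendsto_enn2real) (use that in auto)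
      then show ?thesis using p by (intro tendsto_zero_powrI[where b="1 / p"]) auto
    qed
    from tendsto_add[OF this[OF \<psi>(2)] this[OF \<psi>(3)]] show ?thesis unfolding norm_eq by simp
  qed
  moreover have "in_W1p p ?K v"
    unfolding in_W1p_def in_Lp_iff
  proof -
    have "restr ?K v = v" "restr ?K V = V" by (rule restr_id; use supp in simp)+
    then show "(restr ?K v \<in> borel_measurable borel \<and> pint p (restr ?K v) < \<infinity>) \<and>
        (\<exists>G. has_weak_gradient ?K v G \<and> restr ?K G \<in> borel_measurable borel \<and> pint p (restr ?K G) < \<infinity>)"
      using wg fin vm by metis
  qed
  ultimately show "in_W1p_0 p ?K v"
    unfolding in_W1p_0_def using \<psi>(1) by blast
qed

section \<open>Riesz potentials and the Sobolev inequality\<close>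

text \<open>The function vanishes far out on the ray, so its value is minus the integral of its
  derivative along the ray.\<close>

lemma line_integral_bound:
  fixes \<phi> :: "'a::euclidean_space \<Rightarrow> real"
  assumes \<phi>: "C1_gradient \<phi> \<Phi>" and supp: "\<And>x. r \<le> norm x \<Longrightarrow> \<phi> x = 0" and z: "1 \<le> norm z"
  shows "ennreal \<bar>\<phi> x\<bar> \<le> (\<integral>\<^sup>+t. indicator {0<..} t * ennreal (norm (\<Phi> (x + t *\<^sub>R z)) * norm z) \<partial>lborel)"
proof -
  have [measurable]: "\<Phi> \<in> borel_measurable borel" using C1_gradient_measurable[OF \<phi>] by simp
  define T where "T = max 0 r + norm x"
  have T: "0 \<le> T" by (simp add: T_def)
  have "T \<le> norm (T *\<^sub>R z)" using z T mult_left_mono[of 1 "norm z" T] by simp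
  also have "norm (T *\<^sub>R z) \<le> norm (x + T *\<^sub>R z) + norm x"
    using norm_triangle_ineq4[of "x + T *\<^sub>R z" x] by simp
  finally have "\<phi> (x + T *\<^sub>R z) = 0" by (intro supp) (simp add: T_def)
  define f where "f t = \<Phi> (x + t *\<^sub>R z) \<bullet> z" for t
  have f: "((\<lambda>t. \<phi> (x + t *\<^sub>R z)) has_vector_derivative f t) (at t within {0..T})" for t
  proof -
    have "((\<lambda>t. \<phi> (x + t *\<^sub>R z)) has_derivative (\<lambda>h. \<Phi> (x + t *\<^sub>R z) \<bullet> (h *\<^sub>R z))) (at t)"
      by (rule has_derivative_compose[where g=\<phi> and f="\<lambda>t. x + t *\<^sub>R z"])
        (auto intro!: derivative_eq_intros C1_gradient_deriv[OF \<phi>])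
    then show ?thesis
      unfolding has_vector_derivative_def f_def
      by (auto intro: has_derivative_at_withinI simp: mult.commute)
  qed
  have fc: "continuous_on UNIV f"
    unfolding f_def
    by (intro continuous_on_inner continuous_on_const continuous_on_compose2[OF C1_gradient_cont[OF \<phi>]]
        continuous_on_add continuous_on_scaleR continuous_on_id) auto
  have eq: "(\<integral>t. indicator {0..T} t *\<^sub>R f t \<partial>lborel) = - \<phi> x"
    using integral_FTC_atLeastAtMost[OF T f continuous_on_subset[OF fc subset_UNIV]]
      \<open>\<phi> (x + T *\<^sub>R z) = 0\<close> by simp
  have [measurable]: "f \<in> borel_measurable borel" by (rule borel_measurable_continuous_onI[OF fc])
  have int: "integrable lborel (\<lambda>t. indicator {0..T} t *\<^sub>R f t)"
    using borel_integrable_atLeastAtMost'[of 0 T f] continuous_on_subset[OF fc, of "{0..T}"]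
    by (simp add: set_integrable_def)
  have "ennreal \<bar>\<phi> x\<bar> \<le> (\<integral>\<^sup>+t. ennreal (norm (indicator {0..T} t *\<^sub>R f t)) \<partial>lborel)"
    using integral_norm_bound_ennreal[OF int] unfolding eq by simp
  also have "\<dots> \<le> (\<integral>\<^sup>+t. indicator {0<..} t * ennreal (norm (\<Phi> (x + t *\<^sub>R z)) * norm z) \<partial>lborel)"
  proof (rule nn_integral_mono_AE)
    show "AE t in lborel. ennreal (norm (indicator {0..T} t *\<^sub>R f t))
        \<le> indicator {0<..} t * ennreal (norm (\<Phi> (x + t *\<^sub>R z)) * norm z)"
      using AE_lborel_singleton[of "0::real"]
    proof eventually_elim
      case (elim t)
      have "\<bar>f t\<bar> \<le> norm (\<Phi> (x + t *\<^sub>R z)) * norm z"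
        unfolding f_def by (rule Cauchy_Schwarz_ineq2)
      then show ?case using elim by (auto simp: indicator_def ennreal_leI)
    qed
  qed
  finally show ?thesis .
qed

text \<open>Integrate the fundamental theorem of calculus along all rays \<open>x + t z\<close> with \<open>z\<close> in an
  annulus, substitute \<open>w = t z\<close> and integrate in \<open>t\<close> first. Averaging over an annulus
  instead of the sphere avoids polar coordinates.\<close>

lemma Riesz_potential_bound:
  obtains c where "0 < c"
    "\<And>(\<phi> :: 'a::euclidean_space \<Rightarrow> real) \<Phi> r x. C1_gradient \<phi> \<Phi> \<Longrightarrow> (\<And>x. r \<le> norm x \<Longrightarrow> \<phi> x = 0) \<Longrightarrow>
      ennreal \<bar>\<phi> x\<bar> \<le> ennreal c * (\<integral>\<^sup>+w. ennreal (norm (\<Phi> (x + w)) * norm w powr (1 - real DIM('a))) \<partial>lborel)"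
proof -
  define N where "N = DIM('a)"
  define A where "A = {z::'a. 1 < norm z \<and> norm z < 2}"
  have oA: "open A"
    unfolding A_def by (intro open_Collect_conj open_Collect_less continuous_intros)
  then have [measurable]: "A \<in> sets borel" by simp
  have "emeasure lborel A \<le> emeasure lborel (ball (0::'a) 2)"
    by (rule emeasure_mono) (auto simp: A_def)
  also have "\<dots> < \<infinity>" by (rule emeasure_lborel_ball_finite)
  finally obtain a where a: "emeasure lborel A = ennreal a" "0 \<le> a" by (cases "emeasure lborel A") auto
  have "a \<noteq> 0"
  proof
    assume "a = 0"
    obtain b :: 'a where b: "b \<in> Basis" using nonempty_Basis by blast
    have "ball ((3/2) *\<^sub>R b) (1/2) \<subseteq> A"
    proof
      fix z assume z: "z \<in> ball ((3/2) *\<^sub>R b) (1/2)"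
      then have "norm ((3/2) *\<^sub>R b - z) < 1/2" by (simp add: dist_norm)
      moreover have "norm ((3/2) *\<^sub>R b) = 3/2" using b by simp
      ultimately show "z \<in> A"
        using norm_triangle_sub[of "(3/2) *\<^sub>R b" z] norm_triangle_sub[of z "(3/2) *\<^sub>R b"]
        by (simp add: A_def norm_minus_commute)
    qed
    then have "emeasure lborel (ball ((3/2) *\<^sub>R b) (1/2)) \<le> emeasure lborel A"
      by (rule emeasure_mono) simp
    then have "emeasure lborel (ball ((3/2) *\<^sub>R b) (1/2)) = 0" using a \<open>a = 0\<close> by simp
    then show False
      using content_ball_pos[of "1/2" "(3/2) *\<^sub>R b"] by (simp add: measure_def)
  qed
  then have apos: "0 < a" using a by simp
  define c where "c = 2 ^ N / a"
  have "ennreal \<bar>\<phi> x\<bar> \<le> ennreal c * (\<integral>\<^sup>+w. ennreal (norm (\<Phi> (x + w)) * norm w powr (1 - real DIM('a))) \<partial>lborel)"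
    if \<phi>: "C1_gradient \<phi> \<Phi>" and supp: "\<And>x. r \<le> norm x \<Longrightarrow> \<phi> x = 0" for \<phi> :: "'a \<Rightarrow> real" and \<Phi> r x
  proof -
    have [measurable]: "\<Phi> \<in> borel_measurable borel" using C1_gradient_measurable[OF \<phi>] by simp
    let ?g = "\<lambda>t z. indicator {0<..} t * ennreal (norm (\<Phi> (x + t *\<^sub>R z)) * norm z) * indicator A z"
    let ?h = "\<lambda>t w. indicator {0<..} t * (ennreal ((1 / t) ^ N) * (ennreal (norm (\<Phi> (x + w)) * (norm w / t)) * indicator A ((1 / t) *\<^sub>R w)))"
    have "ennreal \<bar>\<phi> x\<bar> * ennreal a = (\<integral>\<^sup>+z. ennreal \<bar>\<phi> x\<bar> * indicator A z \<partial>lborel)"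
      using a by (simp add: nn_integral_cmult_indicator)
    also have "\<dots> \<le> (\<integral>\<^sup>+z. (\<integral>\<^sup>+t. ?g t z \<partial>lborel) \<partial>lborel)"
    proof (rule nn_integral_mono)
      fix z :: 'a
      show "ennreal \<bar>\<phi> x\<bar> * indicator A z \<le> (\<integral>\<^sup>+t. ?g t z \<partial>lborel)"
      proof (cases "z \<in> A")
        case True
        then show ?thesis using line_integral_bound[OF \<phi> supp, where z=z and x=x] by (simp add: A_def)
      qed simp
    qed
    also have "\<dots> = (\<integral>\<^sup>+t. (\<integral>\<^sup>+z. ?g t z \<partial>lborel) \<partial>lborel)"
      by (rule lborel_pair.Fubini') measurable
    also have "\<dots> = (\<integral>\<^sup>+t. (\<integral>\<^sup>+w. ?h t w \<partial>lborel) \<partial>lborel)"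
    proof (rule nn_integral_cong)
      fix t :: real
      show "(\<integral>\<^sup>+z. ?g t z \<partial>lborel) = (\<integral>\<^sup>+w. ?h t w \<partial>lborel)"
      proof (cases "0 < t")
        case True
        have "(\<integral>\<^sup>+z. ?g t z \<partial>lborel) = ennreal (\<bar>1 / t\<bar> ^ DIM('a)) * (\<integral>\<^sup>+w. ?g t (0 + (1 / t) *\<^sub>R w) \<partial>lborel)"
          by (rule nn_integral_lborel_affine) (use True in auto)
        also have "\<dots> = (\<integral>\<^sup>+w. ennreal ((1 / t) ^ N) * ?g t (0 + (1 / t) *\<^sub>R w) \<partial>lborel)"
          using True by (subst nn_integral_cmult) (auto simp: N_def)
        also have "\<dots> = (\<integral>\<^sup>+w. ?h t w \<partial>lborel)"
          using True by (intro nn_integral_cong) (simp add: mult_ac)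
        finally show ?thesis .
      qed simp
    qed
    also have "\<dots> = (\<integral>\<^sup>+w. (\<integral>\<^sup>+t. ?h t w \<partial>lborel) \<partial>lborel)"
      by (rule lborel_pair.Fubini') measurable
    also have "\<dots> \<le> (\<integral>\<^sup>+w. ennreal (2 ^ N) * ennreal (norm (\<Phi> (x + w)) * norm w powr (1 - real N)) \<partial>lborel)"
    proof (rule nn_integral_mono)
      fix w :: 'a
      show "(\<integral>\<^sup>+t. ?h t w \<partial>lborel) \<le> ennreal (2 ^ N) * ennreal (norm (\<Phi> (x + w)) * norm w powr (1 - real N))"
      proof (cases "w = 0")
        case True
        then show ?thesis by simp
      next
        case False
        then have w: "0 < norm w" by simp
        have "(\<integral>\<^sup>+t. ?h t w \<partial>lborel)
            \<le> (\<integral>\<^sup>+t. ennreal (2 * (2 / norm w) ^ N * norm (\<Phi> (x + w))) * indicator {norm w / 2..norm w} t \<partial>lborel)"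
        proof (rule nn_integral_mono)
          fix t :: real
          show "?h t w \<le> ennreal (2 * (2 / norm w) ^ N * norm (\<Phi> (x + w))) * indicator {norm w / 2..norm w} t"
          proof (cases "0 < t \<and> (1 / t) *\<^sub>R w \<in> A")
            case True
            then have t: "0 < t" "t < norm w" "norm w < 2 * t"
              by (auto simp: A_def field_simps)
            have "(1 / t) ^ N \<le> (2 / norm w) ^ N"
              using t w by (intro power_mono) (auto simp: field_simps)
            moreover have "norm w / t \<le> 2" using t by (simp add: field_simps)
            ultimately have "(1 / t) ^ N * (norm (\<Phi> (x + w)) * (norm w / t))
                \<le> (2 / norm w) ^ N * (norm (\<Phi> (x + w)) * 2)"
              using t w by (intro mult_mono) auto
            then have "?h t w \<le> ennreal ((2 / norm w) ^ N * (norm (\<Phi> (x + w)) * 2))"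
              using True t by (simp add: ennreal_leI flip: ennreal_mult)
            then show ?thesis using t by (simp add: mult_ac)
          next
            case False
            then have zero: "?h t w = 0" by (auto simp: indicator_def)
            show ?thesis unfolding zero by simp
          qed
        qed
        also have "\<dots> = ennreal (2 * (2 / norm w) ^ N * norm (\<Phi> (x + w))) * ennreal (norm w / 2)"
          using w by (simp add: nn_integral_cmult_indicator)
        also have "\<dots> = ennreal (2 ^ N * (norm (\<Phi> (x + w)) * norm w powr (1 - real N)))"
        proof -
          have "norm w powr (1 - real N) = norm w / norm w ^ N"
            using w by (simp add: powr_diff powr_realpow)
          then show ?thesis using w by (simp add: power_divide field_simps flip: ennreal_mult)
        qed
        finally show ?thesis by (simp add: ennreal_mult)
      qed
    qed
    also have "\<dots> = ennreal (2 ^ N) * (\<integral>\<^sup>+w. ennreal (norm (\<Phi> (x + w)) * norm w powr (1 - real N)) \<partial>lborel)"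
      by (rule nn_integral_cmult) measurable
    finally have "ennreal (1 / a) * (ennreal \<bar>\<phi> x\<bar> * ennreal a)
        \<le> ennreal (1 / a) * (ennreal (2 ^ N) * (\<integral>\<^sup>+w. ennreal (norm (\<Phi> (x + w)) * norm w powr (1 - real N)) \<partial>lborel))"
      by (rule mult_left_mono) simp
    moreover have "ennreal (1 / a) * (ennreal \<bar>\<phi> x\<bar> * ennreal a) = ennreal \<bar>\<phi> x\<bar>"
      using apos by (simp flip: ennreal_mult)
    moreover have "ennreal (1 / a) * ennreal (2 ^ N) = ennreal c"
      using apos by (simp add: c_def flip: ennreal_mult)
    ultimately show ?thesis by (simp add: N_def mult.assoc[symmetric])
  qed
  moreover have "0 < c" using apos by (simp add: c_def)
  ultimately show ?thesis using that by blast
qed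

text \<open>On dyadic shells the kernel is comparable to a constant; the resulting geometric series
  converges since the exponent \<open>a\<close> is positive.\<close>

lemma kernel_integral:
  assumes a: "0 < (a::real)"
  obtains C where "0 < C"
    "\<And>\<rho>. 0 < \<rho> \<Longrightarrow>
      (\<integral>\<^sup>+w. indicator (ball (0::'a::euclidean_space) \<rho>) w * ennreal (norm w powr (a - real DIM('a))) \<partial>lborel)
      \<le> ennreal (C * \<rho> powr a)"
proof -
  define N where "N = real DIM('a)"
  define V where "V = unit_ball_vol N"
  have V: "0 < V" by (simp add: V_def N_def)
  define c where "c = max 1 (2 powr (N - a))"
  define q where "q = (1/2) powr a"
  have q: "0 < q" "q < 1" using a powr_less_mono2[of a "1/2" 1] by (auto simp: q_def)
  define C where "C = c * V / (1 - q)"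
  have "0 < C" using V q by (simp add: C_def c_def)
  moreover have "(\<integral>\<^sup>+w. indicator (ball (0::'a) \<rho>) w * ennreal (norm w powr (a - N)) \<partial>lborel)
      \<le> ennreal (C * \<rho> powr a)"
    if \<rho>: "0 < \<rho>" for \<rho>
  proof -
    define d where "d j = \<rho> * (1/2) ^ j" for j :: nat
    have d: "0 < d j" for j using \<rho> by (simp add: d_def)
    define F where "F j w = ennreal (c * d j powr (a - N)) * indicator (ball (0::'a) (d j)) w" for j w
    have [measurable]: "F j \<in> borel_measurable borel" for j
      unfolding F_def[abs_def]
      by (rule borel_measurable_times_ennreal[OF borel_measurable_const borel_measurable_indicator]) simp
    have "(\<integral>\<^sup>+w. indicator (ball (0::'a) \<rho>) w * ennreal (norm w powr (a - N)) \<partial>lborel)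
        \<le> (\<integral>\<^sup>+w. (\<Sum>j. F j w) \<partial>lborel)"
    proof (rule nn_integral_mono)
      fix w :: 'a
      show "indicator (ball 0 \<rho>) w * ennreal (norm w powr (a - N)) \<le> (\<Sum>j. F j w)"
      proof (cases "w \<in> ball 0 \<rho> \<and> w \<noteq> 0")
        case True
        then have w: "0 < norm w" "norm w < \<rho>" by auto
        have "\<exists>j. d j \<le> norm w"
        proof -
          have "(\<lambda>j. \<rho> * (1/2) ^ j) \<longlonglongrightarrow> \<rho> * 0" by (intro tendsto_intros LIMSEQ_realpow_zero) auto
          then have "\<forall>\<^sub>F j in sequentially. \<rho> * (1/2) ^ j < norm w"
            by (rule order_tendstoD(2)) (use w in simp)
          then show ?thesis using eventually_happens'[OF sequentially_bot] unfolding d_def by (metis less_imp_le)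
        qed
        then obtain m where m: "d m \<le> norm w" "\<And>j. j < m \<Longrightarrow> \<not> d j \<le> norm w"
          using exists_least_iff[of "\<lambda>j. d j \<le> norm w"] by auto
        have "d 0 = \<rho>" by (simp add: d_def)
        then have "m \<noteq> 0" using m(1) w(2) by (metis not_le)
        then obtain j where j: "m = Suc j" by (cases m) auto
        have lo: "d j / 2 \<le> norm w" and hi: "norm w < d j"
          using m(1) m(2)[of j] by (auto simp: j d_def)
        have "norm w powr (a - N) \<le> c * d j powr (a - N)"
        proof (cases "a - N \<ge> 0")
          case True
          then have "norm w powr (a - N) \<le> 1 * d j powr (a - N)" using hi w by (simp add: powr_mono2)
          also have "\<dots> \<le> c * d j powr (a - N)" by (intro mult_right_mono) (auto simp: c_def)
          finally show ?thesis .
        next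
          case False
          then have "norm w powr (a - N) \<le> (d j / 2) powr (a - N)"
            using lo w d[of j] by (intro powr_mono2') auto
          also have "\<dots> = 2 powr (N - a) * d j powr (a - N)"
          proof -
            have "2 powr (N - a) = 1 / 2 powr (a - N)"
              using powr_minus_divide[of 2 "a - N"] by (simp only: minus_diff_eq)
            then show ?thesis by (simp only: powr_divide times_divide_eq_left times_divide_eq_right mult_1)
          qed
          also have "\<dots> \<le> c * d j powr (a - N)" by (intro mult_right_mono) (auto simp: c_def)
          finally show ?thesis .
        qed
        then have "indicator (ball 0 \<rho>) w * ennreal (norm w powr (a - N)) \<le> F j w"
          using hi True by (simp add: ennreal_leI F_def)
        also have "\<dots> = (\<Sum>i\<in>{j}. F i w)"
          by (subst sum.insert) (simp_all only: finite.emptyI sum.empty add_0_right empty_iff not_False_eq_True)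
        also have "\<dots> \<le> (\<Sum>i. F i w)" by (intro sum_le_suminf) auto
        finally show ?thesis .
      qed auto
    qed
    also have "\<dots> = (\<Sum>j. \<integral>\<^sup>+w. F j w \<partial>lborel)"
      by (rule nn_integral_suminf) measurable
    also have "\<dots> = (\<Sum>j. ennreal (c * V * \<rho> powr a * q ^ j))"
    proof (rule suminf_cong)
      fix j
      have "(\<integral>\<^sup>+w. F j w \<partial>lborel) = ennreal (c * d j powr (a - N)) * ennreal (V * d j ^ DIM('a))"
        using d[of j] by (simp add: nn_integral_cmult_indicator emeasure_ball V_def N_def F_def)
      also have "\<dots> = ennreal (c * V * (d j powr (a - N) * d j powr N))"
        using d[of j] V by (simp add: N_def c_def powr_realpow mult_ac flip: ennreal_mult)
      also have "d j powr (a - N) * d j powr N = d j powr a" by (simp flip: powr_add)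
      also have "\<dots> = \<rho> powr a * q ^ j"
      proof -
        have "((1/2) ^ j) powr a = ((1/2::real) powr a) ^ j" by (induction j) (auto simp: powr_mult powr_divide)
        then show ?thesis by (simp add: d_def powr_mult q_def)
      qed
      finally show "(\<integral>\<^sup>+w. F j w \<partial>lborel) = ennreal (c * V * \<rho> powr a * q ^ j)" by (simp add: mult_ac)
    qed
    also have "\<dots> = ennreal (c * V * \<rho> powr a * (1 / (1 - q)))"
    proof (rule suminf_ennreal_eq)
      show "(\<lambda>j. c * V * \<rho> powr a * q ^ j) sums (c * V * \<rho> powr a * (1 / (1 - q)))"
        using q by (intro sums_mult geometric_sums) auto
    qed (use V q in \<open>auto simp: c_def\<close>)
    also have "c * V * \<rho> powr a * (1 / (1 - q)) = C * \<rho> powr a" by (simp add: C_def)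
    finally show ?thesis .
  qed
  ultimately show ?thesis using that by (simp add: N_def)
qed

text \<open>Two points of a ball of radius \<open>R\<close> have distance less than \<open>2 * R\<close>, so functions that vanish
  outside the ball see only this part of the kernel.\<close>

definition riesz_kernel :: "real \<Rightarrow> 'a::euclidean_space \<Rightarrow> real"
  where "riesz_kernel R w = indicator (ball 0 (2 * R)) w * norm w powr (1 - real DIM('a))"

lemma ball_measurable [measurable]: "ball (x::'a::euclidean_space) r \<in> sets borel"
  by simp

lemma riesz_kernel_measurable [measurable]: "riesz_kernel R \<in> borel_measurable borel"
  unfolding riesz_kernel_def[abs_def] by measurable

lemma riesz_kernel_nonneg: "0 \<le> riesz_kernel R w"
  by (simp add: riesz_kernel_def)

lemma riesz_kernel_powr:
  "riesz_kernel R w powr s = indicator (ball (0::'a) (2 * R)) w * norm (w::'a::euclidean_space) powr ((1 - real DIM('a)) * s)"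
  by (cases "w \<in> ball 0 (2 * R)") (auto simp: riesz_kernel_def powr_powr)

lemma riesz_kernel_integral:
  assumes "0 < real DIM('a::euclidean_space) + (1 - real DIM('a)) * s"
  obtains C where "0 < C" "\<And>R. 0 < R \<Longrightarrow> (\<integral>\<^sup>+w. ennreal (riesz_kernel R (w::'a) powr s) \<partial>lborel)
      \<le> ennreal (C * (2 * R) powr (real DIM('a) + (1 - real DIM('a)) * s))"
proof -
  obtain C where C: "0 < C" "\<And>\<rho>. 0 < \<rho> \<Longrightarrow> (\<integral>\<^sup>+w. indicator (ball (0::'a) \<rho>) w *
      ennreal (norm w powr (real DIM('a) + (1 - real DIM('a)) * s - real DIM('a))) \<partial>lborel)
      \<le> ennreal (C * \<rho> powr (real DIM('a) + (1 - real DIM('a)) * s))"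
    using kernel_integral[OF assms, where 'a='a] by blast
  have "ennreal (riesz_kernel R (w::'a) powr s) = indicator (ball (0::'a) (2 * R)) w *
      ennreal (norm w powr (real DIM('a) + (1 - real DIM('a)) * s - real DIM('a)))" for R w
    by (cases "w \<in> ball 0 (2 * R)") (auto simp: riesz_kernel_powr)
  then show ?thesis using C that by simp
qed

lemma Riesz_potential_bound_ball:
  obtains c where "0 < c"
    "\<And>(\<phi> :: 'a::euclidean_space \<Rightarrow> real) \<Phi> x0 R x. C1_gradient \<phi> \<Phi> \<Longrightarrow> (\<And>x. x \<notin> ball x0 R \<Longrightarrow> \<phi> x = 0) \<Longrightarrow>
      x \<in> ball x0 R \<Longrightarrow> ennreal \<bar>\<phi> x\<bar> \<le> ennreal c * (\<integral>\<^sup>+w. ennreal (norm (\<Phi> (x + w)) * riesz_kernel R w) \<partial>lborel)"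
proof -
  obtain c where c: "0 < c" "\<And>(\<phi> :: 'a::euclidean_space \<Rightarrow> real) \<Phi> r x. C1_gradient \<phi> \<Phi> \<Longrightarrow> (\<And>x. r \<le> norm x \<Longrightarrow> \<phi> x = 0) \<Longrightarrow>
      ennreal \<bar>\<phi> x\<bar> \<le> ennreal c * (\<integral>\<^sup>+w. ennreal (norm (\<Phi> (x + w)) * norm w powr (1 - real DIM('a))) \<partial>lborel)"
    using Riesz_potential_bound[where 'a='a] by blast
  have "ennreal \<bar>\<phi> x\<bar> \<le> ennreal c * (\<integral>\<^sup>+w. ennreal (norm (\<Phi> (x + w)) * riesz_kernel R w) \<partial>lborel)"
    if \<phi>: "C1_gradient \<phi> \<Phi>" and supp: "\<And>x. x \<notin> ball x0 R \<Longrightarrow> \<phi> x = 0" and x: "x \<in> ball x0 R"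
    for \<phi> :: "'a \<Rightarrow> real" and \<Phi> x0 R x
  proof -
    have far: "\<phi> y = 0" if "norm x0 + R \<le> norm y" for y
      using norm_dist_bound[OF that] by (intro supp) auto
    have eq: "norm (\<Phi> (x + w)) * norm w powr (1 - real DIM('a)) = norm (\<Phi> (x + w)) * riesz_kernel R w" for w
    proof (cases "x + w \<in> cball x0 R")
      case True
      have "norm w \<le> norm (x0 - x) + norm (x0 - (x + w))"
        using norm_triangle_ineq4[of "x0 - x" "x0 - (x + w)"] by simp
      then have "w \<in> ball 0 (2 * R)" using True x by (simp add: dist_norm)
      then show ?thesis by (simp add: riesz_kernel_def)
    next
      case False
      have "\<Phi> (x + w) = 0"
        by (rule gradient_zero_outside_support[OF \<phi> _ closed_cball False]) (use supp in auto)
      then show ?thesis by simp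
    qed
    show ?thesis
      using c(2)[of \<phi> \<Phi> "norm x0 + R" x, OF \<phi> far] unfolding eq by blast
  qed
  then show ?thesis using that c(1) by blast
qed

text \<open>Above the dimension the kernel belongs to the dual space, and Hoelder's inequality suffices.\<close>

lemma Morrey_C1:
  assumes p: "real DIM('a::euclidean_space) < p"
  obtains C where "0 < C"
    "\<And>(\<phi> :: 'a \<Rightarrow> real) \<Phi> x0 R D x. 0 < R \<Longrightarrow> C1_gradient \<phi> \<Phi> \<Longrightarrow> (\<And>x. x \<notin> ball x0 R \<Longrightarrow> \<phi> x = 0) \<Longrightarrow>
      pint p \<Phi> \<le> ennreal D \<Longrightarrow> 0 \<le> D \<Longrightarrow> \<bar>\<phi> x\<bar> powr p \<le> C * R powr (p - real DIM('a)) * D"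
proof -
  define N where "N = real DIM('a)"
  have N: "1 \<le> N" using DIM_positive[where 'a='a] by (simp add: N_def Suc_le_eq)
  have p1: "1 < p" using p N unfolding N_def by linarith
  define q where "q = p / (p - 1)"
  have q: "1 < q" "1 / p + 1 / q = 1" using p1 by (auto simp: q_def field_simps)
  have a: "N + (1 - N) * q = (p - N) / (p - 1)"
    using p1 by (simp add: q_def field_simps)
  have apos: "0 < N + (1 - N) * q" unfolding a using p p1 by (simp add: N_def)
  obtain C1 where C1: "0 < C1" "\<And>R. 0 < R \<Longrightarrow> (\<integral>\<^sup>+w. ennreal (riesz_kernel R (w::'a) powr q) \<partial>lborel)
      \<le> ennreal (C1 * (2 * R) powr (N + (1 - N) * q))"
    using riesz_kernel_integral[OF apos[unfolded N_def]] unfolding N_def by blast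
  obtain c where c: "0 < c"
    "\<And>(\<phi> :: 'a \<Rightarrow> real) \<Phi> x0 R x. C1_gradient \<phi> \<Phi> \<Longrightarrow> (\<And>x. x \<notin> ball x0 R \<Longrightarrow> \<phi> x = 0) \<Longrightarrow>
      x \<in> ball x0 R \<Longrightarrow> ennreal \<bar>\<phi> x\<bar> \<le> ennreal c * (\<integral>\<^sup>+w. ennreal (norm (\<Phi> (x + w)) * riesz_kernel R w) \<partial>lborel)"
    using Riesz_potential_bound_ball[where 'a='a] by blast
  define C where "C = c powr p * C1 powr (p - 1) * 2 powr (p - N)"
  have C: "0 < C" using c C1 by (simp add: C_def)
  have main: "\<bar>\<phi> x\<bar> powr p \<le> C * R powr (p - N) * D"
    if R: "0 < R" and \<phi>: "C1_gradient \<phi> \<Phi>" and supp: "\<And>x. x \<notin> ball x0 R \<Longrightarrow> \<phi> x = 0"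
      and D: "pint p \<Phi> \<le> ennreal D" "0 \<le> D" for \<phi> :: "'a \<Rightarrow> real" and \<Phi> x0 R D x
  proof (cases "x \<in> ball x0 R")
    case False
    then show ?thesis using supp C D by simp
  next
    case True
    have [measurable]: "\<Phi> \<in> borel_measurable borel" using C1_gradient_measurable[OF \<phi>] by simp
    define B where "B = C1 * (2 * R) powr (N + (1 - N) * q)"
    have B: "0 \<le> B" using C1 by (simp add: B_def)
    have tr: "(\<integral>\<^sup>+w. ennreal (norm (\<Phi> (x + w)) powr p) \<partial>lborel) = pint p \<Phi>"
      unfolding pint_def
      using nn_integral_lborel_translate[of "\<lambda>w. ennreal (norm (\<Phi> w) powr p)" x] by (simp add: add.commute)
    have "(\<integral>\<^sup>+w. ennreal (norm (\<Phi> (x + w)) * riesz_kernel R w) \<partial>lborel) \<le> ennreal (D powr (1 / p) * B powr (1 / q))"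
      by (rule nn_integral_Hoelder)
        (use p1 q D B C1(2)[OF R] riesz_kernel_nonneg in \<open>auto simp: tr B_def\<close>)
    then have "ennreal c * (\<integral>\<^sup>+w. ennreal (norm (\<Phi> (x + w)) * riesz_kernel R w) \<partial>lborel)
        \<le> ennreal c * ennreal (D powr (1 / p) * B powr (1 / q))" by (rule mult_left_mono) simp
    then have "ennreal \<bar>\<phi> x\<bar> \<le> ennreal (c * (D powr (1 / p) * B powr (1 / q)))"
      using c(2)[OF \<phi> supp True] c(1) by (simp add: ennreal_mult' order_trans)
    then have "\<bar>\<phi> x\<bar> \<le> c * (D powr (1 / p) * B powr (1 / q))"
      using c(1) by (subst (asm) ennreal_le_iff) auto
    then have "\<bar>\<phi> x\<bar> powr p \<le> (c * (D powr (1 / p) * B powr (1 / q))) powr p"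
      using p1 by (intro powr_mono2) auto
    also have "\<dots> = c powr p * (D * B powr (p - 1))"
    proof -
      have "1 / q * p = p - 1" using p1 by (simp add: q_def)
      then show ?thesis using p1 D by (simp add: powr_mult powr_powr)
    qed
    also have "B powr (p - 1) = C1 powr (p - 1) * ((2 * R) powr (p - N))"
      unfolding B_def a using p1 by (simp add: powr_mult powr_powr)
    finally show ?thesis by (simp add: C_def powr_mult mult_ac)
  qed
  show ?thesis by (rule that[OF C]) (rule main[unfolded N_def], assumption+)
qed

text \<open>Young's inequality for the convolution with the truncated Riesz kernel, done by hand: split the
  kernel by Hoelder's inequality and apply Jensen's inequality with the weight
  \<open>norm (\<Phi> (x + w)) powr p\<close>. Every exponent below the critical one is reached.\<close>

lemma Sobolev_C1:
  assumes p: "1 < p" and \<kappa>: "1 \<le> \<kappa>" "(real DIM('a::euclidean_space) - p) * \<kappa> < real DIM('a)"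
  obtains C where "0 < C"
    "\<And>(\<phi> :: 'a \<Rightarrow> real) \<Phi> x0 R D. 0 < R \<Longrightarrow> C1_gradient \<phi> \<Phi> \<Longrightarrow> (\<And>x. x \<notin> ball x0 R \<Longrightarrow> \<phi> x = 0) \<Longrightarrow>
      pint p \<Phi> \<le> ennreal D \<Longrightarrow> 0 < D \<Longrightarrow>
      pint (p * \<kappa>) \<phi> \<le> ennreal (C * R powr (\<kappa> * (p - real DIM('a)) + real DIM('a)) * D powr \<kappa>)"
proof -
  define N where "N = real DIM('a)"
  have N: "1 \<le> N" using DIM_positive[where 'a='a] by (simp add: N_def Suc_le_eq)
  define m where "m = N - 1"
  define q where "q = p / (p - 1)"
  have q: "1 < q" "1 / p + 1 / q = 1" using p by (auto simp: q_def field_simps)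
  \<comment> \<open>The kernel is the product of its powers with exponents \<open>\<beta>\<close> and \<open>1 - \<beta>\<close>. For some \<open>\<beta>\<close> both
    factors are integrable to the required powers precisely if \<open>\<kappa>\<close> is subcritical.\<close>
  obtain \<beta> where \<beta>: "m * (\<beta> * p * \<kappa>) < N" "m * ((1 - \<beta>) * q) < N"
  proof (cases "m = 0")
    case True
    then show ?thesis using that[of 0] N by simp
  next
    case False
    then have m: "0 < m" using N by (simp add: m_def)
    have "1 - N / (m * q) < N / (m * (p * \<kappa>))"
    proof -
      have "m * p * \<kappa> < N * (p - 1) * \<kappa> + N"
        using \<kappa>(2) by (simp add: m_def N_def algebra_simps)
      then have "m * p * \<kappa> / (m * p * \<kappa>) < (N * (p - 1) * \<kappa> + N) / (m * p * \<kappa>)"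
        using m p \<kappa>(1) by (intro divide_strict_right_mono) auto
      moreover have "(N * (p - 1) * \<kappa> + N) / (m * p * \<kappa>) = N / (m * q) + N / (m * (p * \<kappa>))"
        using m p \<kappa>(1) by (simp add: q_def field_simps)
      moreover have "m * p * \<kappa> / (m * p * \<kappa>) = 1" using m p \<kappa>(1) by simp
      ultimately show ?thesis by simp
    qed
    then obtain \<beta> where b: "1 - N / (m * q) < \<beta>" "\<beta> < N / (m * (p * \<kappa>))" using dense by blast
    have "m * (\<beta> * p * \<kappa>) < N"
      using b(2) m p \<kappa>(1) by (simp add: field_simps)
    moreover have "m * ((1 - \<beta>) * q) < N"
    proof -
      have "1 - \<beta> < N / (m * q)" using b(1) by simp
      then show ?thesis using m q by (simp add: field_simps)
    qed
    ultimately show ?thesis by (rule that)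
  qed
  define g1 where "g1 = N + (1 - N) * (\<beta> * p * \<kappa>)"
  define g2 where "g2 = N + (1 - N) * ((1 - \<beta>) * q)"
  have g: "0 < g1" "0 < g2" using \<beta> by (auto simp: g1_def g2_def m_def algebra_simps)
  obtain C1 where C1: "0 < C1" "\<And>R. 0 < R \<Longrightarrow> (\<integral>\<^sup>+w. ennreal (riesz_kernel R (w::'a) powr (\<beta> * p * \<kappa>)) \<partial>lborel)
      \<le> ennreal (C1 * (2 * R) powr g1)"
    using riesz_kernel_integral[of "\<beta> * p * \<kappa>", where 'a='a] g(1) unfolding N_def g1_def by blast
  obtain C2 where C2: "0 < C2" "\<And>R. 0 < R \<Longrightarrow> (\<integral>\<^sup>+w. ennreal (riesz_kernel R (w::'a) powr ((1 - \<beta>) * q)) \<partial>lborel)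
      \<le> ennreal (C2 * (2 * R) powr g2)"
    using riesz_kernel_integral[of "(1 - \<beta>) * q", where 'a='a] g(2) unfolding N_def g2_def by blast
  obtain c where c: "0 < c"
    "\<And>(\<phi> :: 'a \<Rightarrow> real) \<Phi> x0 R x. C1_gradient \<phi> \<Phi> \<Longrightarrow> (\<And>x. x \<notin> ball x0 R \<Longrightarrow> \<phi> x = 0) \<Longrightarrow>
      x \<in> ball x0 R \<Longrightarrow> ennreal \<bar>\<phi> x\<bar> \<le> ennreal c * (\<integral>\<^sup>+w. ennreal (norm (\<Phi> (x + w)) * riesz_kernel R w) \<partial>lborel)"
    using Riesz_potential_bound_ball[where 'a='a] by blast
  define C where "C = (c powr p * C2 powr (p - 1)) powr \<kappa> * C1 * 2 powr (\<kappa> * (p - N) + N)"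
  have C: "0 < C" using c C1 C2 by (simp add: C_def)
  have main: "pint (p * \<kappa>) \<phi> \<le> ennreal (C * R powr (\<kappa> * (p - N) + N) * D powr \<kappa>)"
    if R: "0 < R" and \<phi>: "C1_gradient \<phi> \<Phi>" and supp: "\<And>x. x \<notin> ball x0 R \<Longrightarrow> \<phi> x = 0"
      and D: "pint p \<Phi> \<le> ennreal D" "0 < D" for \<phi> :: "'a \<Rightarrow> real" and \<Phi> x0 R D
  proof -
    have [measurable]: "\<Phi> \<in> borel_measurable borel" using C1_gradient_measurable[OF \<phi>] by simp
    define k :: "'a \<Rightarrow> real" where "k = riesz_kernel R"
    have [measurable]: "k \<in> borel_measurable borel" by (simp add: k_def)
    have k0: "0 \<le> k w" for w by (simp add: k_def riesz_kernel_nonneg)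
    define B where "B = C2 * (2 * R) powr g2"
    have B: "0 < B" using C2 R by (simp add: B_def)
    define E where "E = (c powr p * B powr (p - 1)) powr \<kappa> * D powr (\<kappa> - 1)"
    have E: "0 < E" using c B D by (simp add: E_def)
    define H where "H x = (\<integral>\<^sup>+w. ennreal (norm (\<Phi> (x + w)) powr p * k w powr (\<beta> * p * \<kappa>)) \<partial>lborel)" for x
    have pt: "ennreal (norm (\<phi> x) powr (p * \<kappa>)) \<le> ennreal E * H x" for x
    proof (cases "x \<in> ball x0 R \<and> H x < \<infinity>")
      case False
      then show ?thesis
      proof (cases "x \<in> ball x0 R")
        case True
        then have "H x = \<infinity>" using False by (simp add: less_top[symmetric])
        then show ?thesis using E by (simp add: ennreal_mult_top)
      qed (simp add: supp)
    next
      case True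
      then obtain A where A: "H x = ennreal A" "0 \<le> A" by (cases "H x") auto
      have tr: "(\<integral>\<^sup>+w. ennreal (norm (\<Phi> (x + w)) powr p) \<partial>lborel) = pint p \<Phi>"
        unfolding pint_def
        using nn_integral_lborel_translate[of "\<lambda>w. ennreal (norm (\<Phi> w) powr p)" x] by (simp add: add.commute)
      define A1 where "A1 = D powr (1 - 1 / \<kappa>) * A powr (1 / \<kappa>)"
      have A1: "0 \<le> A1" by (simp add: A1_def)
      have h: "(\<integral>\<^sup>+w. ennreal (norm (\<Phi> (x + w)) powr p * k w powr (\<beta> * p)) \<partial>lborel) \<le> ennreal A1"
        unfolding A1_def
      proof (rule nn_integral_power_mean)
        show "(\<integral>\<^sup>+w. ennreal (norm (\<Phi> (x + w)) powr p * (k w powr (\<beta> * p)) powr \<kappa>) \<partial>lborel) \<le> ennreal A"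
          using A by (simp add: H_def powr_powr)
      qed (use \<kappa> D A tr in auto)
      have "(\<integral>\<^sup>+w. ennreal ((norm (\<Phi> (x + w)) * k w powr \<beta>) * k w powr (1 - \<beta>)) \<partial>lborel)
          \<le> ennreal (A1 powr (1 / p) * B powr (1 / q))"
      proof (rule nn_integral_Hoelder)
        show "(\<integral>\<^sup>+w. ennreal ((norm (\<Phi> (x + w)) * k w powr \<beta>) powr p) \<partial>lborel) \<le> ennreal A1"
          using h by (simp add: powr_mult powr_powr)
        show "(\<integral>\<^sup>+w. ennreal ((k w powr (1 - \<beta>)) powr q) \<partial>lborel) \<le> ennreal B"
          using C2(2)[OF R] by (simp add: powr_powr k_def B_def)
      qed (use p q A1 B in auto)
      moreover have "(norm (\<Phi> (x + w)) * k w powr \<beta>) * k w powr (1 - \<beta>) = norm (\<Phi> (x + w)) * k w" for w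
        using k0[of w] by (simp add: mult.assoc flip: powr_add)
      ultimately have "(\<integral>\<^sup>+w. ennreal (norm (\<Phi> (x + w)) * k w) \<partial>lborel) \<le> ennreal (A1 powr (1 / p) * B powr (1 / q))"
        by simp
      then have "ennreal c * (\<integral>\<^sup>+w. ennreal (norm (\<Phi> (x + w)) * k w) \<partial>lborel)
          \<le> ennreal c * ennreal (A1 powr (1 / p) * B powr (1 / q))" by (rule mult_left_mono) simp
      then have "ennreal \<bar>\<phi> x\<bar> \<le> ennreal (c * (A1 powr (1 / p) * B powr (1 / q)))"
        using c(2)[of \<phi> \<Phi> x0 R x, OF \<phi> supp] True c(1) by (simp add: ennreal_mult' k_def order_trans)
      then have "\<bar>\<phi> x\<bar> \<le> c * (A1 powr (1 / p) * B powr (1 / q))"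
        using c(1) by (subst (asm) ennreal_le_iff) auto
      then have "\<bar>\<phi> x\<bar> powr (p * \<kappa>) \<le> (c * (A1 powr (1 / p) * B powr (1 / q))) powr (p * \<kappa>)"
        using p \<kappa> by (intro powr_mono2) auto
      also have "\<dots> = ((c * (A1 powr (1 / p) * B powr (1 / q))) powr p) powr \<kappa>" by (simp add: powr_powr)
      also have "(c * (A1 powr (1 / p) * B powr (1 / q))) powr p = c powr p * B powr (p - 1) * A1"
      proof -
        have "1 / q * p = p - 1" using p by (simp add: q_def)
        then show ?thesis using p A1 by (simp add: powr_mult powr_powr)
      qed
      also have "(c powr p * B powr (p - 1) * A1) powr \<kappa> = E * A"
      proof -
        have "A1 powr \<kappa> = D powr (\<kappa> - 1) * A"
          using \<kappa> A by (simp add: A1_def powr_mult powr_powr left_diff_distrib)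
        then show ?thesis by (simp add: E_def powr_mult)
      qed
      finally have "ennreal (norm (\<phi> x) powr (p * \<kappa>)) \<le> ennreal (E * A)" by (simp add: ennreal_leI)
      then show ?thesis using A E by (simp add: ennreal_mult)
    qed
    have "pint (p * \<kappa>) \<phi> \<le> (\<integral>\<^sup>+x. ennreal E * H x \<partial>lborel)"
      unfolding pint_def by (rule nn_integral_mono) (rule pt)
    also have "\<dots> = ennreal E * (\<integral>\<^sup>+x. H x \<partial>lborel)"
      unfolding H_def by (rule nn_integral_cmult) measurable
    also have "(\<integral>\<^sup>+x. H x \<partial>lborel)
        = (\<integral>\<^sup>+w. (\<integral>\<^sup>+x. ennreal (norm (\<Phi> (x + w)) powr p * k w powr (\<beta> * p * \<kappa>)) \<partial>lborel) \<partial>lborel)"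
      unfolding H_def by (rule lborel_pair.Fubini') measurable
    also have "\<dots> = (\<integral>\<^sup>+w. pint p \<Phi> * ennreal (k w powr (\<beta> * p * \<kappa>)) \<partial>lborel)"
    proof (rule nn_integral_cong)
      fix w
      have "(\<integral>\<^sup>+x. ennreal (norm (\<Phi> (x + w)) powr p * k w powr (\<beta> * p * \<kappa>)) \<partial>lborel)
          = (\<integral>\<^sup>+x. ennreal (norm (\<Phi> (x + w)) powr p) \<partial>lborel) * ennreal (k w powr (\<beta> * p * \<kappa>))"
        by (simp add: ennreal_mult nn_integral_multc)
      then show "(\<integral>\<^sup>+x. ennreal (norm (\<Phi> (x + w)) powr p * k w powr (\<beta> * p * \<kappa>)) \<partial>lborel)
          = pint p \<Phi> * ennreal (k w powr (\<beta> * p * \<kappa>))"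
        using nn_integral_lborel_translate[of "\<lambda>x. ennreal (norm (\<Phi> x) powr p)" w] by (simp add: pint_def)
    qed
    also have "\<dots> = pint p \<Phi> * (\<integral>\<^sup>+w. ennreal (k w powr (\<beta> * p * \<kappa>)) \<partial>lborel)"
      by (rule nn_integral_cmult) measurable
    also have "\<dots> \<le> ennreal D * ennreal (C1 * (2 * R) powr g1)"
      using D(1) C1(2)[OF R] by (intro mult_mono) (auto simp: k_def)
    finally have "pint (p * \<kappa>) \<phi> \<le> ennreal E * (ennreal D * ennreal (C1 * (2 * R) powr g1))"
      by (simp add: mult_left_mono)
    also have "\<dots> = ennreal (E * (D * (C1 * (2 * R) powr g1)))"
      using E D C1 by (simp flip: ennreal_mult)
    also have "E * (D * (C1 * (2 * R) powr g1)) = C * R powr (\<kappa> * (p - N) + N) * D powr \<kappa>"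
    proof -
      have D1: "D powr (\<kappa> - 1) * D = D powr \<kappa>" using D by (simp add: powr_diff)
      have "B powr (p - 1) = C2 powr (p - 1) * (2 * R) powr (g2 * (p - 1))"
        by (simp add: B_def powr_mult powr_powr)
      then have "(c powr p * B powr (p - 1)) powr \<kappa>
          = (c powr p * C2 powr (p - 1)) powr \<kappa> * ((2 * R) powr (g2 * (p - 1))) powr \<kappa>"
        by (simp only: powr_mult mult.assoc)
      then have e: "(c powr p * B powr (p - 1)) powr \<kappa>
          = (c powr p * C2 powr (p - 1)) powr \<kappa> * (2 * R) powr (g2 * (p - 1) * \<kappa>)"
        by (simp only: powr_powr)
      have f: "(2 * R) powr (g2 * (p - 1) * \<kappa>) * (2 * R) powr g1 = (2 * R) powr (\<kappa> * (p - N) + N)"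
      proof -
        have "(1 - \<beta>) * q * (p - 1) = (1 - \<beta>) * p" using p by (simp add: q_def)
        then have "g2 * (p - 1) = N * (p - 1) + (1 - N) * ((1 - \<beta>) * p)"
          by (simp add: g2_def distrib_right)
        then have "g2 * (p - 1) * \<kappa> + g1 = (N * (p - 1) + (1 - N) * ((1 - \<beta>) * p)) * \<kappa> + g1" by simp
        also have "\<dots> = \<kappa> * (p - N) + N" by (simp add: g1_def algebra_simps)
        finally have "g2 * (p - 1) * \<kappa> + g1 = \<kappa> * (p - N) + N" .
        then show ?thesis by (simp flip: powr_add)
      qed
      have "E * (D * (C1 * (2 * R) powr g1)) = (c powr p * C2 powr (p - 1)) powr \<kappa> * C1
          * ((2 * R) powr (g2 * (p - 1) * \<kappa>) * (2 * R) powr g1) * (D powr (\<kappa> - 1) * D)"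
        unfolding E_def e by (simp only: mult_ac)
      also have "\<dots> = C * R powr (\<kappa> * (p - N) + N) * D powr \<kappa>"
        unfolding f D1 unfolding C_def powr_mult[of 2 R] by (simp only: mult_ac)
      finally show ?thesis .
    qed
    finally show ?thesis .
  qed
  show ?thesis by (rule that[OF C]) (rule main[unfolded N_def], assumption+)
qed

text \<open>Estimates for smooth functions carry over to limits along an almost everywhere convergent
  subsequence, at the cost of a constant in the bound for the gradients.\<close>

lemma ex_limit_subseq:
  fixes v :: "'a::euclidean_space \<Rightarrow> real"
  assumes lim: "W0_limit K p v V" and p: "1 \<le> p" and D: "pint p V \<le> ennreal D" "0 < D"
  obtains \<psi> where "\<And>n. test_function K (\<psi> n)" "AE x in lborel. (\<lambda>n. \<psi> n x) \<longlonglongrightarrow> v x"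
    "\<And>n. pint p (grad (\<psi> n)) \<le> ennreal (2 powr p * (D + D))"
proof -
  obtain \<psi> where \<psi>: "\<And>n. test_function K (\<psi> n)" "(\<lambda>n. pint p (\<lambda>x. \<psi> n x - v x)) \<longlonglongrightarrow> 0"
    "(\<lambda>n. pint p (\<lambda>x. grad (\<psi> n) x - V x)) \<longlonglongrightarrow> 0"
    and m[measurable]: "v \<in> borel_measurable borel" "V \<in> borel_measurable borel"
    using lim unfolding W0_limit_def by blast
  note \<psi>m[measurable] = C1_gradient_measurable[OF test_function_C1[OF \<psi>(1)]]
  have "\<forall>\<^sub>F n in sequentially. pint p (\<lambda>x. \<psi> n x - v x) < ennreal D"
    "\<forall>\<^sub>F n in sequentially. pint p (\<lambda>x. grad (\<psi> n) x - V x) < ennreal D"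
    using \<psi>(2,3) D(2) by (auto intro: order_tendstoD)
  then have "\<forall>\<^sub>F n in sequentially. pint p (\<lambda>x. \<psi> n x - v x) < ennreal D \<and>
      pint p (\<lambda>x. grad (\<psi> n) x - V x) < ennreal D"
    by eventually_elim auto
  then obtain n0 where n0: "\<And>n. n0 \<le> n \<Longrightarrow> pint p (\<lambda>x. \<psi> n x - v x) < ennreal D"
    "\<And>n. n0 \<le> n \<Longrightarrow> pint p (\<lambda>x. grad (\<psi> n) x - V x) < ennreal D"
    unfolding eventually_sequentially by blast
  define \<eta> where "\<eta> n = \<psi> (n + n0)" for n
  have \<eta>m[measurable]: "\<eta> n \<in> borel_measurable borel" "grad (\<eta> n) \<in> borel_measurable borel" for n
    by (simp_all add: \<eta>_def)
  have lim': "(\<lambda>n. pint p (\<lambda>x. \<eta> n x - v x)) \<longlonglongrightarrow> 0"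
    unfolding \<eta>_def by (rule LIMSEQ_ignore_initial_segment[OF \<psi>(2)])
  have fin: "pint p (\<lambda>x. \<eta> n x - v x) < \<infinity>" for n
    using n0(1)[of "n + n0"] unfolding \<eta>_def by (simp add: order.strict_trans[OF _ ennreal_less_top])
  obtain r :: "nat \<Rightarrow> nat" where r: "AE x in lborel. (\<lambda>n. \<eta> (r n) x - v x) \<longlonglongrightarrow> 0"
    using pint_AE_subseq[OF _ _ lim' fin] p by auto
  show thesis
  proof
    show "test_function K (\<eta> (r n))" for n by (simp add: \<eta>_def \<psi>(1))
    show "AE x in lborel. (\<lambda>n. \<eta> (r n) x) \<longlonglongrightarrow> v x"
      using r by eventually_elim (simp add: LIM_zero_iff)
    show "pint p (grad (\<eta> (r n))) \<le> ennreal (2 powr p * (D + D))" for n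
    proof -
      have "pint p (\<lambda>x. grad (\<eta> (r n)) x - 0) \<le> ennreal (2 powr p * (D + D))"
        by (rule pint_triangle_le[where g=V])
          (use n0(2)[of "r n + n0"] D p in \<open>auto simp: \<eta>_def less_imp_le\<close>)
      then show ?thesis by simp
    qed
  qed
qed

lemma test_function_zero: "test_function K \<phi> \<Longrightarrow> x \<notin> K \<Longrightarrow> \<phi> x = 0"
  using test_function_compact[of K \<phi>] by (metis subsetD)

lemma Morrey_W0:
  assumes p: "real DIM('a::euclidean_space) < p"
  obtains C where "0 < C"
    "\<And>(v :: 'a \<Rightarrow> real) V x0 R D. 0 < R \<Longrightarrow> W0_limit (ball x0 R) p v V \<Longrightarrow>
      pint p V \<le> ennreal D \<Longrightarrow> 0 < D \<Longrightarrow> AE x in lborel. \<bar>v x\<bar> powr p \<le> C * R powr (p - real DIM('a)) * D"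
proof -
  have p1: "1 < p" using p DIM_positive[where 'a='a] by linarith
  obtain C where C: "0 < C" "\<And>(\<phi> :: 'a \<Rightarrow> real) \<Phi> x0 R D x. 0 < R \<Longrightarrow> C1_gradient \<phi> \<Phi> \<Longrightarrow>
      (\<And>x. x \<notin> ball x0 R \<Longrightarrow> \<phi> x = 0) \<Longrightarrow>
      pint p \<Phi> \<le> ennreal D \<Longrightarrow> 0 \<le> D \<Longrightarrow> \<bar>\<phi> x\<bar> powr p \<le> C * R powr (p - real DIM('a)) * D"
    using Morrey_C1[OF p] by blast
  define C' where "C' = C * (2 powr p * 2)"
  have C': "0 < C'" using C by (simp add: C'_def)
  have main: "AE x in lborel. \<bar>v x\<bar> powr p \<le> C' * R powr (p - real DIM('a)) * D"
    if R: "0 < R" and lim: "W0_limit (ball x0 R) p v V" and D: "pint p V \<le> ennreal D" "0 < D"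
    for v :: "'a \<Rightarrow> real" and V x0 R D
  proof -
    obtain \<psi> where \<psi>: "\<And>n. test_function (ball x0 R) (\<psi> n)" "AE x in lborel. (\<lambda>n. \<psi> n x) \<longlonglongrightarrow> v x"
      "\<And>n. pint p (grad (\<psi> n)) \<le> ennreal (2 powr p * (D + D))"
      using ex_limit_subseq[OF lim _ D] p1 by auto
    have b: "\<bar>\<psi> n x\<bar> powr p \<le> C' * R powr (p - real DIM('a)) * D" for n x
      using C(2)[of R "\<psi> n" "grad (\<psi> n)" x0 "2 powr p * (D + D)" x,
          OF R test_function_C1[OF \<psi>(1)] test_function_zero[OF \<psi>(1)] \<psi>(3)] D
      by (simp add: C'_def mult_ac)
    show ?thesis
      using \<psi>(2)
    proof eventually_elim
      case (elim x)
      have "(\<lambda>n. \<bar>\<psi> n x\<bar> powr p) \<longlonglongrightarrow> \<bar>v x\<bar> powr p"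
        using elim p1 by (intro tendsto_powr' tendsto_rabs tendsto_const) auto
      then show ?case by (rule LIMSEQ_le_const2) (use b in auto)
    qed
  qed
  show ?thesis by (rule that[OF C']) (rule main, assumption+)
qed

lemma Sobolev_W0:
  assumes p: "1 < p" and \<kappa>: "1 \<le> \<kappa>" "(real DIM('a::euclidean_space) - p) * \<kappa> < real DIM('a)"
  obtains C where "0 < C"
    "\<And>(v :: 'a \<Rightarrow> real) V x0 R D. 0 < R \<Longrightarrow> W0_limit (ball x0 R) p v V \<Longrightarrow>
      pint p V \<le> ennreal D \<Longrightarrow> 0 < D \<Longrightarrow>
      pint (p * \<kappa>) v \<le> ennreal (C * R powr (\<kappa> * (p - real DIM('a)) + real DIM('a)) * D powr \<kappa>)"
proof -
  obtain C where C: "0 < C" "\<And>(\<phi> :: 'a \<Rightarrow> real) \<Phi> x0 R D. 0 < R \<Longrightarrow> C1_gradient \<phi> \<Phi> \<Longrightarrow>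
      (\<And>x. x \<notin> ball x0 R \<Longrightarrow> \<phi> x = 0) \<Longrightarrow> pint p \<Phi> \<le> ennreal D \<Longrightarrow> 0 < D \<Longrightarrow>
      pint (p * \<kappa>) \<phi> \<le> ennreal (C * R powr (\<kappa> * (p - real DIM('a)) + real DIM('a)) * D powr \<kappa>)"
    using Sobolev_C1[OF p \<kappa>] by blast
  define C' where "C' = C * (2 powr p * 2) powr \<kappa>"
  have C': "0 < C'" using C by (simp add: C'_def)
  have main: "pint (p * \<kappa>) v \<le> ennreal (C' * R powr (\<kappa> * (p - real DIM('a)) + real DIM('a)) * D powr \<kappa>)"
    if R: "0 < R" and lim: "W0_limit (ball x0 R) p v V" and D: "pint p V \<le> ennreal D" "0 < D"
    for v :: "'a \<Rightarrow> real" and V x0 R D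
  proof -
    obtain \<psi> where \<psi>: "\<And>n. test_function (ball x0 R) (\<psi> n)" "AE x in lborel. (\<lambda>n. \<psi> n x) \<longlonglongrightarrow> v x"
      "\<And>n. pint p (grad (\<psi> n)) \<le> ennreal (2 powr p * (D + D))"
      using ex_limit_subseq[OF lim _ D] p by auto
    note \<psi>m[measurable] = C1_gradient_measurable[OF test_function_C1[OF \<psi>(1)]]
    let ?b = "C' * R powr (\<kappa> * (p - real DIM('a)) + real DIM('a)) * D powr \<kappa>"
    have b: "pint (p * \<kappa>) (\<psi> n) \<le> ennreal ?b" for n
    proof -
      have "(2 powr p * (D + D)) powr \<kappa> = (2 powr p * 2) powr \<kappa> * D powr \<kappa>"
        by (simp add: mult.assoc flip: powr_mult)
      then show ?thesis
        using C(2)[of R "\<psi> n" "grad (\<psi> n)" x0 "2 powr p * (D + D)",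
            OF R test_function_C1[OF \<psi>(1)] test_function_zero[OF \<psi>(1)] \<psi>(3)] D
        by (simp only: C'_def mult_ac) simp
    qed
    have "pint (p * \<kappa>) v = (\<integral>\<^sup>+x. liminf (\<lambda>n. ennreal (norm (\<psi> n x) powr (p * \<kappa>))) \<partial>lborel)"
      unfolding pint_def
    proof (rule nn_integral_cong_AE)
      show "AE x in lborel. ennreal (norm (v x) powr (p * \<kappa>)) = liminf (\<lambda>n. ennreal (norm (\<psi> n x) powr (p * \<kappa>)))"
        using \<psi>(2)
      proof eventually_elim
        case (elim x)
        have "(\<lambda>n. norm (\<psi> n x) powr (p * \<kappa>)) \<longlonglongrightarrow> norm (v x) powr (p * \<kappa>)"
          using elim p \<kappa> by (intro tendsto_powr' tendsto_norm tendsto_const) auto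
        then have "(\<lambda>n. ennreal (norm (\<psi> n x) powr (p * \<kappa>))) \<longlonglongrightarrow> ennreal (norm (v x) powr (p * \<kappa>))"
          by (rule tendsto_ennrealI)
        from lim_imp_Liminf[OF sequentially_bot this] show ?case by simp
      qed
    qed
    also have "\<dots> \<le> liminf (\<lambda>n. pint (p * \<kappa>) (\<psi> n))"
      unfolding pint_def by (rule nn_integral_liminf) measurable
    also have "\<dots> \<le> liminf (\<lambda>n. ennreal ?b)"
      by (rule Liminf_mono) (use b in auto)
    also have "\<dots> = ennreal ?b" by (simp add: Liminf_const)
    finally show ?thesis .
  qed
  show ?thesis by (rule that[OF C']) (rule main, assumption+)
qed

section \<open>Cutoff functions\<close>

text \<open>A \<open>C\<^sup>1\<close> transition from \<open>0\<close> to \<open>1\<close> on the unit interval. As a rational function of squared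
  positive parts it has an explicit derivative.\<close>

definition smoothstep :: "real \<Rightarrow> real"
  where "smoothstep t = (max t 0)\<^sup>2 / ((max t 0)\<^sup>2 + (max (1 - t) 0)\<^sup>2)"

definition smoothstep' :: "real \<Rightarrow> real"
  where "smoothstep' t = (2 * max t 0 * (max (1 - t) 0)\<^sup>2 + 2 * max (1 - t) 0 * (max t 0)\<^sup>2)
    / ((max t 0)\<^sup>2 + (max (1 - t) 0)\<^sup>2)\<^sup>2"

lemma smoothstep_denom: "(max t 0)\<^sup>2 + (max (1 - t) 0)\<^sup>2 > (0::real)"
proof (cases "t > 0")
  case True
  then show ?thesis by (intro add_pos_nonneg) auto
next
  case False
  then show ?thesis by (intro add_nonneg_pos) auto
qed

lemma smoothstep_deriv: "(smoothstep has_real_derivative smoothstep' t) (at t)"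
proof -
  have q: "((\<lambda>t. (max (1 - t) 0)\<^sup>2) has_real_derivative - (2 * max (1 - t) 0)) (at t)"
    by (rule DERIV_cong[OF DERIV_chain2[OF max_0_squared_deriv DERIV_diff[OF DERIV_const DERIV_ident]]]) simp
  have "((\<lambda>t. (max t 0)\<^sup>2 / ((max t 0)\<^sup>2 + (max (1 - t) 0)\<^sup>2)) has_real_derivative
      (2 * max t 0 * ((max t 0)\<^sup>2 + (max (1 - t) 0)\<^sup>2) - (max t 0)\<^sup>2 * (2 * max t 0 + - (2 * max (1 - t) 0)))
      / (((max t 0)\<^sup>2 + (max (1 - t) 0)\<^sup>2) * ((max t 0)\<^sup>2 + (max (1 - t) 0)\<^sup>2))) (at t)"
    using smoothstep_denom[of t]
    by (intro DERIV_divide[OF max_0_squared_deriv DERIV_add[OF max_0_squared_deriv q]]) linarith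
  moreover have "2 * max t 0 * ((max t 0)\<^sup>2 + (max (1 - t) 0)\<^sup>2) - (max t 0)\<^sup>2 * (2 * max t 0 + - (2 * max (1 - t) 0))
      = 2 * max t 0 * (max (1 - t) 0)\<^sup>2 + 2 * max (1 - t) 0 * (max t 0)\<^sup>2"
    by (simp add: algebra_simps)
  ultimately show ?thesis
    by (simp add: smoothstep_def[abs_def] smoothstep'_def power2_eq_square)
qed

lemma smoothstep'_continuous: "continuous_on UNIV smoothstep'"
  unfolding smoothstep'_def[abs_def]
proof (intro continuous_intros ballI)
  fix t :: real
  show "((max t 0)\<^sup>2 + (max (1 - t) 0)\<^sup>2)\<^sup>2 \<noteq> 0"
    using smoothstep_denom[of t] by (intro power_not_zero) linarith
qed

lemma smoothstep_bounds: "0 \<le> smoothstep t" "smoothstep t \<le> 1"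
  using smoothstep_denom[of t] by (auto simp: smoothstep_def)

lemma smoothstep_eq: "t \<le> 0 \<Longrightarrow> smoothstep t = 0" "1 \<le> t \<Longrightarrow> smoothstep t = 1"
  by (auto simp: smoothstep_def)

lemma smoothstep'_zero: "t \<le> 0 \<Longrightarrow> smoothstep' t = 0"
  by (simp add: smoothstep'_def)

lemma smoothstep'_bound: "\<bar>smoothstep' t\<bar> \<le> 2"
proof (cases "0 < t \<and> t < 1")
  case True
  define s where "s = t\<^sup>2 + (1 - t)\<^sup>2"
  have "0 \<le> (2 * t - 1)\<^sup>2" by simp
  then have s: "1 / 2 \<le> s" and ts: "t * (1 - t) \<le> 1 / 4"
    by (auto simp: s_def power2_eq_square algebra_simps)
  have "smoothstep' t = 2 * (t * (1 - t)) / s\<^sup>2"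
    using True by (simp add: smoothstep'_def s_def) (simp add: power2_eq_square algebra_simps)
  moreover have "(1 / 2)\<^sup>2 \<le> s\<^sup>2" using s by (intro power_mono) auto
  moreover have "0 \<le> t * (1 - t)" using True by simp
  moreover from this have "0 \<le> 2 * (t * (1 - t)) / s\<^sup>2" by simp
  moreover have "2 * (t * (1 - t)) \<le> 2 * s\<^sup>2"
    using ts \<open>(1 / 2)\<^sup>2 \<le> s\<^sup>2\<close> by (simp add: power2_eq_square)
  then have "2 * (t * (1 - t)) / s\<^sup>2 \<le> 2" using s by (subst pos_divide_le_eq) auto
  ultimately show ?thesis by simp
next
  case False
  then show ?thesis by (auto simp: smoothstep'_def)
qed

lemma power_diff_le:
  fixes x y :: real
  assumes "0 \<le> y" "y \<le> x"
  shows "x ^ Suc n - y ^ Suc n \<le> real (Suc n) * x ^ n * (x - y)"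
proof (induction n)
  case (Suc n)
  have "x ^ Suc (Suc n) - y ^ Suc (Suc n) = x * (x ^ Suc n - y ^ Suc n) + y ^ Suc n * (x - y)"
    by (simp add: algebra_simps)
  also have "\<dots> \<le> x * (real (Suc n) * x ^ n * (x - y)) + x ^ Suc n * (x - y)"
    using assms by (intro add_mono mult_left_mono Suc mult_right_mono power_mono) auto
  also have "\<dots> = real (Suc (Suc n)) * x ^ Suc n * (x - y)"
    by (simp add: algebra_simps)
  finally show ?case .
qed simp

text \<open>The cutoff functions are powers of simpler ones. This makes their oscillation small
  where they are small, so that the gradient of the cutoff can be absorbed in the energy.\<close>

definition good_cutoff ::
  "real \<Rightarrow> real \<Rightarrow> 'a::euclidean_space \<Rightarrow> real \<Rightarrow> ('a \<Rightarrow> real) \<Rightarrow> ('a \<Rightarrow> 'a) \<Rightarrow> bool"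
  where "good_cutoff p M x0 r \<zeta> Z \<longleftrightarrow> C1_gradient \<zeta> Z \<and> (\<forall>x. 0 \<le> \<zeta> x \<and> \<zeta> x \<le> 1) \<and>
    (\<forall>x. x \<notin> cball x0 r \<longrightarrow> \<zeta> x = 0) \<and>
    (\<forall>x y. \<bar>\<zeta> x - \<zeta> y\<bar> \<le> M * max (\<zeta> x) (\<zeta> y) powr (1 - 1 / p) * norm (x - y)) \<and>
    (\<forall>x. norm (Z x) \<le> M * \<zeta> x powr (1 - 1 / p))"

lemma ex_good_cutoff:
  assumes p: "2 \<le> p"
  obtains c where "0 < c" "\<And>(x0 :: 'a::euclidean_space) r r'. 0 < r \<Longrightarrow> r < r' \<Longrightarrow>
    \<exists>\<zeta> Z. good_cutoff p (c / (r' - r)) x0 r' \<zeta> Z \<and> (\<forall>x\<in>ball x0 r. \<zeta> x = 1)"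
proof -
  \<comment> \<open>The cutoff function is a power \<open>n + 1 \<ge> p\<close> of a Lipschitz one; differentiating lowers the power
    by one, which leaves at least the exponent \<open>1 - 1 / p\<close>.\<close>
  define n where "n = nat \<lceil>p\<rceil> - 1"
  have n: "p \<le> real (Suc n)" using p unfolding n_def by linarith
  have main: "\<exists>\<zeta> Z. good_cutoff p ((4 * real (Suc n)) / (r' - r)) x0 r' \<zeta> Z \<and> (\<forall>x\<in>ball x0 r. \<zeta> x = 1)"
    if r: "0 < r" "r < r'" for x0 :: 'a and r r'
  proof -
    define d where "d = r'\<^sup>2 - r\<^sup>2"
    have d: "d = (r' - r) * (r' + r)" by (simp add: d_def power2_eq_square algebra_simps)
    have dpos: "0 < d" unfolding d using r by simp
    define g where "g x = (r'\<^sup>2 - (x - x0) \<bullet> (x - x0)) / d" for x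
    have gC1: "C1_gradient g (\<lambda>x. (- 2 / d) *\<^sub>R (x - x0))"
    proof (rule C1_gradientI)
      show "(g has_derivative (\<lambda>h. - ((x - x0) \<bullet> h + h \<bullet> (x - x0)) / d)) (at x)" for x
        unfolding g_def[abs_def] using dpos
        by (auto intro!: derivative_eq_intros simp: divide_inverse)
    qed (auto simp: inner_commute intro!: continuous_intros)
    define \<theta> where "\<theta> x = smoothstep (g x)" for x
    define T where "T x = smoothstep' (g x) *\<^sub>R ((- 2 / d) *\<^sub>R (x - x0))" for x
    have \<theta>C1: "C1_gradient \<theta> T"
      unfolding \<theta>_def[abs_def] T_def[abs_def]
      by (rule C1_gradient_compose[OF gC1 smoothstep_deriv smoothstep'_continuous])
    define L where "L = 4 / (r' - r)"
    have L: "0 < L" using r by (simp add: L_def)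
    have TL: "norm (T x) \<le> L" for x
    proof (cases "g x \<le> 0")
      case True
      then show ?thesis using L by (simp add: T_def smoothstep'_zero)
    next
      case False
      then have "0 < g x" by simp
      then have "(norm (x - x0))\<^sup>2 < r'\<^sup>2" using dpos by (simp add: g_def dot_square_norm zero_less_divide_iff)
      then have nx: "norm (x - x0) \<le> r'" using r by (meson less_imp_le order.strict_trans power2_less_imp_less)
      have "norm (T x) = \<bar>smoothstep' (g x)\<bar> * (2 / d * norm (x - x0))"
        using dpos by (simp add: T_def abs_mult)
      also have "\<dots> \<le> 2 * (2 / d * r')"
        using smoothstep'_bound nx dpos r by (intro mult_mono) auto
      also have "\<dots> = L * (r' / (r' + r))" using r by (simp add: L_def d)
      also have "\<dots> \<le> L * 1" using L r by (intro mult_left_mono) auto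
      finally show ?thesis by simp
    qed
    have \<theta>b: "0 \<le> \<theta> x" "\<theta> x \<le> 1" for x using smoothstep_bounds by (auto simp: \<theta>_def)
    have \<theta>L: "\<bar>\<theta> x - \<theta> y\<bar> \<le> L * norm (x - y)" for x y
      by (rule C1_lipschitz[OF \<theta>C1 TL])
    define \<zeta> where "\<zeta> x = \<theta> x ^ Suc n" for x
    define Z where "Z x = (real (Suc n) * \<theta> x ^ n) *\<^sub>R T x" for x
    have \<zeta>C1: "C1_gradient \<zeta> Z"
      unfolding \<zeta>_def[abs_def] Z_def[abs_def]
      by (rule C1_gradient_compose[OF \<theta>C1, where \<Psi>="\<lambda>t. t ^ Suc n"])
        (auto intro!: derivative_eq_intros continuous_intros simp del: power_Suc)
    have pw: "t ^ n \<le> (t ^ Suc n) powr (1 - 1 / p)" if t: "0 \<le> t" "t \<le> 1" for t :: real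
    proof (cases "t = 0")
      case True
      have "n \<noteq> 0" using n p by (cases n) auto
      then show ?thesis using True by (simp add: zero_power)
    next
      case False
      then have t0: "0 < t" using t by simp
      have "1 \<le> real (Suc n) / p" using n p by simp
      then have "real (Suc n) * (1 - 1 / p) \<le> real n" by (simp add: right_diff_distrib)
      then have "t powr real n \<le> t powr (real (Suc n) * (1 - 1 / p))"
        using t0 t by (intro powr_mono') auto
      also have "\<dots> = (t ^ Suc n) powr (1 - 1 / p)"
        using t0 by (simp add: powr_powr[symmetric] powr_realpow del: power_Suc of_nat_Suc)
      finally show ?thesis using t0 by (simp add: powr_realpow)
    qed
    have osc: "\<zeta> x - \<zeta> y \<le> L * real (Suc n) * max (\<zeta> x) (\<zeta> y) powr (1 - 1 / p) * norm (x - y)" for x y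
    proof (cases "\<theta> y \<le> \<theta> x")
      case True
      have "\<zeta> x - \<zeta> y \<le> real (Suc n) * \<theta> x ^ n * (\<theta> x - \<theta> y)"
        unfolding \<zeta>_def by (rule power_diff_le[OF \<theta>b(1) True])
      also have "\<dots> \<le> real (Suc n) * \<zeta> x powr (1 - 1 / p) * (L * norm (x - y))"
        using pw[of "\<theta> x"] \<theta>b[of x] \<theta>L[of x y] True
        by (intro mult_mono) (auto simp: \<zeta>_def simp del: power_Suc)
      also have "\<zeta> x = max (\<zeta> x) (\<zeta> y)"
        using power_mono[OF True \<theta>b(1), of "Suc n"] by (simp add: \<zeta>_def max_def del: power_Suc)
      finally show ?thesis by (simp add: mult_ac)
    next
      case False
      then have "\<zeta> x \<le> \<zeta> y" unfolding \<zeta>_def using \<theta>b by (intro power_mono) auto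
      moreover have "0 \<le> L * real (Suc n) * max (\<zeta> x) (\<zeta> y) powr (1 - 1 / p) * norm (x - y)"
        using L by simp
      ultimately show ?thesis by linarith
    qed
    have "good_cutoff p ((4 * real (Suc n)) / (r' - r)) x0 r' \<zeta> Z"
      unfolding good_cutoff_def
    proof (intro conjI allI impI)
      show "0 \<le> \<zeta> x" "\<zeta> x \<le> 1" for x using \<theta>b[of x] by (auto simp: \<zeta>_def simp del: power_Suc intro: power_le_one)
      show "\<zeta> x = 0" if "x \<notin> cball x0 r'" for x
      proof -
        have "r' \<le> norm (x - x0)" using that by (simp add: dist_norm norm_minus_commute)
        then have "r'\<^sup>2 \<le> (norm (x - x0))\<^sup>2" using r by (intro power_mono) auto
        then have "g x \<le> 0" using dpos by (simp add: g_def dot_square_norm divide_le_0_iff)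
        then show ?thesis by (simp add: \<zeta>_def \<theta>_def smoothstep_eq)
      qed
      show "\<bar>\<zeta> x - \<zeta> y\<bar> \<le> 4 * real (Suc n) / (r' - r) * max (\<zeta> x) (\<zeta> y) powr (1 - 1 / p) * norm (x - y)" for x y
        using osc[of x y] osc[of y x] by (simp add: L_def max.commute norm_minus_commute abs_le_iff)
      show "norm (Z x) \<le> 4 * real (Suc n) / (r' - r) * \<zeta> x powr (1 - 1 / p)" for x
      proof -
        have "norm (Z x) = real (Suc n) * \<theta> x ^ n * norm (T x)" using \<theta>b[of x] by (simp add: Z_def)
        also have "\<dots> \<le> real (Suc n) * \<zeta> x powr (1 - 1 / p) * L"
          using pw[of "\<theta> x"] \<theta>b[of x] TL[of x]
          by (intro mult_mono) (auto simp: \<zeta>_def simp del: power_Suc)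
        finally show ?thesis by (simp add: L_def mult_ac del: of_nat_Suc)
      qed
    qed (rule \<zeta>C1)
    moreover have "\<zeta> x = 1" if "x \<in> ball x0 r" for x
    proof -
      have "norm (x - x0) \<le> r" using that by (simp add: dist_norm norm_minus_commute)
      then have "(norm (x - x0))\<^sup>2 \<le> r\<^sup>2" by (intro power_mono) auto
      then have "1 \<le> g x" using dpos by (simp add: g_def dot_square_norm le_divide_eq d_def)
      then show ?thesis by (simp add: \<zeta>_def \<theta>_def smoothstep_eq)
    qed
    ultimately show ?thesis by blast
  qed
  show ?thesis by (rule that[of "4 * real (Suc n)"]) (simp, rule main)
qed

section \<open>The Caccioppoli inequality\<close>

subsection \<open>Pointwise inequalities\<close>

text \<open>Young's inequality with the factor \<open>1 / 2\<close> in front of the term that will be absorbed.\<close>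

lemma Young_absorb:
  fixes X Y p :: real
  assumes "1 \<le> p" "0 \<le> X" "0 \<le> Y"
  shows "X powr (p - 1) * Y \<le> X powr p / 2 + 2 powr (p - 1) * Y powr p"
proof (cases "Y \<le> X / 2")
  case True
  have "X powr (p - 1) * Y \<le> X powr (p - 1) * (X / 2)" using True by (intro mult_left_mono) auto
  also have "\<dots> = X powr p / 2" using assms by (cases "X = 0") (auto simp: powr_diff)
  finally show ?thesis by (simp add: add_increasing2)
next
  case False
  have "X powr (p - 1) * Y \<le> (2 * Y) powr (p - 1) * Y"
    using False assms by (intro mult_right_mono powr_mono2) auto
  also have "\<dots> = 2 powr (p - 1) * Y powr p"
    using assms by (cases "Y = 0") (auto simp: powr_mult powr_diff)
  finally show ?thesis by (simp add: add_increasing)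
qed

text \<open>Here \<open>G\<close> is the gradient of the solution and \<open>H\<close> that of the test function. The mixed term
  \<open>w * norm G powr (p - 1) * norm Z\<close> is absorbed by \<open>z * norm G powr p\<close>, for which \<open>Z\<close> has to be
  bounded by a power of the cutoff function.\<close>

lemma local_energy_bound:
  fixes G Z H :: "'a::euclidean_space"
  assumes p: "2 \<le> p" and w: "0 \<le> w" and z: "0 \<le> z" "z \<le> 1" and M: "0 \<le> M"
    and Z: "norm Z \<le> M * z powr (1 - 1 / p)"
    and H: "H = w *\<^sub>R Z + z *\<^sub>R G"
  shows "norm H powr p \<le> 2 powr (p + 1) * (norm G powr (p - 2) * (G \<bullet> H)) + 2 powr (2 * p + 1) * (w * M) powr p"
proof -
  define g where "g = norm G"
  define X where "X = g * z powr (1 / p)"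
  define Y where "Y = w * M"
  have X0: "0 \<le> X" and Y0: "0 \<le> Y" using w M by (auto simp: X_def Y_def g_def)
  have g0: "0 \<le> g" by (simp add: g_def)
  have Xp: "X powr p = z * g powr p"
    using p z by (simp add: X_def powr_mult powr_powr mult.commute)
  have Xp1: "X powr (p - 1) = g powr (p - 1) * z powr (1 - 1 / p)"
    using p by (simp add: X_def powr_mult powr_powr diff_divide_distrib)
  have gg: "g powr (p - 2) * (g * g) = g powr p"
  proof (cases "g = 0")
    case False
    then have "g powr p = g powr (p - 2) * g powr 2" by (simp flip: powr_add)
    then show ?thesis using g0 False by (simp add: powr_numeral power2_eq_square)
  qed simp
  have g1: "g powr (p - 2) * g = g powr (p - 1)"
  proof (cases "g = 0")
    case False
    have "g powr (p - 1) = g powr (p - 2) * g powr 1" by (subst powr_add[symmetric]) simp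
    then show ?thesis by (simp only: powr_one[OF g0])
  qed simp
  have "norm G powr (p - 2) * (G \<bullet> H) = z * g powr p + w * (g powr (p - 2) * (G \<bullet> Z))"
  proof -
    have "g powr (p - 2) * (z * (G \<bullet> G)) = z * g powr p"
      using gg by (simp add: dot_square_norm g_def power2_eq_square mult_ac)
    then show ?thesis by (simp add: H inner_add_right g_def algebra_simps)
  qed
  moreover have "- (g powr (p - 2) * (G \<bullet> Z)) \<le> g powr (p - 1) * (M * z powr (1 - 1 / p))"
  proof -
    have "- (G \<bullet> Z) \<le> g * norm Z" using Cauchy_Schwarz_ineq2[of G Z] by (simp add: g_def)
    also have "\<dots> \<le> g * (M * z powr (1 - 1 / p))" using Z g0 by (rule mult_left_mono)
    finally have "g powr (p - 2) * - (G \<bullet> Z) \<le> g powr (p - 2) * (g * (M * z powr (1 - 1 / p)))"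
      by (rule mult_left_mono) simp
    then show ?thesis using g1 by (simp add: mult.assoc[symmetric])
  qed
  then have "w * - (g powr (p - 2) * (G \<bullet> Z)) \<le> w * (g powr (p - 1) * (M * z powr (1 - 1 / p)))"
    using w by (rule mult_left_mono)
  then have "- (w * (g powr (p - 2) * (G \<bullet> Z))) \<le> X powr (p - 1) * Y"
    by (simp add: Xp1 Y_def mult_ac)
  ultimately have lower: "X powr p / 2 - 2 powr (p - 1) * Y powr p \<le> norm G powr (p - 2) * (G \<bullet> H)"
    using Young_absorb[of p X Y] p X0 Y0 unfolding Xp by linarith
  have "norm H \<le> Y + X"
  proof -
    have "z powr (1 - 1 / p) \<le> 1" using z p by (intro powr_le1) auto
    then have "M * z powr (1 - 1 / p) \<le> M" using M by (simp add: mult_left_le)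
    then have "w * norm Z \<le> Y" using Z w unfolding Y_def by (intro mult_left_mono) auto
    moreover have "z \<le> z powr (1 / p)" using z p powr_mono'[of "1 / p" 1 z] by simp
    then have "z * g \<le> X" unfolding X_def using g0 by (simp add: mult.commute mult_left_mono)
    ultimately show ?thesis
      unfolding H using norm_triangle_ineq[of "w *\<^sub>R Z" "z *\<^sub>R G"] w z by (simp add: g_def)
  qed
  then have "norm H powr p \<le> (X + Y) powr p" using p by (intro powr_mono2) auto
  also have "\<dots> \<le> 2 powr p * (X powr p + Y powr p)" using X0 Y0 p by (intro powr_add_le) auto
  also have "X powr p \<le> 2 * (norm G powr (p - 2) * (G \<bullet> H)) + 2 * 2 powr (p - 1) * Y powr p"
    using lower by simp
  also have "2 * 2 powr (p - 1) = 2 powr p" by (simp add: powr_diff)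
  finally have "norm H powr p \<le> 2 powr p * (2 * (norm G powr (p - 2) * (G \<bullet> H)) + 2 powr p * Y powr p + Y powr p)"
    by simp
  also have "\<dots> \<le> 2 powr p * (2 * (norm G powr (p - 2) * (G \<bullet> H)) + 2 powr p * Y powr p + 2 powr p * Y powr p)"
    using p ge_one_powr_ge_zero[of 2 p] by (intro mult_left_mono add_left_mono) (auto simp: mult_le_cancel_right1)
  also have "\<dots> = 2 powr (p + 1) * (norm G powr (p - 2) * (G \<bullet> H)) + 2 powr (2 * p + 1) * Y powr p"
  proof -
    have "2 powr (p + 1) = 2 powr p * 2" "2 powr (2 * p + 1) = 2 powr p * 2 powr p * 2"
      by (simp_all add: powr_add flip: powr_add[of 2 p p])
    then show ?thesis by (simp add: algebra_simps)
  qed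
  finally show ?thesis by (simp add: Y_def)
qed

lemma J_minus: "J p (- a) = - J p a"
  by (simp add: J_def)

lemma J_nonneg: "0 \<le> a \<Longrightarrow> 0 \<le> J p a"
  by (simp add: J_def)

lemma J_pos: "0 \<le> a \<Longrightarrow> 2 \<le> p \<Longrightarrow> J p a = a powr (p - 1)"
  unfolding J_def by (cases "a = 0") (auto simp: powr_mult_base mult.commute)

text \<open>The nonlocal counterpart for two points of the ball. If \<open>a\<close> is the larger value, the sign is bad
  only if the cutoff is larger at the other point; then the difference of the truncations, weighted
  with the cutoff, absorbs the mixed term.\<close>

lemma nonlocal_near_bound:
  fixes a b k zx zy e p :: real
  assumes p: "2 \<le> p" and z: "0 \<le> zx" "zx \<le> 1" "0 \<le> zy" "zy \<le> 1" and e: "0 \<le> e"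
    and osc: "\<bar>zx - zy\<bar> \<le> e * max zx zy powr (1 - 1 / p)"
  shows "- (J p (a - b) * (max (a - k) 0 * zx - max (b - k) 0 * zy))
    \<le> 2 powr (p - 1) * e powr p * (max (a - k) 0 powr p + max (b - k) 0 powr p)"
proof -
  have main: "- (J p (a - b) * (max (a - k) 0 * zx - max (b - k) 0 * zy))
    \<le> 2 powr (p - 1) * e powr p * (max (a - k) 0 powr p + max (b - k) 0 powr p)"
    if ab: "b \<le> a" and z: "0 \<le> zx" "zx \<le> 1" "0 \<le> zy" "zy \<le> 1" and osc: "\<bar>zx - zy\<bar> \<le> e * max zx zy powr (1 - 1 / p)"
    for a b zx zy
  proof -
    define A where "A = max (a - k) 0"
    define B where "B = max (b - k) 0"
    have AB: "0 \<le> B" "B \<le> A" using ab by (auto simp: A_def B_def)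
    have rhs: "0 \<le> 2 powr (p - 1) * e powr p * (A powr p + B powr p)" by simp
    show ?thesis
      unfolding A_def[symmetric] B_def[symmetric]
    proof (cases "B * zy \<le> A * zx")
      case True
      then have "0 \<le> J p (a - b) * (A * zx - B * zy)" using ab by (intro mult_nonneg_nonneg J_nonneg) auto
      then show "- (J p (a - b) * (A * zx - B * zy)) \<le> 2 powr (p - 1) * e powr p * (A powr p + B powr p)"
        using rhs by linarith
    next
      case False
      then have B0: "B \<noteq> 0" using AB z by (auto simp: mult_nonneg_nonneg)
      then have "a - b = A - B" using ab by (auto simp: A_def B_def max_def split: if_splits)
      have zxy: "zx < zy"
      proof (rule ccontr)
        assume "\<not> zx < zy"
        then have "B * zy \<le> A * zx" using AB z by (intro mult_mono) auto
        then show False using False by simp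
      qed
      define X where "X = (A - B) * zy powr (1 / p)"
      define Y where "Y = A * e"
      have XY: "0 \<le> X" "0 \<le> Y" using AB e by (auto simp: X_def Y_def)
      have Xp: "X powr p = (A - B) powr p * zy" using p z by (simp add: X_def powr_mult powr_powr)
      have Xp1: "X powr (p - 1) = (A - B) powr (p - 1) * zy powr (1 - 1 / p)"
        using p by (simp add: X_def powr_mult powr_powr diff_divide_distrib)
      have Jeq: "J p (a - b) = (A - B) powr (p - 1)" using \<open>a - b = A - B\<close> AB p by (simp add: J_pos)
      have pp: "(A - B) powr (p - 1) * (A - B) = (A - B) powr p"
        using AB by (cases "A = B") (auto simp: powr_diff)
      have "- (J p (a - b) * (A * zx - B * zy))
          = (A - B) powr (p - 1) * A * (zy - zx) - (A - B) powr (p - 1) * (A - B) * zy"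
        by (simp add: Jeq algebra_simps)
      also have "\<dots> = (A - B) powr (p - 1) * A * (zy - zx) - X powr p" unfolding pp Xp ..
      also have "(A - B) powr (p - 1) * A * (zy - zx) \<le> (A - B) powr (p - 1) * A * (e * zy powr (1 - 1 / p))"
        using osc zxy AB by (intro mult_left_mono) (auto simp: max_def)
      also have "\<dots> = X powr (p - 1) * Y" by (simp add: Xp1 Y_def mult_ac)
      also have "\<dots> \<le> X powr p / 2 + 2 powr (p - 1) * Y powr p"
        using p XY by (intro Young_absorb) auto
      finally have "- (J p (a - b) * (A * zx - B * zy)) \<le> 2 powr (p - 1) * Y powr p - X powr p / 2"
        by simp
      also have "\<dots> \<le> 2 powr (p - 1) * Y powr p" by simp
      also have "2 powr (p - 1) * Y powr p = 2 powr (p - 1) * e powr p * A powr p"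
        by (simp add: Y_def powr_mult)
      also have "\<dots> \<le> 2 powr (p - 1) * e powr p * (A powr p + B powr p)"
        by (intro mult_left_mono) auto
      finally show "- (J p (a - b) * (A * zx - B * zy)) \<le> 2 powr (p - 1) * e powr p * (A powr p + B powr p)" .
    qed
  qed
  show ?thesis
  proof (cases "b \<le> a")
    case True
    then show ?thesis using main z osc by blast
  next
    case False
    have "J p (a - b) = - J p (b - a)" using J_minus[of p "b - a"] by simp
    then have "J p (a - b) * (max (a - k) 0 * zx - max (b - k) 0 * zy)
        = J p (b - a) * (max (b - k) 0 * zy - max (a - k) 0 * zx)" by (simp add: algebra_simps)
    then show ?thesis
      using main[of a b zy zx] False z osc by (simp add: max.commute abs_minus_commute add.commute)
  qed
qed

text \<open>If the far value \<open>b\<close> exceeds \<open>a\<close>, then their difference is at most \<open>b\<close>, because \<open>a\<close> lies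
  above the nonnegative level; in the other case the sign is good.\<close>

lemma nonlocal_far_bound:
  fixes a b k z p :: real
  assumes p: "2 \<le> p" and "0 \<le> k" "0 \<le> z"
  shows "- (J p (a - b) * (max (a - k) 0 * z)) \<le> max b 0 powr (p - 1) * (max (a - k) 0 * z)"
proof (cases "a \<le> k \<or> b \<le> a")
  case True
  have "0 \<le> J p (a - b) * (max (a - k) 0 * z)"
    using True assms J_nonneg[of "a - b" p] by auto
  moreover have "0 \<le> max b 0 powr (p - 1) * (max (a - k) 0 * z)" using assms by simp
  ultimately show ?thesis by linarith
next
  case False
  then have ab: "0 \<le> b - a" "b - a \<le> b" "0 \<le> b" using assms by auto
  have "- J p (a - b) = J p (b - a)" using J_minus[of p "b - a"] by simp
  also have "\<dots> = (b - a) powr (p - 1)" using ab p by (simp add: J_pos)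
  also have "\<dots> \<le> max b 0 powr (p - 1)" using ab p by (intro powr_mono2) auto
  finally have "- J p (a - b) * (max (a - k) 0 * z) \<le> max b 0 powr (p - 1) * (max (a - k) 0 * z)"
    using assms by (intro mult_right_mono) auto
  then show ?thesis by simp
qed

subsection \<open>The nonlocal term\<close>

lemma integral_le_of_nn_integral:
  fixes f :: "'a \<Rightarrow> real"
  assumes "(\<integral>\<^sup>+x. ennreal (f x) \<partial>M) \<le> ennreal Q" "0 \<le> Q"
  shows "integral\<^sup>L M f \<le> Q"
proof (cases "integrable M f")
  case True
  have "enn2real (\<integral>\<^sup>+x. ennreal (f x) \<partial>M) \<le> enn2real (ennreal Q)"
    using assms by (intro enn2real_mono) auto
  moreover have "integral\<^sup>L M f \<le> enn2real (\<integral>\<^sup>+x. ennreal (f x) \<partial>M)"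
    unfolding real_lebesgue_integral_def[OF True] by simp
  ultimately show ?thesis using assms(2) by simp
qed (use assms in \<open>simp add: not_integrable_integral_eq\<close>)

lemma good_cutoffD:
  assumes "good_cutoff p M x0 r \<zeta> Z"
  shows "C1_gradient \<zeta> Z" "0 \<le> \<zeta> x" "\<zeta> x \<le> 1" "x \<notin> cball x0 r \<Longrightarrow> \<zeta> x = 0"
    "\<bar>\<zeta> x - \<zeta> y\<bar> \<le> M * max (\<zeta> x) (\<zeta> y) powr (1 - 1 / p) * norm (x - y)"
    "norm (Z x) \<le> M * \<zeta> x powr (1 - 1 / p)"
    "\<zeta> \<in> borel_measurable borel" "Z \<in> borel_measurable borel"
  using assms C1_gradient_measurable unfolding good_cutoff_def by auto

text \<open>Pairs of points of the ball contribute through the oscillation of the cutoff, other pairs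
  through the tail. A nonlocal form that fails to converge is zero by convention and satisfies
  the bound trivially.\<close>

lemma nonlocal_form_lower:
  assumes p: "2 \<le> p" and s: "0 < s" "s < 1"
  obtains C where "0 < C"
    "\<And>(u :: 'a::euclidean_space \<Rightarrow> real) x0 r r' M \<zeta> Z k \<Theta> W W1.
      u \<in> borel_measurable borel \<Longrightarrow> 0 < r \<Longrightarrow> r' < r \<Longrightarrow> 0 \<le> k \<Longrightarrow> 0 \<le> M \<Longrightarrow> good_cutoff p M x0 r' \<zeta> Z \<Longrightarrow>
      (\<And>x. x \<in> cball x0 r' \<Longrightarrow> (\<integral>\<^sup>+y. indicator (- ball x0 r) y *
          ennreal (max (u y) 0 powr (p - 1) / norm (x - y) powr (real DIM('a) + s * p)) \<partial>lborel) \<le> ennreal \<Theta>) \<Longrightarrow> 0 \<le> \<Theta> \<Longrightarrow>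
      (\<integral>\<^sup>+x. indicator (ball x0 r) x * ennreal (max (u x - k) 0 powr p) \<partial>lborel) \<le> ennreal W \<Longrightarrow> 0 \<le> W \<Longrightarrow>
      (\<integral>\<^sup>+x. ennreal (max (u x - k) 0 * \<zeta> x) \<partial>lborel) \<le> ennreal W1 \<Longrightarrow> 0 \<le> W1 \<Longrightarrow>
      - nonlocal_form p s u (\<lambda>x. max (u x - k) 0 * \<zeta> x) \<le> C * M powr p * r powr (p - s * p) * W + 2 * \<Theta> * W1"
proof -
  define N where "N = real DIM('a)"
  define e where "e = N + s * p"
  have a: "0 < p - s * p" using p s by (simp add: mult_less_cancel_right2)
  obtain C3 where C3: "0 < C3" "\<And>\<rho>. 0 < \<rho> \<Longrightarrow>
      (\<integral>\<^sup>+w. indicator (ball (0::'a) \<rho>) w * ennreal (norm w powr (p - s * p - real DIM('a))) \<partial>lborel)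
      \<le> ennreal (C3 * \<rho> powr (p - s * p))"
    using kernel_integral[OF a, where 'a='a] by blast
  define C where "C = 2 * (2 powr (p - 1) * (C3 * 2 powr (p - s * p)))"
  have C: "0 < C" using C3 by (simp add: C_def)
  have main: "- nonlocal_form p s u (\<lambda>x. max (u x - k) 0 * \<zeta> x) \<le> C * M powr p * r powr (p - s * p) * W + 2 * \<Theta> * W1"
    if u[measurable]: "u \<in> borel_measurable borel" and r: "0 < r" "r' < r" and k: "0 \<le> k" and M: "0 \<le> M"
      and cut: "good_cutoff p M x0 r' \<zeta> Z"
      and \<Theta>: "\<And>x. x \<in> cball x0 r' \<Longrightarrow> (\<integral>\<^sup>+y. indicator (- ball x0 r) y *
          ennreal (max (u y) 0 powr (p - 1) / norm (x - y) powr (real DIM('a) + s * p)) \<partial>lborel) \<le> ennreal \<Theta>" "0 \<le> \<Theta>"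
      and W: "(\<integral>\<^sup>+x. indicator (ball x0 r) x * ennreal (max (u x - k) 0 powr p) \<partial>lborel) \<le> ennreal W" "0 \<le> W"
      and W1: "(\<integral>\<^sup>+x. ennreal (max (u x - k) 0 * \<zeta> x) \<partial>lborel) \<le> ennreal W1" "0 \<le> W1"
    for u :: "'a \<Rightarrow> real" and x0 r r' M \<zeta> Z k \<Theta> W W1
  proof -
    have \<zeta>m[measurable]: "\<zeta> \<in> borel_measurable borel" by (rule good_cutoffD[OF cut])
    define U where "U = ball x0 r"
    have Um[measurable]: "U \<in> sets borel" by (simp add: U_def)
    define w where "w x = max (u x - k) 0" for x
    have wm[measurable]: "w \<in> borel_measurable borel" unfolding w_def[abs_def] by measurable
    have w0: "0 \<le> w x" for x by (simp add: w_def)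
    define \<phi> where "\<phi> x = w x * \<zeta> x" for x
    have \<phi>m[measurable]: "\<phi> \<in> borel_measurable borel" unfolding \<phi>_def[abs_def] by measurable
    have \<phi>0: "0 \<le> \<phi> x" for x using w0 good_cutoffD(2)[OF cut] by (simp add: \<phi>_def)
    have \<phi>U: "\<phi> x = 0" if "x \<notin> U" for x
    proof -
      have "x \<notin> cball x0 r'" using that r by (auto simp: U_def)
      then show ?thesis using good_cutoffD(4)[OF cut] by (simp add: \<phi>_def)
    qed
    define c where "c = 2 powr (p - 1) * M powr p"
    have c0: "0 \<le> c" by (simp add: c_def)
    \<comment> \<open>The integrand is bounded below by \<open>- (h x y + h y x)\<close>, where \<open>h1\<close> majorises pairs inside the ball
      and \<open>h2\<close> pairs with one point outside.\<close>
    define h1 where "h1 x y = indicator U x * indicator U y * (c * w x powr p * norm (x - y) powr (p - e))" for x y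
    define h2 where "h2 x y = indicator (- U) y * (\<phi> x * (max (u y) 0 powr (p - 1) / norm (x - y) powr e))" for x y
    define h where "h x y = h1 x y + h2 x y" for x y
    have h0: "0 \<le> h1 x y" "0 \<le> h2 x y" "0 \<le> h x y" for x y
      using c0 \<phi>0[of x] by (auto simp: h1_def h2_def h_def)
    have hm[measurable]: "(\<lambda>z. h1 (fst z) (snd z)) \<in> borel_measurable (borel \<Otimes>\<^sub>M borel)"
      "(\<lambda>z. h2 (fst z) (snd z)) \<in> borel_measurable (borel \<Otimes>\<^sub>M borel)"
      unfolding h1_def h2_def by measurable
    have h1m[measurable]: "h1 x \<in> borel_measurable borel" and h2m[measurable]: "h2 x \<in> borel_measurable borel" for x
      unfolding h1_def[abs_def] h2_def[abs_def] by measurable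
    define I where "I x y = J p (u x - u y) * (\<phi> x - \<phi> y) / norm (x - y) powr e" for x y
    have I: "- I x y \<le> h x y + h y x" for x y
    proof (cases "x = y")
      case True
      then show ?thesis using h0(3)[of x y] h0(3)[of y x] by (simp add: I_def)
    next
      case False
      then have n: "0 < norm (x - y)" by simp
      have div: "- I x y = - (J p (u x - u y) * (\<phi> x - \<phi> y)) / norm (x - y) powr e" by (simp add: I_def)
      consider "x \<in> U" "y \<in> U" | "x \<in> U" "y \<notin> U" | "x \<notin> U" "y \<in> U" | "x \<notin> U" "y \<notin> U" by blast
      then show ?thesis
      proof cases
        case 1
        have "- (J p (u x - u y) * (\<phi> x - \<phi> y)) \<le> 2 powr (p - 1) * (M * norm (x - y)) powr p * (w x powr p + w y powr p)"
          unfolding \<phi>_def w_def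
        proof (rule nonlocal_near_bound[OF p])
          show "\<bar>\<zeta> x - \<zeta> y\<bar> \<le> M * norm (x - y) * max (\<zeta> x) (\<zeta> y) powr (1 - 1 / p)"
            using good_cutoffD(5)[OF cut, of x y] by (simp add: mult_ac)
        qed (use good_cutoffD(2,3)[OF cut] M in auto)
        also have "\<dots> = c * (w x powr p + w y powr p) * norm (x - y) powr p"
          by (simp add: c_def powr_mult)
        finally have "- I x y \<le> c * (w x powr p + w y powr p) * norm (x - y) powr p / norm (x - y) powr e"
          unfolding div by (intro divide_right_mono) auto
        also have "\<dots> = c * (w x powr p + w y powr p) * norm (x - y) powr (p - e)"
          using n by (simp add: powr_diff)
        also have "\<dots> = h1 x y + h1 y x" using 1 by (simp add: h1_def norm_minus_commute algebra_simps)
        finally show ?thesis using h0(2)[of x y] h0(2)[of y x] by (simp add: h_def)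
      next
        case 2
        have "- (J p (u x - u y) * \<phi> x) \<le> max (u y) 0 powr (p - 1) * \<phi> x"
          unfolding \<phi>_def w_def by (rule nonlocal_far_bound[OF p k good_cutoffD(2)[OF cut]])
        then have "- I x y \<le> (max (u y) 0 powr (p - 1) * \<phi> x) / norm (x - y) powr e"
          unfolding div using \<phi>U[OF 2(2)] by (intro divide_right_mono) auto
        also have "\<dots> = h2 x y" using 2 by (simp add: h2_def)
        finally show ?thesis using h0(1)[of x y] h0(3)[of y x] by (simp add: h_def)
      next
        case 3
        have "- (J p (u y - u x) * \<phi> y) \<le> max (u x) 0 powr (p - 1) * \<phi> y"
          unfolding \<phi>_def w_def by (rule nonlocal_far_bound[OF p k good_cutoffD(2)[OF cut]])
        moreover have "J p (u x - u y) = - J p (u y - u x)" using J_minus[of p "u y - u x"] by simp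
        ultimately have "- I x y \<le> (max (u x) 0 powr (p - 1) * \<phi> y) / norm (x - y) powr e"
          unfolding div using \<phi>U[OF 3(1)] by (intro divide_right_mono) auto
        also have "\<dots> = h2 y x" using 3 by (simp add: h2_def norm_minus_commute)
        finally show ?thesis using h0(1)[of y x] h0(3)[of x y] by (simp add: h_def)
      next
        case 4
        then show ?thesis using \<phi>U h0(3)[of x y] h0(3)[of y x] by (simp add: I_def)
      qed
    qed
    define Q where "Q = c * (C3 * (2 * r) powr (p - s * p)) * W + \<Theta> * W1"
    have Q0: "0 \<le> Q" using c0 C3 W \<Theta> W1 by (simp add: Q_def)
    have int_h: "(\<integral>\<^sup>+x. \<integral>\<^sup>+y. ennreal (h x y) \<partial>lborel \<partial>lborel) \<le> ennreal Q"
    proof -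
      have "(\<integral>\<^sup>+y. ennreal (h x y) \<partial>lborel)
          \<le> ennreal (c * (C3 * (2 * r) powr (p - s * p))) * (indicator U x * ennreal (w x powr p)) + ennreal \<Theta> * ennreal (\<phi> x)" for x
      proof -
        have "(\<integral>\<^sup>+y. ennreal (h x y) \<partial>lborel) = (\<integral>\<^sup>+y. ennreal (h1 x y) \<partial>lborel) + (\<integral>\<^sup>+y. ennreal (h2 x y) \<partial>lborel)"
          by (simp add: h_def h0 ennreal_plus nn_integral_add)
        moreover have "(\<integral>\<^sup>+y. ennreal (h1 x y) \<partial>lborel)
            \<le> ennreal (c * (C3 * (2 * r) powr (p - s * p))) * (indicator U x * ennreal (w x powr p))"
        proof (cases "x \<in> U")
          case True
          have pe: "p - e = p - s * p - real DIM('a)" by (simp add: e_def N_def)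
          have "(\<integral>\<^sup>+y. ennreal (h1 x y) \<partial>lborel)
              \<le> (\<integral>\<^sup>+y. ennreal (c * w x powr p) * (indicator (ball 0 (2 * r)) (x - y) * ennreal (norm (x - y) powr (p - s * p - real DIM('a)))) \<partial>lborel)"
          proof (rule nn_integral_mono)
            fix y
            have "norm (x - y) \<le> norm (x0 - x) + norm (x0 - y)"
              using norm_triangle_ineq4[of "x0 - y" "x0 - x"] by simp
            then have "y \<in> U \<Longrightarrow> x - y \<in> ball 0 (2 * r)"
              unfolding mem_ball_0 using True by (simp add: U_def dist_norm)
            then show "ennreal (h1 x y) \<le> ennreal (c * w x powr p) *
                (indicator (ball 0 (2 * r)) (x - y) * ennreal (norm (x - y) powr (p - s * p - real DIM('a))))"
              using True c0 by (cases "y \<in> U") (simp_all add: h1_def pe ennreal_mult)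
          qed
          also have "\<dots> = ennreal (c * w x powr p) * (\<integral>\<^sup>+y. indicator (ball 0 (2 * r)) (x - y) * ennreal (norm (x - y) powr (p - s * p - real DIM('a))) \<partial>lborel)"
            by (rule nn_integral_cmult) measurable
          also have "(\<integral>\<^sup>+y. indicator (ball 0 (2 * r)) (x - y) * ennreal (norm (x - y) powr (p - s * p - real DIM('a))) \<partial>lborel)
              = (\<integral>\<^sup>+z. indicator (ball (0::'a) (2 * r)) z * ennreal (norm z powr (p - s * p - real DIM('a))) \<partial>lborel)"
            by (rule nn_integral_lborel_reflect[of "\<lambda>z. indicator (ball 0 (2 * r)) z * ennreal (norm z powr (p - s * p - real DIM('a)))"]) measurable
          also have "\<dots> \<le> ennreal (C3 * (2 * r) powr (p - s * p))" by (rule C3(2)) (use r in simp)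
          finally have "(\<integral>\<^sup>+y. ennreal (h1 x y) \<partial>lborel) \<le> ennreal (c * w x powr p) * ennreal (C3 * (2 * r) powr (p - s * p))"
            by (simp add: mult_left_mono)
          also have "\<dots> = ennreal (c * (C3 * (2 * r) powr (p - s * p))) * (indicator U x * ennreal (w x powr p))"
            using True c0 C3 by (simp add: mult_ac flip: ennreal_mult)
          finally show ?thesis .
        qed (simp add: h1_def)
        moreover have "(\<integral>\<^sup>+y. ennreal (h2 x y) \<partial>lborel) \<le> ennreal \<Theta> * ennreal (\<phi> x)"
        proof (cases "x \<in> cball x0 r'")
          case True
          have "(\<integral>\<^sup>+y. ennreal (h2 x y) \<partial>lborel)
              = (\<integral>\<^sup>+y. ennreal (\<phi> x) * (indicator (- ball x0 r) y * ennreal (max (u y) 0 powr (p - 1) / norm (x - y) powr (real DIM('a) + s * p))) \<partial>lborel)"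
          proof (rule nn_integral_cong)
            fix y
            show "ennreal (h2 x y) = ennreal (\<phi> x) * (indicator (- ball x0 r) y *
                ennreal (max (u y) 0 powr (p - 1) / norm (x - y) powr (real DIM('a) + s * p)))"
            proof (cases "y \<in> U")
              case False
              then have "h2 x y = \<phi> x * (max (u y) 0 powr (p - 1) / norm (x - y) powr (real DIM('a) + s * p))"
                by (simp add: h2_def e_def N_def)
              then show ?thesis using False by (simp only: ennreal_mult'[OF \<phi>0]) (simp add: U_def)
            qed (simp add: h2_def U_def)
          qed
          also have "\<dots> = ennreal (\<phi> x) * (\<integral>\<^sup>+y. indicator (- ball x0 r) y * ennreal (max (u y) 0 powr (p - 1) / norm (x - y) powr (real DIM('a) + s * p)) \<partial>lborel)"
            by (rule nn_integral_cmult) measurable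
          also have "\<dots> \<le> ennreal (\<phi> x) * ennreal \<Theta>" by (intro mult_left_mono \<Theta>(1)[OF True]) simp
          finally show ?thesis by (simp add: mult.commute)
        next
          case False
          then have "\<phi> x = 0" using good_cutoffD(4)[OF cut] by (simp add: \<phi>_def)
          then show ?thesis by (simp add: h2_def)
        qed
        ultimately show ?thesis by (simp add: add_mono)
      qed
      then have "(\<integral>\<^sup>+x. \<integral>\<^sup>+y. ennreal (h x y) \<partial>lborel \<partial>lborel)
          \<le> (\<integral>\<^sup>+x. ennreal (c * (C3 * (2 * r) powr (p - s * p))) * (indicator U x * ennreal (w x powr p)) + ennreal \<Theta> * ennreal (\<phi> x) \<partial>lborel)"
        by (rule nn_integral_mono)
      also have "\<dots> = ennreal (c * (C3 * (2 * r) powr (p - s * p))) * (\<integral>\<^sup>+x. indicator U x * ennreal (w x powr p) \<partial>lborel)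
          + ennreal \<Theta> * (\<integral>\<^sup>+x. ennreal (\<phi> x) \<partial>lborel)"
        by (subst nn_integral_add) (measurable, simp add: nn_integral_cmult)
      also have "\<dots> \<le> ennreal (c * (C3 * (2 * r) powr (p - s * p))) * ennreal W + ennreal \<Theta> * ennreal W1"
        using W(1) W1(1) unfolding U_def w_def \<phi>_def by (intro add_mono mult_left_mono) auto
      also have "\<dots> = ennreal Q"
        unfolding Q_def using c0 C3 W(2) W1(2) \<Theta>(2) by (simp flip: ennreal_mult ennreal_plus)
      finally show ?thesis .
    qed
    have hs[measurable]: "(\<lambda>z. h (fst z) (snd z)) \<in> borel_measurable (borel \<Otimes>\<^sub>M borel)"
      unfolding h_def by measurable
    have hs1[measurable]: "h x \<in> borel_measurable borel" and hs2[measurable]: "(\<lambda>y. h y x) \<in> borel_measurable borel" for x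
      using measurable_compose[OF _ hs, of "\<lambda>y. (x, y)" borel] measurable_compose[OF _ hs, of "\<lambda>y. (y, x)" borel] by simp_all
    have hc[measurable]: "(\<lambda>(x, y). ennreal (h x y)) \<in> borel_measurable (lborel \<Otimes>\<^sub>M lborel)"
      "(\<lambda>(x, y). ennreal (h y x)) \<in> borel_measurable (lborel \<Otimes>\<^sub>M lborel)"
      using measurable_compose[OF _ hs, of "\<lambda>z. (snd z, fst z)" "borel \<Otimes>\<^sub>M borel"] hs
      by (simp_all add: case_prod_beta)
    have int_h': "(\<integral>\<^sup>+x. \<integral>\<^sup>+y. ennreal (h y x) \<partial>lborel \<partial>lborel) \<le> ennreal Q"
      using lborel_pair.Fubini'[OF hc(1)] int_h by simp
    have "(\<integral>\<^sup>+z. ennreal ((\<lambda>(x, y). - I x y) z) \<partial>(lborel \<Otimes>\<^sub>M lborel))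
        \<le> (\<integral>\<^sup>+z. (\<lambda>(x, y). ennreal (h x y)) z + (\<lambda>(x, y). ennreal (h y x)) z \<partial>(lborel \<Otimes>\<^sub>M lborel))"
      using I h0(3) by (intro nn_integral_mono) (auto simp: ennreal_leI simp flip: ennreal_plus)
    also have "\<dots> = (\<integral>\<^sup>+z. (\<lambda>(x, y). ennreal (h x y)) z \<partial>(lborel \<Otimes>\<^sub>M lborel))
        + (\<integral>\<^sup>+z. (\<lambda>(x, y). ennreal (h y x)) z \<partial>(lborel \<Otimes>\<^sub>M lborel))"
      by (rule nn_integral_add) (rule hc)+
    also have "\<dots> \<le> ennreal Q + ennreal Q"
      using int_h int_h' lborel.nn_integral_fst[OF hc(1)] lborel.nn_integral_fst[OF hc(2)]
      by (intro add_mono) simp_all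
    also have "\<dots> = ennreal (2 * Q)" using Q0 by (simp flip: ennreal_plus)
    finally have "integral\<^sup>L (lborel \<Otimes>\<^sub>M lborel) (\<lambda>(x, y). - I x y) \<le> 2 * Q"
      by (rule integral_le_of_nn_integral) (use Q0 in simp)
    moreover have "nonlocal_form p s u (\<lambda>x. max (u x - k) 0 * \<zeta> x) = integral\<^sup>L (lborel \<Otimes>\<^sub>M lborel) (\<lambda>(x, y). I x y)"
      unfolding nonlocal_form_def I_def \<phi>_def w_def e_def N_def ..
    moreover have "integral\<^sup>L (lborel \<Otimes>\<^sub>M lborel) (\<lambda>(x, y). - I x y) = - integral\<^sup>L (lborel \<Otimes>\<^sub>M lborel) (\<lambda>(x, y). I x y)"
    proof -
      have "(\<lambda>(x, y). - I x y) = (\<lambda>z. - (case z of (x, y) \<Rightarrow> I x y))" by auto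
      then show ?thesis by (simp only: Bochner_Integration.integral_minus)
    qed
    ultimately have "- nonlocal_form p s u (\<lambda>x. max (u x - k) 0 * \<zeta> x) \<le> 2 * Q" by simp
    also have "2 * Q = C * M powr p * r powr (p - s * p) * W + 2 * \<Theta> * W1"
      using r by (simp add: Q_def C_def c_def powr_mult algebra_simps)
    finally show ?thesis .
  qed
  show ?thesis by (rule that[OF C]) (rule main, assumption+)
qed

subsection \<open>The energy estimate\<close>

lemma tail_space_measurable:
  fixes u :: "'a::euclidean_space \<Rightarrow> real"
  assumes "in_tail_space m \<alpha> u"
  shows "u \<in> borel_measurable borel"
proof (rule borel_measurable_LIMSEQ_metric)
  fix n :: nat
  have "in_Lp (ereal m) (cball 0 (real n)) u"
    using assms unfolding in_tail_space_def in_Lp_loc_def by auto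
  then show "restr (cball 0 (real n)) u \<in> borel_measurable borel" by (simp add: in_Lp_iff)
next
  fix x :: 'a
  obtain k :: nat where k: "norm x \<le> real k" using real_arch_simple by blast
  show "(\<lambda>n. restr (cball 0 (real n)) u x) \<longlonglongrightarrow> u x"
  proof (rule tendsto_eventually)
    show "\<forall>\<^sub>F n in sequentially. restr (cball 0 (real n)) u x = u x"
      using eventually_ge_at_top[of k] by eventually_elim (use k in \<open>auto intro!: restr_in\<close>)
  qed
qed

lemma has_weak_gradient_restr:
  assumes "has_weak_gradient K u G" shows "has_weak_gradient K u (restr K G)"
proof -
  have "restr S (restr K G) = restr S G" if "S \<subseteq> K" for S
  proof (rule ext)
    fix x show "restr S (restr K G) x = restr S G x" using that by (cases "x \<in> S") auto
  qed
  then have "in_Lp_loc (ereal 1) K (restr K G)"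
    using assms unfolding has_weak_gradient_def in_Lp_loc_def by (auto simp: in_Lp_iff one_ereal_def)
  moreover have "(LINT x:K|lborel. (restr K G x \<bullet> i) * \<phi> x) = (LINT x:K|lborel. (G x \<bullet> i) * \<phi> x)" for i \<phi>
    unfolding set_lebesgue_integral_def by (rule Bochner_Integration.integral_cong) (auto simp: indicator_def)
  ultimately show ?thesis
    using assms unfolding has_weak_gradient_def by (auto simp: one_ereal_def)
qed

lemma powr_mult_le_sum:
  fixes g v p :: real
  assumes "0 \<le> g" "0 \<le> v" "2 \<le> p"
  shows "g powr (p - 2) * (g * v) \<le> g powr p + v powr p"
proof -
  define m where "m = max g v"
  have m: "0 \<le> m" "g \<le> m" "v \<le> m" using assms by (auto simp: m_def)
  have "g powr (p - 2) * (g * v) \<le> m powr (p - 2) * (m * m)"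
    using m assms by (intro mult_mono powr_mono2) auto
  also have "\<dots> = m powr p"
  proof (cases "m = 0")
    case False
    then have "m powr (p - 2) * m powr 2 = m powr p" by (subst powr_add[symmetric]) simp
    then show ?thesis using m False by (simp add: powr_numeral power2_eq_square)
  qed simp
  also have "\<dots> \<le> g powr p + v powr p" by (simp add: m_def max_def)
  finally show ?thesis .
qed

text \<open>Testing the equation with the truncated solution times a cutoff function controls
  the full gradient of that test function, so that the Sobolev inequality applies to it directly.\<close>

lemma Caccioppoli:
  assumes p: "2 \<le> p" and s: "0 < s" "s < 1"
  obtains C where "0 < C"
    "\<And>A (\<Omega> :: 'a::euclidean_space set) u f x0 R r r' M \<zeta> Z k \<Theta> W W1.
      weak_solution p s A \<Omega> f u \<Longrightarrow> 0 \<le> A \<Longrightarrow> A \<le> 1 \<Longrightarrow> R < 1 \<Longrightarrow> ball x0 R \<Subset> \<Omega> \<Longrightarrow>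
      0 < r \<Longrightarrow> r' < r \<Longrightarrow> r \<le> R \<Longrightarrow> 0 \<le> k \<Longrightarrow> 0 \<le> M \<Longrightarrow> good_cutoff p M x0 r' \<zeta> Z \<Longrightarrow>
      (\<And>x. x \<in> cball x0 r' \<Longrightarrow> (\<integral>\<^sup>+y. indicator (- ball x0 r) y *
          ennreal (max (u y) 0 powr (p - 1) / norm (x - y) powr (real DIM('a) + s * p)) \<partial>lborel) \<le> ennreal \<Theta>) \<Longrightarrow> 0 \<le> \<Theta> \<Longrightarrow>
      (\<integral>\<^sup>+x. indicator (ball x0 r) x * ennreal (max (u x - k) 0 powr p) \<partial>lborel) \<le> ennreal W \<Longrightarrow> 0 \<le> W \<Longrightarrow>
      (\<integral>\<^sup>+x. ennreal (max (u x - k) 0 * \<zeta> x) \<partial>lborel) \<le> ennreal W1 \<Longrightarrow> 0 \<le> W1 \<Longrightarrow>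
      \<exists>V. W0_limit (ball x0 R) p (\<lambda>x. max (u x - k) 0 * \<zeta> x) V \<and> pint p V < \<infinity> \<and>
        (\<forall>F\<ge>0. (\<integral>\<^sup>+x. indicator (ball x0 R) x * ennreal (\<bar>f x\<bar> * (max (u x - k) 0 * \<zeta> x)) \<partial>lborel) \<le> ennreal F \<longrightarrow>
          pint p V \<le> ennreal (C * (M powr p * W + \<Theta> * W1 + F)))"
proof -
  obtain C9 where C9: "0 < C9"
    "\<And>(u :: 'a \<Rightarrow> real) x0 r r' M \<zeta> Z k \<Theta> W W1.
      u \<in> borel_measurable borel \<Longrightarrow> 0 < r \<Longrightarrow> r' < r \<Longrightarrow> 0 \<le> k \<Longrightarrow> 0 \<le> M \<Longrightarrow> good_cutoff p M x0 r' \<zeta> Z \<Longrightarrow>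
      (\<And>x. x \<in> cball x0 r' \<Longrightarrow> (\<integral>\<^sup>+y. indicator (- ball x0 r) y *
          ennreal (max (u y) 0 powr (p - 1) / norm (x - y) powr (real DIM('a) + s * p)) \<partial>lborel) \<le> ennreal \<Theta>) \<Longrightarrow> 0 \<le> \<Theta> \<Longrightarrow>
      (\<integral>\<^sup>+x. indicator (ball x0 r) x * ennreal (max (u x - k) 0 powr p) \<partial>lborel) \<le> ennreal W \<Longrightarrow> 0 \<le> W \<Longrightarrow>
      (\<integral>\<^sup>+x. ennreal (max (u x - k) 0 * \<zeta> x) \<partial>lborel) \<le> ennreal W1 \<Longrightarrow> 0 \<le> W1 \<Longrightarrow>
      - nonlocal_form p s u (\<lambda>x. max (u x - k) 0 * \<zeta> x) \<le> C9 * M powr p * r powr (p - s * p) * W + 2 * \<Theta> * W1"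
    using nonlocal_form_lower[OF p s, where 'a='a] by blast
  \<comment> \<open>The powers of \<open>2\<close> are those of the local energy bound.\<close>
  define C where "C = 2 powr (p + 1) * (C9 + 2) + 2 powr (2 * p + 1)"
  have C: "0 < C" using C9 by (simp add: C_def add_pos_pos)
  have main: "\<exists>V. W0_limit (ball x0 R) p (\<lambda>x. max (u x - k) 0 * \<zeta> x) V \<and> pint p V < \<infinity> \<and>
        (\<forall>F\<ge>0. (\<integral>\<^sup>+x. indicator (ball x0 R) x * ennreal (\<bar>f x\<bar> * (max (u x - k) 0 * \<zeta> x)) \<partial>lborel) \<le> ennreal F \<longrightarrow>
          pint p V \<le> ennreal (C * (M powr p * W + \<Theta> * W1 + F)))"
    if sol: "weak_solution p s A \<Omega> f u" and A: "0 \<le> A" "A \<le> 1" and R: "R < 1" "ball x0 R \<Subset> \<Omega>"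
      and r: "0 < r" "r' < r" "r \<le> R" and k: "0 \<le> k" and M: "0 \<le> M" and cut: "good_cutoff p M x0 r' \<zeta> Z"
      and \<Theta>: "\<And>x. x \<in> cball x0 r' \<Longrightarrow> (\<integral>\<^sup>+y. indicator (- ball x0 r) y *
          ennreal (max (u y) 0 powr (p - 1) / norm (x - y) powr (real DIM('a) + s * p)) \<partial>lborel) \<le> ennreal \<Theta>" "0 \<le> \<Theta>"
      and W: "(\<integral>\<^sup>+x. indicator (ball x0 r) x * ennreal (max (u x - k) 0 powr p) \<partial>lborel) \<le> ennreal W" "0 \<le> W"
      and W1: "(\<integral>\<^sup>+x. ennreal (max (u x - k) 0 * \<zeta> x) \<partial>lborel) \<le> ennreal W1" "0 \<le> W1"
    for A and \<Omega> :: "'a set" and u f x0 R r r' M \<zeta> Z k \<Theta> W W1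
  proof -
    define K where "K = ball x0 R"
    have um[measurable]: "u \<in> borel_measurable borel"
      using sol tail_space_measurable unfolding weak_solution_def by blast
    note \<zeta>m[measurable] = good_cutoffD(7)[OF cut] and Zm[measurable] = good_cutoffD(8)[OF cut]
    have Km[measurable]: "K \<in> sets borel" by (simp add: K_def)
    have K: "open K" "K \<Subset> \<Omega>" using R by (auto simp: K_def)
    have "in_W1p p K u" using sol K unfolding weak_solution_def in_W1p_loc_def by blast
    then obtain G0 where G0: "has_weak_gradient K u G0" "in_Lp (ereal p) K G0" and uL: "in_Lp (ereal p) K u"
      unfolding in_W1p_def by blast
    define G where "G = restr K G0"
    have wgG: "has_weak_gradient K u G" unfolding G_def by (rule has_weak_gradient_restr[OF G0(1)])
    have Gm[measurable]: "G \<in> borel_measurable borel" and Gfin: "pint p G < \<infinity>"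
      using G0(2) by (auto simp: G_def in_Lp_iff)
    have Gout: "G x = 0" if "x \<notin> K" for x using that by (simp add: G_def)
    have rG: "restr K G = G" by (rule restr_id[OF Gout])
    have ufin: "pint p (restr K u) < \<infinity>" using uL by (simp add: in_Lp_iff)
    have rum[measurable]: "restr K u \<in> borel_measurable borel" by (rule restr_measurable[OF um Km])
    define w where "w x = max (u x - k) 0" for x
    have wm[measurable]: "w \<in> borel_measurable borel" unfolding w_def[abs_def] by measurable
    have w0: "0 \<le> w x" "w x \<le> \<bar>u x\<bar>" for x using k by (auto simp: w_def)
    define \<phi> where "\<phi> x = w x * \<zeta> x" for x
    define V where "V x = w x *\<^sub>R Z x + \<zeta> x *\<^sub>R (if k < u x then 1 else 0) *\<^sub>R G x" for x
    have sub: "cball x0 r' \<subseteq> ball x0 r" "ball x0 r \<subseteq> K" using r by (auto simp: K_def)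
    have \<zeta>out: "\<zeta> x = 0" "Z x = 0" if "x \<notin> cball x0 r'" for x
    proof -
      show "\<zeta> x = 0" using good_cutoffD(4)[OF cut that] .
      show "Z x = 0"
        by (rule gradient_zero_outside_support[OF good_cutoffD(1)[OF cut] good_cutoffD(4)[OF cut] closed_cball that])
    qed
    have W0: "W0_limit K p \<phi> V"
      unfolding K_def \<phi>_def V_def w_def
      by (rule W0_limit_pos_part[OF um Gm])
        (use wgG ufin Gfin rG good_cutoffD[OF cut] r p in \<open>auto simp: K_def[symmetric]\<close>)
    then have \<phi>m[measurable]: "\<phi> \<in> borel_measurable borel" and Vm[measurable]: "V \<in> borel_measurable borel"
      by (auto simp: W0_limit_def)
    have out: "\<phi> x = 0" "V x = 0" if "x \<notin> K" for x
    proof -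
      have "x \<notin> cball x0 r'" using that sub by blast
      then show "\<phi> x = 0" "V x = 0" using \<zeta>out[of x] by (simp_all add: \<phi>_def V_def)
    qed
    have \<phi>fin: "pint p \<phi> < \<infinity>"
    proof -
      have "pint p \<phi> \<le> pint p (restr K u)"
      proof (rule pint_mono)
        show "norm (\<phi> x) \<le> norm (restr K u x)" for x
        proof (cases "x \<in> K")
          case True
          have "w x * \<zeta> x \<le> \<bar>u x\<bar> * 1" using w0 good_cutoffD(2,3)[OF cut] by (intro mult_mono) auto
          then show ?thesis using True w0 good_cutoffD(2)[OF cut] by (simp add: \<phi>_def abs_mult)
        qed (simp add: out)
      qed (use p in simp)
      then show ?thesis using ufin by simp
    qed
    have Zb: "norm (Z x) \<le> M" for x
    proof -
      have "\<zeta> x powr (1 - 1 / p) \<le> 1" using good_cutoffD(2,3)[OF cut] p by (intro powr_le1) auto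
      then have "M * \<zeta> x powr (1 - 1 / p) \<le> M" using M by (simp add: mult_left_le)
      then show ?thesis using good_cutoffD(6)[OF cut, of x] by simp
    qed
    have Vfin: "pint p V < \<infinity>"
    proof -
      have "pint p (\<lambda>x. w x *\<^sub>R Z x) \<le> pint p (\<lambda>x. M *\<^sub>R restr K u x)"
      proof (rule pint_mono)
        show "norm (w x *\<^sub>R Z x) \<le> norm (M *\<^sub>R restr K u x)" for x
        proof (cases "x \<in> K")
          case True
          have "w x * norm (Z x) \<le> \<bar>u x\<bar> * M" using w0 Zb by (intro mult_mono) auto
          then show ?thesis using True w0 M by (simp add: abs_mult mult.commute)
        next
          case False
          then have "x \<notin> cball x0 r'" using sub by blast
          then show ?thesis using \<zeta>out(2)[of x] by simp
        qed
      qed (use p in simp)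
      also have "\<dots> < \<infinity>"
        unfolding pint_cmult[OF rum] using ufin by (simp add: ennreal_mult_less_top)
      finally have 1: "pint p (\<lambda>x. w x *\<^sub>R Z x) < \<infinity>" .
      have "pint p (\<lambda>x. \<zeta> x *\<^sub>R (if k < u x then 1 else 0) *\<^sub>R G x) \<le> pint p G"
      proof (rule pint_mono)
        show "norm (\<zeta> x *\<^sub>R (if k < u x then 1 else 0) *\<^sub>R G x) \<le> norm (G x)" for x
          using good_cutoffD(2,3)[OF cut, of x] by (auto simp: mult_left_le_one_le)
      qed (use p in simp)
      then have 2: "pint p (\<lambda>x. \<zeta> x *\<^sub>R (if k < u x then 1 else 0) *\<^sub>R G x) < \<infinity>" using Gfin by simp
      have "pint p V \<le> ennreal (2 powr p) * (pint p (\<lambda>x. w x *\<^sub>R Z x) + pint p (\<lambda>x. \<zeta> x *\<^sub>R (if k < u x then 1 else 0) *\<^sub>R G x))"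
        unfolding V_def by (rule pint_add) (use p in simp_all)
      also have "\<dots> < \<infinity>" using 1 2 by (simp add: ennreal_mult_less_top)
      finally show ?thesis .
    qed
    have p1: "1 \<le> p" using p by simp
    have wg\<phi>: "has_weak_gradient K \<phi> V" and W10: "in_W1p_0 p K \<phi>"
      unfolding K_def
      by (rule W0_limit_has_weak_gradient[OF W0[unfolded K_def] p1 \<phi>fin Vfin out[unfolded K_def]]; assumption)+
    have ext: "zero_extension K \<phi> = \<phi>" using out by (auto simp: zero_extension_def)
    define E where "E x = norm (G x) powr (p - 2) * (G x \<bullet> V x)" for x
    have Em[measurable]: "E \<in> borel_measurable borel" unfolding E_def[abs_def] by measurable
    have eq: "(LINT x:K|lborel. norm (weak_gradient K u x) powr (p - 2) * (weak_gradient K u x \<bullet> weak_gradient K \<phi> x))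
        = (\<integral>x. E x \<partial>lborel)"
    proof -
      have wm1: "restr K (weak_gradient K u) \<in> borel_measurable borel"
        unfolding K_def
        by (rule weak_gradient_measurable) (use wgG in \<open>auto simp: weak_gradient_def K_def[symmetric] intro: someI[of "has_weak_gradient K u"]\<close>)
      have wm2: "restr K (weak_gradient K \<phi>) \<in> borel_measurable borel"
        unfolding K_def
        by (rule weak_gradient_measurable) (use wg\<phi> in \<open>auto simp: weak_gradient_def K_def[symmetric] intro: someI[of "has_weak_gradient K \<phi>"]\<close>)
      have "(LINT x:K|lborel. norm (weak_gradient K u x) powr (p - 2) * (weak_gradient K u x \<bullet> weak_gradient K \<phi> x))
          = (\<integral>x. norm (restr K (weak_gradient K u) x) powr (p - 2) * (restr K (weak_gradient K u) x \<bullet> restr K (weak_gradient K \<phi>) x) \<partial>lborel)"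
        unfolding set_lebesgue_integral_def
      proof (rule Bochner_Integration.integral_cong)
        show "indicator K x *\<^sub>R (norm (weak_gradient K u x) powr (p - 2) * (weak_gradient K u x \<bullet> weak_gradient K \<phi> x))
            = norm (restr K (weak_gradient K u) x) powr (p - 2) * (restr K (weak_gradient K u) x \<bullet> restr K (weak_gradient K \<phi>) x)" for x
          by (cases "x \<in> K") auto
      qed simp
      also have "\<dots> = (\<integral>x. E x \<partial>lborel)"
      proof (rule integral_cong_AE)
        show "AE x in lborel. norm (restr K (weak_gradient K u) x) powr (p - 2) * (restr K (weak_gradient K u) x \<bullet> restr K (weak_gradient K \<phi>) x) = E x"
          using weak_gradient_AE[OF wgG[unfolded K_def]] weak_gradient_AE[OF wg\<phi>[unfolded K_def]]
        proof eventually_elim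
          case (elim x)
          then show ?case using out Gout by (cases "x \<in> K") (auto simp: E_def K_def[symmetric])
        qed
      qed (use wm1 wm2 in measurable)
      finally show ?thesis .
    qed
    have weak: "(\<integral>x. E x \<partial>lborel) + A * nonlocal_form p s u \<phi> = (LINT x:K|lborel. f x * \<phi> x)"
    proof -
      have "(LINT x:K|lborel. norm (weak_gradient K u x) powr (p - 2) * (weak_gradient K u x \<bullet> weak_gradient K \<phi> x))
          + A * nonlocal_form p s u (zero_extension K \<phi>) = (LINT x:K|lborel. f x * \<phi> x)"
        using sol K W10 unfolding weak_solution_def by blast
      then show ?thesis unfolding eq ext .
    qed
    have iG: "integrable lborel (\<lambda>x. norm (G x) powr p)" and iV: "integrable lborel (\<lambda>x. norm (V x) powr p)"
      using Gfin Vfin by (auto simp: pint_def integrable_iff_bounded)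
    have iE: "integrable lborel E"
    proof (rule Bochner_Integration.integrable_bound)
      show "integrable lborel (\<lambda>x. norm (G x) powr p + norm (V x) powr p)" using iG iV by simp
      show "AE x in lborel. norm (E x) \<le> norm (norm (G x) powr p + norm (V x) powr p)"
      proof (rule AE_I2)
        fix x
        have "norm (E x) \<le> norm (G x) powr (p - 2) * (norm (G x) * norm (V x))"
          unfolding E_def using Cauchy_Schwarz_ineq2[of "G x" "V x"] by (auto simp: abs_mult intro!: mult_left_mono)
        also have "\<dots> \<le> norm (G x) powr p + norm (V x) powr p"
          by (rule powr_mult_le_sum) (use p in auto)
        finally show "norm (E x) \<le> norm (norm (G x) powr p + norm (V x) powr p)" by simp
      qed
    qed measurable
    define wp where "wp x = indicator (ball x0 r) x * w x powr p" for x
    have wpm[measurable]: "wp \<in> borel_measurable borel" unfolding wp_def[abs_def] by measurable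
    have wp_nn: "(\<integral>\<^sup>+x. ennreal (wp x) \<partial>lborel) \<le> ennreal W"
    proof -
      have "ennreal (wp x) = indicator (ball x0 r) x * ennreal (max (u x - k) 0 powr p)" for x
        by (cases "x \<in> ball x0 r") (auto simp: wp_def w_def)
      then show ?thesis using W(1) by simp
    qed
    have wpi: "integrable lborel wp"
      by (rule integrableI_bounded) (use le_less_trans[OF wp_nn] in \<open>auto simp: wp_def\<close>)
    have wpW: "(\<integral>x. wp x \<partial>lborel) \<le> W" by (rule integral_le_of_nn_integral[OF wp_nn W(2)])
    have pt: "norm (V x) powr p \<le> 2 powr (p + 1) * E x + 2 powr (2 * p + 1) * M powr p * wp x" for x
    proof (cases "k < u x \<and> x \<in> cball x0 r'")
      case True
      then have "V x = w x *\<^sub>R Z x + \<zeta> x *\<^sub>R G x" by (simp add: V_def)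
      from local_energy_bound[OF p w0(1) good_cutoffD(2,3)[OF cut] M good_cutoffD(6)[OF cut] this]
      have "norm (V x) powr p \<le> 2 powr (p + 1) * E x + 2 powr (2 * p + 1) * (w x * M) powr p"
        by (simp add: E_def)
      moreover have "x \<in> ball x0 r" using True sub by auto
      ultimately show ?thesis by (simp add: wp_def powr_mult mult_ac)
    next
      case False
      then have "V x = 0" using \<zeta>out[of x] by (auto simp: V_def w_def)
      then show ?thesis by (simp add: E_def wp_def)
    qed
    have "pint p V \<le> ennreal (C * (M powr p * W + \<Theta> * W1 + F))"
      if F: "(\<integral>\<^sup>+x. indicator (ball x0 R) x * ennreal (\<bar>f x\<bar> * (max (u x - k) 0 * \<zeta> x)) \<partial>lborel) \<le> ennreal F" "0 \<le> F" for F
    proof -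
      have "(\<integral>x. norm (V x) powr p \<partial>lborel) \<le> (\<integral>x. 2 powr (p + 1) * E x + 2 powr (2 * p + 1) * M powr p * wp x \<partial>lborel)"
        using iV iE wpi pt by (intro integral_mono) auto
      also have "\<dots> = 2 powr (p + 1) * (\<integral>x. E x \<partial>lborel) + 2 powr (2 * p + 1) * M powr p * (\<integral>x. wp x \<partial>lborel)"
        using iE wpi by simp
      also have "\<dots> \<le> 2 powr (p + 1) * (F + (C9 * M powr p * W + 2 * \<Theta> * W1)) + 2 powr (2 * p + 1) * M powr p * W"
      proof (intro add_mono mult_left_mono wpW)
        have "(LINT x:K|lborel. f x * \<phi> x) \<le> F"
          unfolding set_lebesgue_integral_def
        proof (rule integral_le_of_nn_integral[OF _ F(2)])
          have "(\<integral>\<^sup>+x. ennreal (indicator K x *\<^sub>R (f x * \<phi> x)) \<partial>lborel)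
              \<le> (\<integral>\<^sup>+x. indicator (ball x0 R) x * ennreal (\<bar>f x\<bar> * (max (u x - k) 0 * \<zeta> x)) \<partial>lborel)"
          proof (rule nn_integral_mono)
            fix x
            have "f x * \<phi> x \<le> \<bar>f x\<bar> * \<phi> x"
              using w0(1)[of x] good_cutoffD(2)[OF cut, of x] by (intro mult_right_mono) (auto simp: \<phi>_def)
            then show "ennreal (indicator K x *\<^sub>R (f x * \<phi> x)) \<le> indicator (ball x0 R) x * ennreal (\<bar>f x\<bar> * (max (u x - k) 0 * \<zeta> x))"
              by (cases "x \<in> K") (auto simp: K_def \<phi>_def w_def intro: ennreal_leI)
          qed
          then show "(\<integral>\<^sup>+x. ennreal (indicator K x *\<^sub>R (f x * \<phi> x)) \<partial>lborel) \<le> ennreal F" using F(1) by simp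
        qed
        moreover have "- (A * nonlocal_form p s u \<phi>) \<le> C9 * M powr p * W + 2 * \<Theta> * W1"
        proof -
          have "- nonlocal_form p s u \<phi> \<le> C9 * M powr p * r powr (p - s * p) * W + 2 * \<Theta> * W1"
            unfolding \<phi>_def w_def using C9(2)[OF um r(1,2) k M cut \<Theta> W W1] .
          also have "\<dots> \<le> C9 * M powr p * 1 * W + 2 * \<Theta> * W1"
            using r R p s C9 W by (intro add_right_mono mult_right_mono mult_left_mono powr_le1) (auto simp: mult_le_cancel_right2)
          finally have b: "- nonlocal_form p s u \<phi> \<le> C9 * M powr p * W + 2 * \<Theta> * W1" by simp
          have "A * (- nonlocal_form p s u \<phi>) \<le> A * (C9 * M powr p * W + 2 * \<Theta> * W1)"
            using A b by (intro mult_left_mono) auto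
          also have "\<dots> \<le> 1 * (C9 * M powr p * W + 2 * \<Theta> * W1)"
            using A C9 W \<Theta> W1 by (intro mult_right_mono) auto
          finally show ?thesis by simp
        qed
        ultimately show "(\<integral>x. E x \<partial>lborel) \<le> F + (C9 * M powr p * W + 2 * \<Theta> * W1)" using weak by linarith
      qed auto
      also have "\<dots> \<le> C * (M powr p * W + \<Theta> * W1 + F)"
      proof -
        have "0 \<le> 2 powr (p + 1) * (C9 + 1) * F + 2 * 2 powr (p + 1) * (M powr p * W) + 2 powr (p + 1) * C9 * (\<Theta> * W1)
              + 2 powr (2 * p + 1) * (\<Theta> * W1 + F)"
          by (intro add_nonneg_nonneg mult_nonneg_nonneg) (use F(2) C9(1) W(2) \<Theta>(2) W1(2) in simp_all)
        also have "\<dots> = C * (M powr p * W + \<Theta> * W1 + F) - (2 powr (p + 1) * (F + (C9 * M powr p * W + 2 * \<Theta> * W1)) + 2 powr (2 * p + 1) * M powr p * W)"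
          by (simp add: C_def algebra_simps)
        finally show ?thesis by simp
      qed
      finally have "ennreal (\<integral>x. norm (V x) powr p \<partial>lborel) \<le> ennreal (C * (M powr p * W + \<Theta> * W1 + F))"
        by (rule ennreal_leI)
      then show ?thesis
        using iV by (simp add: pint_def nn_integral_eq_integral)
    qed
    then show ?thesis using W0 Vfin unfolding K_def \<phi>_def w_def by blast
  qed
  show ?thesis by (rule that[OF C]) (rule main, assumption+)
qed

section \<open>Local boundedness\<close>

subsection \<open>Normalised data\<close>

text \<open>All three quantities on the right of the estimate are bounded by one level \<open>L\<close>, in the
  scaling of the ball.\<close>

definition local_data ::
  "real \<Rightarrow> real \<Rightarrow> real \<Rightarrow> 'a::euclidean_space \<Rightarrow> real \<Rightarrow> ('a \<Rightarrow> real) \<Rightarrow> ('a \<Rightarrow> real) \<Rightarrow> real \<Rightarrow> bool"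
  where "local_data p s q x0 R u f L \<longleftrightarrow> 0 < L \<and> u \<in> borel_measurable borel \<and>
    restr (ball x0 R) f \<in> borel_measurable borel \<and>
    pint p (restr (ball x0 R) (\<lambda>x. max (u x) 0)) \<le> ennreal (R powr real DIM('a) * L powr p) \<and>
    (\<integral>\<^sup>+y. indicator (- ball x0 R) y * ennreal (max (u y) 0 powr (p - 1) / norm (y - x0) powr (real DIM('a) + s * p)) \<partial>lborel)
      \<le> ennreal (R powr (- (s * p)) * L powr (p - 1)) \<and>
    pint q (restr (ball x0 R) f) \<le> ennreal (R powr (real DIM('a) - p * q) * L powr ((p - 1) * q))"

lemma pint_restr: "pint p (restr S g) = (\<integral>\<^sup>+x. indicator S x * ennreal (norm (g x) powr p) \<partial>lborel)"
  unfolding pint_def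
proof (rule nn_integral_cong)
  fix x show "ennreal (norm (restr S g x) powr p) = indicator S x * ennreal (norm (g x) powr p)"
    by (cases "x \<in> S") auto
qed

lemma ball_emeasure_powr:
  assumes "0 < R"
  shows "emeasure lborel (ball (x0::'a::euclidean_space) R) = ennreal (unit_ball_vol (real DIM('a)) * R powr real DIM('a))"
  using assms by (simp add: emeasure_ball powr_realpow)

text \<open>Far from the centre all points of the inner ball are equivalent, and the part of the
  tail inside the large ball is controlled by the mean of the solution.\<close>

lemma tail_bound:
  assumes p: "2 \<le> p" and s: "0 < s" and \<sigma>: "0 < \<sigma>" "\<sigma> < 1"
  obtains C where "0 < C"
    "\<And>u (x0 :: 'a::euclidean_space) R q f L r r' x. local_data p s q x0 R u f L \<Longrightarrow> 0 < R \<Longrightarrow>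
      \<sigma> * R \<le> r \<Longrightarrow> r \<le> R \<Longrightarrow> r' < r \<Longrightarrow> x \<in> cball x0 r' \<Longrightarrow>
      (\<integral>\<^sup>+y. indicator (- ball x0 r) y * ennreal (max (u y) 0 powr (p - 1) / norm (x - y) powr (real DIM('a) + s * p)) \<partial>lborel)
      \<le> ennreal (C * (R / (r - r')) powr (real DIM('a) + s * p) * R powr (- (s * p)) * L powr (p - 1))"
proof -
  define N where "N = real DIM('a)"
  define e where "e = N + s * p"
  have e: "0 < e" using p s by (simp add: e_def N_def add_pos_pos)
  define v where "v = unit_ball_vol N"
  have v: "0 < v" by (simp add: v_def N_def)
  define C where "C = 1 + \<sigma> powr (- e) * v powr (1 / p)"
  have C: "0 < C" by (simp add: C_def add_pos_nonneg)
  have main: "(\<integral>\<^sup>+y. indicator (- ball x0 r) y * ennreal (max (u y) 0 powr (p - 1) / norm (x - y) powr e) \<partial>lborel)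
      \<le> ennreal (C * (R / (r - r')) powr e * R powr (- (s * p)) * L powr (p - 1))"
    if dat: "local_data p s q x0 R u f L" and R: "0 < R" and r: "\<sigma> * R \<le> r" "r \<le> R" "r' < r" and x: "x \<in> cball x0 r'"
    for u and x0 :: 'a and R q f L r r' x
  proof -
    have um[measurable]: "u \<in> borel_measurable borel" and L: "0 < L"
      and Hp: "pint p (restr (ball x0 R) (\<lambda>x. max (u x) 0)) \<le> ennreal (R powr N * L powr p)"
      and Ht: "(\<integral>\<^sup>+y. indicator (- ball x0 R) y * ennreal (max (u y) 0 powr (p - 1) / norm (y - x0) powr e) \<partial>lborel)
        \<le> ennreal (R powr (- (s * p)) * L powr (p - 1))"
      using dat unfolding local_data_def N_def e_def by auto
    have r0: "0 < r" using \<sigma> R r by (meson less_le_trans mult_pos_pos)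
    have r'0: "0 \<le> r'" using x by (meson mem_cball order_trans zero_le_dist)
    define g where "g y = max (u y) 0 powr (p - 1)" for y
    have gm[measurable]: "g \<in> borel_measurable borel" unfolding g_def[abs_def] by measurable
    have g0: "0 \<le> g y" for y by (simp add: g_def)
    define c where "c = (R / (r - r')) powr e"
    have pt: "indicator (- ball x0 r) y * ennreal (g y / norm (x - y) powr e)
        \<le> ennreal c * (indicator (- ball x0 R) y * ennreal (g y / norm (y - x0) powr e)
          + ennreal (r powr (- e)) * ennreal (indicator (ball x0 R) y * g y))" for y
    proof (cases "y \<in> ball x0 r")
      case False
      define d where "d = norm (y - x0)"
      have d: "r \<le> d" using False by (simp add: d_def dist_norm norm_minus_commute)
      have "d \<le> norm (x - y) + norm (x0 - x)"
        using norm_triangle_ineq4[of "x0 - x" "y - x"] norm_triangle_ineq[of "y - x" "x - x0"]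
        by (simp add: d_def norm_minus_commute)
      moreover have "norm (x0 - x) \<le> r'" using x by (simp add: dist_norm)
      ultimately have lo: "d - r' \<le> norm (x - y)" by simp
      have "d * ((r - r') / r) = d - r' * (d / r)" using r0 by (simp add: field_simps)
      also have "\<dots> \<le> d - r' * 1" using d r0 r'0 by (intro diff_left_mono mult_left_mono) auto
      finally have lo2: "d * ((r - r') / r) \<le> norm (x - y)" using lo by simp
      have dpos: "0 < d" using d r0 by simp
      have "g y / norm (x - y) powr e \<le> g y / (d * ((r - r') / r)) powr e"
      proof -
        have P: "0 < d * ((r - r') / r)" using dpos r r0 by simp
        then have "0 < norm (x - y)" using lo2 by linarith
        with P show ?thesis using lo2 e g0 by (intro divide_left_mono powr_mono2 mult_pos_pos) auto
      qed
      also have "\<dots> = (r / (r - r')) powr e * (g y / d powr e)"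
        using r0 r dpos by (simp add: powr_mult powr_divide mult_ac)
      also have "\<dots> \<le> c * (g y / d powr e)"
        unfolding c_def using r r0 e g0 by (intro mult_right_mono powr_mono2 divide_right_mono) auto
      finally have b: "g y / norm (x - y) powr e \<le> c * (g y / d powr e)" .
      show ?thesis
      proof (cases "y \<in> ball x0 R")
        case True
        have "g y / d powr e \<le> g y / r powr e"
          using d r0 e g0 by (intro divide_left_mono powr_mono2 mult_pos_pos) auto
        also have "\<dots> = r powr (- e) * g y" by (simp add: powr_minus divide_inverse)
        finally have "c * (g y / d powr e) \<le> c * (r powr (- e) * g y)" by (intro mult_left_mono) (auto simp: c_def)
        then have "ennreal (g y / norm (x - y) powr e) \<le> ennreal (c * (r powr (- e) * g y))"
          using b by (intro ennreal_leI) linarith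
        then show ?thesis using True False g0 by (simp add: c_def ennreal_mult)
      next
        case out: False
        have "ennreal (g y / norm (x - y) powr e) \<le> ennreal (c * (g y / d powr e))" using b by (rule ennreal_leI)
        moreover have "ennreal (c * (g y / d powr e)) = ennreal c * ennreal (g y / d powr e)"
          by (rule ennreal_mult) (use g0 in \<open>auto simp: c_def\<close>)
        ultimately show ?thesis using out False by (simp add: d_def)
      qed
    qed simp
    have gB: "(\<integral>\<^sup>+y. ennreal (indicator (ball x0 R) y * g y) \<partial>lborel) \<le> ennreal (v powr (1 / p) * R powr N * L powr (p - 1))"
    proof -
      have p': "p / (p - 1) \<ge> 1" using p by (simp add: field_simps)
      have gp: "g y powr (p / (p - 1)) = max (u y) 0 powr p" for y
        using p by (simp add: g_def powr_powr)
      have "(\<integral>\<^sup>+y. ennreal (indicator (ball x0 R) y * g y) \<partial>lborel)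
          \<le> ennreal ((v * R powr N) powr (1 - 1 / (p / (p - 1))) * (R powr N * L powr p) powr (1 / (p / (p - 1))))"
      proof (rule nn_integral_power_mean[OF _ _ _ _ p'])
        show "(\<integral>\<^sup>+y. ennreal (indicator (ball x0 R) y) \<partial>lborel) \<le> ennreal (v * R powr N)"
          using ball_emeasure_powr[OF R, of x0] by (simp add: ennreal_indicator v_def N_def)
        have "ennreal (indicator (ball x0 R) y * g y powr (p / (p - 1))) = ennreal (norm (restr (ball x0 R) (\<lambda>x. max (u x) 0) y) powr p)" for y
          by (cases "y \<in> ball x0 R") (auto simp: gp)
        then show "(\<integral>\<^sup>+y. ennreal (indicator (ball x0 R) y * g y powr (p / (p - 1))) \<partial>lborel) \<le> ennreal (R powr N * L powr p)"
          using Hp by (simp add: pint_def)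
      qed (use g0 v in auto)
      also have "(v * R powr N) powr (1 - 1 / (p / (p - 1))) * (R powr N * L powr p) powr (1 / (p / (p - 1)))
          = v powr (1 / p) * R powr N * L powr (p - 1)"
      proof -
        have q: "1 - (p - 1) / p = 1 / p" "1 / (p / (p - 1)) = (p - 1) / p" using p by (auto simp: field_simps)
        have "R powr (N * (1 / p)) * R powr (N * ((p - 1) / p)) = R powr N"
        proof -
          have "N * (1 / p) + N * ((p - 1) / p) = N" using p by (simp add: field_simps)
          then show ?thesis by (subst powr_add[symmetric]) simp
        qed
        moreover have "p * ((p - 1) / p) = p - 1" using p by simp
        moreover have regroup: "(a * b) * (c * d) = a * (b * c) * d" for a b c d :: real by simp
        ultimately show ?thesis unfolding q powr_mult powr_powr by (simp only: regroup)
      qed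
      finally show ?thesis .
    qed
    have "(\<integral>\<^sup>+y. indicator (- ball x0 r) y * ennreal (g y / norm (x - y) powr e) \<partial>lborel)
        \<le> (\<integral>\<^sup>+y. ennreal c * (indicator (- ball x0 R) y * ennreal (g y / norm (y - x0) powr e)
          + ennreal (r powr (- e)) * ennreal (indicator (ball x0 R) y * g y)) \<partial>lborel)"
      by (rule nn_integral_mono) (rule pt)
    also have "\<dots> = ennreal c * ((\<integral>\<^sup>+y. indicator (- ball x0 R) y * ennreal (g y / norm (y - x0) powr e) \<partial>lborel)
          + ennreal (r powr (- e)) * (\<integral>\<^sup>+y. ennreal (indicator (ball x0 R) y * g y) \<partial>lborel))"
      by (subst nn_integral_cmult, measurable, subst nn_integral_add, measurable, subst nn_integral_cmult, measurable)
    also have "\<dots> \<le> ennreal c * (ennreal (R powr (- (s * p)) * L powr (p - 1))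
          + ennreal (r powr (- e)) * ennreal (v powr (1 / p) * R powr N * L powr (p - 1)))"
      using Ht gB unfolding g_def by (intro mult_left_mono add_mono) auto
    also have "\<dots> = ennreal (c * (R powr (- (s * p)) * L powr (p - 1) + r powr (- e) * (v powr (1 / p) * R powr N * L powr (p - 1))))"
      by (simp add: c_def flip: ennreal_mult ennreal_plus)
    also have "\<dots> \<le> ennreal (C * c * R powr (- (s * p)) * L powr (p - 1))"
    proof (rule ennreal_leI)
      have "r powr (- e) \<le> (\<sigma> * R) powr (- e)" using r R \<sigma> e by (intro powr_mono2') auto
      then have "r powr (- e) * R powr N \<le> (\<sigma> * R) powr (- e) * R powr N" by (intro mult_right_mono) auto
      also have "\<dots> = \<sigma> powr (- e) * R powr (- (s * p))"
      proof -
        have "R powr (- e) * R powr N = R powr (- (s * p))" by (subst powr_add[symmetric]) (simp add: e_def)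
        then show ?thesis by (simp add: powr_mult)
      qed
      finally have "r powr (- e) * R powr N * (v powr (1 / p) * L powr (p - 1)) \<le> \<sigma> powr (- e) * R powr (- (s * p)) * (v powr (1 / p) * L powr (p - 1))"
        by (rule mult_right_mono) simp
      then have "R powr (- (s * p)) * L powr (p - 1) + r powr (- e) * (v powr (1 / p) * R powr N * L powr (p - 1)) \<le> C * (R powr (- (s * p)) * L powr (p - 1))"
        by (simp add: C_def algebra_simps)
      then have "c * (R powr (- (s * p)) * L powr (p - 1) + r powr (- e) * (v powr (1 / p) * R powr N * L powr (p - 1))) \<le> c * (C * (R powr (- (s * p)) * L powr (p - 1)))"
        by (rule mult_left_mono) (simp add: c_def)
      then show "c * (R powr (- (s * p)) * L powr (p - 1) + r powr (- e) * (v powr (1 / p) * R powr N * L powr (p - 1)))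
          \<le> C * c * R powr (- (s * p)) * L powr (p - 1)" by (simp add: mult_ac)
    qed
    finally show ?thesis by (simp add: g_def c_def)
  qed
  show ?thesis by (rule that[OF C]) (rule main[unfolded e_def N_def], assumption+)
qed

subsection \<open>Absorbing the right-hand side\<close>

lemma absorb_power:
  fixes X a b p :: real
  assumes "1 < p" "0 \<le> X" "X \<le> a + b * X powr (1 / p)" "0 \<le> a" "0 \<le> b"
  shows "X \<le> 2 * a + (2 * b) powr (p / (p - 1))"
proof (cases "b * X powr (1 / p) \<le> X / 2")
  case True
  then have "X \<le> 2 * a" using assms(3) by linarith
  then show ?thesis by (simp add: add_increasing2)
next
  case False
  then have "X \<noteq> 0" by auto
  then have X: "0 < X" using assms(2) by simp
  have "X = X powr (1 - 1 / p) * X powr (1 / p)" using X by (simp flip: powr_add)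
  then have "X powr (1 - 1 / p) * X powr (1 / p) < (2 * b) * X powr (1 / p)" using False by linarith
  then have "X powr (1 - 1 / p) < 2 * b" using X by simp
  then have "(X powr (1 - 1 / p)) powr (p / (p - 1)) \<le> (2 * b) powr (p / (p - 1))"
    using assms by (intro powr_mono2) auto
  moreover have "(1 - 1 / p) * (p / (p - 1)) = 1" using assms(1) by (simp add: field_simps)
  ultimately have "X \<le> (2 * b) powr (p / (p - 1))" using X by (simp only: powr_powr powr_one)
  then show ?thesis using assms(4) by simp
qed

text \<open>The predicate \<open>P\<close> stands for a bound in the space into which the Sobolev inequality embeds:
  \<open>L\<^sup>\<infinity>\<close> for large exponents and \<open>L\<^sup>p\<^sup>\<kappa>\<close> otherwise. The right-hand side of the equation is controlled in
  terms of that same bound, with a power less than one.\<close>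

lemma absorbed_energy:
  fixes P :: "real \<Rightarrow> bool" and p CS C E \<Lambda> m :: real and I pV :: ennreal
  assumes p: "1 < p" and c: "0 < CS" "0 < C" "0 < E" "0 \<le> \<Lambda>" "0 < m"
    and S: "\<And>D. pV \<le> ennreal D \<Longrightarrow> 0 < D \<Longrightarrow> P (CS * m * D)" and fin: "pV < \<infinity>"
    and Fb: "\<And>X. 0 \<le> X \<Longrightarrow> P X \<Longrightarrow> I \<le> ennreal (\<Lambda> / m * X powr (1 / p))"
    and Cac: "\<And>F. 0 \<le> F \<Longrightarrow> I \<le> ennreal F \<Longrightarrow> pV \<le> ennreal (C * (E + F))"
  shows "\<exists>X\<ge>0. P X \<and> X \<le> 2 * (CS * (C + 1) * (m * E)) + (2 * CS * C * \<Lambda>) powr (p / (p - 1))"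
proof -
  obtain d where d: "pV = ennreal d" "0 \<le> d" using fin by (cases pV) auto
  \<comment> \<open>Adding \<open>E\<close> makes the bound positive.\<close>
  define D where "D = d + E"
  define X where "X = CS * m * D"
  have D: "0 < D" using d c by (simp add: D_def)
  have X: "0 < X" using D c by (simp add: X_def)
  have PX: "P X" unfolding X_def by (rule S) (use d c D in \<open>auto simp: D_def intro: ennreal_leI\<close>)
  define F where "F = \<Lambda> / m * X powr (1 / p)"
  have F: "0 \<le> F" using c by (simp add: F_def)
  have "pV \<le> ennreal (C * (E + F))"
    by (rule Cac[OF F]) (use Fb[OF _ PX] X in \<open>simp add: F_def\<close>)
  then have "d \<le> C * (E + F)" unfolding d(1) using c F by (subst (asm) ennreal_le_iff) auto
  then have "D \<le> (C + 1) * E + C * F" by (simp add: D_def algebra_simps)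
  then have "X \<le> CS * m * ((C + 1) * E + C * F)" unfolding X_def using c by (intro mult_left_mono) auto
  also have "\<dots> = CS * (C + 1) * (m * E) + CS * C * \<Lambda> * X powr (1 / p)"
    using c by (simp add: F_def field_simps)
  finally have "X \<le> 2 * (CS * (C + 1) * (m * E)) + (2 * (CS * C * \<Lambda>)) powr (p / (p - 1))"
    using p X c by (intro absorb_power) auto
  then show ?thesis using PX X by (intro exI[of _ X]) (simp add: mult.assoc)
qed

lemma pos_part_mean:
  assumes dat: "local_data p s q (x0 :: 'a::euclidean_space) R u f L" and p: "2 \<le> p" and R: "0 < R"
  shows "pint 1 (restr (ball x0 R) (\<lambda>x. max (u x) 0))
    \<le> ennreal (unit_ball_vol (real DIM('a)) powr (1 - 1 / p) * R powr real DIM('a) * L)"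
proof -
  have um[measurable]: "u \<in> borel_measurable borel" and L: "0 < L"
    and Hp: "pint p (restr (ball x0 R) (\<lambda>x. max (u x) 0)) \<le> ennreal (R powr real DIM('a) * L powr p)"
    using dat unfolding local_data_def by auto
  let ?v = "unit_ball_vol (real DIM('a))"
  have "pint 1 (restr (ball x0 R) (\<lambda>x. max (u x) 0))
      \<le> ennreal ((?v * R powr real DIM('a)) powr (1 - 1 / p) * (R powr real DIM('a) * L powr p) powr (1 / p))"
    by (rule pint_1_le[where K="ball x0 R"])
      (use p Hp R in \<open>auto simp: ball_emeasure_powr intro!: restr_measurable\<close>)
  also have "(?v * R powr real DIM('a)) powr (1 - 1 / p) * (R powr real DIM('a) * L powr p) powr (1 / p)
      = ?v powr (1 - 1 / p) * R powr real DIM('a) * L"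
  proof -
    have "R powr (real DIM('a) * (1 - 1 / p)) * R powr (real DIM('a) * (1 / p)) = R powr real DIM('a)"
      by (subst powr_add[symmetric]) (simp add: right_diff_distrib)
    then show ?thesis using p L by (simp add: powr_mult powr_powr)
  qed
  finally show ?thesis .
qed

subsection \<open>Exponents above the dimension\<close>

text \<open>One energy estimate at level zero suffices, because it bounds the test function pointwise; this
  is also why an integrable right-hand side can be absorbed.\<close>

lemma bounded_above_dimension:
  assumes p: "2 \<le> p" and s: "0 < s" "s < 1" and \<sigma>: "0 < \<sigma>" "\<sigma> < 1" and pN: "real DIM('a::euclidean_space) < p"
  obtains C where "0 < C"
    "\<And>A (\<Omega> :: 'a set) u f x0 R L. weak_solution p s A \<Omega> f u \<Longrightarrow> 0 \<le> A \<Longrightarrow> A \<le> 1 \<Longrightarrow> 0 < R \<Longrightarrow> R < 1 \<Longrightarrow>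
      ball x0 R \<Subset> \<Omega> \<Longrightarrow> local_data p s 1 x0 R u f L \<Longrightarrow> AE x in lborel. x \<in> ball x0 (\<sigma> * R) \<longrightarrow> u x \<le> C * L"
proof -
  define N where "N = real DIM('a)"
  define e where "e = N + s * p"
  obtain CC where CC: "0 < CC"
    "\<And>A (\<Omega> :: 'a set) u f x0 R r r' M \<zeta> Z k \<Theta> W W1.
      weak_solution p s A \<Omega> f u \<Longrightarrow> 0 \<le> A \<Longrightarrow> A \<le> 1 \<Longrightarrow> R < 1 \<Longrightarrow> ball x0 R \<Subset> \<Omega> \<Longrightarrow>
      0 < r \<Longrightarrow> r' < r \<Longrightarrow> r \<le> R \<Longrightarrow> 0 \<le> k \<Longrightarrow> 0 \<le> M \<Longrightarrow> good_cutoff p M x0 r' \<zeta> Z \<Longrightarrow>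
      (\<And>x. x \<in> cball x0 r' \<Longrightarrow> (\<integral>\<^sup>+y. indicator (- ball x0 r) y *
          ennreal (max (u y) 0 powr (p - 1) / norm (x - y) powr (real DIM('a) + s * p)) \<partial>lborel) \<le> ennreal \<Theta>) \<Longrightarrow> 0 \<le> \<Theta> \<Longrightarrow>
      (\<integral>\<^sup>+x. indicator (ball x0 r) x * ennreal (max (u x - k) 0 powr p) \<partial>lborel) \<le> ennreal W \<Longrightarrow> 0 \<le> W \<Longrightarrow>
      (\<integral>\<^sup>+x. ennreal (max (u x - k) 0 * \<zeta> x) \<partial>lborel) \<le> ennreal W1 \<Longrightarrow> 0 \<le> W1 \<Longrightarrow>
      \<exists>V. W0_limit (ball x0 R) p (\<lambda>x. max (u x - k) 0 * \<zeta> x) V \<and> pint p V < \<infinity> \<and>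
        (\<forall>F\<ge>0. (\<integral>\<^sup>+x. indicator (ball x0 R) x * ennreal (\<bar>f x\<bar> * (max (u x - k) 0 * \<zeta> x)) \<partial>lborel) \<le> ennreal F \<longrightarrow>
          pint p V \<le> ennreal (CC * (M powr p * W + \<Theta> * W1 + F)))"
    using Caccioppoli[OF p s, where 'a='a] by blast
  obtain CS where CS: "0 < CS"
    "\<And>(v :: 'a \<Rightarrow> real) V x0 R D. 0 < R \<Longrightarrow> W0_limit (ball x0 R) p v V \<Longrightarrow>
      pint p V \<le> ennreal D \<Longrightarrow> 0 < D \<Longrightarrow> AE x in lborel. \<bar>v x\<bar> powr p \<le> CS * R powr (p - real DIM('a)) * D"
    using Morrey_W0[OF pN] by blast
  obtain CT where CT: "0 < CT"
    "\<And>u (x0 :: 'a) R q f L r r' x. local_data p s q x0 R u f L \<Longrightarrow> 0 < R \<Longrightarrow>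
      \<sigma> * R \<le> r \<Longrightarrow> r \<le> R \<Longrightarrow> r' < r \<Longrightarrow> x \<in> cball x0 r' \<Longrightarrow>
      (\<integral>\<^sup>+y. indicator (- ball x0 r) y * ennreal (max (u y) 0 powr (p - 1) / norm (x - y) powr (real DIM('a) + s * p)) \<partial>lborel)
      \<le> ennreal (CT * (R / (r - r')) powr (real DIM('a) + s * p) * R powr (- (s * p)) * L powr (p - 1))"
    using tail_bound[OF p s(1) \<sigma>, where 'a='a] by blast
  obtain c where c: "0 < c" "\<And>(x0 :: 'a) r r'. 0 < r \<Longrightarrow> r < r' \<Longrightarrow>
    \<exists>\<zeta> Z. good_cutoff p (c / (r' - r)) x0 r' \<zeta> Z \<and> (\<forall>x\<in>ball x0 r. \<zeta> x = 1)"
    using ex_good_cutoff[OF p, where 'a='a] by blast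
  define v where "v = unit_ball_vol N"
  have v: "0 < v" by (simp add: v_def N_def)
  define \<tau> where "\<tau> = 2 / (1 - \<sigma>)"
  have \<tau>: "0 < \<tau>" using \<sigma> by (simp add: \<tau>_def)
  define K1 where "K1 = (c * \<tau>) powr p + CT * \<tau> powr e * v powr (1 - 1 / p)"
  have K1: "0 < K1" using c \<tau> CT v by (simp add: K1_def add_pos_nonneg)
  define K2 where "K2 = 2 * (CS * (CC + 1) * K1) + (2 * CS * CC) powr (p / (p - 1))"
  have K2: "0 < K2" using CS CC K1 by (simp add: K2_def add_pos_nonneg)
  have main: "AE x in lborel. x \<in> ball x0 (\<sigma> * R) \<longrightarrow> u x \<le> K2 powr (1 / p) * L"
    if sol: "weak_solution p s A \<Omega> f u" and A: "0 \<le> A" "A \<le> 1" and R: "0 < R" "R < 1" and B: "ball x0 R \<Subset> \<Omega>"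
      and dat: "local_data p s 1 x0 R u f L"
    for A and \<Omega> :: "'a set" and u f x0 R L
  proof -
    have um[measurable]: "u \<in> borel_measurable borel" and L: "0 < L"
      and fm[measurable]: "restr (ball x0 R) f \<in> borel_measurable borel"
      and Hp: "pint p (restr (ball x0 R) (\<lambda>x. max (u x) 0)) \<le> ennreal (R powr N * L powr p)"
      and Hf: "pint 1 (restr (ball x0 R) f) \<le> ennreal (R powr (N - p) * L powr (p - 1))"
      using dat unfolding local_data_def N_def by auto
    define r' where "r' = R - R / \<tau>"
    have r': "\<sigma> * R < r'" "r' < R" "r' - \<sigma> * R = R / \<tau>" "R - r' = R / \<tau>"
    proof -
      have "r' = \<sigma> * R + R / \<tau>" using \<sigma> by (simp add: r'_def \<tau>_def field_simps)
      then show "\<sigma> * R < r'" "r' - \<sigma> * R = R / \<tau>" using R \<tau> by auto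
      show "r' < R" "R - r' = R / \<tau>" using R \<tau> by (auto simp: r'_def)
    qed
    define M where "M = c / (r' - \<sigma> * R)"
    have M: "0 < M" "M = c * \<tau> / R" using c(1) r'(1,3) R(1) \<tau> by (auto simp: M_def)
    obtain \<zeta> Z where cut: "good_cutoff p M x0 r' \<zeta> Z" and \<zeta>1: "\<And>x. x \<in> ball x0 (\<sigma> * R) \<Longrightarrow> \<zeta> x = 1"
      using c(2)[of "\<sigma> * R" r' x0] \<sigma> R r' unfolding M_def by auto
    define \<Theta> where "\<Theta> = CT * \<tau> powr e * R powr (- (s * p)) * L powr (p - 1)"
    define W where "W = R powr N * L powr p"
    define W1 where "W1 = v powr (1 - 1 / p) * R powr N * L"
    have nn: "0 \<le> \<Theta>" "0 < W" "0 \<le> W1" using CT L R v by (auto simp: \<Theta>_def W_def W1_def)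
    define \<phi> where "\<phi> x = max (u x - 0) 0 * \<zeta> x" for x
    note \<zeta>b = good_cutoffD(2,3)[OF cut]
    have RR: "R / (R - r') = \<tau>" using R r' \<tau> by simp
    have T: "(\<integral>\<^sup>+y. indicator (- ball x0 R) y * ennreal (max (u y) 0 powr (p - 1) / norm (x - y) powr (real DIM('a) + s * p)) \<partial>lborel) \<le> ennreal \<Theta>"
      if "x \<in> cball x0 r'" for x
      using CT(2)[OF dat R(1) _ order_refl r'(2) that] \<sigma> R unfolding \<Theta>_def e_def N_def RR by simp
    have Wb: "(\<integral>\<^sup>+x. indicator (ball x0 R) x * ennreal (max (u x - 0) 0 powr p) \<partial>lborel) \<le> ennreal W"
      using Hp unfolding pint_restr W_def by simp
    have W1b: "(\<integral>\<^sup>+x. ennreal (max (u x - 0) 0 * \<zeta> x) \<partial>lborel) \<le> ennreal W1"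
    proof -
      have "(\<integral>\<^sup>+x. ennreal (max (u x - 0) 0 * \<zeta> x) \<partial>lborel) \<le> pint 1 (restr (ball x0 R) (\<lambda>x. max (u x) 0))"
        unfolding pint_def
      proof (rule nn_integral_mono)
        fix x
        show "ennreal (max (u x - 0) 0 * \<zeta> x) \<le> ennreal (norm (restr (ball x0 R) (\<lambda>x. max (u x) 0) x) powr 1)"
        proof (cases "x \<in> ball x0 R")
          case True
          then show ?thesis using \<zeta>b[of x] by (auto intro!: ennreal_leI mult_left_le)
        next
          case False
          then have "\<zeta> x = 0" using r'(2) by (intro good_cutoffD(4)[OF cut]) auto
          then show ?thesis by simp
        qed
      qed
      then show ?thesis using pos_part_mean[OF dat p R(1)] unfolding W1_def v_def N_def by simp
    qed
    obtain V where V: "W0_limit (ball x0 R) p \<phi> V" "pint p V < \<infinity>"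
      "\<And>F. 0 \<le> F \<Longrightarrow> (\<integral>\<^sup>+x. indicator (ball x0 R) x * ennreal (\<bar>f x\<bar> * \<phi> x) \<partial>lborel) \<le> ennreal F \<Longrightarrow>
          pint p V \<le> ennreal (CC * (M powr p * W + \<Theta> * W1 + F))"
      using CC(2)[OF sol A R(2) B R(1) r'(2) order_refl order_refl less_imp_le[OF M(1)] cut T nn(1) Wb less_imp_le[OF nn(2)] W1b nn(3)]
      unfolding \<phi>_def by blast
    define E where "E = M powr p * W + \<Theta> * W1"
    have E: "0 < E" unfolding E_def
      by (intro add_pos_nonneg mult_pos_pos mult_nonneg_nonneg) (use M(1) nn in auto)
    define m where "m = R powr (p - N)"
    have m: "0 < m" using R by (simp add: m_def)
    have mE: "m * E \<le> K1 * L powr p"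
    proof -
      have "R powr (p - N) * (R powr (- p) * R powr N) = 1"
        using R by (simp flip: powr_add)
      moreover have "m * (M powr p * W) = (c * \<tau>) powr p * L powr p * (R powr (p - N) * (R powr (- p) * R powr N))"
      proof -
        have "(c * \<tau> / R) powr p = (c * \<tau>) powr p * R powr (- p)"
          using powr_divide[of "c * \<tau>" R p] R(1) by (simp only: powr_minus_divide times_divide_eq_right mult_1_right)
        then show ?thesis by (simp add: m_def M(2) W_def mult_ac)
      qed
      moreover have "m * (\<Theta> * W1) = CT * \<tau> powr e * v powr (1 - 1 / p) * (L powr (p - 1) * L) * (R powr (p - N) * (R powr (- (s * p)) * R powr N))"
        by (simp add: m_def \<Theta>_def W1_def mult_ac)
      moreover have "R powr (p - N) * (R powr (- (s * p)) * R powr N) = R powr (p - s * p)"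
        by (simp flip: powr_add)
      moreover have "R powr (p - s * p) \<le> 1" using R p s by (intro powr_le1) (auto simp: mult_le_cancel_right2)
      moreover have "L powr (p - 1) * L = L powr p" using L by (simp add: powr_diff)
      moreover have "CT * \<tau> powr e * v powr (1 - 1 / p) * L powr p * R powr (p - s * p) \<le> CT * \<tau> powr e * v powr (1 - 1 / p) * L powr p * 1"
        if "R powr (p - s * p) \<le> 1" using that CT(1) by (intro mult_left_mono) auto
      ultimately have "m * E \<le> (c * \<tau>) powr p * L powr p + CT * \<tau> powr e * v powr (1 - 1 / p) * L powr p * 1"
        unfolding E_def distrib_left by simp
      then show ?thesis by (simp add: K1_def algebra_simps)
    qed
    have "\<exists>X\<ge>0. (AE x in lborel. \<bar>\<phi> x\<bar> powr p \<le> X) \<and>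
        X \<le> 2 * (CS * (CC + 1) * (m * E)) + (2 * CS * CC * L powr (p - 1)) powr (p / (p - 1))"
    proof (rule absorbed_energy[where pV="pint p V" and I="\<integral>\<^sup>+x. indicator (ball x0 R) x * ennreal (\<bar>f x\<bar> * \<phi> x) \<partial>lborel"])
      show "AE x in lborel. \<bar>\<phi> x\<bar> powr p \<le> CS * m * D" if "pint p V \<le> ennreal D" "0 < D" for D
        using CS(2)[OF R(1) V(1) that] unfolding m_def N_def .
      fix X assume X: "0 \<le> X" "AE x in lborel. \<bar>\<phi> x\<bar> powr p \<le> X"
      have "(\<integral>\<^sup>+x. indicator (ball x0 R) x * ennreal (\<bar>f x\<bar> * \<phi> x) \<partial>lborel)
          \<le> (\<integral>\<^sup>+x. ennreal (X powr (1 / p)) * ennreal (norm (restr (ball x0 R) f x) powr 1) \<partial>lborel)"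
      proof (rule nn_integral_mono_AE)
        show "AE x in lborel. indicator (ball x0 R) x * ennreal (\<bar>f x\<bar> * \<phi> x)
            \<le> ennreal (X powr (1 / p)) * ennreal (norm (restr (ball x0 R) f x) powr 1)"
          using X(2)
        proof eventually_elim
          case (elim x)
          have "(\<bar>\<phi> x\<bar> powr p) powr (1 / p) \<le> X powr (1 / p)" using elim p by (intro powr_mono2) auto
          then have "\<phi> x \<le> X powr (1 / p)" using p by (simp add: powr_powr)
          then have "\<bar>f x\<bar> * \<phi> x \<le> X powr (1 / p) * \<bar>f x\<bar>"
            by (subst mult.commute) (rule mult_right_mono, simp_all)
          then show ?case by (cases "x \<in> ball x0 R") (auto simp flip: ennreal_mult intro: ennreal_leI)
        qed
      qed
      also have "\<dots> = ennreal (X powr (1 / p)) * pint 1 (restr (ball x0 R) f)"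
        unfolding pint_def by (rule nn_integral_cmult) measurable
      also have "\<dots> \<le> ennreal (X powr (1 / p)) * ennreal (R powr (N - p) * L powr (p - 1))"
        by (rule mult_left_mono[OF Hf]) simp
      also have "\<dots> = ennreal (L powr (p - 1) / m * X powr (1 / p))"
      proof -
        have "R powr (N - p) = 1 / m" using powr_minus_divide[of R "p - N"] by (simp add: m_def)
        then show ?thesis using m by (simp flip: ennreal_mult add: mult.commute)
      qed
      finally show "(\<integral>\<^sup>+x. indicator (ball x0 R) x * ennreal (\<bar>f x\<bar> * \<phi> x) \<partial>lborel) \<le> ennreal (L powr (p - 1) / m * X powr (1 / p))" .
    next
      show "pint p V \<le> ennreal (CC * (E + F))"
        if "0 \<le> F" "(\<integral>\<^sup>+x. indicator (ball x0 R) x * ennreal (\<bar>f x\<bar> * \<phi> x) \<partial>lborel) \<le> ennreal F" for F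
        using V(3)[OF that] unfolding E_def .
    qed (use p CS CC E m V in auto)
    then obtain X where X: "0 \<le> X" "AE x in lborel. \<bar>\<phi> x\<bar> powr p \<le> X"
      "X \<le> 2 * (CS * (CC + 1) * (m * E)) + (2 * CS * CC * L powr (p - 1)) powr (p / (p - 1))" by blast
    have "(2 * CS * CC * L powr (p - 1)) powr (p / (p - 1)) = (2 * CS * CC) powr (p / (p - 1)) * L powr p"
      using p by (simp add: powr_mult powr_powr)
    moreover have "2 * (CS * (CC + 1) * (m * E)) \<le> 2 * (CS * (CC + 1) * (K1 * L powr p))"
      using mE CS CC by (intro mult_left_mono) auto
    ultimately have XK: "X \<le> K2 * L powr p" using X(3) by (simp add: K2_def algebra_simps)
    show ?thesis
      using X(2)
    proof eventually_elim
      case (elim x)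
      show ?case
      proof
        assume x: "x \<in> ball x0 (\<sigma> * R)"
        have "\<phi> x = max (u x) 0" using \<zeta>1[OF x] by (simp add: \<phi>_def)
        then have "max (u x) 0 powr p \<le> K2 * L powr p" using elim XK by simp
        then have "(max (u x) 0 powr p) powr (1 / p) \<le> (K2 * L powr p) powr (1 / p)"
          using p by (intro powr_mono2) auto
        then have "max (u x) 0 \<le> K2 powr (1 / p) * L" using p L by (simp add: powr_powr powr_mult)
        then show "u x \<le> K2 powr (1 / p) * L" by simp
      qed
    qed
  qed
  show ?thesis by (rule that[of "K2 powr (1 / p)"]) (use K2 in simp, rule main, assumption+)
qed

subsection \<open>Exponents up to the dimension\<close>

lemma nn_integral_Hoelder_on:
  fixes f g :: "'a \<Rightarrow> real"
  assumes [measurable]: "f \<in> borel_measurable M" "g \<in> borel_measurable M" "S \<in> sets M"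
    and nn: "\<And>x. 0 \<le> f x" "\<And>x. 0 \<le> g x" and q: "1 < q" and r: "0 < r" "1 / q + 1 / r \<le> 1"
    and F: "(\<integral>\<^sup>+x. ennreal (f x powr q) \<partial>M) \<le> ennreal F" "0 \<le> F"
    and G: "(\<integral>\<^sup>+x. ennreal (g x powr r) \<partial>M) \<le> ennreal G" "0 \<le> G"
    and m: "emeasure M S \<le> ennreal m" "0 \<le> m"
  shows "(\<integral>\<^sup>+x. ennreal (f x * (indicator S x * g x)) \<partial>M) \<le> ennreal (F powr (1 / q) * G powr (1 / r) * m powr (1 - 1 / q - 1 / r))"
proof -
  define q' where "q' = q / (q - 1)"
  have q': "1 < q'" "1 / q + 1 / q' = 1" "1 / q' = 1 - 1 / q" using q by (auto simp: q'_def field_simps)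
  define \<theta> where "\<theta> = r / q'"
  have iq: "1 / r \<le> 1 / q'" using r q'(3) by linarith
  then have "q' \<le> r" using q'(1) r(1) by (simp add: field_simps)
  then have \<theta>: "1 \<le> \<theta>" "q' * \<theta> = r" "1 / \<theta> * (1 / q') = 1 / r" using q'(1) r(1) by (auto simp: \<theta>_def field_simps)
  define B where "B = m powr (1 - 1 / \<theta>) * G powr (1 / \<theta>)"
  have p1: "(indicator S x * g x) powr q' = indicator S x * g x powr q'" for x
    by (cases "x \<in> S") auto
  have "(\<integral>\<^sup>+x. ennreal (indicator S x * g x powr q') \<partial>M) \<le> ennreal B"
    unfolding B_def
  proof (rule nn_integral_power_mean[OF _ _ _ _ \<theta>(1)])
    show "(\<integral>\<^sup>+x. ennreal (indicator S x) \<partial>M) \<le> ennreal m" using m(1) by (simp add: ennreal_indicator)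
    have "(\<integral>\<^sup>+x. ennreal (indicator S x * (g x powr q') powr \<theta>) \<partial>M) \<le> (\<integral>\<^sup>+x. ennreal (g x powr r) \<partial>M)"
      by (rule nn_integral_mono) (auto simp: powr_powr \<theta>(2) indicator_def)
    then show "(\<integral>\<^sup>+x. ennreal (indicator S x * (g x powr q') powr \<theta>) \<partial>M) \<le> ennreal G" using G(1) by (rule order_trans)
  qed (use G m in auto)
  then have "(\<integral>\<^sup>+x. ennreal (f x * (indicator S x * g x)) \<partial>M) \<le> ennreal (F powr (1 / q) * B powr (1 / q'))"
    using nn q q' F by (intro nn_integral_Hoelder) (auto simp: p1 B_def)
  also have "B powr (1 / q') = G powr (1 / r) * m powr (1 - 1 / q - 1 / r)"
  proof -
    have "(1 - 1 / \<theta>) * (1 / q') = 1 - 1 / q - 1 / r" using \<theta>(3) q'(3) by (simp add: left_diff_distrib)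
    then show ?thesis unfolding B_def powr_mult powr_powr \<theta>(3) by simp
  qed
  finally show ?thesis by (simp add: mult_ac)
qed

text \<open>As \<open>g \<ge> 1\<close> and \<open>z \<le> 1\<close>, every term is majorised by raising the exponent of \<open>g\<close> and lowering
  that of \<open>z\<close>.\<close>

lemma step_algebra:
  fixes g b z \<theta> \<delta> \<beta> K K' Q e p X :: real
  assumes g: "1 \<le> b" "b \<le> g" and z: "0 < z" "z \<le> 1" and th: "0 \<le> \<theta>" "\<theta> \<le> 1" and de: "0 \<le> \<delta>"
    and be: "\<beta> \<le> \<theta>" "1 + \<beta> \<le> \<delta> + \<theta>" and K: "0 \<le> K" "0 \<le> K'" "0 \<le> Q" and e: "0 \<le> e" "0 \<le> p"
    and X: "X \<le> K * (g powr e * Q * z) + K' * Q * (b powr p * z) powr \<delta>"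
  shows "X * (b powr p * z) powr \<theta> \<le> (K + K') * (Q * (g powr (e + p + p * \<delta>) * z powr (1 + \<beta>)))"
proof -
  have g1: "1 \<le> g" "0 < g" using g by auto
  let ?R = "Q * (g powr (e + p + p * \<delta>) * z powr (1 + \<beta>))"
  have bt: "(b powr p * z) powr \<tau> \<le> g powr (p * \<tau>) * z powr \<tau>" if "0 \<le> \<tau>" for \<tau>
  proof -
    have "b powr (p * \<tau>) \<le> g powr (p * \<tau>)" using g e that by (intro powr_mono2) auto
    then show ?thesis by (simp add: powr_mult powr_powr mult_right_mono)
  qed
  have p\<theta>: "p * \<theta> \<le> p" using e th by (simp add: mult_left_le)
  have 1: "(g powr e * Q * z) * (b powr p * z) powr \<theta> \<le> ?R"
  proof -
    have "(g powr e * Q * z) * (b powr p * z) powr \<theta> \<le> (g powr e * Q * z) * (g powr (p * \<theta>) * z powr \<theta>)"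
      using bt[OF th(1)] z K by (intro mult_left_mono) auto
    also have "\<dots> = Q * (g powr (e + p * \<theta>) * z powr (1 + \<theta>))" using z by (simp add: powr_add)
    also have "\<dots> \<le> ?R"
    proof -
      have "0 \<le> p * \<delta>" using e de by simp
      then have "g powr (e + p * \<theta>) \<le> g powr (e + p + p * \<delta>)" using g1 p\<theta> by (intro powr_mono) auto
      moreover have "z powr (1 + \<theta>) \<le> z powr (1 + \<beta>)" using z be by (intro powr_mono') auto
      ultimately show ?thesis using K by (intro mult_left_mono mult_mono) auto
    qed
    finally show ?thesis .
  qed
  have 2: "(Q * (b powr p * z) powr \<delta>) * (b powr p * z) powr \<theta> \<le> ?R"
  proof -
    have "(Q * (b powr p * z) powr \<delta>) * (b powr p * z) powr \<theta> = Q * (b powr p * z) powr (\<delta> + \<theta>)" by (simp add: powr_add)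
    also have "\<dots> \<le> Q * (g powr (p * (\<delta> + \<theta>)) * z powr (\<delta> + \<theta>))"
      using bt[of "\<delta> + \<theta>"] th de K by (intro mult_left_mono) auto
    also have "\<dots> \<le> ?R"
    proof -
      have "g powr (p * (\<delta> + \<theta>)) \<le> g powr (e + p + p * \<delta>)" using g1 p\<theta> e by (intro powr_mono) (auto simp: distrib_left)
      moreover have "z powr (\<delta> + \<theta>) \<le> z powr (1 + \<beta>)" using z be by (intro powr_mono') auto
      ultimately show ?thesis using K by (intro mult_left_mono mult_mono) auto
    qed
    finally show ?thesis .
  qed
  have "X * (b powr p * z) powr \<theta> \<le> (K * (g powr e * Q * z) + K' * Q * (b powr p * z) powr \<delta>) * (b powr p * z) powr \<theta>"
    using X by (intro mult_right_mono) auto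
  also have "\<dots> = K * ((g powr e * Q * z) * (b powr p * z) powr \<theta>) + K' * ((Q * (b powr p * z) powr \<delta>) * (b powr p * z) powr \<theta>)"
    by (simp add: algebra_simps)
  also have "\<dots> \<le> K * ?R + K' * ?R" using 1 2 K by (intro add_mono mult_left_mono) auto
  finally show ?thesis by (simp add: distrib_right)
qed

definition excess :: "real \<Rightarrow> ('a::euclidean_space \<Rightarrow> real) \<Rightarrow> 'a \<Rightarrow> real \<Rightarrow> real \<Rightarrow> ennreal"
  where "excess p u x0 r k = (\<integral>\<^sup>+x. indicator (ball x0 r) x * ennreal (max (u x - k) 0 powr p) \<partial>lborel)"

lemma excess_mono:
  assumes "r \<le> r'" "k' \<le> k" "0 \<le> p"
  shows "excess p u x0 r k \<le> excess p u x0 r' k'"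
  unfolding excess_def
proof (rule nn_integral_mono)
  fix x show "indicator (ball x0 r) x * ennreal (max (u x - k) 0 powr p) \<le> indicator (ball x0 r') x * ennreal (max (u x - k') 0 powr p)"
    using assms by (cases "x \<in> ball x0 r") (auto intro!: ennreal_leI powr_mono2)
qed

text \<open>Above the raised level the old excess is at least the difference of the levels, which
  bounds the measure of the superlevel set and lower powers of the new excess.\<close>

lemma level_raise:
  assumes "0 < d" "1 \<le> (p::real)" "k + d < t"
  shows "1 \<le> d powr (- p) * max (t - k) 0 powr p" and "t - (k + d) \<le> d powr (1 - p) * max (t - k) 0 powr p"
proof -
  have m: "d < max (t - k) 0" using assms by simp
  have "d powr p \<le> max (t - k) 0 powr p" using m assms by (intro powr_mono2) auto
  then have "d powr (- p) * d powr p \<le> d powr (- p) * max (t - k) 0 powr p" by (rule mult_left_mono) simp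
  then show "1 \<le> d powr (- p) * max (t - k) 0 powr p" using assms by (simp flip: powr_add)
  have "d powr (p - 1) \<le> max (t - k) 0 powr (p - 1)" using m assms by (intro powr_mono2) auto
  then have "d powr (1 - p) * d powr (p - 1) \<le> d powr (1 - p) * max (t - k) 0 powr (p - 1)" by (rule mult_left_mono) simp
  then have "1 \<le> d powr (1 - p) * max (t - k) 0 powr (p - 1)" using assms by (simp flip: powr_add)
  then have "max (t - k) 0 * 1 \<le> max (t - k) 0 * (d powr (1 - p) * max (t - k) 0 powr (p - 1))" by (rule mult_left_mono) simp
  also have "\<dots> = d powr (1 - p) * max (t - k) 0 powr p" using m assms by (simp add: powr_diff)
  finally show "t - (k + d) \<le> d powr (1 - p) * max (t - k) 0 powr p" using assms by simp
qed

text \<open>One step of De Giorgi's iteration. Raising the level and shrinking the ball improves the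
  excess by a power larger than one: the energy inequality and the Sobolev embedding gain
  integrability, and the superlevel set is small by Chebyshev's inequality. For the
  right-hand side this needs precisely \<open>1 / q + 1 / \<kappa> < 1\<close>.\<close>

lemma level_step:
  assumes p: "2 \<le> p" and s: "0 < s" "s < 1" and \<sigma>: "0 < \<sigma>" "\<sigma> < 1"
    and \<kappa>: "1 < \<kappa>" "(real DIM('a::euclidean_space) - p) * \<kappa> < real DIM('a)" and q: "1 < q" "1 / q + 1 / \<kappa> < 1"
  obtains C a \<beta> where "0 < C" "0 < a" "0 < \<beta>"
    "\<And>A (\<Omega> :: 'a set) u f x0 R L r r1 k d T z. weak_solution p s A \<Omega> f u \<Longrightarrow> 0 \<le> A \<Longrightarrow> A \<le> 1 \<Longrightarrow> 0 < R \<Longrightarrow> R < 1 \<Longrightarrow>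
      ball x0 R \<Subset> \<Omega> \<Longrightarrow> local_data p s q x0 R u f L \<Longrightarrow> \<sigma> * R \<le> r1 \<Longrightarrow> r1 < r \<Longrightarrow> r \<le> R \<Longrightarrow>
      0 \<le> k \<Longrightarrow> 0 < d \<Longrightarrow> d \<le> T \<Longrightarrow> L \<le> T \<Longrightarrow> 0 < z \<Longrightarrow> z \<le> 1 \<Longrightarrow>
      excess p u x0 r k \<le> ennreal (R powr real DIM('a) * T powr p * z) \<Longrightarrow>
      excess p u x0 r1 (k + d) \<le> ennreal (R powr real DIM('a) *
        (C * (T powr p * ((R / (r - r1) * (T / d)) powr a * z powr (1 + \<beta>)))))"
proof -
  define N where "N = real DIM('a)"
  define e where "e = N + s * p"
  have e: "0 < e" using p s by (simp add: e_def N_def add_pos_pos)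
  define \<gamma> where "\<gamma> = 1 - 1 / q - 1 / (p * \<kappa>)"
  define \<theta> where "\<theta> = 1 - 1 / \<kappa>"
  define \<delta> where "\<delta> = \<gamma> * (p / (p - 1))"
  define \<beta> where "\<beta> = min \<theta> (\<delta> + \<theta> - 1)"
  have k1: "1 / (p * \<kappa>) \<le> 1 / \<kappa>" using p \<kappa>(1) by (simp add: field_simps)
  have \<gamma>: "0 < \<gamma>" using q(2) k1 by (simp add: \<gamma>_def)
  have \<delta>: "0 < \<delta>" using \<gamma> p by (simp add: \<delta>_def)
  have \<theta>: "0 < \<theta>" "\<theta> < 1" using \<kappa>(1) by (auto simp: \<theta>_def)
  have \<beta>: "0 < \<beta>"
  proof -
    have "\<delta> + \<theta> - 1 = p / (p - 1) * (1 - 1 / q - 1 / \<kappa>)"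
      using p \<kappa>(1) q(1) by (simp add: \<delta>_def \<gamma>_def \<theta>_def field_simps)
    also have "\<dots> > 0" using p q(2) by (intro mult_pos_pos) auto
    finally show ?thesis using \<theta> by (simp add: \<beta>_def)
  qed
  define a where "a = (p + e) + p + p * \<delta>"
  have a: "0 < a" using p e \<delta> by (simp add: a_def add_pos_pos)
  obtain CC where CC: "0 < CC"
    "\<And>A (\<Omega> :: 'a set) u f x0 R r r' M \<zeta> Z k \<Theta> W W1.
      weak_solution p s A \<Omega> f u \<Longrightarrow> 0 \<le> A \<Longrightarrow> A \<le> 1 \<Longrightarrow> R < 1 \<Longrightarrow> ball x0 R \<Subset> \<Omega> \<Longrightarrow>
      0 < r \<Longrightarrow> r' < r \<Longrightarrow> r \<le> R \<Longrightarrow> 0 \<le> k \<Longrightarrow> 0 \<le> M \<Longrightarrow> good_cutoff p M x0 r' \<zeta> Z \<Longrightarrow>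
      (\<And>x. x \<in> cball x0 r' \<Longrightarrow> (\<integral>\<^sup>+y. indicator (- ball x0 r) y *
          ennreal (max (u y) 0 powr (p - 1) / norm (x - y) powr (real DIM('a) + s * p)) \<partial>lborel) \<le> ennreal \<Theta>) \<Longrightarrow> 0 \<le> \<Theta> \<Longrightarrow>
      (\<integral>\<^sup>+x. indicator (ball x0 r) x * ennreal (max (u x - k) 0 powr p) \<partial>lborel) \<le> ennreal W \<Longrightarrow> 0 \<le> W \<Longrightarrow>
      (\<integral>\<^sup>+x. ennreal (max (u x - k) 0 * \<zeta> x) \<partial>lborel) \<le> ennreal W1 \<Longrightarrow> 0 \<le> W1 \<Longrightarrow>
      \<exists>V. W0_limit (ball x0 R) p (\<lambda>x. max (u x - k) 0 * \<zeta> x) V \<and> pint p V < \<infinity> \<and>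
        (\<forall>F\<ge>0. (\<integral>\<^sup>+x. indicator (ball x0 R) x * ennreal (\<bar>f x\<bar> * (max (u x - k) 0 * \<zeta> x)) \<partial>lborel) \<le> ennreal F \<longrightarrow>
          pint p V \<le> ennreal (CC * (M powr p * W + \<Theta> * W1 + F)))"
    using Caccioppoli[OF p s, where 'a='a] by blast
  have p1: "1 < p" using p by simp
  obtain CS0 where CS0: "0 < CS0"
    "\<And>(v :: 'a \<Rightarrow> real) V x0 R D. 0 < R \<Longrightarrow> W0_limit (ball x0 R) p v V \<Longrightarrow>
      pint p V \<le> ennreal D \<Longrightarrow> 0 < D \<Longrightarrow>
      pint (p * \<kappa>) v \<le> ennreal (CS0 * R powr (\<kappa> * (p - real DIM('a)) + real DIM('a)) * D powr \<kappa>)"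
    using Sobolev_W0[OF p1 less_imp_le[OF \<kappa>(1)] \<kappa>(2)] by blast
  obtain CT where CT: "0 < CT"
    "\<And>u (x0 :: 'a) R q f L r r' x. local_data p s q x0 R u f L \<Longrightarrow> 0 < R \<Longrightarrow>
      \<sigma> * R \<le> r \<Longrightarrow> r \<le> R \<Longrightarrow> r' < r \<Longrightarrow> x \<in> cball x0 r' \<Longrightarrow>
      (\<integral>\<^sup>+y. indicator (- ball x0 r) y * ennreal (max (u y) 0 powr (p - 1) / norm (x - y) powr (real DIM('a) + s * p)) \<partial>lborel)
      \<le> ennreal (CT * (R / (r - r')) powr (real DIM('a) + s * p) * R powr (- (s * p)) * L powr (p - 1))"
    using tail_bound[OF p s(1) \<sigma>, where 'a='a] by blast
  obtain c where c: "0 < c" "\<And>(x0 :: 'a) r r'. 0 < r \<Longrightarrow> r < r' \<Longrightarrow>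
    \<exists>\<zeta> Z. good_cutoff p (c / (r' - r)) x0 r' \<zeta> Z \<and> (\<forall>x\<in>ball x0 r. \<zeta> x = 1)"
    using ex_good_cutoff[OF p, where 'a='a] by blast
  define CS where "CS = CS0 powr (1 / \<kappa>)"
  have CS: "0 < CS" using CS0(1) by (simp add: CS_def)
  define K1 where "K1 = (2 * c) powr p + CT * 2 powr e"
  have K1: "0 < K1" using c(1) CT(1) by (simp add: K1_def add_pos_nonneg)
  define K where "K = 2 * (CS * (CC + 1) * K1)"
  define K' where "K' = (2 * CS * CC) powr (p / (p - 1))"
  have K: "0 < K" "0 < K'" using CS CC(1) K1 by (auto simp: K_def K'_def)
  have main: "excess p u x0 r1 (k + d) \<le> ennreal (R powr N *
        ((K + K') * (T powr p * ((R / (r - r1) * (T / d)) powr a * z powr (1 + \<beta>)))))"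
    if sol: "weak_solution p s A \<Omega> f u" and A: "0 \<le> A" "A \<le> 1" and R: "0 < R" "R < 1" and B: "ball x0 R \<Subset> \<Omega>"
      and dat: "local_data p s q x0 R u f L" and r: "\<sigma> * R \<le> r1" "r1 < r" "r \<le> R"
      and k: "0 \<le> k" and d: "0 < d" "d \<le> T" and LT: "L \<le> T" and z: "0 < z" "z \<le> 1"
      and ex: "excess p u x0 r k \<le> ennreal (R powr N * T powr p * z)"
    for A and \<Omega> :: "'a set" and u f x0 R L r r1 k d T z
  proof -
    have um[measurable]: "u \<in> borel_measurable borel" and L: "0 < L"
      and fm[measurable]: "restr (ball x0 R) f \<in> borel_measurable borel"
      and Hf: "pint q (restr (ball x0 R) f) \<le> ennreal (R powr (N - p * q) * L powr ((p - 1) * q))"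
      using dat unfolding local_data_def N_def by auto
    have T: "0 < T" using L LT by simp
    have r10: "0 < r1" using \<sigma>(1) R(1) r(1) by (meson less_le_trans mult_pos_pos)
    define t where "t = R / (r - r1)"
    define b where "b = T / d"
    have t1: "1 \<le> t" using r r10 R by (simp add: t_def)
    have b1: "1 \<le> b" using d by (simp add: b_def)
    define g where "g = t * b"
    have bg: "b \<le> g" "t \<le> g" using t1 b1 mult_right_mono[of 1 t b] mult_left_mono[of 1 b t] by (auto simp: g_def)
    have g1: "1 \<le> g" using bg b1 by linarith
    \<comment> \<open>The cutoff function is supported in an intermediate ball, so that the points outside the
      larger one keep their distance from it.\<close>
    define r' where "r' = (r + r1) / 2"
    have r': "r1 < r'" "r' < r" "r' - r1 = R / (2 * t)" "r - r' = R / (2 * t)"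
      using r R by (auto simp: r'_def t_def field_simps)
    define M where "M = c / (r' - r1)"
    have M: "0 < M" "M = 2 * c * t / R"
    proof -
      show "0 < M" unfolding M_def by (rule divide_pos_pos) (use c(1) r'(1) in auto)
      show "M = 2 * c * t / R" unfolding M_def r'(3) by simp
    qed
    obtain \<zeta> Z where cut: "good_cutoff p M x0 r' \<zeta> Z" and \<zeta>1: "\<And>x. x \<in> ball x0 r1 \<Longrightarrow> \<zeta> x = 1"
      using c(2)[OF r10 r'(1), of x0] unfolding M_def by auto
    note \<zeta>b = good_cutoffD(2,3)[OF cut]
    note \<zeta>0 = good_cutoffD(4)[OF cut]
    define w where "w x = max (u x - (k + d)) 0" for x
    define \<phi> where "\<phi> x = w x * \<zeta> x" for x
    have [measurable]: "\<zeta> \<in> borel_measurable borel" by (rule good_cutoffD(7)[OF cut])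
    have [measurable]: "\<phi> \<in> borel_measurable borel" unfolding \<phi>_def[abs_def] w_def by measurable
    have \<phi>nn: "0 \<le> \<phi> x" and \<phi>w: "\<phi> x \<le> w x" for x using \<zeta>b[of x] by (auto simp: \<phi>_def w_def mult_left_le)
    define S where "S = {x \<in> ball x0 r. k + d < u x}"
    have [measurable]: "S \<in> sets borel" unfolding S_def by measurable
    have \<phi>S: "\<phi> x = indicator S x * \<phi> x" for x
    proof (cases "x \<in> S")
      case False
      then consider "u x \<le> k + d" | "x \<notin> cball x0 r'" using r'(2) unfolding S_def by force
      then have "\<phi> x = 0" by cases (auto simp: \<phi>_def w_def \<zeta>0)
      then show ?thesis by simp
    qed simp
    define W where "W = R powr N * T powr p * z"
    have W: "0 < W" using R T z by (simp add: W_def)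
    define y where "y = b powr p * z"
    have y: "0 < y" using b1 z by (simp add: y_def)
    have dW: "d powr (- p) * W = R powr N * y"
    proof -
      have "b powr p = T powr p * d powr (- p)"
        using powr_divide[of T d p] by (simp only: b_def powr_minus_divide times_divide_eq_right mult_1_right)
      then show ?thesis by (simp add: W_def y_def mult_ac)
    qed
    define \<Theta> where "\<Theta> = CT * (2 * t) powr e * R powr (- (s * p)) * L powr (p - 1)"
    define W1 where "W1 = d powr (1 - p) * W"
    have nn: "0 \<le> \<Theta>" "0 \<le> W1" using CT(1) W by (auto simp: \<Theta>_def W1_def)
    have RR: "R / (r - r') = 2 * t" unfolding r'(4) using R t1 by simp
    have Th: "(\<integral>\<^sup>+y. indicator (- ball x0 r) y * ennreal (max (u y) 0 powr (p - 1) / norm (x - y) powr (real DIM('a) + s * p)) \<partial>lborel) \<le> ennreal \<Theta>"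
      if "x \<in> cball x0 r'" for x
      using CT(2)[OF dat R(1) _ r(3) r'(2) that] r unfolding \<Theta>_def e_def N_def RR by simp
    have Wb: "(\<integral>\<^sup>+x. indicator (ball x0 r) x * ennreal (max (u x - (k + d)) 0 powr p) \<partial>lborel) \<le> ennreal W"
      using order_trans[OF excess_mono[of r r k "k + d" p u x0] ex] d p unfolding excess_def W_def by simp
    have cheb: "(\<integral>\<^sup>+x. indicator S x * ennreal (h x) \<partial>lborel) \<le> ennreal (l * W)"
      if "0 \<le> l" "\<And>x. k + d < u x \<Longrightarrow> h x \<le> l * max (u x - k) 0 powr p" for h :: "'a \<Rightarrow> real" and l
    proof -
      have "(\<integral>\<^sup>+x. indicator S x * ennreal (h x) \<partial>lborel)
          \<le> (\<integral>\<^sup>+x. ennreal l * (indicator (ball x0 r) x * ennreal (max (u x - k) 0 powr p)) \<partial>lborel)"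
      proof (rule nn_integral_mono)
        fix x
        show "indicator S x * ennreal (h x) \<le> ennreal l * (indicator (ball x0 r) x * ennreal (max (u x - k) 0 powr p))"
        proof (cases "x \<in> S")
          case True
          then have "ennreal (h x) \<le> ennreal (l * max (u x - k) 0 powr p)" by (intro ennreal_leI that) (auto simp: S_def)
          then show ?thesis using True that(1) by (simp add: S_def ennreal_mult)
        qed simp
      qed
      also have "\<dots> = ennreal l * excess p u x0 r k" unfolding excess_def by (rule nn_integral_cmult) measurable
      also have "\<dots> \<le> ennreal l * ennreal W" using ex unfolding W_def by (rule mult_left_mono) simp
      finally show ?thesis using that(1) W by (simp add: ennreal_mult)
    qed
    have Sm: "emeasure lborel S \<le> ennreal (R powr N * y)"
      using cheb[of "d powr (- p)" "\<lambda>_. 1"] level_raise(1)[OF d(1), of p k] p unfolding dW by simp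
    have W1b: "(\<integral>\<^sup>+x. ennreal (max (u x - (k + d)) 0 * \<zeta> x) \<partial>lborel) \<le> ennreal W1"
    proof -
      have "(\<integral>\<^sup>+x. ennreal (max (u x - (k + d)) 0 * \<zeta> x) \<partial>lborel) = (\<integral>\<^sup>+x. indicator S x * ennreal (\<phi> x) \<partial>lborel)"
      proof (rule nn_integral_cong)
        fix x show "ennreal (max (u x - (k + d)) 0 * \<zeta> x) = indicator S x * ennreal (\<phi> x)"
          using \<phi>S[of x] by (cases "x \<in> S") (auto simp: \<phi>_def w_def)
      qed
      also have "\<dots> \<le> ennreal W1" unfolding W1_def
      proof (rule cheb)
        fix x assume "k + d < u x"
        then show "\<phi> x \<le> d powr (1 - p) * max (u x - k) 0 powr p"
          using \<phi>w[of x] level_raise(2)[OF d(1), of p k "u x"] p by (simp add: w_def)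
      qed simp
      finally show ?thesis .
    qed
    have kd: "0 \<le> k + d" using k d by simp
    have r0: "0 < r" using r10 r by simp
    obtain V where V: "W0_limit (ball x0 R) p \<phi> V" "pint p V < \<infinity>"
      "\<And>F. 0 \<le> F \<Longrightarrow> (\<integral>\<^sup>+x. indicator (ball x0 R) x * ennreal (\<bar>f x\<bar> * \<phi> x) \<partial>lborel) \<le> ennreal F \<Longrightarrow>
          pint p V \<le> ennreal (CC * (M powr p * W + \<Theta> * W1 + F))"
      using CC(2)[OF sol A R(2) B r0 r'(2) r(3) kd less_imp_le[OF M(1)] cut Th nn(1) Wb less_imp_le[OF W] W1b nn(2)]
      unfolding \<phi>_def w_def by blast
    define E where "E = M powr p * W + \<Theta> * W1"
    have E: "0 < E" unfolding E_def
      by (intro add_pos_nonneg mult_pos_pos mult_nonneg_nonneg) (use M(1) W nn in auto)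
    define m where "m = R powr (p - N)"
    have m: "0 < m" using R by (simp add: m_def)
    have mE: "m * E \<le> K1 * (g powr (p + e) * T powr p * z)"
    proof -
      have Mp: "M powr p = (2 * c) powr p * t powr p * R powr (- p)"
        using powr_divide[of "2 * c * t" R p] R(1) by (simp only: M(2) powr_mult powr_minus_divide times_divide_eq_right mult_1_right)
      have RN: "R powr (p - N) * (R powr (- p) * R powr N) = 1" using R by (simp flip: powr_add)
      have tg: "t powr p \<le> g powr (p + e)" "t powr e * b powr (p - 1) \<le> g powr (p + e)"
      proof -
        have "t powr p \<le> g powr p" using bg t1 p by (intro powr_mono2) auto
        also have "\<dots> \<le> g powr (p + e)" using g1 e by (intro powr_mono) auto
        finally show "t powr p \<le> g powr (p + e)" .
        have "t powr e * b powr (p - 1) \<le> g powr e * g powr (p - 1)"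
          using bg t1 b1 p e by (intro mult_mono powr_mono2) auto
        also have "\<dots> = g powr (p - 1 + e)" by (simp add: powr_add)
        also have "\<dots> \<le> g powr (p + e)" using g1 by (intro powr_mono) auto
        finally show "t powr e * b powr (p - 1) \<le> g powr (p + e)" .
      qed
      have "m * (M powr p * W) = ((2 * c) powr p * (T powr p * z)) * t powr p * (R powr (p - N) * (R powr (- p) * R powr N))"
        by (simp add: m_def Mp W_def mult_ac)
      also have "\<dots> \<le> ((2 * c) powr p * (T powr p * z)) * g powr (p + e)"
        unfolding RN using tg(1) z by (simp add: mult_left_mono)
      finally have 1: "m * (M powr p * W) \<le> ((2 * c) powr p * (T powr p * z)) * g powr (p + e)" .
      have bd: "d powr (1 - p) * T powr p = b powr (p - 1) * T"
      proof -
        have "b powr (p - 1) = T powr (p - 1) * d powr (- (p - 1))"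
          using powr_divide[of T d "p - 1"] by (simp only: b_def powr_minus_divide times_divide_eq_right mult_1_right)
        moreover have "T powr (p - 1) * T = T powr p" using T by (simp add: powr_diff)
        ultimately show ?thesis by (simp add: mult_ac)
      qed
      have "m * (\<Theta> * W1) = CT * 2 powr e * t powr e * z * (d powr (1 - p) * T powr p) * (L powr (p - 1) * (R powr (p - N) * (R powr (- (s * p)) * R powr N)))"
        by (simp add: m_def \<Theta>_def W1_def W_def powr_mult mult_ac)
      also have "\<dots> \<le> CT * 2 powr e * t powr e * z * (b powr (p - 1) * T) * (T powr (p - 1) * 1)"
        unfolding bd
      proof (rule mult_left_mono)
        have 3: "L powr (p - 1) \<le> T powr (p - 1)" using LT L p by (intro powr_mono2) auto
        have "R powr (p - N) * (R powr (- (s * p)) * R powr N) = R powr (p - s * p)" by (simp flip: powr_add)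
        also have "\<dots> \<le> 1" using R p s by (intro powr_le1) (auto simp: mult_le_cancel_right2)
        finally have "R powr (p - N) * (R powr (- (s * p)) * R powr N) \<le> 1" .
        with 3 show "L powr (p - 1) * (R powr (p - N) * (R powr (- (s * p)) * R powr N)) \<le> T powr (p - 1) * 1"
          by (intro mult_mono) auto
      qed (use CT(1) z T in auto)
      also have "\<dots> = (CT * 2 powr e * (T powr p * z)) * (t powr e * b powr (p - 1))"
      proof -
        have "T powr (p - 1) * T = T powr p" using T by (simp add: powr_diff)
        moreover have "CT * 2 powr e * t powr e * z * (b powr (p - 1) * T) * (T powr (p - 1) * 1)
            = CT * 2 powr e * ((T powr (p - 1) * T) * z) * (t powr e * b powr (p - 1))" by (simp add: mult_ac)
        ultimately show ?thesis by simp
      qed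
      also have "\<dots> \<le> (CT * 2 powr e * (T powr p * z)) * g powr (p + e)"
        using tg(2) CT(1) z by (intro mult_left_mono) auto
      finally have 2: "m * (\<Theta> * W1) \<le> (CT * 2 powr e * (T powr p * z)) * g powr (p + e)" .
      show ?thesis using 1 2 by (simp add: E_def K1_def algebra_simps)
    qed
    define \<Lambda> where "\<Lambda> = L powr (p - 1) * y powr \<gamma>"
    have "\<exists>X\<ge>0. pint (p * \<kappa>) \<phi> \<le> ennreal (R powr N * X powr \<kappa>) \<and>
        X \<le> 2 * (CS * (CC + 1) * (m * E)) + (2 * CS * CC * \<Lambda>) powr (p / (p - 1))"
    proof (rule absorbed_energy[where pV="pint p V" and I="\<integral>\<^sup>+x. indicator (ball x0 R) x * ennreal (\<bar>f x\<bar> * \<phi> x) \<partial>lborel"])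
      show "pint (p * \<kappa>) \<phi> \<le> ennreal (R powr N * (CS * m * D) powr \<kappa>)" if "pint p V \<le> ennreal D" "0 < D" for D
      proof -
        have "CS powr \<kappa> = CS0" using \<kappa>(1) CS0(1) by (simp add: CS_def powr_powr)
        moreover have "R powr N * R powr ((p - N) * \<kappa>) = R powr (\<kappa> * (p - N) + N)"
          by (simp add: mult.commute add.commute flip: powr_add)
        ultimately have "R powr N * (CS * m * D) powr \<kappa> = CS0 * R powr (\<kappa> * (p - N) + N) * D powr \<kappa>"
          by (simp add: m_def powr_mult powr_powr mult_ac)
        then show ?thesis using CS0(2)[OF R(1) V(1) that] unfolding N_def by simp
      qed
      fix X assume X: "0 \<le> X" "pint (p * \<kappa>) \<phi> \<le> ennreal (R powr N * X powr \<kappa>)"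
      have "(\<integral>\<^sup>+x. indicator (ball x0 R) x * ennreal (\<bar>f x\<bar> * \<phi> x) \<partial>lborel)
          = (\<integral>\<^sup>+x. ennreal (norm (restr (ball x0 R) f x) * (indicator S x * \<phi> x)) \<partial>lborel)"
      proof (rule nn_integral_cong)
        fix x show "indicator (ball x0 R) x * ennreal (\<bar>f x\<bar> * \<phi> x) = ennreal (norm (restr (ball x0 R) f x) * (indicator S x * \<phi> x))"
          using \<phi>S[of x] by (cases "x \<in> ball x0 R") auto
      qed
      also have "\<dots> \<le> ennreal ((R powr (N - p * q) * L powr ((p - 1) * q)) powr (1 / q)
          * (R powr N * X powr \<kappa>) powr (1 / (p * \<kappa>)) * (R powr N * y) powr (1 - 1 / q - 1 / (p * \<kappa>)))"
        by (rule nn_integral_Hoelder_on)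
          (use Hf X Sm q \<gamma> p \<kappa>(1) y \<phi>nn in \<open>auto simp: pint_def \<gamma>_def\<close>)
      also have "(R powr (N - p * q) * L powr ((p - 1) * q)) powr (1 / q)
          * (R powr N * X powr \<kappa>) powr (1 / (p * \<kappa>)) * (R powr N * y) powr (1 - 1 / q - 1 / (p * \<kappa>))
          = \<Lambda> / m * X powr (1 / p)"
      proof -
        have ex: "(p - 1) * q * (1 / q) = p - 1" "\<kappa> * (1 / (p * \<kappa>)) = 1 / p" using q(1) p \<kappa>(1) by auto
        have "(N - p * q) * (1 / q) + N * (1 / (p * \<kappa>)) + N * (1 - 1 / q - 1 / (p * \<kappa>)) = N - p"
          using q(1) by (simp add: algebra_simps)
        then have "R powr ((N - p * q) * (1 / q)) * R powr (N * (1 / (p * \<kappa>))) * R powr (N * (1 - 1 / q - 1 / (p * \<kappa>))) = R powr (N - p)"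
          by (simp only: powr_add[symmetric])
        also have "\<dots> = 1 / m" using powr_minus_divide[of R "p - N"] by (simp add: m_def)
        finally have Rm: "R powr ((N - p * q) * (1 / q)) * R powr (N * (1 / (p * \<kappa>))) * R powr (N * (1 - 1 / q - 1 / (p * \<kappa>))) = 1 / m" .
        have regroup: "(a1 * l) * (a2 * x) * (a3 * v) = (l * v) * (a1 * a2 * a3) * x" for a1 a2 a3 l x v :: real by simp
        show ?thesis unfolding powr_mult powr_powr ex regroup Rm by (simp add: \<Lambda>_def \<gamma>_def)
      qed
      finally show "(\<integral>\<^sup>+x. indicator (ball x0 R) x * ennreal (\<bar>f x\<bar> * \<phi> x) \<partial>lborel) \<le> ennreal (\<Lambda> / m * X powr (1 / p))" .
    next
      show "pint p V \<le> ennreal (CC * (E + F))"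
        if "0 \<le> F" "(\<integral>\<^sup>+x. indicator (ball x0 R) x * ennreal (\<bar>f x\<bar> * \<phi> x) \<partial>lborel) \<le> ennreal F" for F
        using V(3)[OF that] unfolding E_def .
    qed (use p CS CC(1) E m V(2) in \<open>auto simp: \<Lambda>_def\<close>)
    then obtain X where X: "0 \<le> X" "pint (p * \<kappa>) \<phi> \<le> ennreal (R powr N * X powr \<kappa>)"
      "X \<le> 2 * (CS * (CC + 1) * (m * E)) + (2 * CS * CC * \<Lambda>) powr (p / (p - 1))" by blast
    have "(2 * CS * CC * \<Lambda>) powr (p / (p - 1)) \<le> K' * T powr p * y powr \<delta>"
    proof -
      have "(p - 1) * (p / (p - 1)) = p" using p by simp
      then have "\<Lambda> powr (p / (p - 1)) = L powr p * y powr \<delta>" by (simp only: \<Lambda>_def powr_mult powr_powr \<delta>_def)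
      also have "\<dots> \<le> T powr p * y powr \<delta>" using LT L p by (intro mult_right_mono powr_mono2) auto
      finally show ?thesis unfolding powr_mult[of _ \<Lambda>] K'_def mult.assoc[of _ _ "y powr \<delta>"] by (rule mult_left_mono) simp
    qed
    moreover have "2 * (CS * (CC + 1) * (m * E)) \<le> K * (g powr (p + e) * T powr p * z)"
    proof -
      have "CS * (CC + 1) * (m * E) \<le> CS * (CC + 1) * (K1 * (g powr (p + e) * T powr p * z))"
        using mE CS CC(1) by (intro mult_left_mono) auto
      then show ?thesis unfolding K_def by (simp add: mult.assoc)
    qed
    ultimately have XK: "X \<le> K * (g powr (p + e) * T powr p * z) + K' * T powr p * (b powr p * z) powr \<delta>"
      using X(3) by (simp add: y_def)
    have fin: "X * y powr \<theta> \<le> (K + K') * (T powr p * (g powr a * z powr (1 + \<beta>)))"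
      unfolding y_def a_def
      by (rule step_algebra[OF b1 bg(1) z _ _ _ _ _ _ _ _ _ _ XK])
        (use \<theta> \<delta> K T p e in \<open>auto simp: \<beta>_def\<close>)
    have "excess p u x0 r1 (k + d) \<le> (\<integral>\<^sup>+x. ennreal (indicator S x * \<phi> x powr p) \<partial>lborel)"
      unfolding excess_def
    proof (rule nn_integral_mono)
      fix x
      show "indicator (ball x0 r1) x * ennreal (max (u x - (k + d)) 0 powr p) \<le> ennreal (indicator S x * \<phi> x powr p)"
      proof (cases "x \<in> ball x0 r1")
        case True
        then have "max (u x - (k + d)) 0 = \<phi> x" using \<zeta>1[OF True] by (simp add: \<phi>_def w_def)
        moreover have "\<phi> x = 0" if "x \<notin> S" using \<phi>S[of x] that by simp
        ultimately show ?thesis using True by (cases "x \<in> S") auto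
      qed simp
    qed
    also have "\<dots> \<le> ennreal ((R powr N * y) powr (1 - 1 / \<kappa>) * (R powr N * X powr \<kappa>) powr (1 / \<kappa>))"
    proof (rule nn_integral_power_mean[OF _ _ _ _ less_imp_le[OF \<kappa>(1)]])
      show "(\<integral>\<^sup>+x. ennreal (indicator S x) \<partial>lborel) \<le> ennreal (R powr N * y)" using Sm by (simp add: ennreal_indicator)
      have "(\<integral>\<^sup>+x. ennreal (indicator S x * (\<phi> x powr p) powr \<kappa>) \<partial>lborel) \<le> pint (p * \<kappa>) \<phi>"
        unfolding pint_def by (rule nn_integral_mono) (use \<phi>nn in \<open>auto simp: powr_powr indicator_def\<close>)
      then show "(\<integral>\<^sup>+x. ennreal (indicator S x * (\<phi> x powr p) powr \<kappa>) \<partial>lborel) \<le> ennreal (R powr N * X powr \<kappa>)"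
        using X(2) by (rule order_trans)
    qed (use y in auto)
    also have "(R powr N * y) powr (1 - 1 / \<kappa>) * (R powr N * X powr \<kappa>) powr (1 / \<kappa>) = R powr N * (X * y powr \<theta>)"
    proof -
      have "\<kappa> * (1 / \<kappa>) = 1" using \<kappa>(1) by simp
      moreover have "R powr (N * (1 - 1 / \<kappa>)) * R powr (N * (1 / \<kappa>)) = R powr N"
        by (subst powr_add[symmetric]) (simp add: right_diff_distrib)
      moreover have regroup: "(a1 * v) * (a2 * x) = (a1 * a2) * (x * v)" for a1 a2 x v :: real by simp
      ultimately show ?thesis unfolding powr_mult powr_powr regroup using X(1) by (simp add: \<theta>_def)
    qed
    also have "ennreal (R powr N * (X * y powr \<theta>)) \<le> ennreal (R powr N * ((K + K') * (T powr p * (g powr a * z powr (1 + \<beta>)))))"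
      using fin by (intro ennreal_leI mult_left_mono) auto
    finally show ?thesis by (simp add: g_def t_def b_def)
  qed
  have KK: "0 < K + K'" using K by simp
  show ?thesis by (rule that[OF KK a \<beta>]) (rule main[unfolded N_def], assumption+)
qed

text \<open>With levels and radii converging geometrically the excess decays geometrically, provided
  that it is small at the start; the latter is achieved by taking the limiting level large.\<close>

lemma bounded_below_dimension:
  assumes p: "2 \<le> p" and s: "0 < s" "s < 1" and \<sigma>: "0 < \<sigma>" "\<sigma> < 1" and q: "1 < q" "real DIM('a::euclidean_space) / p < q"
  obtains C where "0 < C"
    "\<And>A (\<Omega> :: 'a set) u f x0 R L. weak_solution p s A \<Omega> f u \<Longrightarrow> 0 \<le> A \<Longrightarrow> A \<le> 1 \<Longrightarrow> 0 < R \<Longrightarrow> R < 1 \<Longrightarrow>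
      ball x0 R \<Subset> \<Omega> \<Longrightarrow> local_data p s q x0 R u f L \<Longrightarrow> AE x in lborel. x \<in> ball x0 (\<sigma> * R) \<longrightarrow> u x \<le> C * L"
proof -
  define N where "N = real DIM('a)"
  \<comment> \<open>The exponent \<open>\<kappa>\<close> has to exceed the conjugate exponent of \<open>q\<close> and to stay below the Sobolev
    exponent; both are possible exactly if \<open>N / p < q\<close>.\<close>
  have "\<exists>\<kappa>>1. (N - p) * \<kappa> < N \<and> 1 / q + 1 / \<kappa> < 1"
  proof -
    have q1: "1 < q / (q - 1)" using q(1) by (simp add: field_simps)
    have good: "1 / q + 1 / \<kappa> < 1" if "q / (q - 1) < \<kappa>" for \<kappa>
    proof -
      have "1 / \<kappa> < 1 / (q / (q - 1))" using that q1 by (intro divide_strict_left_mono mult_pos_pos) linarith+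
      also have "\<dots> = 1 - 1 / q" using q(1) by (simp add: field_simps)
      finally show ?thesis by simp
    qed
    show ?thesis
    proof (cases "N \<le> p")
      case True
      have "(N - p) * (q / (q - 1) + 1) \<le> 0" using True q1 by (intro mult_nonpos_nonneg) auto
      then have "(N - p) * (q / (q - 1) + 1) < N" by (simp add: N_def le_less_trans)
      then show ?thesis using good[of "q / (q - 1) + 1"] q1 by (intro exI[of _ "q / (q - 1) + 1"]) auto
    next
      case False
      have "N < q * p" using q(2) p by (simp add: N_def field_simps)
      then have "q / (q - 1) < N / (N - p)" using False q(1) by (simp add: field_simps)
      then obtain \<kappa> where \<kappa>: "q / (q - 1) < \<kappa>" "\<kappa> < N / (N - p)" using dense by blast
      then have "(N - p) * \<kappa> < N" using False by (simp add: field_simps)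
      then show ?thesis using good[OF \<kappa>(1)] \<kappa>(1) q1 by (intro exI[of _ \<kappa>]) auto
    qed
  qed
  then obtain \<kappa> where \<kappa>: "1 < \<kappa>" "(real DIM('a) - p) * \<kappa> < real DIM('a)" "1 / q + 1 / \<kappa> < 1" unfolding N_def by blast
  obtain C a \<beta> where C: "0 < C" "0 < a" "0 < \<beta>"
    "\<And>A (\<Omega> :: 'a set) u f x0 R L r r1 k d T z. weak_solution p s A \<Omega> f u \<Longrightarrow> 0 \<le> A \<Longrightarrow> A \<le> 1 \<Longrightarrow> 0 < R \<Longrightarrow> R < 1 \<Longrightarrow>
      ball x0 R \<Subset> \<Omega> \<Longrightarrow> local_data p s q x0 R u f L \<Longrightarrow> \<sigma> * R \<le> r1 \<Longrightarrow> r1 < r \<Longrightarrow> r \<le> R \<Longrightarrow>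
      0 \<le> k \<Longrightarrow> 0 < d \<Longrightarrow> d \<le> T \<Longrightarrow> L \<le> T \<Longrightarrow> 0 < z \<Longrightarrow> z \<le> 1 \<Longrightarrow>
      excess p u x0 r k \<le> ennreal (R powr real DIM('a) * T powr p * z) \<Longrightarrow>
      excess p u x0 r1 (k + d) \<le> ennreal (R powr real DIM('a) *
        (C * (T powr p * ((R / (r - r1) * (T / d)) powr a * z powr (1 + \<beta>)))))"
    using level_step[OF p s \<sigma> \<kappa>(1,2) q(1) \<kappa>(3)] by blast
  define B where "B = 4 powr a"
  have B: "1 < B" using C(2) by (simp add: B_def)
  \<comment> \<open>The rate \<open>\<rho>\<close> is such that \<open>\<rho> powr \<beta>\<close> compensates the growth \<open>B ^ j\<close> of the factors in the steps.\<close>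
  define \<rho> where "\<rho> = B powr (- (1 / \<beta>))"
  have \<rho>: "0 < \<rho>" "\<rho> < 1" "\<rho> powr \<beta> = 1 / B"
  proof -
    show "0 < \<rho>" using B by (simp add: \<rho>_def)
    have "B powr (- (1 / \<beta>)) < B powr 0" using B C(3) by (intro powr_less_mono) auto
    then show "\<rho> < 1" using B by (simp add: \<rho>_def)
    have "- (1 / \<beta>) * \<beta> = - 1" using C(3) by simp
    then show "\<rho> powr \<beta> = 1 / B" using B unfolding \<rho>_def powr_powr by (simp add: powr_minus_divide)
  qed
  define C1 where "C1 = C * (4 / (1 - \<sigma>)) powr a"
  have C1: "0 < C1" using C(1) \<sigma> by (simp add: C1_def)
  define z0 where "z0 = min 1 ((\<rho> / C1) powr (1 / \<beta>))"
  have z0: "0 < z0" "z0 \<le> 1" using \<rho> C1 by (auto simp: z0_def)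
  have C1z: "C1 * z0 powr \<beta> \<le> \<rho>"
  proof -
    have "z0 powr \<beta> \<le> ((\<rho> / C1) powr (1 / \<beta>)) powr \<beta>" using z0 C(3) by (intro powr_mono2) (auto simp: z0_def)
    also have "\<dots> = \<rho> / C1" using C(3) \<rho> C1 by (simp add: powr_powr)
    finally show ?thesis using C1 by (simp add: field_simps)
  qed
  \<comment> \<open>The levels tend to \<open>H * L\<close>; relative to this level the initial excess is \<open>z0\<close>.\<close>
  define H where "H = z0 powr (- (1 / p))"
  have H: "1 \<le> H"
  proof -
    have "z0 powr 0 \<le> z0 powr (- (1 / p))" using z0 p by (intro powr_mono') auto
    then show ?thesis using z0 by (simp add: H_def)
  qed
  have Hz: "H powr p * z0 = 1"
  proof -
    have "- (1 / p) * p = - 1" using p by simp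
    then show ?thesis using z0 unfolding H_def powr_powr by (simp add: powr_minus_divide)
  qed
  have main: "AE x in lborel. x \<in> ball x0 (\<sigma> * R) \<longrightarrow> u x \<le> H * L"
    if sol: "weak_solution p s A \<Omega> f u" and A: "0 \<le> A" "A \<le> 1" and R: "0 < R" "R < 1" and Bl: "ball x0 R \<Subset> \<Omega>"
      and dat: "local_data p s q x0 R u f L"
    for A and \<Omega> :: "'a set" and u f x0 R L
  proof -
    have um[measurable]: "u \<in> borel_measurable borel" and L: "0 < L"
      and Hp: "pint p (restr (ball x0 R) (\<lambda>x. max (u x) 0)) \<le> ennreal (R powr N * L powr p)"
      using dat unfolding local_data_def N_def by auto
    define T where "T = H * L"
    have T: "0 < T" "L \<le> T" using H L mult_right_mono[of 1 H L] by (auto simp: T_def)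
    have Tz: "T powr p * z0 = L powr p" using Hz by (simp add: T_def powr_mult)
    define h where "h j = (1 / 2 :: real) ^ j" for j :: nat
    have h: "0 < h j" "h j \<le> 1" "h (Suc j) = h j / 2" for j by (auto simp: h_def power_le_one)
    define r where "r j = R * (\<sigma> + (1 - \<sigma>) * h j)" for j
    define k where "k j = T * (1 - h j)" for j
    have step: "excess p u x0 (r j) (k j) \<le> ennreal (R powr N * T powr p * (z0 * \<rho> ^ j))" for j
    proof (induction j)
      case 0
      have "r 0 = R" "k 0 = 0" by (auto simp: r_def k_def h_def)
      then show ?case using Hp Tz by (simp add: excess_def pint_restr mult.assoc)
    next
      case (Suc j)
      define z where "z = z0 * \<rho> ^ j"
      have \<rho>j: "0 < \<rho> ^ j" "\<rho> ^ j \<le> 1" using \<rho> by (auto simp: power_le_one)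
      have z: "0 < z" "z \<le> 1" using z0 \<rho>j mult_le_one[of z0 "\<rho> ^ j"] by (auto simp: z_def)
      define d where "d = T * (h j / 2)"
      have d: "0 < d" "d \<le> T" "T / d = 2 / h j" "k (Suc j) = k j + d"
      proof -
        show "0 < d" using T h[of j] by (simp add: d_def)
        show "d \<le> T" using T h[of j] by (simp add: d_def)
        show "T / d = 2 / h j" using T by (simp add: d_def)
        show "k (Suc j) = k j + d" by (simp add: k_def d_def h(3) algebra_simps)
      qed
      have dr: "r j - r (Suc j) = R * ((1 - \<sigma>) * (h j / 2))" by (simp add: r_def h(3) field_simps)
      have dr0: "0 < R * ((1 - \<sigma>) * (h j / 2))" using R \<sigma> h[of j] by simp
      have rr: "\<sigma> * R \<le> r (Suc j)" "r (Suc j) < r j" "r j \<le> R"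
      proof -
        show "\<sigma> * R \<le> r (Suc j)" using R \<sigma> h[of "Suc j"] by (simp add: r_def algebra_simps)
        show "r (Suc j) < r j" using dr dr0 by linarith
        have "\<sigma> + (1 - \<sigma>) * h j \<le> \<sigma> + (1 - \<sigma>) * 1" using \<sigma> h[of j] by (intro add_left_mono mult_left_mono) auto
        then show "r j \<le> R" using R mult_left_mono[of "\<sigma> + (1 - \<sigma>) * h j" 1 R] by (simp add: r_def)
      qed
      have kj: "0 \<le> k j" using T h[of j] by (simp add: k_def)
      have RT: "(R / (r j - r (Suc j)) * (T / d)) powr a = (4 / (1 - \<sigma>)) powr a * B ^ j"
      proof -
        have "R / (r j - r (Suc j)) * (T / d) = (4 / (1 - \<sigma>)) * 4 ^ j"
        proof -
          have "h j * h j = (1 / 4) ^ j" by (simp add: h_def flip: power_mult_distrib)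
          then have "4 ^ j * (h j * h j) = 1" by (simp flip: power_mult_distrib)
          then have "1 / (h j * h j) = 4 ^ j" using h(1)[of j] by (simp add: field_simps)
          moreover have "R / (r j - r (Suc j)) * (T / d) = (4 / (1 - \<sigma>)) * (1 / (h j * h j))"
            unfolding dr d(3) using R \<sigma> h(1)[of j] by (simp add: field_simps)
          ultimately show ?thesis by simp
        qed
        moreover have "((4::real) ^ j) powr a = B ^ j"
          by (simp add: B_def powr_powr mult.commute flip: powr_realpow)
        ultimately show ?thesis by (simp only: powr_mult)
      qed
      have zb: "z powr (1 + \<beta>) = z * (z0 powr \<beta> * (1 / B) ^ j)"
      proof -
        have "(\<rho> ^ j) powr \<beta> = (\<rho> powr \<beta>) ^ j"
          using \<rho>(1) by (simp add: powr_powr mult.commute flip: powr_realpow)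
        then have "z powr \<beta> = z0 powr \<beta> * (1 / B) ^ j" by (simp add: z_def powr_mult \<rho>(3))
        then show ?thesis using z by (simp add: powr_add)
      qed
      have BB: "B ^ j * (1 / B) ^ j = 1" using B by (simp flip: power_mult_distrib)
      have "excess p u x0 (r (Suc j)) (k (Suc j)) \<le> ennreal (R powr N *
          (C * (T powr p * ((R / (r j - r (Suc j)) * (T / d)) powr a * z powr (1 + \<beta>)))))"
        unfolding d(4) N_def
        by (rule C(4)[OF sol A R Bl dat rr kj d(1,2) T(2) z]) (use Suc.IH in \<open>simp add: z_def N_def\<close>)
      also have "R powr N * (C * (T powr p * ((R / (r j - r (Suc j)) * (T / d)) powr a * z powr (1 + \<beta>))))
          = R powr N * T powr p * z * (C1 * z0 powr \<beta>) * (B ^ j * (1 / B) ^ j)"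
        unfolding RT zb C1_def by (simp only: mult_ac)
      also have "\<dots> \<le> R powr N * T powr p * z * \<rho>"
        unfolding BB using C1z z by (simp add: mult_left_mono)
      also have "\<dots> = R powr N * T powr p * (z0 * \<rho> ^ Suc j)" by (simp add: z_def mult_ac)
      finally show ?case by (simp add: ennreal_leI)
    qed
    have "excess p u x0 (\<sigma> * R) T \<le> ennreal (R powr N * T powr p * (z0 * \<rho> ^ j))" for j
    proof (rule order_trans[OF excess_mono step[of j]])
      show "\<sigma> * R \<le> r j" using R \<sigma> h[of j] by (simp add: r_def algebra_simps)
      show "k j \<le> T" using T h[of j] by (simp add: k_def algebra_simps)
    qed (use p in simp)
    moreover have "(\<lambda>j. ennreal (R powr N * T powr p * (z0 * \<rho> ^ j))) \<longlonglongrightarrow> ennreal (R powr N * T powr p * (z0 * 0))"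
      by (intro tendsto_intros LIMSEQ_power_zero) (use \<rho> in auto)
    ultimately have "excess p u x0 (\<sigma> * R) T \<le> ennreal (R powr N * T powr p * (z0 * 0))"
      by (intro tendsto_lowerbound[of _ _ sequentially]) auto
    then have "excess p u x0 (\<sigma> * R) T = 0" by simp
    then have "AE x in lborel. indicator (ball x0 (\<sigma> * R)) x * ennreal (max (u x - T) 0 powr p) = 0"
      unfolding excess_def by (subst (asm) nn_integral_0_iff_AE) auto
    then show ?thesis
    proof eventually_elim
      case (elim x)
      then show ?case by (auto simp: T_def indicator_def split: if_splits)
    qed
  qed
  have H0: "0 < H" using H by simp
  show ?thesis by (rule that[OF H0]) (rule main, assumption+)
qed

section \<open>From normalised data to the stated norms\<close>

lemma Linf_norm_le_iff:
  fixes g :: "'a::euclidean_space \<Rightarrow> 'b::euclidean_space"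
  assumes S[measurable]: "S \<in> sets borel" and g: "restr S g \<in> borel_measurable borel"
  shows "Linf_norm S g \<le> ereal b \<longleftrightarrow> (AE x in lborel. x \<in> S \<longrightarrow> norm (g x) \<le> b)"
proof -
  have "g \<in> borel_measurable (restrict_space lborel S)"
    using g by (subst borel_measurable_restrict_space_iff) (auto simp: restr_def[abs_def])
  then have gm: "(\<lambda>x. ereal (norm (g x))) \<in> borel_measurable (restrict_space lborel S)" by measurable
  have "Linf_norm S g \<le> ereal b \<longleftrightarrow> (AE x in restrict_space lborel S. ereal (norm (g x)) \<le> ereal b)"
  proof
    assume le: "Linf_norm S g \<le> ereal b"
    have "AE x in restrict_space lborel S. ereal (norm (g x)) \<le> Linf_norm S g"
      unfolding Linf_norm_def by (rule esssup_AE)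
    then show "AE x in restrict_space lborel S. ereal (norm (g x)) \<le> ereal b"
      by eventually_elim (rule order_trans[OF _ le])
  qed (unfold Linf_norm_def, rule esssup_I[OF gm])
  also have "\<dots> \<longleftrightarrow> (AE x in lborel. x \<in> S \<longrightarrow> norm (g x) \<le> b)" by (simp add: AE_restrict_space_iff)
  finally show ?thesis .
qed

lemma restr_restr: "S \<subseteq> T \<Longrightarrow> restr S (restr T g) = restr S g"
  by (auto simp: restr_def indicator_def fun_eq_iff)

lemma in_Lp_subset:
  fixes g :: "'a::euclidean_space \<Rightarrow> real"
  assumes "in_Lp q T g" and ST: "S \<subseteq> T" and Sm[measurable]: "S \<in> sets borel" "T \<in> sets borel"
    and q: "0 < q"
  shows "in_Lp q S g"
proof -
  have Tm[measurable]: "restr T g \<in> borel_measurable borel"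
    using assms(1) by (simp add: in_Lp_def set_borel_measurable_def restr_def[abs_def])
  have S: "restr S g \<in> borel_measurable borel"
    using restr_measurable[OF Tm Sm(1)] unfolding restr_restr[OF ST] .
  have sm: "set_borel_measurable lborel S g"
    using S by (simp add: set_borel_measurable_def restr_def[abs_def])
  show ?thesis
  proof (cases "q = \<infinity>")
    case True
    then have "Linf_norm T g < \<infinity>" using assms(1) by (simp add: in_Lp_def)
    then obtain b where "Linf_norm T g \<le> ereal b" by (cases "Linf_norm T g") auto
    then have "AE x in lborel. x \<in> T \<longrightarrow> norm (g x) \<le> b" by (simp add: Linf_norm_le_iff[OF Sm(2) Tm])
    then have "AE x in lborel. x \<in> S \<longrightarrow> norm (g x) \<le> b" by eventually_elim (use ST in auto)
    then have "Linf_norm S g \<le> ereal b" by (simp add: Linf_norm_le_iff[OF Sm(1) S])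
    then show ?thesis using True sm by (auto simp: in_Lp_def)
  next
    case False
    then obtain q' where q': "q = ereal q'" "0 < q'" using q by (cases q) auto
    have "pint q' (restr S g) \<le> pint q' (restr T g)"
      using q' ST by (intro pint_mono) (auto simp: restr_def indicator_def)
    then show ?thesis using assms(1) S unfolding q' in_Lp_iff by (auto intro: le_less_trans)
  qed
qed

text \<open>The hypothesis on \<open>f\<close> is used with a finite exponent only; smaller exponents are covered by
  the power mean inequality, with the right power of the radius.\<close>

lemma pint_le_Lp_norm:
  fixes f :: "'a::euclidean_space \<Rightarrow> real"
  assumes f: "in_Lp q (ball x0 R) f" and R: "0 < R" and r: "1 \<le> r" "ereal r \<le> q"
  shows "0 \<le> Lp_norm q (ball x0 R) f" and
    "pint r (restr (ball x0 R) f) \<le> ennreal (R powr (real DIM('a) - p * r) *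
      ((1 + unit_ball_vol (real DIM('a))) * (R powr (p - real_of_ereal (ereal (real DIM('a)) / q)) * Lp_norm q (ball x0 R) f)) powr r)"
proof -
  define N where "N = real DIM('a)"
  define v where "v = unit_ball_vol N"
  have v: "0 < v" by (simp add: v_def N_def)
  define S where "S = ball x0 R"
  have Sm[measurable]: "S \<in> sets borel" by (simp add: S_def)
  have fm[measurable]: "restr S f \<in> borel_measurable borel"
    using f by (simp add: in_Lp_def set_borel_measurable_def restr_def[abs_def] S_def)
  define i where "i = (if q = \<infinity> then 0 else 1 / real_of_ereal q)"
  define F where "F = Lp_norm q S f"
  have Sv: "emeasure lborel S = ennreal (v * R powr N)"
    unfolding S_def v_def N_def by (rule ball_emeasure_powr[OF R])
  have "0 \<le> F \<and> 0 \<le> r * i \<and> r * i \<le> 1 \<and> real_of_ereal (ereal N / q) = N * i \<and>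
    pint r (restr S f) \<le> ennreal ((v * R powr N) powr (1 - r * i) * F powr r)"
  proof (cases "q = \<infinity>")
    case True
    have "Linf_norm S f < \<infinity>" using f True by (simp add: in_Lp_def S_def)
    then have "Linf_norm S f \<le> ereal F" using True by (cases "Linf_norm S f") (auto simp: F_def Lp_norm_def)
    then have bd: "AE x in lborel. x \<in> S \<longrightarrow> norm (f x) \<le> F" by (simp add: Linf_norm_le_iff[OF Sm fm])
    have F: "0 \<le> F"
    proof (rule ccontr)
      assume "\<not> 0 \<le> F"
      from bd have "AE x in lborel. indicator S x = (0 :: ennreal)"
      proof eventually_elim
        case (elim x)
        have "x \<notin> S" using elim \<open>\<not> 0 \<le> F\<close> norm_ge_zero[of "f x"] by linarith
        then show ?case by simp
      qed
      then have "(\<integral>\<^sup>+x. indicator S x \<partial>(lborel :: 'a measure)) = (\<integral>\<^sup>+x. 0 \<partial>(lborel :: 'a measure))"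
        by (rule nn_integral_cong_AE)
      then have "emeasure lborel S = 0" by simp
      then show False using Sv v R by simp
    qed
    have "pint r (restr S f) \<le> (\<integral>\<^sup>+x. ennreal (F powr r) * indicator S x \<partial>lborel)"
      unfolding pint_def
    proof (rule nn_integral_mono_AE)
      show "AE x in lborel. ennreal (norm (restr S f x) powr r) \<le> ennreal (F powr r) * indicator S x"
        using bd
      proof eventually_elim
        case (elim x)
        then show ?case using r by (cases "x \<in> S") (auto intro!: ennreal_leI powr_mono2)
      qed
    qed
    also have "\<dots> = ennreal (F powr r) * ennreal (v * R powr N)" by (simp add: Sv nn_integral_cmult)
    also have "\<dots> = ennreal ((v * R powr N) powr (1 - r * i) * F powr r)"
      using True v R by (simp add: i_def mult.commute flip: ennreal_mult)
    finally show ?thesis using F True by (simp add: i_def)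
  next
    case False
    obtain q' where q': "q = ereal q'" "r \<le> q'" using r False by (cases q) auto
    have i: "i = 1 / q'" by (simp add: i_def q')
    have fin: "pint q' (restr S f) < \<infinity>" using f unfolding q' in_Lp_iff S_def by simp
    have F: "F = enn2real (pint q' (restr S f)) powr (1 / q')" unfolding F_def q' by (rule Lp_norm_eq[OF fm])
    have eq: "indicator S x * norm (restr S f x) powr a = norm (restr S f x) powr a" for x a
      by (cases "x \<in> S") auto
    have "(\<integral>\<^sup>+x. ennreal (indicator S x * norm (restr S f x) powr r) \<partial>lborel)
        \<le> ennreal ((v * R powr N) powr (1 - 1 / (q' / r)) * enn2real (pint q' (restr S f)) powr (1 / (q' / r)))"
    proof (rule nn_integral_power_mean)
      show "1 \<le> q' / r" using q' r by simp
      show "(\<integral>\<^sup>+x. ennreal (indicator S x) \<partial>lborel) \<le> ennreal (v * R powr N)" by (simp add: ennreal_indicator Sv)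
      show "(\<integral>\<^sup>+x. ennreal (indicator S x * (norm (restr S f x) powr r) powr (q' / r)) \<partial>lborel) \<le> ennreal (enn2real (pint q' (restr S f)))"
      proof -
        have "(\<integral>\<^sup>+x. ennreal (indicator S x * (norm (restr S f x) powr r) powr (q' / r)) \<partial>lborel) = pint q' (restr S f)"
          using r by (simp only: powr_powr eq pint_def) simp
        then show ?thesis using fin by simp
      qed
    qed (use v R in auto)
    moreover have "enn2real (pint q' (restr S f)) powr (1 / (q' / r)) = F powr r"
      unfolding F powr_powr by simp
    moreover have "1 / (q' / r) = r * i" by (simp add: i)
    ultimately have "pint r (restr S f) \<le> ennreal ((v * R powr N) powr (1 - r * i) * F powr r)"
      unfolding pint_def eq by simp
    moreover have "0 \<le> F" by (simp add: F)
    moreover have "real_of_ereal (ereal N / q) = N * i" using q' r by (simp add: i)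
    ultimately show ?thesis using q' r by (simp add: i)
  qed
  then have F: "0 \<le> F" and ri: "0 \<le> r * i" "r * i \<le> 1" and Ni: "real_of_ereal (ereal N / q) = N * i"
    and P: "pint r (restr S f) \<le> ennreal ((v * R powr N) powr (1 - r * i) * F powr r)" by auto
  show "0 \<le> Lp_norm q (ball x0 R) f" using F by (simp add: F_def S_def)
  note P
  also have "(v * R powr N) powr (1 - r * i) * F powr r \<le> R powr (N - p * r) * ((1 + v) * (R powr (p - N * i) * F)) powr r"
  proof -
    have "v powr (1 - r * i) \<le> (1 + v) powr (1 - r * i)" using v ri by (intro powr_mono2) auto
    also have "\<dots> \<le> (1 + v) powr r" using v ri r by (intro powr_mono) auto
    finally have "v powr (1 - r * i) * (R powr (N * (1 - r * i)) * F powr r) \<le> (1 + v) powr r * (R powr (N * (1 - r * i)) * F powr r)"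
      by (rule mult_right_mono) simp
    moreover have "R powr (N * (1 - r * i)) = R powr (N - p * r) * R powr ((p - N * i) * r)"
      by (subst powr_add[symmetric]) (simp add: algebra_simps)
    ultimately show ?thesis by (simp add: powr_mult powr_powr mult_ac)
  qed
  finally show "pint r (restr (ball x0 R) f) \<le> ennreal (R powr (real DIM('a) - p * r) *
      ((1 + unit_ball_vol (real DIM('a))) * (R powr (p - real_of_ereal (ereal (real DIM('a)) / q)) * Lp_norm q (ball x0 R) f)) powr r)"
    unfolding Ni[symmetric] by (simp add: N_def v_def F_def S_def ennreal_leI)
qed

lemma tail_integrable:
  fixes u :: "'a::euclidean_space \<Rightarrow> real"
  assumes u: "in_tail_space m \<alpha> u" and R: "0 < R" and m: "0 < m" "0 < \<alpha>"
  shows "set_integrable lborel (- ball x0 R) (\<lambda>x. \<bar>pos_part u x\<bar> powr m / norm (x - x0) powr (real DIM('a) + \<alpha>))"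
proof -
  define e where "e = real DIM('a) + \<alpha>"
  have e: "0 < e" using m by (simp add: e_def add_pos_pos)
  have [measurable]: "u \<in> borel_measurable borel" by (rule tail_space_measurable[OF u])
  have int: "integrable lborel (\<lambda>x. \<bar>u x\<bar> powr m / (1 + norm x powr e))"
    using u by (simp add: in_tail_space_def e_def)
  define c where "c = R powr (- e) + (1 + norm x0 / R) powr e"
  have c: "0 \<le> c" by (simp add: c_def)
  have pt: "norm (indicator (- ball x0 R) x *\<^sub>R (\<bar>pos_part u x\<bar> powr m / norm (x - x0) powr e))
      \<le> norm (c * (\<bar>u x\<bar> powr m / (1 + norm x powr e)))" for x
  proof (cases "x \<in> ball x0 R")
    case False
    define d where "d = norm (x - x0)"
    have d: "R \<le> d" using False by (simp add: d_def dist_norm norm_minus_commute)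
    have "1 \<le> R powr (- e) * d powr e"
    proof -
      have "R powr (- e) * R powr e \<le> R powr (- e) * d powr e" using d R e by (intro mult_left_mono powr_mono2) auto
      then show ?thesis using R by (simp flip: powr_add)
    qed
    moreover have "norm x powr e \<le> (1 + norm x0 / R) powr e * d powr e"
    proof -
      have "norm x \<le> d + norm x0" using norm_triangle_ineq[of "x - x0" x0] by (simp add: d_def)
      also have "\<dots> \<le> d + norm x0 * (d / R)" using d R mult_left_mono[of 1 "d / R" "norm x0"] by simp
      also have "\<dots> = (1 + norm x0 / R) * d" by (simp add: field_simps)
      finally have "norm x powr e \<le> ((1 + norm x0 / R) * d) powr e" using e by (intro powr_mono2) auto
      then show ?thesis by (simp add: powr_mult)
    qed
    ultimately have cd: "1 + norm x powr e \<le> c * d powr e" by (simp add: c_def distrib_right)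
    have pos: "0 < d powr e" "0 < 1 + norm x powr e" using d R by (auto intro: add_pos_nonneg)
    have "\<bar>pos_part u x\<bar> powr m / d powr e \<le> \<bar>u x\<bar> powr m / d powr e"
      using m by (intro divide_right_mono powr_mono2) (auto simp: pos_part_def)
    also have "\<dots> \<le> c * (\<bar>u x\<bar> powr m / (1 + norm x powr e))"
    proof -
      have "\<bar>u x\<bar> powr m * (1 + norm x powr e) \<le> \<bar>u x\<bar> powr m * (c * d powr e)" using cd by (rule mult_left_mono) simp
      then show ?thesis using pos by (simp add: field_simps)
    qed
    finally show ?thesis using False c by (simp add: d_def)
  qed simp
  show ?thesis
    unfolding set_integrable_def e_def[symmetric]
  proof (rule Bochner_Integration.integrable_bound)
    show "integrable lborel (\<lambda>x. c * (\<bar>u x\<bar> powr m / (1 + norm x powr e)))" by (rule integrable_mult_right[OF int])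
    show "AE x in lborel. norm (indicator (- ball x0 R) x *\<^sub>R (\<bar>pos_part u x\<bar> powr m / norm (x - x0) powr e))
        \<le> norm (c * (\<bar>u x\<bar> powr m / (1 + norm x powr e)))" using pt by simp
    show "(\<lambda>x. indicator (- ball x0 R) x *\<^sub>R (\<bar>pos_part u x\<bar> powr m / norm (x - x0) powr e)) \<in> borel_measurable lborel"
      unfolding pos_part_def by measurable
  qed
qed

text \<open>The estimate for a single ball. The level is chosen slightly larger than the sum of the three
  quantities, since these may all vanish.\<close>

lemma local_bound:
  assumes p: "2 \<le> p" and s: "0 < s" "s < 1" and \<sigma>: "0 < \<sigma>" "\<sigma> < 1"
    and q1: "p \<le> real DIM('a::euclidean_space) \<Longrightarrow> ereal (real DIM('a) / p) < q"
    and q2: "real DIM('a) < p \<Longrightarrow> 1 \<le> q"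
  obtains C where "0 < C"
    "\<And>A (\<Omega> :: 'a set) u f x0 R. weak_solution p s A \<Omega> f u \<Longrightarrow> 0 \<le> A \<Longrightarrow> A \<le> 1 \<Longrightarrow> 0 < R \<Longrightarrow> R < 1 \<Longrightarrow>
      ball x0 R \<Subset> \<Omega> \<Longrightarrow> in_Lp q (ball x0 R) f \<Longrightarrow>
      Linf_norm (ball x0 (\<sigma> * R)) (pos_part u) \<le> ereal (C *
          ((1 / measure lborel (ball x0 R) *
              (LINT x:ball x0 R|lborel. pos_part u x powr p)) powr (1 / p)
           + Tail (p - 1) (s * p) (s * p) (pos_part u) x0 R
           + (R powr (p - real_of_ereal (ereal (real DIM('a)) / q))
                * Lp_norm q (ball x0 R) f) powr (1 / (p - 1))))"
proof -
  define N where "N = real DIM('a)"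
  define v where "v = unit_ball_vol N"
  have v: "0 < v" by (simp add: v_def N_def)
  define good where "good r C \<longleftrightarrow> (\<forall>A (\<Omega> :: 'a set) u f x0 R L. weak_solution p s A \<Omega> f u \<longrightarrow> 0 \<le> A \<longrightarrow> A \<le> 1 \<longrightarrow> 0 < R \<longrightarrow> R < 1 \<longrightarrow>
      ball x0 R \<Subset> \<Omega> \<longrightarrow> local_data p s r x0 R u f L \<longrightarrow> (AE x in lborel. x \<in> ball x0 (\<sigma> * R) \<longrightarrow> u x \<le> C * L))" for r C
  have "\<exists>r C. 1 \<le> r \<and> ereal r \<le> q \<and> 0 < C \<and> good r C"
  proof (cases "N < p")
    case True
    then have pN: "real DIM('a) < p" by (simp add: N_def)
    obtain C where C: "0 < C"
      "\<And>A (\<Omega> :: 'a set) u f x0 R L. weak_solution p s A \<Omega> f u \<Longrightarrow> 0 \<le> A \<Longrightarrow> A \<le> 1 \<Longrightarrow> 0 < R \<Longrightarrow> R < 1 \<Longrightarrow>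
        ball x0 R \<Subset> \<Omega> \<Longrightarrow> local_data p s 1 x0 R u f L \<Longrightarrow> AE x in lborel. x \<in> ball x0 (\<sigma> * R) \<longrightarrow> u x \<le> C * L"
      using bounded_above_dimension[OF p s \<sigma> pN] by blast
    have "good 1 C" unfolding good_def by (intro allI impI) (rule C(2), assumption+)
    then show ?thesis using q2[OF pN] C(1) unfolding one_ereal_def by blast
  next
    case False
    define r where "r = (if q = \<infinity> then N / p + 1 else real_of_ereal q)"
    have "ereal (N / p) < q" using q1 False by (simp add: N_def)
    then have r: "N / p < r" "ereal r \<le> q" by (cases q; auto simp: r_def)+
    have "1 \<le> N / p" using False p by (simp add: field_simps)
    then have r1: "1 < r" using r by simp
    have rN: "real DIM('a) / p < r" using r by (simp add: N_def)
    obtain C where C: "0 < C"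
      "\<And>A (\<Omega> :: 'a set) u f x0 R L. weak_solution p s A \<Omega> f u \<Longrightarrow> 0 \<le> A \<Longrightarrow> A \<le> 1 \<Longrightarrow> 0 < R \<Longrightarrow> R < 1 \<Longrightarrow>
        ball x0 R \<Subset> \<Omega> \<Longrightarrow> local_data p s r x0 R u f L \<Longrightarrow> AE x in lborel. x \<in> ball x0 (\<sigma> * R) \<longrightarrow> u x \<le> C * L"
      using bounded_below_dimension[OF p s \<sigma> r1 rN] by blast
    have "good r C" unfolding good_def by (intro allI impI) (rule C(2), assumption+)
    then show ?thesis using less_imp_le[OF r1] r(2) C(1) by blast
  qed
  then obtain r C where r: "1 \<le> r" "ereal r \<le> q" and C: "0 < C" and good: "good r C"
    by (elim exE conjE)
  define c1 where "c1 = v powr (1 / p)"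
  define c2 where "c2 = (1 + v) powr (1 / (p - 1))"
  define c0 where "c0 = 1 + c1 + c2"
  have c0: "0 \<le> c1" "0 \<le> c2" "0 < c0" by (auto simp: c1_def c2_def c0_def add_pos_nonneg)
  have main: "Linf_norm (ball x0 (\<sigma> * R)) (pos_part u) \<le> ereal (C * c0 *
          ((1 / measure lborel (ball x0 R) *
              (LINT x:ball x0 R|lborel. pos_part u x powr p)) powr (1 / p)
           + Tail (p - 1) (s * p) (s * p) (pos_part u) x0 R
           + (R powr (p - real_of_ereal (ereal (real DIM('a)) / q))
                * Lp_norm q (ball x0 R) f) powr (1 / (p - 1))))"
    if sol: "weak_solution p s A \<Omega> f u" and A: "0 \<le> A" "A \<le> 1" and R: "0 < R" "R < 1" and B: "ball x0 R \<Subset> \<Omega>"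
      and f: "in_Lp q (ball x0 R) f"
    for A and \<Omega> :: "'a set" and u f x0 R
  proof -
    have ts: "in_tail_space (p - 1) (s * p) u" using sol by (simp add: weak_solution_def)
    have um[measurable]: "u \<in> borel_measurable borel" by (rule tail_space_measurable[OF ts])
    have [measurable]: "pos_part u \<in> borel_measurable borel" unfolding pos_part_def[abs_def] by measurable
    have fm: "restr (ball x0 R) f \<in> borel_measurable borel"
      using f by (simp add: in_Lp_def set_borel_measurable_def restr_def[abs_def])
    have pp: "pos_part u x = max (u x) 0" for x by (simp add: pos_part_def)
    define I where "I = (LINT x:ball x0 R|lborel. pos_part u x powr p)"
    define a where "a = (1 / measure lborel (ball x0 R) * I) powr (1 / p)"
    define TI where "TI = (LINT x:- ball x0 R|lborel. \<bar>pos_part u x\<bar> powr (p - 1) / norm (x - x0) powr (real DIM('a) + s * p))"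
    define t where "t = (R powr (s * p) * TI) powr (1 / (p - 1))"
    define F where "F = R powr (p - real_of_ereal (ereal (real DIM('a)) / q)) * Lp_norm q (ball x0 R) f"
    define F' where "F' = F powr (1 / (p - 1))"
    have nn: "0 \<le> I" "0 \<le> TI" "0 \<le> a" "0 \<le> t" "0 \<le> F'"
      by (auto simp: I_def TI_def a_def t_def F'_def set_lebesgue_integral_def intro!: integral_nonneg_AE)
    have F: "0 \<le> F" using pint_le_Lp_norm(1)[OF f R(1) r] by (simp add: F_def)
    have Iint: "pint p (restr (ball x0 R) (\<lambda>x. max (u x) 0)) = ennreal I"
    proof -
      have W: "in_W1p p (ball x0 R) u" using sol B unfolding weak_solution_def in_W1p_loc_def by auto
      then have fin: "pint p (restr (ball x0 R) u) < \<infinity>" unfolding in_W1p_def in_Lp_iff by simp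
      have "pint p (restr (ball x0 R) (\<lambda>x. max (u x) 0)) \<le> pint p (restr (ball x0 R) u)"
        using p by (intro pint_mono) (auto simp: restr_def indicator_def)
      then have fin2: "pint p (restr (ball x0 R) (\<lambda>x. max (u x) 0)) < \<infinity>" using fin by (rule le_less_trans)
      have "I = (\<integral>x. norm (restr (ball x0 R) (\<lambda>x. max (u x) 0) x) powr p \<partial>lborel)"
        unfolding I_def set_lebesgue_integral_def
      proof (rule Bochner_Integration.integral_cong[OF refl])
        fix x show "indicator (ball x0 R) x *\<^sub>R pos_part u x powr p = norm (restr (ball x0 R) (\<lambda>x. max (u x) 0) x) powr p"
          by (cases "x \<in> ball x0 R") (auto simp: pp)
      qed
      also have "\<dots> = enn2real (pint p (restr (ball x0 R) (\<lambda>x. max (u x) 0)))"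
        unfolding pint_def by (intro integral_eq_nn_integral) (auto simp: restr_def[abs_def])
      finally show ?thesis using fin2 by simp
    qed
    have Tint: "(\<integral>\<^sup>+y. indicator (- ball x0 R) y * ennreal (max (u y) 0 powr (p - 1) / norm (y - x0) powr (real DIM('a) + s * p)) \<partial>lborel) = ennreal TI"
    proof -
      have "(\<integral>\<^sup>+y. indicator (- ball x0 R) y * ennreal (max (u y) 0 powr (p - 1) / norm (y - x0) powr (real DIM('a) + s * p)) \<partial>lborel)
          = (\<integral>\<^sup>+y. ennreal (indicator (- ball x0 R) y *\<^sub>R (\<bar>pos_part u y\<bar> powr (p - 1) / norm (y - x0) powr (real DIM('a) + s * p))) \<partial>lborel)"
      proof (rule nn_integral_cong)
        fix y show "indicator (- ball x0 R) y * ennreal (max (u y) 0 powr (p - 1) / norm (y - x0) powr (real DIM('a) + s * p))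
            = ennreal (indicator (- ball x0 R) y *\<^sub>R (\<bar>pos_part u y\<bar> powr (p - 1) / norm (y - x0) powr (real DIM('a) + s * p)))"
          by (cases "y \<in> ball x0 R") (auto simp: pp)
      qed
      also have "\<dots> = ennreal TI"
        unfolding TI_def set_lebesgue_integral_def
        by (rule nn_integral_eq_integral) (use tail_integrable[OF ts R(1)] p s in \<open>auto simp: set_integrable_def\<close>)
      finally show ?thesis .
    qed
    have vol: "measure lborel (ball x0 R) = v * R powr N"
      unfolding measure_def ball_emeasure_powr[OF R(1)] using v by (simp add: v_def N_def)
    have Ia: "I = R powr N * (c1 * a) powr p"
    proof -
      have "a powr p = 1 / (v * R powr N) * I"
        using p nn(1) v R by (simp add: a_def vol powr_powr)
      moreover have "c1 powr p = v" using p v by (simp add: c1_def powr_powr)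
      ultimately show ?thesis using v R by (simp add: powr_mult)
    qed
    have TIt: "TI = R powr (- (s * p)) * t powr (p - 1)"
    proof -
      have "t powr (p - 1) = R powr (s * p) * TI" using p nn(2) by (simp add: t_def powr_powr)
      moreover have "R powr (- (s * p)) * R powr (s * p) = 1" using R by (simp flip: powr_add)
      ultimately show ?thesis by (simp add: mult.assoc[symmetric])
    qed
    have bound: "AE x in lborel. x \<in> ball x0 (\<sigma> * R) \<longrightarrow> u x \<le> C * (c0 * (a + t + F') + \<epsilon>)" if \<epsilon>: "0 < \<epsilon>" for \<epsilon>
    proof -
      define L where "L = c0 * (a + t + F') + \<epsilon>"
      have L: "0 < L" "c1 * a \<le> L" "t \<le> L" "c2 * F' \<le> L"
        using nn c0 \<epsilon> by (auto simp: L_def c0_def algebra_simps add_pos_nonneg add_nonneg_pos)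
      have "local_data p s r x0 R u f L"
        unfolding local_data_def
      proof (intro conjI L(1) um fm)
        show "pint p (restr (ball x0 R) (\<lambda>x. max (u x) 0)) \<le> ennreal (R powr real DIM('a) * L powr p)"
          unfolding Iint Ia N_def using L nn c0 p by (intro ennreal_leI mult_left_mono powr_mono2) auto
        show "(\<integral>\<^sup>+y. indicator (- ball x0 R) y * ennreal (max (u y) 0 powr (p - 1) / norm (y - x0) powr (real DIM('a) + s * p)) \<partial>lborel)
            \<le> ennreal (R powr (- (s * p)) * L powr (p - 1))"
          unfolding Tint TIt using L nn p by (intro ennreal_leI mult_left_mono powr_mono2) auto
        have "(1 + v) * F = (c2 * F') powr (p - 1)"
          using p v F by (simp add: c2_def F'_def powr_mult powr_powr)
        also have "\<dots> \<le> L powr (p - 1)" using L nn c0 p by (intro powr_mono2) auto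
        finally have "((1 + v) * F) powr r \<le> (L powr (p - 1)) powr r" using r v F by (intro powr_mono2) auto
        then have "R powr (N - p * r) * ((1 + v) * F) powr r \<le> R powr (N - p * r) * L powr ((p - 1) * r)"
          unfolding powr_powr by (rule mult_left_mono) simp
        then show "pint r (restr (ball x0 R) f) \<le> ennreal (R powr (real DIM('a) - p * r) * L powr ((p - 1) * r))"
          using order_trans[OF pint_le_Lp_norm(2)[OF f R(1) r, of p]] unfolding F_def N_def v_def by (simp add: ennreal_leI)
      qed
      with good sol A R B show ?thesis unfolding good_def L_def by blast
    qed
    have "Linf_norm (ball x0 (\<sigma> * R)) (pos_part u) \<le> ereal (C * c0 * (a + t + F')) + ereal \<epsilon>" if \<epsilon>: "0 < \<epsilon>" for \<epsilon>
    proof -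
      have "0 < \<epsilon> / C" using \<epsilon> C by simp
      from bound[OF this] have "AE x in lborel. x \<in> ball x0 (\<sigma> * R) \<longrightarrow> norm (pos_part u x) \<le> C * c0 * (a + t + F') + \<epsilon>"
      proof eventually_elim
        case (elim x)
        have "0 \<le> C * c0 * (a + t + F') + \<epsilon>" using C c0 nn \<epsilon> by simp
        moreover have "C * (c0 * (a + t + F') + \<epsilon> / C) = C * c0 * (a + t + F') + \<epsilon>"
          using C by (simp add: distrib_left)
        ultimately show ?case using elim by (auto simp: pp)
      qed
      then show ?thesis by (simp add: Linf_norm_le_iff restr_measurable)
    qed
    then have "Linf_norm (ball x0 (\<sigma> * R)) (pos_part u) \<le> ereal (C * c0 * (a + t + F'))" by (rule ereal_le_epsilon2)
    then show ?thesis by (simp add: a_def t_def F'_def F_def I_def TI_def Tail_def)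
  qed
  have "0 < C * c0" using C c0(3) by simp
  then show ?thesis by (rule that) (rule main, assumption+)
qed

lemma in_Linf_loc_of_balls:
  fixes g :: "'a::euclidean_space \<Rightarrow> real"
  assumes "open \<Omega>" and g[measurable]: "g \<in> borel_measurable borel" and \<sigma>: "0 < \<sigma>"
    and bd: "\<And>x0 R. 0 < R \<Longrightarrow> R < 1 \<Longrightarrow> ball x0 R \<Subset> \<Omega> \<Longrightarrow> \<exists>b. Linf_norm (ball x0 (\<sigma> * R)) g \<le> ereal b"
  shows "in_Lp_loc \<infinity> \<Omega> g"
  unfolding in_Lp_loc_def
proof (intro allI impI)
  fix K assume K: "compact K \<and> K \<subseteq> \<Omega>"
  then have Km[measurable]: "K \<in> sets borel" by (auto intro: borel_compact)
  have "\<exists>R>0. \<exists>b. AE y in lborel. y \<in> ball x (\<sigma> * R) \<longrightarrow> norm (g y) \<le> b" if "x \<in> K" for x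
  proof -
    have "x \<in> \<Omega>" using K that by auto
    then obtain e where e: "0 < e" "cball x e \<subseteq> \<Omega>"
      using assms(1)[unfolded open_contains_cball] by auto
    define R where "R = min e (1 / 2)"
    have R: "0 < R" "R < 1" "cball x R \<subseteq> \<Omega>" using e by (auto simp: R_def)
    then have "ball x R \<Subset> \<Omega>" by (simp add: compactly_contained_def)
    from bd[OF R(1,2) this] obtain b where "Linf_norm (ball x (\<sigma> * R)) g \<le> ereal b" by blast
    then have "AE y in lborel. y \<in> ball x (\<sigma> * R) \<longrightarrow> norm (g y) \<le> b" by (simp add: Linf_norm_le_iff restr_measurable)
    then show ?thesis using R(1) by blast
  qed
  then obtain R b where Rb: "\<And>x. x \<in> K \<Longrightarrow> 0 < R x"
    "\<And>x. x \<in> K \<Longrightarrow> AE y in lborel. y \<in> ball x (\<sigma> * R x) \<longrightarrow> norm (g y) \<le> b x" by metis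
  have "K \<subseteq> (\<Union>x\<in>K. ball x (\<sigma> * R x))"
  proof
    fix x assume "x \<in> K"
    then show "x \<in> (\<Union>x\<in>K. ball x (\<sigma> * R x))" using Rb(1)[of x] \<sigma> by (intro UN_I[of x]) auto
  qed
  then obtain D where D: "D \<subseteq> K" "finite D" "K \<subseteq> (\<Union>x\<in>D. ball x (\<sigma> * R x))"
    using K compactE_image[of K K "\<lambda>x. ball x (\<sigma> * R x)"] by auto
  have "AE y in lborel. \<forall>x\<in>D. y \<in> ball x (\<sigma> * R x) \<longrightarrow> norm (g y) \<le> b x"
    using D Rb(2) by (intro AE_finite_allI) auto
  then have "AE y in lborel. y \<in> K \<longrightarrow> norm (g y) \<le> (\<Sum>x\<in>D. \<bar>b x\<bar>)"
  proof eventually_elim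
    case (elim y)
    show ?case
    proof
      assume "y \<in> K"
      then obtain x where x: "x \<in> D" "y \<in> ball x (\<sigma> * R x)" using D(3) by blast
      then have "norm (g y) \<le> \<bar>b x\<bar>" using elim by force
      also have "\<dots> \<le> (\<Sum>x\<in>D. \<bar>b x\<bar>)" using D(2) x(1) by (intro member_le_sum) auto
      finally show "norm (g y) \<le> (\<Sum>x\<in>D. \<bar>b x\<bar>)" .
    qed
  qed
  then have "Linf_norm K g \<le> ereal (\<Sum>x\<in>D. \<bar>b x\<bar>)" by (simp add: Linf_norm_le_iff restr_measurable)
  then show "in_Lp \<infinity> K g" by (auto simp: in_Lp_def set_borel_measurable_def)
qed

theorem theorem1p2:
  fixes p s \<sigma> :: real and q :: ereal
  assumes "2 \<le> p" and "0 < s" "s < 1" and "0 < \<sigma>" "\<sigma> < 1"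
    and "p \<le> real DIM('a::euclidean_space) \<Longrightarrow> ereal (real DIM('a) / p) < q"
    and "real DIM('a) < p \<Longrightarrow> 1 \<le> q"
  shows "\<exists>C>0. \<forall>A (\<Omega> :: 'a set) u f.
    0 \<le> A \<and> A \<le> 1 \<and> open \<Omega> \<and> bounded \<Omega> \<and> in_Lp_loc q \<Omega> f \<and> weak_solution p s A \<Omega> f u \<longrightarrow>
      in_Lp_loc \<infinity> \<Omega> (pos_part u) \<and>
      (\<forall>x0 R. 0 < R \<and> R < 1 \<and> ball x0 R \<Subset> \<Omega> \<longrightarrow>
        Linf_norm (ball x0 (\<sigma> * R)) (pos_part u) \<le> ereal (C *
          ((1 / measure lborel (ball x0 R) *
              (LINT x:ball x0 R|lborel. pos_part u x powr p)) powr (1 / p)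
           + Tail (p - 1) (s * p) (s * p) (pos_part u) x0 R
           + (R powr (p - real_of_ereal (ereal (real DIM('a)) / q))
                * Lp_norm q (ball x0 R) f) powr (1 / (p - 1)))))"
proof -
  obtain C where C: "0 < C"
    "\<And>A (\<Omega> :: 'a set) u f x0 R. weak_solution p s A \<Omega> f u \<Longrightarrow> 0 \<le> A \<Longrightarrow> A \<le> 1 \<Longrightarrow> 0 < R \<Longrightarrow> R < 1 \<Longrightarrow>
      ball x0 R \<Subset> \<Omega> \<Longrightarrow> in_Lp q (ball x0 R) f \<Longrightarrow>
      Linf_norm (ball x0 (\<sigma> * R)) (pos_part u) \<le> ereal (C *
          ((1 / measure lborel (ball x0 R) *
              (LINT x:ball x0 R|lborel. pos_part u x powr p)) powr (1 / p)
           + Tail (p - 1) (s * p) (s * p) (pos_part u) x0 R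
           + (R powr (p - real_of_ereal (ereal (real DIM('a)) / q))
                * Lp_norm q (ball x0 R) f) powr (1 / (p - 1))))"
    using local_bound[OF assms] by blast
  have q0: "0 < q"
  proof (cases "real DIM('a) < p")
    case True
    then show ?thesis using less_le_trans[of "0::ereal" 1 q] assms(7) by simp
  next
    case False
    have "0 < ereal (real DIM('a) / p)" using assms(1) by simp
    also have "\<dots> < q" using assms(6) False by simp
    finally show ?thesis .
  qed
  show ?thesis
  proof (intro exI[of _ C] conjI allI impI C(1))
    fix A u f and \<Omega> :: "'a set"
    assume h: "0 \<le> A \<and> A \<le> 1 \<and> open \<Omega> \<and> bounded \<Omega> \<and> in_Lp_loc q \<Omega> f \<and> weak_solution p s A \<Omega> f u"
    then have sol: "weak_solution p s A \<Omega> f u" and A: "0 \<le> A" "A \<le> 1" and op: "open \<Omega>"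
      and lf: "in_Lp_loc q \<Omega> f" by simp_all
    have fB: "in_Lp q (ball x0 R) f" if "ball x0 R \<Subset> \<Omega>" for x0 R
    proof (rule in_Lp_subset[OF _ closure_subset _ _ q0])
      show "in_Lp q (closure (ball x0 R)) f"
        using lf[unfolded in_Lp_loc_def, rule_format, of "closure (ball x0 R)"] that
        by (simp only: compactly_contained_def)
    qed (simp_all only: borel_open open_ball borel_closed closed_closure)
    {
      fix x0 R assume R: "0 < R \<and> R < 1 \<and> ball x0 R \<Subset> \<Omega>"
      show "Linf_norm (ball x0 (\<sigma> * R)) (pos_part u) \<le> ereal (C *
          ((1 / measure lborel (ball x0 R) *
              (LINT x:ball x0 R|lborel. pos_part u x powr p)) powr (1 / p)
           + Tail (p - 1) (s * p) (s * p) (pos_part u) x0 R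
           + (R powr (p - real_of_ereal (ereal (real DIM('a)) / q))
                * Lp_norm q (ball x0 R) f) powr (1 / (p - 1))))"
        by (rule C(2)[OF sol A _ _ _ fB]) (simp_all only: R)
    }
    show "in_Lp_loc \<infinity> \<Omega> (pos_part u)"
    proof (rule in_Linf_loc_of_balls[OF _ _ assms(4)])
      have "in_tail_space (p - 1) (s * p) u" using sol by (simp add: weak_solution_def)
      then have [measurable]: "u \<in> borel_measurable borel" by (rule tail_space_measurable)
      show "pos_part u \<in> borel_measurable borel" unfolding pos_part_def[abs_def] by measurable
      show "\<exists>b. Linf_norm (ball x0 (\<sigma> * R)) (pos_part u) \<le> ereal b" if "0 < R" "R < 1" "ball x0 R \<Subset> \<Omega>" for x0 R
        by (rule exI) (rule C(2)[OF sol A that fB[OF that(3)]])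
    qed (rule op)
  qed
qed

end
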